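(* Let $R$ be a field, $\delta\in R$ with $\delta\ne0$, $n\ge1$, and $B=B(C_n,R,\delta)$ the Brauer algebra of type $C_n$. Then the decomposition matrices of the hyperoctahedral groups appear along the diagonal of the decomposition matrix of $B$. More specifically, for every $0\le k\le n$, every cell module $\Delta(\mu)$ of $RH_{n-k}$ and every simple module $D(\lambda)$ of $RH_{n-k}$, $$[\Delta(\mu,k):D(\lambda,k)]=[\Delta(\mu):D(\lambda)],$$ where the left-hand side is a composition multiplicity of $B$-modules and the right-hand side one of $RH_{n-k}$-modules.
   Context: The algebra. A Brauer diagram on $2n$ strands is a perfect matching of $4n$ nodes arranged in a top row and a bottom row, each labelled $1,\dots,2n$ from left to right. An edge joining two nodes of the same row is an arc. The product $d_1d_2$ is formed by placing $d_1$ above $d_2$, identifying the bottom row of $d_1$ with the top row of $d_2$, removing closed loops, and multiplying by $\delta$ for each closed loop removed. Let $\sigma$ be the reflection in the vertical axis, $j\mapsto 2n+1-j$ on both rows. $B=B(C_n,R,\delta)$ is the $R$-algebra with $R$-basis the $\sigma$-invariant Brauer diagrams on $2n$ strands, with this product. Its involution $i$ exchanges the top and bottom rows. For $0\le k\le n$, $J_k$ is the two-sided ideal spanned by the $\sigma$-invariant diagrams with at least $k$ arcs in each row; $J_{n+1}=0$. Layers. $H_m$ is the hyperoctahedral group, the group of permutations of $\{1,\dots,2m\}$ commuting with $j\mapsto 2m+1-j$, with products read from left to right, $(\pi\rho)(j)=\rho(\pi(j))$. A symmetric $(2n,k)$-dangle is a partition of $\{1,\dots,2n\}$ into $k$ two-element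 subsets and $2n-2k$ one-element subsets (free nodes), invariant under $j\mapsto 2n+1-j$. $V(2n,k)$ is the $R$-vector space with basis these dangles. There is an $R$-linear isomorphism $\psi_k:J_k/J_{k+1}\to V(2n,k)\otimes V(2n,k)\otimes RH_{n-k}$ sending a diagram $d$ with exactly $k$ arcs in each row to $e\otimes f\otimes\pi_d$. Here $e$ and $f$ are the dangles of the top and bottom rows obtained by cutting the through strands, and the $j$-th free top node is joined to the $\pi_d(j)$-th free bottom node. We identify both sides via $\psi_k$. For a non-zero $v_k\in V(2n,k)$, the subspace $V(2n,k)\otimes v_k\otimes RH_{n-k}$ is a left $B$-submodule, and a right $RH_{n-k}$-module by multiplication in the last factor. Cell modules. For an algebra $A$ with anti-involution $i$, a cell ideal is an $i$-stable two-sided ideal $J$ with a left ideal $\Delta\subset J$ and an $A$-bimodule isomorphism $\alpha:J\cong\Delta\otimes_R i(\Delta)$ under which $i$ corresponds to $x\otimes y\mapsto i(y)\otimes i(x)$. A cell chain is a chain of $i$-stable two-sided ideals $0=I_0\subset I_1\subset\cdots\subset I_N=A$, with $i$-stable vector space complements, such that each $I_j/I_{j-1}$ is a cell ideal of $A/I_{j-1}$. The corresponding left modules $\Delta$ are the cell modules. Each carries a bilinear form $\Phi$ determined by $(x\otimes i(y))(x'\otimes i(y'))=\Phi(y,x')\,x\otimes i(y')$, and $\operatorname{rad}\Delta$ denotes the radical of this form. Each $RH_m$ is cellular with respect to $\pi\mapsto\pi^{-1}$; fix a cell chain of each $RH_m$, with cell modules $\Delta(\mu)$. The cell structure on $B$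 is the one whose cell chain refines $0=J_{n+1}\subset J_n\subset\cdots\subset J_0=B$ by the preimages in $J_k$ of the subspaces $V(2n,k)\otimes V(2n,k)\otimes I$ of $J_k/J_{k+1}$, with $I$ running through the chosen cell chain of $RH_{n-k}$. Its cell modules are $\Delta(\mu,k)=V(2n,k)\otimes v_k\otimes\Delta(\mu)$, meaning $\big(V(2n,k)\otimes v_k\otimes RH_{n-k}\big)\otimes_{RH_{n-k}}\Delta(\mu)$, where $v_k$ is any non-zero element of $V(2n,k)$. Simple modules. $D(\lambda)=\Delta(\lambda)/\operatorname{rad}\Delta(\lambda)$ for those $\lambda$ for which this is non-zero; these are the simple $RH_{n-k}$-modules. Likewise $D(\lambda,k)=\Delta(\lambda,k)/\operatorname{rad}\Delta(\lambda,k)$ are the simple $B$-modules. $[M:D]$ denotes the multiplicity of the simple module $D$ as a composition factor of $M$. *)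

theory Defs
  imports
    "HOL-Library.Disjoint_Sets"
    "HOL-Combinatorics.Permutations"
    "HOL-Algebra.Algebra"
    "HOL-Algebra.Free_Abelian_Groups"
    "HOL-Algebra.Algebraic_Closure_Type"
begin

section \<open>Left modules and composition multiplicities\<close>

text \<open>The locale \<^locale>\<open>module\<close> requires a commutative ring of scalars, so left and right
  modules over a noncommutative ring are given here just by records of type \<^typ>\<open>('s, 'm) module\<close>.
  The fields \<^const>\<open>monoid.mult\<close> and \<^const>\<open>monoid.one\<close> of a module carry no information.
  Only the carrier of the ring argument \<open>A\<close> below is used.\<close>

definition module_isomorphic ::
    "('s, 'x) ring_scheme \<Rightarrow> ('s, 'm) module \<Rightarrow> ('s, 'n) module \<Rightarrow> bool" where
  "module_isomorphic A M N \<longleftrightarrow>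
     (\<exists>\<phi> \<in> iso (add_monoid M) (add_monoid N).
        \<forall>a \<in> carrier A. \<forall>x \<in> carrier M. \<phi> (a \<odot>\<^bsub>M\<^esub> x) = a \<odot>\<^bsub>N\<^esub> \<phi> x)"

definition quotient_module :: "('s, 'm) module \<Rightarrow> 'm set \<Rightarrow> ('s, 'm set) module" where
  "quotient_module M N =
     \<lparr>carrier = a_rcosets\<^bsub>M\<^esub> N, monoid.mult = undefined, monoid.one = undefined,
      ring.zero = N, add = set_add M,
      module.smult = (\<lambda>a Z. \<Union>x\<in>Z. N +>\<^bsub>M\<^esub> (a \<odot>\<^bsub>M\<^esub> x))\<rparr>"

definition simple_module :: "('s, 'x) ring_scheme \<Rightarrow> ('s, 'm) module \<Rightarrow> bool" where
  "simple_module A M \<longleftrightarrow>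
     carrier M \<noteq> {\<zero>\<^bsub>M\<^esub>} \<and>
     (\<forall>N. submodule N A M \<longrightarrow> N = {\<zero>\<^bsub>M\<^esub>} \<or> N = carrier M)"

definition series_factor ::
    "('s, 'm) module \<Rightarrow> (nat \<Rightarrow> 'm set) \<Rightarrow> nat \<Rightarrow> ('s, 'm set) module" where
  "series_factor M F i = quotient_module (M\<lparr>carrier := F (Suc i)\<rparr>) (F i)"

definition composition_series ::
    "('s, 'x) ring_scheme \<Rightarrow> ('s, 'm) module \<Rightarrow> nat \<Rightarrow> (nat \<Rightarrow> 'm set) \<Rightarrow> bool" where
  "composition_series A M l F \<longleftrightarrow>
     F 0 = {\<zero>\<^bsub>M\<^esub>} \<and> F l = carrier M \<and>
     (\<forall>i\<le>l. submodule (F i) A M) \<and>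
     (\<forall>i<l. F i \<subseteq> F (Suc i) \<and> simple_module A (series_factor M F i))"

text \<open>By the Jordan-Hoelder theorem the number below is the same for all composition series;
  one exists for all modules of interest here, as they are finite-dimensional.\<close>

definition composition_mult ::
    "('s, 'x) ring_scheme \<Rightarrow> ('s, 'm) module \<Rightarrow> ('s, 'd) module \<Rightarrow> nat" where
  "composition_mult A M D =
     (THE c. \<exists>l F. composition_series A M l F \<and>
        c = card {i. i < l \<and> module_isomorphic A (series_factor M F i) D})"

section \<open>Tensor products\<close>

text \<open>For a right \<open>S\<close>-module \<open>M\<close> and a left \<open>S\<close>-module \<open>N\<close>, the abelian group
  \<open>M \<otimes>\<^sub>S N\<close>: the free abelian group on pairs modulo the usual relators.\<close>

definition tensor_relators ::
    "('s, 'x) ring_scheme \<Rightarrow> ('s, 'm) module \<Rightarrow> ('s, 'n) module \<Rightarrow> ('m \<times> 'n \<Rightarrow>\<^sub>0 int) set" where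
  "tensor_relators S M N =
     {frag_of (x \<oplus>\<^bsub>M\<^esub> x', y) - frag_of (x, y) - frag_of (x', y) | x x' y.
        x \<in> carrier M \<and> x' \<in> carrier M \<and> y \<in> carrier N} \<union>
     {frag_of (x, y \<oplus>\<^bsub>N\<^esub> y') - frag_of (x, y) - frag_of (x, y') | x y y'.
        x \<in> carrier M \<and> y \<in> carrier N \<and> y' \<in> carrier N} \<union>
     {frag_of (s \<odot>\<^bsub>M\<^esub> x, y) - frag_of (x, s \<odot>\<^bsub>N\<^esub> y) | s x y.
        s \<in> carrier S \<and> x \<in> carrier M \<and> y \<in> carrier N}"

definition tensor_free :: "('s, 'm) module \<Rightarrow> ('s, 'n) module \<Rightarrow> ('m \<times> 'n \<Rightarrow>\<^sub>0 int) monoid" where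
  "tensor_free M N = free_Abelian_group (carrier M \<times> carrier N)"

definition tensor_null ::
    "('s, 'x) ring_scheme \<Rightarrow> ('s, 'm) module \<Rightarrow> ('s, 'n) module \<Rightarrow> ('m \<times> 'n \<Rightarrow>\<^sub>0 int) set" where
  "tensor_null S M N = generate (tensor_free M N) (tensor_relators S M N)"

definition tensor ::
    "('s, 'x) ring_scheme \<Rightarrow> ('s, 'm) module \<Rightarrow> ('s, 'n) module \<Rightarrow> ('m \<times> 'n \<Rightarrow>\<^sub>0 int) set monoid" where
  "tensor S M N = tensor_free M N Mod tensor_null S M N"

definition pure_tensor ::
    "('s, 'x) ring_scheme \<Rightarrow> ('s, 'm) module \<Rightarrow> ('s, 'n) module \<Rightarrow> 'm \<Rightarrow> 'n \<Rightarrow> ('m \<times> 'n \<Rightarrow>\<^sub>0 int) set"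
  where
  "pure_tensor S M N x y = tensor_null S M N #>\<^bsub>tensor_free M N\<^esub> frag_of (x, y)"

text \<open>For a map \<open>h\<close> on pairs such that \<open>x \<otimes> y \<mapsto> h\<^sub>1 (x, y) \<otimes> h\<^sub>2 (x, y)\<close> respects the relators, the
  induced additive endomorphism of \<open>M \<otimes>\<^sub>S N\<close>.\<close>

definition tensor_map ::
    "('s, 'x) ring_scheme \<Rightarrow> ('s, 'm) module \<Rightarrow> ('s, 'n) module \<Rightarrow>
     ('m \<times> 'n \<Rightarrow> 'm \<times> 'n) \<Rightarrow> ('m \<times> 'n \<Rightarrow>\<^sub>0 int) set \<Rightarrow> ('m \<times> 'n \<Rightarrow>\<^sub>0 int) set" where
  "tensor_map S M N h C =
     (\<Union>z\<in>C. tensor_null S M N #>\<^bsub>tensor_free M N\<^esub> frag_extend (\<lambda>p. frag_of (h p)) z)"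

section \<open>Cell chains\<close>

text \<open>An algebra over the field \<^typ>\<open>'r\<close> is a record of type \<^typ>\<open>('r, 'a) module\<close> whose
  multiplication and unit are meaningful as well.\<close>

definition quotient_algebra :: "('r, 'a) module \<Rightarrow> 'a set \<Rightarrow> ('r, 'a set) module" where
  "quotient_algebra A I =
     ring.extend (A Quot I) (module.fields (\<lambda>c Z. \<Union>x\<in>Z. I +>\<^bsub>A\<^esub> (c \<odot>\<^bsub>A\<^esub> x)))"

definition tensor_inv :: "('r::field, 'a) module \<Rightarrow> ('a \<Rightarrow> 'a) \<Rightarrow> 'a set \<Rightarrow> ('a \<times> 'a \<Rightarrow>\<^sub>0 int) set monoid"
  where
  "tensor_inv A \<iota> L = tensor ring_of_type_algebra (A\<lparr>carrier := L\<rparr>) (A\<lparr>carrier := \<iota> ` L\<rparr>)"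

definition tensor_inv_map ::
    "('r::field, 'a) module \<Rightarrow> ('a \<Rightarrow> 'a) \<Rightarrow> 'a set \<Rightarrow> ('a \<times> 'a \<Rightarrow> 'a \<times> 'a) \<Rightarrow>
     ('a \<times> 'a \<Rightarrow>\<^sub>0 int) set \<Rightarrow> ('a \<times> 'a \<Rightarrow>\<^sub>0 int) set" where
  "tensor_inv_map A \<iota> L =
     tensor_map ring_of_type_algebra (A\<lparr>carrier := L\<rparr>) (A\<lparr>carrier := \<iota> ` L\<rparr>)"

definition cell_ideal ::
    "('r::field, 'a) module \<Rightarrow> ('a \<Rightarrow> 'a) \<Rightarrow> 'a set \<Rightarrow> 'a set \<Rightarrow> ('a \<Rightarrow> ('a \<times> 'a \<Rightarrow>\<^sub>0 int) set) \<Rightarrow> bool"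
  where
  "cell_ideal A \<iota> J L \<alpha> \<longleftrightarrow>
     ideal J A \<and> \<iota> ` J = J \<and>
     additive_subgroup L A \<and> (\<forall>a\<in>carrier A. \<forall>x\<in>L. a \<otimes>\<^bsub>A\<^esub> x \<in> L) \<and> L \<subseteq> J \<and>
     \<alpha> \<in> iso (add_monoid (A\<lparr>carrier := J\<rparr>)) (tensor_inv A \<iota> L) \<and>
     (\<forall>a\<in>carrier A. \<forall>b\<in>carrier A. \<forall>z\<in>J.
        \<alpha> (a \<otimes>\<^bsub>A\<^esub> z \<otimes>\<^bsub>A\<^esub> b) =
        tensor_inv_map A \<iota> L (\<lambda>(x, w). (a \<otimes>\<^bsub>A\<^esub> x, w \<otimes>\<^bsub>A\<^esub> b)) (\<alpha> z)) \<and>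
     (\<forall>z\<in>J. \<alpha> (\<iota> z) = tensor_inv_map A \<iota> L (\<lambda>(x, w). (\<iota> w, \<iota> x)) (\<alpha> z))"

text \<open>\<open>cell_element A \<iota> J L \<alpha> x y\<close> is the element of \<open>J\<close> identified with \<open>x \<otimes> \<iota>(y)\<close>.\<close>

definition cell_element ::
    "('r::field, 'a) module \<Rightarrow> ('a \<Rightarrow> 'a) \<Rightarrow> 'a set \<Rightarrow> 'a set \<Rightarrow> ('a \<Rightarrow> ('a \<times> 'a \<Rightarrow>\<^sub>0 int) set) \<Rightarrow>
     'a \<Rightarrow> 'a \<Rightarrow> 'a" where
  "cell_element A \<iota> J L \<alpha> x y =
     inv_into J \<alpha>
       (pure_tensor ring_of_type_algebra (A\<lparr>carrier := L\<rparr>) (A\<lparr>carrier := \<iota> ` L\<rparr>) x (\<iota> y))"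

definition is_cell_form ::
    "('r::field, 'a) module \<Rightarrow> ('a \<Rightarrow> 'a) \<Rightarrow> 'a set \<Rightarrow> 'a set \<Rightarrow> ('a \<Rightarrow> ('a \<times> 'a \<Rightarrow>\<^sub>0 int) set) \<Rightarrow>
     ('a \<Rightarrow> 'a \<Rightarrow> 'r) \<Rightarrow> bool" where
  "is_cell_form A \<iota> J L \<alpha> \<Phi> \<longleftrightarrow>
     (\<forall>x\<in>L. \<forall>y\<in>L. \<forall>z\<in>L. \<Phi> (x \<oplus>\<^bsub>A\<^esub> y) z = \<Phi> x z + \<Phi> y z \<and> \<Phi> z (x \<oplus>\<^bsub>A\<^esub> y) = \<Phi> z x + \<Phi> z y) \<and>
     (\<forall>c. \<forall>x\<in>L. \<forall>y\<in>L. \<Phi> (c \<odot>\<^bsub>A\<^esub> x) y = c * \<Phi> x y \<and> \<Phi> x (c \<odot>\<^bsub>A\<^esub> y) = c * \<Phi> x y) \<and>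
     (\<forall>x\<in>L. \<forall>y\<in>L. \<forall>x'\<in>L. \<forall>y'\<in>L.
        cell_element A \<iota> J L \<alpha> x y \<otimes>\<^bsub>A\<^esub> cell_element A \<iota> J L \<alpha> x' y' =
        \<Phi> y x' \<odot>\<^bsub>A\<^esub> cell_element A \<iota> J L \<alpha> x y')"

text \<open>The values of the form on \<open>L\<close> are determined by \<^const>\<open>is_cell_form\<close>.\<close>

definition cell_form ::
    "('r::field, 'a) module \<Rightarrow> ('a \<Rightarrow> 'a) \<Rightarrow> 'a set \<Rightarrow> 'a set \<Rightarrow> ('a \<Rightarrow> ('a \<times> 'a \<Rightarrow>\<^sub>0 int) set) \<Rightarrow>
     'a \<Rightarrow> 'a \<Rightarrow> 'r" where
  "cell_form A \<iota> J L \<alpha> = (SOME \<Phi>. is_cell_form A \<iota> J L \<alpha> \<Phi>)"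

definition cell_rad ::
    "('r::field, 'a) module \<Rightarrow> ('a \<Rightarrow> 'a) \<Rightarrow> 'a set \<Rightarrow> 'a set \<Rightarrow> ('a \<Rightarrow> ('a \<times> 'a \<Rightarrow>\<^sub>0 int) set) \<Rightarrow> 'a set"
  where
  "cell_rad A \<iota> J L \<alpha> = {y\<in>L. \<forall>x\<in>L. cell_form A \<iota> J L \<alpha> y x = 0}"

text \<open>A chain \<open>I\<^sub>0, \<dots>, I\<^sub>N\<close> of ideals; entry \<open>j < N\<close> of the other two components is the
  left ideal of the quotient algebra by \<open>I\<^sub>j\<close>, and the bimodule isomorphism, that belong to the
  cell ideal \<open>I\<^sub>j\<^sub>+\<^sub>1 / I\<^sub>j\<close>.\<close>

record 'a cell_data =
  chain_length :: nat
  chain_ideal :: "nat \<Rightarrow> 'a set"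
  chain_left :: "nat \<Rightarrow> 'a set set"
  chain_iso :: "nat \<Rightarrow> 'a set \<Rightarrow> ('a set \<times> 'a set \<Rightarrow>\<^sub>0 int) set"

definition chain_layer :: "('r, 'a) module \<Rightarrow> 'a cell_data \<Rightarrow> nat \<Rightarrow> 'a set set" where
  "chain_layer A C j = (\<lambda>x. chain_ideal C j +>\<^bsub>A\<^esub> x) ` chain_ideal C (Suc j)"

definition cell_chain :: "('r::field, 'a) module \<Rightarrow> ('a \<Rightarrow> 'a) \<Rightarrow> 'a cell_data \<Rightarrow> bool" where
  "cell_chain A \<iota> C \<longleftrightarrow>
     chain_ideal C 0 = {\<zero>\<^bsub>A\<^esub>} \<and> chain_ideal C (chain_length C) = carrier A \<and>
     (\<forall>j \<le> chain_length C. ideal (chain_ideal C j) A \<and> \<iota> ` chain_ideal C j = chain_ideal C j) \<and>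
     (\<forall>j < chain_length C.
        chain_ideal C j \<subseteq> chain_ideal C (Suc j) \<and>
        (\<exists>U. submodule U ring_of_type_algebra A \<and> \<iota> ` U = U \<and>
             chain_ideal C j \<inter> U = {\<zero>\<^bsub>A\<^esub>} \<and> chain_ideal C j <+>\<^bsub>A\<^esub> U = chain_ideal C (Suc j)) \<and>
        cell_ideal (quotient_algebra A (chain_ideal C j)) ((`) \<iota>)
          (chain_layer A C j) (chain_left C j) (chain_iso C j))"

text \<open>The \<open>j\<close>-th cell module (\<open>j < N\<close>) as a module over \<open>A\<close>, and the radical of its form.\<close>

definition cell_module :: "('r, 'a) module \<Rightarrow> 'a cell_data \<Rightarrow> nat \<Rightarrow> ('a, 'a set) module" where
  "cell_module A C j = (let Q = quotient_algebra A (chain_ideal C j) in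
     \<lparr>carrier = chain_left C j, monoid.mult = undefined, monoid.one = undefined,
      ring.zero = \<zero>\<^bsub>Q\<^esub>, add = ring.add Q,
      module.smult = (\<lambda>a Z. (chain_ideal C j +>\<^bsub>A\<^esub> a) \<otimes>\<^bsub>Q\<^esub> Z)\<rparr>)"

definition cell_radical ::
    "('r::field, 'a) module \<Rightarrow> ('a \<Rightarrow> 'a) \<Rightarrow> 'a cell_data \<Rightarrow> nat \<Rightarrow> 'a set set" where
  "cell_radical A \<iota> C j =
     cell_rad (quotient_algebra A (chain_ideal C j)) ((`) \<iota>)
       (chain_layer A C j) (chain_left C j) (chain_iso C j)"

text \<open>\<open>D(\<lambda>) = \<Delta>(\<lambda>) / rad \<Delta>(\<lambda>)\<close>; possibly zero.\<close>

definition cell_head ::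
    "('r::field, 'a) module \<Rightarrow> ('a \<Rightarrow> 'a) \<Rightarrow> 'a cell_data \<Rightarrow> nat \<Rightarrow> ('a, 'a set set) module" where
  "cell_head A \<iota> C j = quotient_module (cell_module A C j) (cell_radical A \<iota> C j)"

section \<open>Algebras with a distinguished basis\<close>

text \<open>The algebra with finite basis \<open>Z\<close>, unit \<open>u \<in> Z\<close> and product
  \<open>a \<cdot> b = c a b (p a b)\<close> of basis elements; elements are coefficient functions.\<close>

definition based_algebra ::
    "'x set \<Rightarrow> ('x \<Rightarrow> 'x \<Rightarrow> 'r) \<Rightarrow> ('x \<Rightarrow> 'x \<Rightarrow> 'x) \<Rightarrow> 'x \<Rightarrow> ('r::field, 'x \<Rightarrow> 'r) module" where
  "based_algebra Z c p u =
     \<lparr>carrier = {f. \<forall>a. a \<notin> Z \<longrightarrow> f a = 0},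
      monoid.mult = (\<lambda>f g z. \<Sum>a\<in>Z. \<Sum>b\<in>Z. if p a b = z then c a b * f a * g b else 0),
      monoid.one = (\<lambda>z. if z = u then 1 else 0),
      ring.zero = (\<lambda>_. 0),
      add = (\<lambda>f g z. f z + g z),
      module.smult = (\<lambda>r f z. r * f z)\<rparr>"

definition hyperoctahedral :: "nat \<Rightarrow> (nat \<Rightarrow> nat) set" where
  "hyperoctahedral m =
     {\<pi>. \<pi> permutes {1..2*m} \<and> (\<forall>j\<in>{1..2*m}. \<pi> (2*m + 1 - j) = 2*m + 1 - \<pi> j)}"

text \<open>Products in the group are read from left to right.\<close>

definition hyp_algebra :: "nat \<Rightarrow> ('r::field, (nat \<Rightarrow> nat) \<Rightarrow> 'r) module" where
  "hyp_algebra m = based_algebra (hyperoctahedral m) (\<lambda>_ _. 1) (\<lambda>\<pi> \<rho>. \<rho> \<circ> \<pi>) id"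

definition hyp_inv :: "nat \<Rightarrow> ((nat \<Rightarrow> nat) \<Rightarrow> 'r::field) \<Rightarrow> (nat \<Rightarrow> nat) \<Rightarrow> 'r" where
  "hyp_inv m h = (\<lambda>\<pi>. if \<pi> \<in> hyperoctahedral m then h (inv_into UNIV \<pi>) else 0)"

section \<open>The Brauer algebra of type C\<close>

text \<open>\<open>Mid\<close> is used only while stacking two diagrams, for the identified middle row.\<close>

datatype node = Top nat | Mid nat | Bot nat

primrec reflect :: "nat \<Rightarrow> node \<Rightarrow> node" where
  "reflect n (Top j) = Top (2*n + 1 - j)"
| "reflect n (Mid j) = Mid (2*n + 1 - j)"
| "reflect n (Bot j) = Bot (2*n + 1 - j)"

primrec swap_rows :: "node \<Rightarrow> node" where
  "swap_rows (Top j) = Bot j"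
| "swap_rows (Mid j) = Mid j"
| "swap_rows (Bot j) = Top j"

primrec to_upper :: "node \<Rightarrow> node" where
  "to_upper (Top j) = Top j"
| "to_upper (Mid j) = Mid j"
| "to_upper (Bot j) = Mid j"

primrec to_lower :: "node \<Rightarrow> node" where
  "to_lower (Top j) = Mid j"
| "to_lower (Mid j) = Mid j"
| "to_lower (Bot j) = Bot j"

definition brauer_diagrams :: "nat \<Rightarrow> node set set set" where
  "brauer_diagrams N =
     {d. partition_on (Top ` {1..N} \<union> Bot ` {1..N}) d \<and> (\<forall>b\<in>d. card b = 2)}"

definition sym_diagrams :: "nat \<Rightarrow> node set set set" where
  "sym_diagrams n = {d \<in> brauer_diagrams (2*n). (`) (reflect n) ` d = d}"

definition stacked :: "node set set \<Rightarrow> node set set \<Rightarrow> node set set" where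
  "stacked d e = (`) to_upper ` d \<union> (`) to_lower ` e"

definition stack_components :: "node set set \<Rightarrow> node set set \<Rightarrow> node set set" where
  "stack_components d e =
     \<Union> (stacked d e) // {(x, y). \<exists>b\<in>stacked d e. x \<in> b \<and> y \<in> b}\<^sup>+"

definition diagram_mult :: "node set set \<Rightarrow> node set set \<Rightarrow> node set set" where
  "diagram_mult d e = {C - range Mid | C. C \<in> stack_components d e} - {{}}"

definition closed_loops :: "node set set \<Rightarrow> node set set \<Rightarrow> nat" where
  "closed_loops d e = card {C \<in> stack_components d e. C \<subseteq> range Mid}"

definition identity_diagram :: "nat \<Rightarrow> node set set" where
  "identity_diagram N = {{Top j, Bot j} | j. j \<in> {1..N}}"

definition brauer_C :: "nat \<Rightarrow> 'r::field \<Rightarrow> ('r, node set set \<Rightarrow> 'r) module" where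
  "brauer_C n \<delta> =
     based_algebra (sym_diagrams n) (\<lambda>d e. \<delta> ^ closed_loops d e) diagram_mult (identity_diagram (2*n))"

definition brauer_inv :: "(node set set \<Rightarrow> 'r::field) \<Rightarrow> node set set \<Rightarrow> 'r" where
  "brauer_inv x = (\<lambda>d. x ((`) swap_rows ` d))"

section \<open>Layers\<close>

definition top_arcs :: "node set set \<Rightarrow> nat" where
  "top_arcs d = card {b\<in>d. b \<subseteq> range Top}"

definition bot_arcs :: "node set set \<Rightarrow> nat" where
  "bot_arcs d = card {b\<in>d. b \<subseteq> range Bot}"

definition arc_ideal :: "nat \<Rightarrow> nat \<Rightarrow> (node set set \<Rightarrow> 'r::field) set" where
  "arc_ideal n k = {x. \<forall>d. x d \<noteq> 0 \<longrightarrow> d \<in> sym_diagrams n \<and> k \<le> top_arcs d \<and> k \<le> bot_arcs d}"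

definition layer_diagrams :: "nat \<Rightarrow> nat \<Rightarrow> node set set set" where
  "layer_diagrams n k = {d \<in> sym_diagrams n. top_arcs d = k \<and> bot_arcs d = k}"

definition dangles :: "nat \<Rightarrow> nat \<Rightarrow> nat set set set" where
  "dangles n k =
     {e. partition_on {1..2*n} e \<and> (\<forall>b\<in>e. card b = 1 \<or> card b = 2) \<and>
         card {b\<in>e. card b = 2} = k \<and> (`) (\<lambda>j. 2*n + 1 - j) ` e = e}"

definition dangle_space :: "nat \<Rightarrow> nat \<Rightarrow> (nat set set \<Rightarrow> 'r::field) set" where
  "dangle_space n k = {v. \<forall>e. e \<notin> dangles n k \<longrightarrow> v e = 0}"

text \<open>A through strand leaves a singleton block; an arc of the other row leaves the empty trace.\<close>

definition top_dangle :: "node set set \<Rightarrow> nat set set" where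
  "top_dangle d = {Top -` b | b. b \<in> d} - {{}}"

definition bot_dangle :: "node set set \<Rightarrow> nat set set" where
  "bot_dangle d = {Bot -` b | b. b \<in> d} - {{}}"

definition free_top :: "node set set \<Rightarrow> nat set" where
  "free_top d = {j. \<exists>i. {Top j, Bot i} \<in> d}"

definition free_bot :: "node set set \<Rightarrow> nat set" where
  "free_bot d = {i. \<exists>j. {Top j, Bot i} \<in> d}"

text \<open>\<open>j \<in> S\<close> is the \<open>rank S j\<close>-th element of \<open>S\<close>, counting from \<open>1\<close>.\<close>

definition rank :: "nat set \<Rightarrow> nat \<Rightarrow> nat" where
  "rank S j = card {i\<in>S. i \<le> j}"

definition through_perm :: "node set set \<Rightarrow> nat \<Rightarrow> nat" where
  "through_perm d =
     (THE \<pi>. \<pi> permutes {1..card (free_top d)} \<and>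
        (\<forall>j i. {Top j, Bot i} \<in> d \<longrightarrow> \<pi> (rank (free_top d) j) = rank (free_bot d) i))"

text \<open>\<open>V(2n,k) \<otimes> V(2n,k) \<otimes> RH\<^sub>n\<^sub>-\<^sub>k\<close> has the basis \<open>e \<otimes> f \<otimes> \<pi>\<close>, so its elements are given
  by their coefficient functions. In particular \<open>u \<otimes> v \<otimes> h\<close> is
  \<open>\<lambda>(e, f, \<pi>). u e * v f * h \<pi>\<close>. The map \<open>layer_map n k\<close> is \<open>\<psi>\<^sub>k\<close>, precomposed with the
  projection from \<open>J\<^sub>k\<close> to \<open>J\<^sub>k / J\<^sub>k\<^sub>+\<^sub>1\<close>.\<close>

type_synonym 'r layer = "nat set set \<times> nat set set \<times> (nat \<Rightarrow> nat) \<Rightarrow> 'r"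

definition layer_map :: "nat \<Rightarrow> nat \<Rightarrow> (node set set \<Rightarrow> 'r::field) \<Rightarrow> 'r layer" where
  "layer_map n k x =
     (\<lambda>t. \<Sum>d \<in> {d \<in> layer_diagrams n k. (top_dangle d, bot_dangle d, through_perm d) = t}. x d)"

text \<open>The left action of the algebra on \<open>J\<^sub>k / J\<^sub>k\<^sub>+\<^sub>1\<close>, transported along \<open>\<psi>\<^sub>k\<close>.\<close>

definition layer_smult ::
    "nat \<Rightarrow> 'r::field \<Rightarrow> nat \<Rightarrow> (node set set \<Rightarrow> 'r) \<Rightarrow> 'r layer \<Rightarrow> 'r layer" where
  "layer_smult n \<delta> k b F =
     layer_map n k (b \<otimes>\<^bsub>brauer_C n \<delta>\<^esub> inv_into (arc_ideal n k) (layer_map n k) F)"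

text \<open>The subspace \<open>V(2n,k) \<otimes> v \<otimes> RH\<^sub>n\<^sub>-\<^sub>k\<close>, whose elements are the sums of
  \<open>e \<otimes> v \<otimes> G e\<close> over the dangles \<open>e\<close>, as a right \<open>RH\<^sub>n\<^sub>-\<^sub>k\<close>-module.\<close>

definition layer_column ::
    "nat \<Rightarrow> nat \<Rightarrow> (nat set set \<Rightarrow> 'r::field) \<Rightarrow> ((nat \<Rightarrow> nat) \<Rightarrow> 'r, 'r layer) module" where
  "layer_column n k v =
     \<lparr>carrier = {\<lambda>(e, f, \<pi>). if e \<in> dangles n k then v f * G e \<pi> else 0 | G.
                  \<forall>e \<in> dangles n k. G e \<in> carrier (hyp_algebra (n - k) :: ('r, _) module)},
      monoid.mult = undefined, monoid.one = undefined,
      ring.zero = (\<lambda>_. 0),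
      add = (\<lambda>F G t. F t + G t),
      module.smult = (\<lambda>h F. \<lambda>(e, f, \<pi>). ((\<lambda>\<rho>. F (e, f, \<rho>)) \<otimes>\<^bsub>hyp_algebra (n - k)\<^esub> h) \<pi>)\<rparr>"

text \<open>\<open>V(2n,k) \<otimes> v \<otimes> M\<close> for a left \<open>RH\<^sub>n\<^sub>-\<^sub>k\<close>-module \<open>M\<close>, as a left module over the Brauer
  algebra.\<close>

definition inflated_module ::
    "nat \<Rightarrow> 'r::field \<Rightarrow> nat \<Rightarrow> (nat set set \<Rightarrow> 'r) \<Rightarrow> ((nat \<Rightarrow> nat) \<Rightarrow> 'r, 'm) module \<Rightarrow>
     (node set set \<Rightarrow> 'r, ('r layer \<times> 'm \<Rightarrow>\<^sub>0 int) set) module" where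
  "inflated_module n \<delta> k v M =
     (let H = (hyp_algebra (n - k) :: ('r, _) module); W = layer_column n k v; T = tensor H W M in
      \<lparr>carrier = carrier T, monoid.mult = undefined, monoid.one = undefined,
       ring.zero = monoid.one T, add = monoid.mult T,
       module.smult = (\<lambda>b. tensor_map H W M (\<lambda>(F, x). (layer_smult n \<delta> k b F, x)))\<rparr>)"

text \<open>The preimage in \<open>J\<^sub>k\<close> of \<open>V(2n,k) \<otimes> V(2n,k) \<otimes> I\<close>. An element of the layer is uniquely a
  sum of \<open>e \<otimes> f \<otimes> h\<^sub>e\<^sub>f\<close> over pairs of dangles, and lies in this subspace iff every \<open>h\<^sub>e\<^sub>f\<close> lies
  in \<open>I\<close>.\<close>

definition layer_preimage ::
    "nat \<Rightarrow> nat \<Rightarrow> ((nat \<Rightarrow> nat) \<Rightarrow> 'r::field) set \<Rightarrow> (node set set \<Rightarrow> 'r) set" where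
  "layer_preimage n k I =
     {x \<in> arc_ideal n k. \<forall>e f. (\<lambda>\<pi>. layer_map n k x (e, f, \<pi>)) \<in> I}"

text \<open>The chain of the Brauer algebra runs first through the layer \<open>k = n\<close>, then
  \<open>k = n - 1\<close>, and so on; the layer \<open>k\<close> starts at the position below, and its
  \<open>j\<close>-th cell module is that of position \<open>layer_start C (n - k) + j\<close>.\<close>

definition layer_start :: "(nat \<Rightarrow> 'a cell_data) \<Rightarrow> nat \<Rightarrow> nat" where
  "layer_start C m = (\<Sum>l<m. chain_length (C l))"

text \<open>\<open>E\<close> is a cell structure on the Brauer algebra with the chain refining
  \<open>0 = J\<^sub>n\<^sub>+\<^sub>1 \<subseteq> J\<^sub>n \<subseteq> \<dots> \<subseteq> J\<^sub>0\<close> by means of the chosen cell chains \<open>C m\<close> of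
  \<open>RH\<^sub>m\<close>, and with cell modules \<open>V(2n,k) \<otimes> v\<^sub>k \<otimes> \<Delta>(\<mu>)\<close>.\<close>

definition brauer_cell_structure ::
    "nat \<Rightarrow> 'r::field \<Rightarrow> (nat \<Rightarrow> ((nat \<Rightarrow> nat) \<Rightarrow> 'r) cell_data) \<Rightarrow> (nat \<Rightarrow> nat set set \<Rightarrow> 'r) \<Rightarrow>
     (node set set \<Rightarrow> 'r) cell_data \<Rightarrow> bool" where
  "brauer_cell_structure n \<delta> C v E \<longleftrightarrow>
     cell_chain (brauer_C n \<delta>) brauer_inv E \<and>
     chain_length E = layer_start C (Suc n) \<and>
     (\<forall>k\<le>n. \<forall>j \<le> chain_length (C (n - k)).
        chain_ideal E (layer_start C (n - k) + j) = layer_preimage n k (chain_ideal (C (n - k)) j)) \<and>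
     (\<forall>k\<le>n. \<forall>j < chain_length (C (n - k)).
        module_isomorphic (brauer_C n \<delta>)
          (cell_module (brauer_C n \<delta>) E (layer_start C (n - k) + j))
          (inflated_module n \<delta> k (v k) (cell_module (hyp_algebra (n - k)) (C (n - k)) j)))"

end

theory Submission
  imports Defs
begin

text \<open>The proof truncates by an idempotent. Choose a dangle \<open>g\<close> with \<open>v\<^sub>k(g) \<noteq> 0\<close>, and let
  \<open>e\<close> be \<open>\<delta>\<^sup>-\<^sup>k\<close> times the diagram that has \<open>g\<close> on both rows and whose through strands do not
  permute the free nodes. Stacking this diagram on itself closes the \<open>k\<close> arcs of \<open>g\<close> to \<open>k\<close> loops,
  so \<open>e\<close> is idempotent; this is where \<open>\<delta> \<noteq> 0\<close> enters. Arcs of the top row of the upper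
  factor and arcs of the bottom row of the lower factor survive in a product of diagrams. Hence, modulo the
  elements of \<open>J\<^sub>k\<close> that vanish under \<open>\<psi>\<^sub>k\<close>, the corner \<open>eBe\<close> consists of combinations of
  diagrams with the dangle \<open>g\<close> on both rows, and is a copy of \<open>RH\<^sub>n\<^sub>-\<^sub>k\<close>.

  Consequently \<open>N \<mapsto> eN\<close> turns a \<open>B\<close>-module that is killed by those elements into an
  \<open>RH\<^sub>n\<^sub>-\<^sub>k\<close>-module. A simple section becomes simple or zero, and two simple modules with
  non-zero isomorphic truncations are isomorphic. Truncation takes \<open>\<Delta>(\<mu>,k)\<close> to \<open>\<Delta>(\<mu>)\<close>, by
  way of \<open>x \<mapsto> (g \<otimes> v\<^sub>k \<otimes> 1) \<otimes> x\<close>, and it takes the radical of \<open>\<Delta>(\<lambda>,k)\<close> to that of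
  \<open>\<Delta>(\<lambda>)\<close>, hence \<open>D(\<lambda>,k)\<close> to \<open>D(\<lambda>) \<noteq> 0\<close>. So it pairs the composition factors
  \<open>D(\<lambda>,k)\<close> of \<open>\<Delta>(\<mu>,k)\<close> with the composition factors \<open>D(\<lambda>)\<close> of \<open>\<Delta>(\<mu>)\<close>.

  The multiplicity is a definite description that ranges over all composition series, so it is enough
  that the same numbers occur as counts on both sides (\<open>composition_mult_corner\<close>). Truncating a
  composition series of \<open>N\<close> and omitting repetitions gives one of \<open>eN\<close> with the same count. In the
  other direction a series of submodules \<open>W\<close> of \<open>eN\<close> is lifted to the largest submodules of \<open>N\<close>
  whose truncation is \<open>W\<close>, and refined to a composition series of \<open>N\<close>; truncation of the refinement
  gives back the original series. A refinement exists because \<open>\<Delta>(\<mu>,k)\<close> has finite dimension.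

  To compare the radicals, the bilinear form is eliminated: the radical of a cell module is the
  set of elements annihilated by its cell ideal, and each element outside of it generates the module
  (\<open>cell_rad_eq_annihilated\<close>, \<open>cell_generated_outside_rad\<close>). Both statements concern the module
  alone, so they can be carried along the isomorphism between the cell module of the given cell
  structure and \<open>\<Delta>(\<lambda>,k)\<close>; the second one yields that \<open>D(\<lambda>,k)\<close> is simple. Associativity
  of \<open>B\<close> and the ideal properties of the layers are part of the given cell chain, whose members are
  ideals of a ring.\<close>

section \<open>Left modules over arbitrary rings\<close>

locale left_module = A: ring A + abelian_group M
  for A :: "('s, 'x) ring_scheme" and M :: "('s, 'm) module" (structure) +
  assumes smult_closed [simp, intro]: "\<lbrakk>a \<in> carrier A; x \<in> carrier M\<rbrakk> \<Longrightarrow> a \<odot> x \<in> carrier M"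
    and smult_r_distr: "\<lbrakk>a \<in> carrier A; x \<in> carrier M; y \<in> carrier M\<rbrakk> \<Longrightarrow> a \<odot> (x \<oplus> y) = a \<odot> x \<oplus> a \<odot> y"
    and smult_l_distr: "\<lbrakk>a \<in> carrier A; b \<in> carrier A; x \<in> carrier M\<rbrakk> \<Longrightarrow>
      (a \<oplus>\<^bsub>A\<^esub> b) \<odot> x = a \<odot> x \<oplus> b \<odot> x"
    and smult_assoc: "\<lbrakk>a \<in> carrier A; b \<in> carrier A; x \<in> carrier M\<rbrakk> \<Longrightarrow>
      (a \<otimes>\<^bsub>A\<^esub> b) \<odot> x = a \<odot> (b \<odot> x)"
    and smult_one [simp]: "x \<in> carrier M \<Longrightarrow> \<one>\<^bsub>A\<^esub> \<odot> x = x"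
begin

lemma smult_r_null [simp]:
  assumes "a \<in> carrier A" shows "a \<odot> \<zero> = \<zero>"
proof -
  have "a \<odot> \<zero> \<oplus> a \<odot> \<zero> = a \<odot> \<zero> \<oplus> \<zero>"
    using assms smult_r_distr[of a \<zero> \<zero>] by simp
  then show ?thesis using assms by (metis add.l_cancel smult_closed zero_closed)
qed

lemma smult_l_null [simp]:
  assumes "x \<in> carrier M" shows "\<zero>\<^bsub>A\<^esub> \<odot> x = \<zero>"
proof -
  have "\<zero>\<^bsub>A\<^esub> \<odot> x \<oplus> \<zero>\<^bsub>A\<^esub> \<odot> x = \<zero>\<^bsub>A\<^esub> \<odot> x \<oplus> \<zero>"
    using assms smult_l_distr[of "\<zero>\<^bsub>A\<^esub>" "\<zero>\<^bsub>A\<^esub>" x] by simp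
  then show ?thesis using assms by (metis add.l_cancel smult_closed A.zero_closed zero_closed)
qed

lemma smult_r_minus:
  assumes "a \<in> carrier A" "x \<in> carrier M" shows "a \<odot> (\<ominus> x) = \<ominus> (a \<odot> x)"
proof -
  have "a \<odot> (\<ominus> x) \<oplus> a \<odot> x = \<zero>"
    using assms by (metis a_inv_closed l_neg smult_r_distr smult_r_null)
  then show ?thesis using assms by (metis add.inv_closed minus_equality smult_closed)
qed

lemma smult_l_minus:
  assumes "a \<in> carrier A" "x \<in> carrier M" shows "(\<ominus>\<^bsub>A\<^esub> a) \<odot> x = \<ominus> (a \<odot> x)"
proof -
  have "(\<ominus>\<^bsub>A\<^esub> a) \<odot> x \<oplus> a \<odot> x = \<zero>"
    using assms by (metis A.a_inv_closed A.l_neg smult_l_distr smult_l_null)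
  then show ?thesis using assms by (metis A.a_inv_closed minus_equality smult_closed)
qed

lemma smult_r_diff:
  assumes "a \<in> carrier A" "x \<in> carrier M" "y \<in> carrier M"
  shows "a \<odot> (x \<ominus> y) = a \<odot> x \<ominus> a \<odot> y"
  using assms by (simp add: minus_eq smult_r_distr smult_r_minus)

lemma eq_iff_diff_zero:
  assumes "x \<in> carrier M" "y \<in> carrier M" shows "x = y \<longleftrightarrow> x \<ominus> y = \<zero>"
  using assms by (metis add.inv_closed minus_eq minus_equality minus_minus r_neg)

lemma submoduleI:
  assumes "U \<subseteq> carrier M" "\<zero> \<in> U"
    and "\<And>x y. \<lbrakk>x \<in> U; y \<in> U\<rbrakk> \<Longrightarrow> x \<oplus> y \<in> U"
    and "\<And>a x. \<lbrakk>a \<in> carrier A; x \<in> U\<rbrakk> \<Longrightarrow> a \<odot> x \<in> U"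
  shows "submodule U A M"
proof -
  have "\<ominus> x \<in> U" if "x \<in> U" for x
  proof -
    have "(\<ominus>\<^bsub>A\<^esub> \<one>\<^bsub>A\<^esub>) \<odot> x = \<ominus> x"
      using that assms(1) smult_l_minus[of "\<one>\<^bsub>A\<^esub>" x] by auto
    then show ?thesis using assms(4)[of "\<ominus>\<^bsub>A\<^esub> \<one>\<^bsub>A\<^esub>" x] that by simp
  qed
  then show ?thesis
    using assms by (intro submodule.intro subgroup.intro) (auto simp: submodule_axioms_def a_inv_def)
qed

lemma submoduleD:
  assumes "submodule U A M"
  shows "U \<subseteq> carrier M" "\<zero> \<in> U"
    "\<And>x y. \<lbrakk>x \<in> U; y \<in> U\<rbrakk> \<Longrightarrow> x \<oplus> y \<in> U"
    "\<And>x. x \<in> U \<Longrightarrow> \<ominus> x \<in> U"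
    "\<And>x y. \<lbrakk>x \<in> U; y \<in> U\<rbrakk> \<Longrightarrow> x \<ominus> y \<in> U"
    "\<And>a x. \<lbrakk>a \<in> carrier A; x \<in> U\<rbrakk> \<Longrightarrow> a \<odot> x \<in> U"
proof -
  interpret U: submodule U A M by fact
  show 1: "U \<subseteq> carrier M" "\<zero> \<in> U" "\<And>x y. \<lbrakk>x \<in> U; y \<in> U\<rbrakk> \<Longrightarrow> x \<oplus> y \<in> U"
    "\<And>x. x \<in> U \<Longrightarrow> \<ominus> x \<in> U"  "\<And>a x. \<lbrakk>a \<in> carrier A; x \<in> U\<rbrakk> \<Longrightarrow> a \<odot> x \<in> U"
    using U.subset U.one_closed U.m_closed U.m_inv_closed U.smult_closed by (auto simp: a_inv_def)
  show "\<And>x y. \<lbrakk>x \<in> U; y \<in> U\<rbrakk> \<Longrightarrow> x \<ominus> y \<in> U"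
    by (simp add: minus_eq 1)
qed

lemma submodule_add_iff:
  assumes "submodule U A M" "y \<in> U" "x \<in> carrier M"
  shows "x \<oplus> y \<in> U \<longleftrightarrow> x \<in> U"
proof
  assume "x \<oplus> y \<in> U"
  then have "(x \<oplus> y) \<ominus> y \<in> U" using submoduleD(5)[OF assms(1)] assms(2) by simp
  moreover have "(x \<oplus> y) \<ominus> y = x"
    using assms submoduleD(1)[OF assms(1)] by (auto simp: minus_eq a_assoc r_neg)
  ultimately show "x \<in> U" by simp
qed (use assms submoduleD(3)[OF assms(1)] in simp)

lemma submodule_zero: "submodule {\<zero>} A M"
  by (rule submoduleI) auto

lemma submodule_is_left_module:
  assumes "submodule U A M" shows "left_module A (M\<lparr>carrier := U\<rparr>)"
proof -
  note U = submoduleD[OF assms]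
  have "\<exists>y\<in>U. y \<oplus> x = \<zero>" if "x \<in> U" for x
    using that U(1) by (intro bexI[of _ "\<ominus> x"] l_neg U(4)) auto
  note inv = this
  have in_M: "x \<in> carrier M" if "x \<in> U" for x using that U(1) by auto
  have "abelian_group (M\<lparr>carrier := U\<rparr>)"
  proof (rule abelian_groupI)
    fix x y z assume "x \<in> carrier (M\<lparr>carrier := U\<rparr>)" "y \<in> carrier (M\<lparr>carrier := U\<rparr>)"
      "z \<in> carrier (M\<lparr>carrier := U\<rparr>)"
    then show "x \<oplus>\<^bsub>M\<lparr>carrier := U\<rparr>\<^esub> y \<oplus>\<^bsub>M\<lparr>carrier := U\<rparr>\<^esub> z =
      x \<oplus>\<^bsub>M\<lparr>carrier := U\<rparr>\<^esub> (y \<oplus>\<^bsub>M\<lparr>carrier := U\<rparr>\<^esub> z)"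
      by (simp add: in_M a_assoc)
  next
    fix x y assume "x \<in> carrier (M\<lparr>carrier := U\<rparr>)" "y \<in> carrier (M\<lparr>carrier := U\<rparr>)"
    then show "x \<oplus>\<^bsub>M\<lparr>carrier := U\<rparr>\<^esub> y = y \<oplus>\<^bsub>M\<lparr>carrier := U\<rparr>\<^esub> x"
      by (simp add: in_M a_comm)
  qed (simp_all add: U inv in_M)
  then show ?thesis
    by (intro left_module.intro left_module_axioms.intro A.ring_axioms)
       (simp_all add: U in_M smult_r_distr smult_l_distr smult_assoc)
qed

lemma submodule_of_submodule:
  assumes "submodule Y A M"
  shows "submodule U A (M\<lparr>carrier := Y\<rparr>) \<longleftrightarrow> submodule U A M \<and> U \<subseteq> Y"
proof -
  interpret Y: left_module A "M\<lparr>carrier := Y\<rparr>" using assms by (rule submodule_is_left_module)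
  show ?thesis
  proof
    assume *: "submodule U A (M\<lparr>carrier := Y\<rparr>)"
    show "submodule U A M \<and> U \<subseteq> Y"
      using Y.submoduleD(1,2,3,6)[OF *] submoduleD(1)[OF assms]
      by (intro conjI submoduleI) auto
  next
    assume "submodule U A M \<and> U \<subseteq> Y"
    then show "submodule U A (M\<lparr>carrier := Y\<rparr>)"
      using submoduleD(1,2,3,6)[of U] by (intro Y.submoduleI) auto
  qed
qed

lemma coset_eq_iff:
  assumes "submodule U A M" "x \<in> carrier M" "y \<in> carrier M"
  shows "U +> x = U +> y \<longleftrightarrow> x \<ominus> y \<in> U"
proof -
  interpret U: submodule U A M by fact
  interpret abelian_subgroup U M
    by (rule abelian_subgroupI3) (use U.subgroup_axioms abelian_group_axioms in \<open>auto simp: additive_subgroup_def\<close>)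
  have "U +> x = U +> y \<longleftrightarrow> x \<in> U +> y"
    using assms a_repr_independence' a_repr_independenceD by (metis a_rcos_self)
  also have "\<dots> \<longleftrightarrow> x \<ominus> y \<in> U"
    using a_rcos_module[OF assms(3,2)] by (simp add: minus_eq)
  finally show ?thesis .
qed

lemma mem_coset_iff:
  assumes "submodule U A M" "x \<in> carrier M"
  shows "y \<in> U +> x \<longleftrightarrow> y \<in> carrier M \<and> U +> y = U +> x"
proof -
  interpret U: submodule U A M by fact
  interpret abelian_subgroup U M
    by (rule abelian_subgroupI3) (use U.subgroup_axioms abelian_group_axioms in \<open>auto simp: additive_subgroup_def\<close>)
  show ?thesis
    using assms a_repr_independence' a_repr_independenceD a_rcos_self a_elemrcos_carrier by metis
qed

lemma quotient_carrier: "carrier (quotient_module M U) = (\<lambda>x. U +> x) ` carrier M"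
  by (auto simp: quotient_module_def A_RCOSETS_def')

lemma quotient_zero: "submodule U A M \<Longrightarrow> \<zero>\<^bsub>quotient_module M U\<^esub> = U +> \<zero>"
  using a_coset_add_zero submoduleD(1) by (auto simp: quotient_module_def)

lemma quotient_add:
  assumes "submodule U A M" "x \<in> carrier M" "y \<in> carrier M"
  shows "(U +> x) \<oplus>\<^bsub>quotient_module M U\<^esub> (U +> y) = U +> (x \<oplus> y)"
proof -
  interpret U: submodule U A M by fact
  interpret abelian_subgroup U M
    by (rule abelian_subgroupI3) (use U.subgroup_axioms abelian_group_axioms in \<open>auto simp: additive_subgroup_def\<close>)
  show ?thesis using assms a_rcos_sum by (simp add: quotient_module_def)
qed

lemma quotient_smult:
  assumes "submodule U A M" "a \<in> carrier A" "x \<in> carrier M"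
  shows "a \<odot>\<^bsub>quotient_module M U\<^esub> (U +> x) = U +> (a \<odot> x)"
proof -
  have "U +> (a \<odot> y) = U +> (a \<odot> x)" if "y \<in> U +> x" for y
  proof -
    have y: "y \<in> carrier M" "y \<ominus> x \<in> U"
      using that assms by (auto simp: mem_coset_iff coset_eq_iff)
    then have "a \<odot> y \<ominus> a \<odot> x \<in> U"
      using submoduleD(6)[OF assms(1,2) y(2)] smult_r_diff[OF assms(2) y(1) assms(3)] by simp
    then show ?thesis using assms y by (simp add: coset_eq_iff)
  qed
  moreover have "x \<in> U +> x" using assms by (simp add: mem_coset_iff)
  ultimately have "(\<Union>y\<in>U +> x. U +> (a \<odot> y)) = U +> (a \<odot> x)" by blast
  then show ?thesis by (simp add: quotient_module_def)
qed

lemma quotient_left_module: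
  assumes U: "submodule U A M" shows "left_module A (quotient_module M U)"
proof -
  let ?Q = "quotient_module M U"
  note c = quotient_carrier[of U]
  have rep: "\<exists>x\<in>carrier M. Z = U +> x" if "Z \<in> carrier ?Q" for Z
    using that by (auto simp: c)
  have in_Q: "U +> x \<in> carrier ?Q" if "x \<in> carrier M" for x
    using that by (auto simp: c)
  have "abelian_group ?Q"
  proof (rule abelian_groupI)
    show "\<zero>\<^bsub>?Q\<^esub> \<in> carrier ?Q" using in_Q[of \<zero>] quotient_zero[OF U] by simp
  next
    fix Z Y assume "Z \<in> carrier ?Q" "Y \<in> carrier ?Q"
    then obtain x y where [simp]: "x \<in> carrier M" "Z = U +> x" "y \<in> carrier M" "Y = U +> y"
      using rep by metis
    show "Z \<oplus>\<^bsub>?Q\<^esub> Y \<in> carrier ?Q" using in_Q by (simp add: quotient_add[OF U])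
    show "Z \<oplus>\<^bsub>?Q\<^esub> Y = Y \<oplus>\<^bsub>?Q\<^esub> Z" by (simp add: quotient_add[OF U] a_comm)
    fix V assume "V \<in> carrier ?Q"
    then obtain v where [simp]: "v \<in> carrier M" "V = U +> v" using rep by metis
    show "Z \<oplus>\<^bsub>?Q\<^esub> Y \<oplus>\<^bsub>?Q\<^esub> V = Z \<oplus>\<^bsub>?Q\<^esub> (Y \<oplus>\<^bsub>?Q\<^esub> V)"
      by (simp add: quotient_add[OF U] a_assoc)
  next
    fix Z assume "Z \<in> carrier ?Q"
    then obtain x where x: "x \<in> carrier M" "Z = U +> x" using rep by metis
    have "\<zero>\<^bsub>?Q\<^esub> \<oplus>\<^bsub>?Q\<^esub> Z = U +> (\<zero> \<oplus> x)"
      using quotient_add[OF U, of \<zero> x] quotient_zero[OF U] x by simp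
    then show "\<zero>\<^bsub>?Q\<^esub> \<oplus>\<^bsub>?Q\<^esub> Z = Z" using x by simp
    have "(U +> \<ominus> x) \<oplus>\<^bsub>?Q\<^esub> Z = \<zero>\<^bsub>?Q\<^esub>"
      using x by (simp add: quotient_add[OF U] quotient_zero[OF U] l_neg)
    then show "\<exists>Y\<in>carrier ?Q. Y \<oplus>\<^bsub>?Q\<^esub> Z = \<zero>\<^bsub>?Q\<^esub>"
      using x in_Q[of "\<ominus> x"] by blast
  qed
  moreover have "left_module_axioms A ?Q"
  proof (rule left_module_axioms.intro)
    fix a Z assume a: "a \<in> carrier A" and "Z \<in> carrier ?Q"
    then obtain x where [simp]: "x \<in> carrier M" "Z = U +> x" using rep by metis
    show "a \<odot>\<^bsub>?Q\<^esub> Z \<in> carrier ?Q" using a in_Q by (simp add: quotient_smult[OF U])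
    show "(a \<oplus>\<^bsub>A\<^esub> b) \<odot>\<^bsub>?Q\<^esub> Z = a \<odot>\<^bsub>?Q\<^esub> Z \<oplus>\<^bsub>?Q\<^esub> b \<odot>\<^bsub>?Q\<^esub> Z" if "b \<in> carrier A" for b
      using a that by (simp add: quotient_smult[OF U] quotient_add[OF U] smult_l_distr)
    show "(a \<otimes>\<^bsub>A\<^esub> b) \<odot>\<^bsub>?Q\<^esub> Z = a \<odot>\<^bsub>?Q\<^esub> (b \<odot>\<^bsub>?Q\<^esub> Z)" if "b \<in> carrier A" for b
      using a that by (simp add: quotient_smult[OF U] smult_assoc)
    fix Y assume "Y \<in> carrier ?Q"
    then obtain y where [simp]: "y \<in> carrier M" "Y = U +> y" using rep by metis
    show "a \<odot>\<^bsub>?Q\<^esub> (Z \<oplus>\<^bsub>?Q\<^esub> Y) = a \<odot>\<^bsub>?Q\<^esub> Z \<oplus>\<^bsub>?Q\<^esub> a \<odot>\<^bsub>?Q\<^esub> Y"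
      using a by (simp add: quotient_smult[OF U] quotient_add[OF U] smult_r_distr)
  next
    fix Z assume "Z \<in> carrier ?Q"
    then obtain x where [simp]: "x \<in> carrier M" "Z = U +> x" using rep by metis
    show "\<one>\<^bsub>A\<^esub> \<odot>\<^bsub>?Q\<^esub> Z = Z" by (simp add: quotient_smult[OF U])
  qed
  ultimately show ?thesis by (intro left_module.intro A.ring_axioms)
qed

lemma quotient_coset_eq_zero_iff:
  assumes "submodule U A M" "x \<in> carrier M"
  shows "U +> x = \<zero>\<^bsub>quotient_module M U\<^esub> \<longleftrightarrow> x \<in> U"
  using assms coset_eq_iff[OF assms(1), of x \<zero>] minus_equality[of \<zero> \<zero>] by (simp add: quotient_zero minus_eq)

text \<open>The submodules of a quotient correspond to the intermediate submodules, so simplicity of a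
  section can be tested in the ambient module.\<close>

lemma simple_quotient_iff:
  assumes U: "submodule U A M"
  shows "simple_module A (quotient_module M U) \<longleftrightarrow>
    U \<noteq> carrier M \<and> (\<forall>Y. submodule Y A M \<and> U \<subseteq> Y \<longrightarrow> Y = U \<or> Y = carrier M)"
    (is "?L \<longleftrightarrow> ?R")
proof -
  let ?Q = "quotient_module M U"
  let ?q = "\<lambda>x. U +> x"
  interpret Q: left_module A ?Q by (rule quotient_left_module[OF U])
  note c = quotient_carrier[of U]
  have z: "?q x = \<zero>\<^bsub>?Q\<^esub> \<longleftrightarrow> x \<in> U" if "x \<in> carrier M" for x
    using that by (rule quotient_coset_eq_zero_iff[OF U])
  have triv: "carrier ?Q = {\<zero>\<^bsub>?Q\<^esub>} \<longleftrightarrow> U = carrier M"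
  proof
    assume "carrier ?Q = {\<zero>\<^bsub>?Q\<^esub>}"
    then have *: "?q ` carrier M = {\<zero>\<^bsub>?Q\<^esub>}" by (simp only: c)
    have "x \<in> U" if x: "x \<in> carrier M" for x
    proof -
      have "?q x \<in> ?q ` carrier M" using x by (rule imageI)
      then show ?thesis using z[of x] x unfolding * by auto
    qed
    then show "U = carrier M" using submoduleD(1)[OF U] by blast
  next
    assume "U = carrier M"
    then have "?q x = \<zero>\<^bsub>?Q\<^esub>" if "x \<in> carrier M" for x using that z by blast
    then show "carrier ?Q = {\<zero>\<^bsub>?Q\<^esub>}" unfolding c using zero_closed
      by (auto simp: image_iff intro!: bexI[of _ \<zero>])
  qed
  have up: "submodule (?q ` Y) A ?Q" if "submodule Y A M" for Y
  proof (rule Q.submoduleI)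
    show "?q ` Y \<subseteq> carrier ?Q" using submoduleD(1)[OF that] by (auto simp: c)
    have "?q \<zero> \<in> ?q ` Y" using submoduleD(2)[OF that] by (rule imageI)
    then show "\<zero>\<^bsub>?Q\<^esub> \<in> ?q ` Y" by (simp only: quotient_zero[OF U])
    show "Z \<oplus>\<^bsub>?Q\<^esub> Z' \<in> ?q ` Y" if "Z \<in> ?q ` Y" "Z' \<in> ?q ` Y" for Z Z'
    proof -
      obtain y y' where y: "y \<in> Y" "y' \<in> Y" "Z = ?q y" "Z' = ?q y'" using \<open>Z \<in> _\<close> \<open>Z' \<in> _\<close> by blast
      then have "y \<in> carrier M" "y' \<in> carrier M" using submoduleD(1)[OF \<open>submodule Y A M\<close>] by auto
      then have "Z \<oplus>\<^bsub>?Q\<^esub> Z' = ?q (y \<oplus> y')" using y quotient_add[OF U] by simp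
      then show ?thesis using submoduleD(3)[OF \<open>submodule Y A M\<close> y(1,2)] by simp
    qed
    show "a \<odot>\<^bsub>?Q\<^esub> Z \<in> ?q ` Y" if a: "a \<in> carrier A" and "Z \<in> ?q ` Y" for a Z
    proof -
      obtain y where y: "y \<in> Y" "Z = ?q y" using \<open>Z \<in> _\<close> by blast
      then have "y \<in> carrier M" using submoduleD(1)[OF \<open>submodule Y A M\<close>] by auto
      then have "a \<odot>\<^bsub>?Q\<^esub> Z = ?q (a \<odot> y)" using y a quotient_smult[OF U] by simp
      then show ?thesis using submoduleD(6)[OF \<open>submodule Y A M\<close> a y(1)] by simp
    qed
  qed
  have down: "submodule {x \<in> carrier M. ?q x \<in> Z} A M" if Z: "submodule Z A ?Q" for Z
  proof (rule submoduleI)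
    show "\<zero> \<in> {x \<in> carrier M. ?q x \<in> Z}"
      using Q.submoduleD(2)[OF Z] quotient_zero[OF U] by simp
    show "x \<oplus> y \<in> {x \<in> carrier M. ?q x \<in> Z}"
      if "x \<in> {x \<in> carrier M. ?q x \<in> Z}" "y \<in> {x \<in> carrier M. ?q x \<in> Z}" for x y
      using that Q.submoduleD(3)[OF Z, of "?q x" "?q y"] quotient_add[OF U, of x y] by simp
    show "a \<odot> x \<in> {x \<in> carrier M. ?q x \<in> Z}"
      if "a \<in> carrier A" "x \<in> {x \<in> carrier M. ?q x \<in> Z}" for a x
      using that Q.submoduleD(6)[OF Z, of a "?q x"] quotient_smult[OF U, of a x] by simp
  qed simp
  show ?thesis
  proof
    assume L: ?L
    show ?R
    proof (intro conjI allI impI)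
      show "U \<noteq> carrier M" using L triv by (simp add: simple_module_def)
      fix Y assume Y: "submodule Y A M \<and> U \<subseteq> Y"
      then have sub: "Y \<subseteq> carrier M" using submoduleD(1) by blast
      have "?q ` Y = {\<zero>\<^bsub>?Q\<^esub>} \<or> ?q ` Y = carrier ?Q"
        using L up Y by (auto simp: simple_module_def)
      then show "Y = U \<or> Y = carrier M"
      proof
        assume *: "?q ` Y = {\<zero>\<^bsub>?Q\<^esub>}"
        have "y \<in> U" if y: "y \<in> Y" for y
        proof -
          have "?q y \<in> ?q ` Y" using y by (rule imageI)
          then show ?thesis using z[of y] sub y unfolding * by auto
        qed
        then have "Y \<subseteq> U" ..
        then show ?thesis using Y by blast
      next
        assume *: "?q ` Y = carrier ?Q"
        have "x \<in> Y" if x: "x \<in> carrier M" for x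
        proof -
          have "?q x \<in> ?q ` Y" unfolding * c using x by (rule imageI)
          then obtain y where y: "?q x = ?q y" "y \<in> Y" by (rule imageE)
          then have yM: "y \<in> carrier M" using sub by auto
          then have "x \<ominus> y \<in> Y" using coset_eq_iff[OF U x yM] y(1) Y by auto
          then have "x \<ominus> y \<oplus> y \<in> Y" using y(2) Y submoduleD(3)[of Y] by simp
          moreover have "x \<ominus> y \<oplus> y = x" using x yM by (simp add: minus_eq a_assoc l_neg)
          ultimately show ?thesis by simp
        qed
        then show ?thesis using sub by blast
      qed
    qed
  next
    assume R: ?R
    show ?L unfolding simple_module_def
    proof (intro conjI allI impI)
      show "carrier ?Q \<noteq> {\<zero>\<^bsub>?Q\<^esub>}" using R triv by blast
      fix Z assume Z: "submodule Z A ?Q"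
      let ?Y = "{x \<in> carrier M. ?q x \<in> Z}"
      have "U \<subseteq> ?Y"
      proof
        fix x assume "x \<in> U"
        then have "x \<in> carrier M" "?q x = \<zero>\<^bsub>?Q\<^esub>" using z submoduleD(1)[OF U] by auto
        then show "x \<in> ?Y" using Q.submoduleD(2)[OF Z] by simp
      qed
      then have cs: "?Y = U \<or> ?Y = carrier M" using R down[OF Z] by blast
      have img: "Z = ?q ` ?Y" using Q.submoduleD(1)[OF Z] unfolding c by blast
      have qU: "?q ` U = {\<zero>\<^bsub>?Q\<^esub>}"
      proof -
        have "?q x = \<zero>\<^bsub>?Q\<^esub>" if "x \<in> U" for x using that z submoduleD(1)[OF U] by auto
        then show ?thesis using submoduleD(2)[OF U] by (auto simp: image_iff intro: bexI[of _ \<zero>])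
      qed
      from cs show "Z = {\<zero>\<^bsub>?Q\<^esub>} \<or> Z = carrier ?Q"
      proof
        assume e: "?Y = U"
        show ?thesis by (rule disjI1) (rule img[unfolded e qU])
      next
        assume e: "?Y = carrier M"
        show ?thesis by (rule disjI2) (rule img[unfolded e, folded c])
      qed
    qed
  qed
qed

end

text \<open>An isomorphism from a quotient onto \<open>D\<close> amounts to an epimorphism onto \<open>D\<close> with the
  prescribed kernel. In this form the elements of the quotient, which are cosets, do not occur.\<close>

definition module_epi ::
    "('s, 'x) ring_scheme \<Rightarrow> ('s, 'm) module \<Rightarrow> 'm set \<Rightarrow> ('s, 'n) module \<Rightarrow> ('m \<Rightarrow> 'n) \<Rightarrow> bool" where
  "module_epi A M U D \<psi> \<longleftrightarrow>
     (\<forall>x\<in>carrier M. \<forall>y\<in>carrier M. \<psi> (x \<oplus>\<^bsub>M\<^esub> y) = \<psi> x \<oplus>\<^bsub>D\<^esub> \<psi> y) \<and>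
     (\<forall>a\<in>carrier A. \<forall>x\<in>carrier M. \<psi> (a \<odot>\<^bsub>M\<^esub> x) = a \<odot>\<^bsub>D\<^esub> \<psi> x) \<and>
     \<psi> ` carrier M = carrier D \<and> (\<forall>x\<in>carrier M. \<psi> x = \<zero>\<^bsub>D\<^esub> \<longleftrightarrow> x \<in> U)"

lemma (in left_module) quotient_isomorphic_iff:
  assumes U: "submodule U A M" and D: "left_module A D"
  shows "module_isomorphic A (quotient_module M U) D \<longleftrightarrow> (\<exists>\<psi>. module_epi A M U D \<psi>)"
proof -
  let ?Q = "quotient_module M U"
  let ?q = "\<lambda>x. U +> x"
  interpret D: left_module A D by fact
  interpret Q: left_module A ?Q by (rule quotient_left_module[OF U])
  note c = quotient_carrier[of U]
  show ?thesis
  proof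
    assume "module_isomorphic A ?Q D"
    then obtain \<phi> where bij: "bij_betw \<phi> (carrier ?Q) (carrier D)"
      and add: "\<And>x y. \<lbrakk>x \<in> carrier ?Q; y \<in> carrier ?Q\<rbrakk> \<Longrightarrow> \<phi> (x \<oplus>\<^bsub>?Q\<^esub> y) = \<phi> x \<oplus>\<^bsub>D\<^esub> \<phi> y"
      and sm: "\<And>a x. \<lbrakk>a \<in> carrier A; x \<in> carrier ?Q\<rbrakk> \<Longrightarrow> \<phi> (a \<odot>\<^bsub>?Q\<^esub> x) = a \<odot>\<^bsub>D\<^esub> \<phi> x"
      by (auto simp: module_isomorphic_def iso_def hom_def)
    have in_D: "\<phi> x \<in> carrier D" if "x \<in> carrier ?Q" for x
      using bij that by (auto simp: bij_betw_def)
    have z0: "\<phi> \<zero>\<^bsub>?Q\<^esub> = \<zero>\<^bsub>D\<^esub>"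
      using add[of "\<zero>\<^bsub>?Q\<^esub>" "\<zero>\<^bsub>?Q\<^esub>"] in_D[of "\<zero>\<^bsub>?Q\<^esub>"]
      by (metis D.add.l_cancel_one Q.zero_closed Q.l_zero)
    have "\<phi> (?q x) = \<zero>\<^bsub>D\<^esub> \<longleftrightarrow> x \<in> U" if "x \<in> carrier M" for x
      using z0 bij quotient_coset_eq_zero_iff[OF U that] that
      by (metis (no_types, lifting) Q.zero_closed bij_betw_def c image_eqI inj_onD)
    moreover have "(\<lambda>x. \<phi> (?q x)) ` carrier M = carrier D"
      using bij by (auto simp: bij_betw_def c)
    moreover have "\<phi> (?q (x \<oplus> y)) = \<phi> (?q x) \<oplus>\<^bsub>D\<^esub> \<phi> (?q y)" if "x \<in> carrier M" "y \<in> carrier M" for x y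
      using that add[of "?q x" "?q y"] quotient_add[OF U that] by (auto simp: c)
    moreover have "\<phi> (?q (a \<odot> x)) = a \<odot>\<^bsub>D\<^esub> \<phi> (?q x)" if "a \<in> carrier A" "x \<in> carrier M" for a x
      using that sm[of a "?q x"] quotient_smult[OF U that] by (auto simp: c)
    ultimately have "module_epi A M U D (\<lambda>x. \<phi> (?q x))" by (simp add: module_epi_def)
    then show "\<exists>\<psi>. module_epi A M U D \<psi>" by blast
  next
    assume "\<exists>\<psi>. module_epi A M U D \<psi>"
    then obtain \<psi> where "module_epi A M U D \<psi>" by blast
    then have
      add: "\<And>x y. \<lbrakk>x \<in> carrier M; y \<in> carrier M\<rbrakk> \<Longrightarrow> \<psi> (x \<oplus> y) = \<psi> x \<oplus>\<^bsub>D\<^esub> \<psi> y"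
      and sm: "\<And>a x. \<lbrakk>a \<in> carrier A; x \<in> carrier M\<rbrakk> \<Longrightarrow> \<psi> (a \<odot> x) = a \<odot>\<^bsub>D\<^esub> \<psi> x"
      and onto: "\<psi> ` carrier M = carrier D"
      and ker: "\<And>x. x \<in> carrier M \<Longrightarrow> \<psi> x = \<zero>\<^bsub>D\<^esub> \<longleftrightarrow> x \<in> U"
      by (simp_all add: module_epi_def)
    have in_D: "\<psi> x \<in> carrier D" if "x \<in> carrier M" for x using onto that by blast
    have eq: "\<psi> x = \<psi> y \<longleftrightarrow> ?q x = ?q y" if xy: "x \<in> carrier M" "y \<in> carrier M" for x y
    proof -
      have "x \<ominus> y \<oplus> y = x" using xy by (simp add: minus_eq a_assoc l_neg)
      then have "\<psi> x = \<psi> (x \<ominus> y) \<oplus>\<^bsub>D\<^esub> \<psi> y" using add[of "x \<ominus> y" y] xy by simp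
      then have "\<psi> x = \<psi> y \<longleftrightarrow> \<psi> (x \<ominus> y) = \<zero>\<^bsub>D\<^esub>"
        using in_D[of "x \<ominus> y"] in_D[OF xy(2)] xy by (metis D.add.r_cancel_one minus_closed)
      then show ?thesis using ker[of "x \<ominus> y"] coset_eq_iff[OF U xy] xy by simp
    qed
    define \<phi> where "\<phi> = (\<lambda>Z. \<psi> (SOME x. x \<in> carrier M \<and> Z = ?q x))"
    have \<phi>: "\<phi> (?q x) = \<psi> x" if "x \<in> carrier M" for x
    proof -
      have "(SOME y. y \<in> carrier M \<and> ?q x = ?q y) \<in> carrier M \<and> ?q x = ?q (SOME y. y \<in> carrier M \<and> ?q x = ?q y)"
        by (rule someI[where P="\<lambda>y. y \<in> carrier M \<and> ?q x = ?q y"]) (use that in auto)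
      then show ?thesis using eq[OF that] unfolding \<phi>_def by metis
    qed
    have "bij_betw \<phi> (carrier ?Q) (carrier D)"
      unfolding bij_betw_def inj_on_def using eq \<phi> onto by (auto simp: c image_image)
    moreover have "\<phi> (Z \<oplus>\<^bsub>?Q\<^esub> Z') = \<phi> Z \<oplus>\<^bsub>D\<^esub> \<phi> Z'" if "Z \<in> carrier ?Q" "Z' \<in> carrier ?Q" for Z Z'
      using that by (auto simp: c quotient_add[OF U] \<phi> add)
    moreover have "\<phi> (a \<odot>\<^bsub>?Q\<^esub> Z) = a \<odot>\<^bsub>D\<^esub> \<phi> Z" if "a \<in> carrier A" "Z \<in> carrier ?Q" for a Z
      using that by (auto simp: c quotient_smult[OF U] \<phi> sm)
    moreover have "\<phi> Z \<in> carrier D" if "Z \<in> carrier ?Q" for Z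
      using that in_D by (auto simp: c \<phi>)
    ultimately show "module_isomorphic A ?Q D"
      unfolding module_isomorphic_def iso_def hom_def by (intro bexI[of _ \<phi>]) simp_all
  qed
qed

section \<open>Counting composition factors\<close>

definition simple_section ::
    "('s, 'x) ring_scheme \<Rightarrow> ('s, 'm) module \<Rightarrow> 'm set \<Rightarrow> 'm set \<Rightarrow> bool" where
  "simple_section A M U Y \<longleftrightarrow> submodule U A M \<and> submodule Y A M \<and> U \<subset> Y \<and>
     (\<forall>Z. submodule Z A M \<and> U \<subseteq> Z \<and> Z \<subseteq> Y \<longrightarrow> Z = U \<or> Z = Y)"

abbreviation section_isomorphic ::
    "('s, 'x) ring_scheme \<Rightarrow> ('s, 'm) module \<Rightarrow> 'm set \<Rightarrow> 'm set \<Rightarrow> ('s, 'd) module \<Rightarrow> bool" where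
  "section_isomorphic A M U Y D \<equiv> module_isomorphic A (quotient_module (M\<lparr>carrier := Y\<rparr>) U) D"

text \<open>Composition series between two submodules, remembered only through their ends and the number of
  sections isomorphic to \<open>D\<close>. In this form series can be spliced and refined without
  renumbering.\<close>

inductive mult_series ::
    "('s, 'x) ring_scheme \<Rightarrow> ('s, 'm) module \<Rightarrow> ('s, 'd) module \<Rightarrow> 'm set \<Rightarrow> 'm set \<Rightarrow> nat \<Rightarrow> bool"
  for A M D where
  refl: "submodule U A M \<Longrightarrow> mult_series A M D U U 0"
| step: "mult_series A M D U Y c \<Longrightarrow> simple_section A M Y Z \<Longrightarrow>
    mult_series A M D U Z (c + of_bool (section_isomorphic A M Y Z D))"

lemma (in left_module) simple_section_iff:
  assumes U: "submodule U A M" and Y: "submodule Y A M" and "U \<subseteq> Y"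
  shows "simple_module A (quotient_module (M\<lparr>carrier := Y\<rparr>) U) \<longleftrightarrow> simple_section A M U Y"
proof -
  interpret Y: left_module A "M\<lparr>carrier := Y\<rparr>" by (rule submodule_is_left_module[OF Y])
  have "submodule U A (M\<lparr>carrier := Y\<rparr>)" using assms by (simp add: submodule_of_submodule)
  from Y.simple_quotient_iff[OF this] show ?thesis
    using assms by (auto simp: submodule_of_submodule simple_section_def)
qed

lemma mult_series_submodule:
  assumes "mult_series A M D U Y c"
  shows "submodule U A M" "submodule Y A M" "U \<subseteq> Y"
  using assms by (induction) (auto simp: simple_section_def)

lemma mult_series_trans:
  assumes "mult_series A M D Y Z c'" "mult_series A M D U Y c"
  shows "mult_series A M D U Z (c + c')"
  using assms
proof (induction)
  case (step V Y c' Z)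
  then show ?case using mult_series.step[of A M D U Y "c + c'" Z] by (simp add: add.assoc)
qed simp

lemma mult_series_refl_count: "mult_series A M D U U c \<Longrightarrow> c = 0"
  by (erule mult_series.cases) (auto simp: simple_section_def dest: mult_series_submodule(3))

text \<open>Between the ends of a simple section there is room for a single step. This recovers the
  contribution of one step of a series after that step has been refined upstairs and truncated again.\<close>

lemma mult_series_simple_section_count:
  assumes "mult_series A M D U Y c" "simple_section A M U Y"
  shows "c = of_bool (section_isomorphic A M U Y D)"
  using assms(1)
proof cases
  case refl
  then show ?thesis using assms(2) by (simp add: simple_section_def)
next
  case (step Z c')
  then have "Z = U"
    using assms(2) mult_series_submodule[OF step(2)] by (auto simp: simple_section_def)
  then show ?thesis using step mult_series_refl_count by fastforce
qed

lemma (in left_module) composition_series_iff_mult_series: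
  "(\<exists>l F. composition_series A M l F \<and>
      c = card {i. i < l \<and> module_isomorphic A (series_factor M F i) D}) \<longleftrightarrow>
   mult_series A M D {\<zero>} (carrier M) c"
proof
  assume "\<exists>l F. composition_series A M l F \<and>
      c = card {i. i < l \<and> module_isomorphic A (series_factor M F i) D}"
  then obtain l F where F: "composition_series A M l F"
    and c: "c = card {i. i < l \<and> module_isomorphic A (series_factor M F i) D}" by blast
  have "mult_series A M D {\<zero>} (F m) (card {i. i < m \<and> module_isomorphic A (series_factor M F i) D})"
    if "m \<le> l" for m
    using that
  proof (induction m)
    case 0
    then show ?case using F submodule_zero by (auto simp: composition_series_def intro: mult_series.refl)
  next
    case (Suc m)
    let ?P = "\<lambda>i. module_isomorphic A (series_factor M F i) D"
    have sub: "submodule (F m) A M" "submodule (F (Suc m)) A M" "F m \<subseteq> F (Suc m)"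
      and "simple_module A (series_factor M F m)"
      using F Suc.prems by (auto simp: composition_series_def)
    then have sec: "simple_section A M (F m) (F (Suc m))"
      using simple_section_iff[OF sub] by (simp add: series_factor_def)
    have "{i. i < Suc m \<and> ?P i} = (if ?P m then insert m {i. i < m \<and> ?P i} else {i. i < m \<and> ?P i})"
      by (auto simp: less_Suc_eq)
    then have "card {i. i < Suc m \<and> ?P i} = card {i. i < m \<and> ?P i} + of_bool (?P m)" by simp
    then show ?case
      using mult_series.step[OF Suc.IH sec] Suc.prems by (simp add: series_factor_def)
  qed
  from this[of l] show "mult_series A M D {\<zero>} (carrier M) c"
    using F c by (simp add: composition_series_def)
next
  have "\<exists>l F. F 0 = U \<and> F l = Y \<and> (\<forall>i\<le>l. submodule (F i) A M) \<and>
      (\<forall>i<l. F i \<subseteq> F (Suc i) \<and> simple_module A (series_factor M F i)) \<and>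
      c = card {i. i < l \<and> module_isomorphic A (series_factor M F i) D}"
    if "mult_series A M D U Y c" for U Y
    using that
  proof induction
    case (refl U)
    then show ?case by (intro exI[of _ 0] exI[of _ "\<lambda>_. U"]) simp
  next
    case (step U Y c Z)
    then obtain l F where F: "F 0 = U" "F l = Y" "\<And>i. i \<le> l \<Longrightarrow> submodule (F i) A M"
      "\<And>i. i < l \<Longrightarrow> F i \<subseteq> F (Suc i) \<and> simple_module A (series_factor M F i)"
      "c = card {i. i < l \<and> module_isomorphic A (series_factor M F i) D}" by blast
    define G where "G = F(Suc l := Z)"
    have G: "G i = F i" if "i \<le> l" for i using that by (simp add: G_def)
    have Gl: "G (Suc l) = Z" by (simp add: G_def)
    have fac: "series_factor M G i = series_factor M F i" if "i < l" for i
      using that by (simp add: series_factor_def G)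
    have facl: "series_factor M G l = quotient_module (M\<lparr>carrier := Z\<rparr>) Y"
      by (simp add: series_factor_def G Gl F(2))
    have sec: "submodule Y A M" "submodule Z A M" "Y \<subseteq> Z"
      using step.hyps by (auto simp: simple_section_def)
    have "{i. i < Suc l \<and> module_isomorphic A (series_factor M G i) D} =
      {i. i < l \<and> module_isomorphic A (series_factor M F i) D} \<union>
      (if section_isomorphic A M Y Z D then {l} else {})"
      using fac facl by (auto simp: less_Suc_eq)
    then have "c + of_bool (section_isomorphic A M Y Z D) =
      card {i. i < Suc l \<and> module_isomorphic A (series_factor M G i) D}"
      using F(5) by simp
    moreover have "\<forall>i\<le>Suc l. submodule (G i) A M"
      using F(3) sec by (auto simp: le_Suc_eq G Gl)
    moreover have "\<forall>i<Suc l. G i \<subseteq> G (Suc i) \<and> simple_module A (series_factor M G i)"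
      using F(2,4) sec simple_section_iff[OF sec] step.hyps facl by (auto simp: less_Suc_eq G Gl fac)
    ultimately show ?case using F(1) Gl
      by (intro exI[of _ "Suc l"] exI[of _ G]) (simp add: G)
  qed
  moreover assume "mult_series A M D {\<zero>} (carrier M) c"
  ultimately show "\<exists>l F. composition_series A M l F \<and>
      c = card {i. i < l \<and> module_isomorphic A (series_factor M F i) D}"
    unfolding composition_series_def by blast
qed

text \<open>The function \<open>\<rho>\<close> stands for the dimension: its growth bounds the number of submodules that
  can be inserted.\<close>

lemma mult_series_exists:
  fixes \<rho> :: "'m set \<Rightarrow> nat"
  assumes mono: "\<And>U Y. \<lbrakk>submodule U A M; submodule Y A M; U \<subset> Y\<rbrakk> \<Longrightarrow> \<rho> U < \<rho> Y"
    and "submodule U A M" "submodule Y A M" "U \<subseteq> Y"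
  shows "\<exists>c. mult_series A M D U Y c"
  using assms(2-)
proof (induction "\<rho> Y - \<rho> U" arbitrary: U Y rule: less_induct)
  case less
  consider "U = Y" | "simple_section A M U Y"
    | Z where "submodule Z A M" "U \<subset> Z" "Z \<subset> Y"
    using less.prems by (auto simp: simple_section_def)
  then show ?case
  proof cases
    case 1
    then show ?thesis using less.prems mult_series.refl by blast
  next
    case 2
    then show ?thesis using mult_series.step[OF mult_series.refl] less.prems by blast
  next
    case 3
    then have "\<rho> U < \<rho> Z" "\<rho> Z < \<rho> Y" using mono less.prems by auto
    then have "\<rho> Z - \<rho> U < \<rho> Y - \<rho> U" "\<rho> Y - \<rho> Z < \<rho> Y - \<rho> U" by auto
    then obtain c c' where "mult_series A M D U Z c" "mult_series A M D Z Y c'"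
      using less.hyps[of Z U] less.hyps[of Y Z] 3 less.prems by blast
    then show ?thesis using mult_series_trans by blast
  qed
qed

section \<open>Truncation by an idempotent\<close>

text \<open>The map \<open>\<theta>\<close> lifts elements of \<open>H\<close> to the corner \<open>eBe\<close>, and reaches all of it modulo
  \<open>K\<close>. So on modules killed by \<open>K\<close> the corner acts through \<open>H\<close>.\<close>

locale corner = B: ring B + H: ring H
  for B :: "('b, 'x) ring_scheme" and H :: "('h, 'y) ring_scheme"
    and e :: 'b and \<theta> :: "'h \<Rightarrow> 'b" and K :: "'b set" +
  assumes e_closed [simp]: "e \<in> carrier B" and e_idem: "e \<otimes>\<^bsub>B\<^esub> e = e"
    and \<theta>_closed [simp]: "h \<in> carrier H \<Longrightarrow> \<theta> h \<in> carrier B"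
    and K_closed: "K \<subseteq> carrier B"
    and corner_mod_K: "b \<in> carrier B \<Longrightarrow>
      \<exists>h\<in>carrier H. \<exists>\<kappa>\<in>K. e \<otimes>\<^bsub>B\<^esub> b \<otimes>\<^bsub>B\<^esub> e = \<theta> h \<oplus>\<^bsub>B\<^esub> \<kappa>"

text \<open>The map \<open>j\<close> identifies the \<open>H\<close>-module \<open>M\<close> with the truncation \<open>eN\<close>.\<close>

locale corner_pair = corner B H e \<theta> K + N: left_module B N + M: left_module H M
  for B :: "('b, 'x) ring_scheme" and H :: "('h, 'y) ring_scheme"
    and e :: 'b and \<theta> :: "'h \<Rightarrow> 'b" and K :: "'b set"
    and N :: "('b, 'n) module" and M :: "('h, 'm) module" +
  fixes j :: "'m \<Rightarrow> 'n"
  assumes K_null: "\<lbrakk>\<kappa> \<in> K; z \<in> carrier N\<rbrakk> \<Longrightarrow> \<kappa> \<odot>\<^bsub>N\<^esub> z = \<zero>\<^bsub>N\<^esub>"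
    and j_add: "\<lbrakk>x \<in> carrier M; y \<in> carrier M\<rbrakk> \<Longrightarrow> j (x \<oplus>\<^bsub>M\<^esub> y) = j x \<oplus>\<^bsub>N\<^esub> j y"
    and j_smult: "\<lbrakk>h \<in> carrier H; x \<in> carrier M\<rbrakk> \<Longrightarrow> j (h \<odot>\<^bsub>M\<^esub> x) = \<theta> h \<odot>\<^bsub>N\<^esub> j x"
    and j_inj: "inj_on j (carrier M)"
    and j_image: "j ` carrier M = (\<lambda>z. e \<odot>\<^bsub>N\<^esub> z) ` carrier N"
begin

lemma j_closed [simp]: "x \<in> carrier M \<Longrightarrow> j x \<in> carrier N"
proof -
  assume "x \<in> carrier M"
  then have "j x \<in> (\<lambda>z. e \<odot>\<^bsub>N\<^esub> z) ` carrier N" using j_image by blast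
  then show ?thesis by auto
qed

lemma e_j [simp]: "x \<in> carrier M \<Longrightarrow> e \<odot>\<^bsub>N\<^esub> j x = j x"
proof -
  assume "x \<in> carrier M"
  then have "j x \<in> (\<lambda>z. e \<odot>\<^bsub>N\<^esub> z) ` carrier N" using j_image by blast
  then obtain z where z: "z \<in> carrier N" "j x = e \<odot>\<^bsub>N\<^esub> z" by blast
  then show ?thesis using N.smult_assoc[of e e z] e_idem by simp
qed

lemma e_smult_in_image: "z \<in> carrier N \<Longrightarrow> \<exists>x\<in>carrier M. e \<odot>\<^bsub>N\<^esub> z = j x"
  using j_image by blast

lemma j_eq_iff [simp]: "\<lbrakk>x \<in> carrier M; y \<in> carrier M\<rbrakk> \<Longrightarrow> j x = j y \<longleftrightarrow> x = y"
  using j_inj by (auto simp: inj_on_def)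

lemma j_zero [simp]: "j \<zero>\<^bsub>M\<^esub> = \<zero>\<^bsub>N\<^esub>"
proof -
  have "j \<zero>\<^bsub>M\<^esub> = j \<zero>\<^bsub>M\<^esub> \<oplus>\<^bsub>N\<^esub> j \<zero>\<^bsub>M\<^esub>" using j_add[of "\<zero>\<^bsub>M\<^esub>" "\<zero>\<^bsub>M\<^esub>"] by simp
  then show ?thesis using N.add.l_cancel_one[of "j \<zero>\<^bsub>M\<^esub>" "j \<zero>\<^bsub>M\<^esub>"] by simp
qed

lemma compress:
  assumes "b \<in> carrier B" "h \<in> carrier H" "\<kappa> \<in> K" "e \<otimes>\<^bsub>B\<^esub> b \<otimes>\<^bsub>B\<^esub> e = \<theta> h \<oplus>\<^bsub>B\<^esub> \<kappa>" "x \<in> carrier M"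
  shows "e \<odot>\<^bsub>N\<^esub> (b \<odot>\<^bsub>N\<^esub> j x) = j (h \<odot>\<^bsub>M\<^esub> x)"
proof -
  have "\<kappa> \<in> carrier B" using assms(3) K_closed by blast
  have "e \<odot>\<^bsub>N\<^esub> (b \<odot>\<^bsub>N\<^esub> j x) = (e \<otimes>\<^bsub>B\<^esub> b \<otimes>\<^bsub>B\<^esub> e) \<odot>\<^bsub>N\<^esub> j x"
    using assms(1,5) by (simp add: N.smult_assoc)
  also have "\<dots> = \<theta> h \<odot>\<^bsub>N\<^esub> j x \<oplus>\<^bsub>N\<^esub> \<kappa> \<odot>\<^bsub>N\<^esub> j x"
    unfolding assms(4) using assms \<open>\<kappa> \<in> carrier B\<close> by (simp add: N.smult_l_distr)
  also have "\<dots> = j (h \<odot>\<^bsub>M\<^esub> x)" using assms by (simp add: K_null j_smult)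
  finally show ?thesis .
qed

lemma compress_ex:
  assumes "b \<in> carrier B"
  shows "\<exists>h\<in>carrier H. \<forall>x\<in>carrier M. e \<odot>\<^bsub>N\<^esub> (b \<odot>\<^bsub>N\<^esub> j x) = j (h \<odot>\<^bsub>M\<^esub> x)"
  using corner_mod_K[OF assms] compress[OF assms] by blast

text \<open>The truncation of a submodule, and a right inverse of it: \<open>coinduced W\<close> is the largest
  submodule of \<open>N\<close> whose truncation is contained in \<open>W\<close>.\<close>

definition corner_part :: "'n set \<Rightarrow> 'm set" where
  "corner_part U = {x \<in> carrier M. j x \<in> U}"

definition coinduced :: "'m set \<Rightarrow> 'n set" where
  "coinduced W = {z \<in> carrier N. \<forall>b\<in>carrier B. \<exists>x\<in>W. e \<odot>\<^bsub>N\<^esub> (b \<odot>\<^bsub>N\<^esub> z) = j x}"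

lemma corner_part_submodule:
  assumes "submodule U B N" shows "submodule (corner_part U) H M"
proof (rule M.submoduleI)
  note U = N.submoduleD[OF assms]
  show "corner_part U \<subseteq> carrier M" by (auto simp: corner_part_def)
  show "\<zero>\<^bsub>M\<^esub> \<in> corner_part U" using U(2) by (simp add: corner_part_def)
  show "x \<oplus>\<^bsub>M\<^esub> y \<in> corner_part U" if "x \<in> corner_part U" "y \<in> corner_part U" for x y
    using that U(3) by (simp add: corner_part_def j_add)
  show "h \<odot>\<^bsub>M\<^esub> x \<in> corner_part U" if "h \<in> carrier H" "x \<in> corner_part U" for h x
    using that U(6) by (simp add: corner_part_def j_smult)
qed

lemma coinduced_submodule:
  assumes "submodule W H M" shows "submodule (coinduced W) B N"
proof (rule N.submoduleI)
  note W = M.submoduleD[OF assms]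
  have WM: "x \<in> carrier M" if "x \<in> W" for x using that W(1) by auto
  show "coinduced W \<subseteq> carrier N" by (auto simp: coinduced_def)
  show "\<zero>\<^bsub>N\<^esub> \<in> coinduced W"
    using W(2) by (auto simp: coinduced_def intro!: bexI[of _ "\<zero>\<^bsub>M\<^esub>"])
  show "y \<oplus>\<^bsub>N\<^esub> z \<in> coinduced W" if yz: "y \<in> coinduced W" "z \<in> coinduced W" for y z
    unfolding coinduced_def
  proof (intro CollectI conjI ballI)
    fix b assume b: "b \<in> carrier B"
    obtain x where x1: "x \<in> W" "e \<odot>\<^bsub>N\<^esub> (b \<odot>\<^bsub>N\<^esub> y) = j x"
      using yz(1) b unfolding coinduced_def by blast
    obtain x' where x2: "x' \<in> W" "e \<odot>\<^bsub>N\<^esub> (b \<odot>\<^bsub>N\<^esub> z) = j x'"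
      using yz(2) b unfolding coinduced_def by blast
    note x = x1(1) x2(1) x1(2) x2(2)
    have "e \<odot>\<^bsub>N\<^esub> (b \<odot>\<^bsub>N\<^esub> (y \<oplus>\<^bsub>N\<^esub> z)) = j (x \<oplus>\<^bsub>M\<^esub> x')"
      using that b x WM by (simp add: coinduced_def N.smult_r_distr j_add)
    then show "\<exists>x\<in>W. e \<odot>\<^bsub>N\<^esub> (b \<odot>\<^bsub>N\<^esub> (y \<oplus>\<^bsub>N\<^esub> z)) = j x" using W(3) x by blast
  qed (use that in \<open>simp add: coinduced_def\<close>)
  show "a \<odot>\<^bsub>N\<^esub> z \<in> coinduced W" if a: "a \<in> carrier B" and z: "z \<in> coinduced W" for a z
    unfolding coinduced_def
  proof (intro CollectI conjI ballI)
    fix b assume b: "b \<in> carrier B"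
    have "\<exists>x\<in>W. e \<odot>\<^bsub>N\<^esub> ((b \<otimes>\<^bsub>B\<^esub> a) \<odot>\<^bsub>N\<^esub> z) = j x" using z a b by (simp add: coinduced_def)
    then show "\<exists>x\<in>W. e \<odot>\<^bsub>N\<^esub> (b \<odot>\<^bsub>N\<^esub> (a \<odot>\<^bsub>N\<^esub> z)) = j x"
      using z a b by (simp add: coinduced_def N.smult_assoc)
  qed (use a z in \<open>simp add: coinduced_def\<close>)
qed

lemma j_in_coinduced:
  assumes "submodule W H M" "x \<in> W" shows "j x \<in> coinduced W"
proof -
  note W = M.submoduleD[OF assms(1)]
  have x: "x \<in> carrier M" using W(1) assms(2) by auto
  have "\<exists>y\<in>W. e \<odot>\<^bsub>N\<^esub> (b \<odot>\<^bsub>N\<^esub> j x) = j y" if "b \<in> carrier B" for b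
    using compress_ex[OF that] W(6) assms(2) x by blast
  then show ?thesis using x by (simp add: coinduced_def)
qed

lemma corner_part_coinduced:
  assumes "submodule W H M" shows "corner_part (coinduced W) = W"
proof
  note W = M.submoduleD[OF assms]
  show "W \<subseteq> corner_part (coinduced W)"
    using W(1) j_in_coinduced[OF assms] by (auto simp: corner_part_def)
  show "corner_part (coinduced W) \<subseteq> W"
  proof
    fix x assume "x \<in> corner_part (coinduced W)"
    then have x: "x \<in> carrier M" "j x \<in> coinduced W" by (auto simp: corner_part_def)
    then obtain y where "y \<in> W" "e \<odot>\<^bsub>N\<^esub> (\<one>\<^bsub>B\<^esub> \<odot>\<^bsub>N\<^esub> j x) = j y"
      using B.one_closed unfolding coinduced_def by blast
    then show "x \<in> W" using x W(1) j_eq_iff[of x y] by auto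
  qed
qed

lemma coinduced_mono: "W \<subseteq> W' \<Longrightarrow> coinduced W \<subseteq> coinduced W'"
  unfolding coinduced_def by blast

lemma coinduced_carrier: "coinduced (carrier M) = carrier N"
  using e_smult_in_image by (auto simp: coinduced_def)

lemma subset_coinduced_corner_part:
  assumes "submodule U B N" shows "U \<subseteq> coinduced (corner_part U)"
proof
  note U = N.submoduleD[OF assms]
  fix z assume z: "z \<in> U"
  have "\<exists>x\<in>corner_part U. e \<odot>\<^bsub>N\<^esub> (b \<odot>\<^bsub>N\<^esub> z) = j x" if "b \<in> carrier B" for b
  proof -
    have *: "e \<odot>\<^bsub>N\<^esub> (b \<odot>\<^bsub>N\<^esub> z) \<in> U" using U(6) that z by simp
    have "b \<odot>\<^bsub>N\<^esub> z \<in> carrier N" using z U(1) that by auto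
    from e_smult_in_image[OF this]
    obtain x where x: "x \<in> carrier M" "e \<odot>\<^bsub>N\<^esub> (b \<odot>\<^bsub>N\<^esub> z) = j x" ..
    then have "x \<in> corner_part U" using * by (simp add: corner_part_def)
    then show ?thesis using x(2) by (rule bexI[rotated])
  qed
  then show "z \<in> coinduced (corner_part U)" using z U(1) by (auto simp: coinduced_def)
qed

lemma submodule_Int:
  assumes "submodule U B N" "submodule Y B N" shows "submodule (U \<inter> Y) B N"
  using N.submoduleD[OF assms(1)] N.submoduleD[OF assms(2)] by (intro N.submoduleI) auto

text \<open>A submodule \<open>W\<close> strictly between the two truncations would make \<open>coinduced W \<inter> Y\<close> a
  submodule strictly between \<open>U\<close> and \<open>Y\<close>, because it truncates to \<open>W\<close>.\<close>

lemma corner_part_simple_section: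
  assumes sec: "simple_section B N U Y" and ne: "corner_part U \<noteq> corner_part Y"
  shows "simple_section H M (corner_part U) (corner_part Y)"
proof -
  have UY: "submodule U B N" "submodule Y B N" "U \<subseteq> Y" using sec by (auto simp: simple_section_def)
  have "W = corner_part U \<or> W = corner_part Y"
    if W: "submodule W H M" "corner_part U \<subseteq> W" "W \<subseteq> corner_part Y" for W
  proof -
    \<comment> \<open>The largest submodule of \<open>Y\<close> that truncates to \<open>W\<close>.\<close>
    let ?Z = "coinduced W \<inter> Y"
    have "submodule ?Z B N" by (rule submodule_Int[OF coinduced_submodule[OF W(1)] UY(2)])
    moreover have "U \<subseteq> ?Z"
      using UY(3) subset_coinduced_corner_part[OF UY(1)] coinduced_mono[OF W(2)] by blast
    ultimately have "?Z = U \<or> ?Z = Y" using sec by (auto simp: simple_section_def)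
    moreover have "corner_part ?Z = W"
      using corner_part_coinduced[OF W(1)] W(3) by (auto simp: corner_part_def)
    ultimately show ?thesis by auto
  qed
  moreover have "corner_part U \<subseteq> corner_part Y" using UY(3) by (auto simp: corner_part_def)
  ultimately show ?thesis
    using ne corner_part_submodule UY by (auto simp: simple_section_def)
qed

end

text \<open>An isomorphism between the simple \<open>B\<close>-modules restricts to the truncations. Conversely, let
  \<open>\<psi>\<close> induce an isomorphism of the truncations. The pairs \<open>(y, d)\<close> such that \<open>\<psi>\<close> matches
  \<open>eby\<close> with \<open>ebd\<close> for all \<open>b\<close> form a submodule of \<open>Y \<oplus> D\<close>. Its two projections and its
  intersections with the two summands are submodules of simple modules (up to \<open>U\<close>), and the non-zero
  truncation decides which ones: the pairs are the graph of an epimorphism \<open>Y \<rightarrow> D\<close> with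
  kernel \<open>U\<close>.\<close>

lemma section_isomorphic_corner_part:
  assumes N: "corner_pair B H e \<theta> K N M j" and D: "corner_pair B H e \<theta> K D D' jD"
    and simple: "simple_module B D" and ne: "carrier D' \<noteq> {\<zero>\<^bsub>D'\<^esub>}"
    and sec: "simple_section B N U Y"
  shows "section_isomorphic B N U Y D \<longleftrightarrow>
    section_isomorphic H M (corner_pair.corner_part M j U) (corner_pair.corner_part M j Y) D'"
proof -
  interpret N: corner_pair B H e \<theta> K N M j by (rule N)
  interpret D: corner_pair B H e \<theta> K D D' jD by (rule D)
  let ?U = "N.corner_part U" and ?Y = "N.corner_part Y"
  have UY: "submodule U B N" "submodule Y B N" "U \<subseteq> Y" using sec by (auto simp: simple_section_def)
  note Ud = N.N.submoduleD[OF UY(1)] and Yd = N.N.submoduleD[OF UY(2)]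
  have YN: "y \<in> carrier N" if "y \<in> Y" for y using that Yd(1) by auto
  have UY': "submodule ?U H M" "submodule ?Y H M" "?U \<subseteq> ?Y"
    using UY N.corner_part_submodule by (auto simp: N.corner_part_def)
  interpret NY: left_module B "N\<lparr>carrier := Y\<rparr>" by (rule N.N.submodule_is_left_module[OF UY(2)])
  interpret MY: left_module H "M\<lparr>carrier := ?Y\<rparr>" by (rule N.M.submodule_is_left_module[OF UY'(2)])
  have "submodule U B (N\<lparr>carrier := Y\<rparr>)" using UY by (simp add: N.N.submodule_of_submodule)
  from NY.quotient_isomorphic_iff[OF this D.N.left_module_axioms]
  have L: "section_isomorphic B N U Y D \<longleftrightarrow> (\<exists>\<psi>. module_epi B (N\<lparr>carrier := Y\<rparr>) U D \<psi>)" .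
  have "submodule ?U H (M\<lparr>carrier := ?Y\<rparr>)" using UY' by (simp add: N.M.submodule_of_submodule)
  from MY.quotient_isomorphic_iff[OF this D.M.left_module_axioms]
  have R: "section_isomorphic H M ?U ?Y D' \<longleftrightarrow> (\<exists>\<psi>. module_epi H (M\<lparr>carrier := ?Y\<rparr>) ?U D' \<psi>)" .
  have cp: "x \<in> ?Y \<longleftrightarrow> x \<in> carrier M \<and> j x \<in> Y" for x by (auto simp: N.corner_part_def)
  have cpU: "x \<in> ?U \<longleftrightarrow> x \<in> carrier M \<and> j x \<in> U" for x by (auto simp: N.corner_part_def)
  show ?thesis unfolding L R
  proof
    assume "\<exists>\<psi>. module_epi B (N\<lparr>carrier := Y\<rparr>) U D \<psi>"
    then obtain \<psi> where "module_epi B (N\<lparr>carrier := Y\<rparr>) U D \<psi>" by blast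
    then have add: "\<And>x y. \<lbrakk>x \<in> Y; y \<in> Y\<rbrakk> \<Longrightarrow> \<psi> (x \<oplus>\<^bsub>N\<^esub> y) = \<psi> x \<oplus>\<^bsub>D\<^esub> \<psi> y"
      and sm: "\<And>a x. \<lbrakk>a \<in> carrier B; x \<in> Y\<rbrakk> \<Longrightarrow> \<psi> (a \<odot>\<^bsub>N\<^esub> x) = a \<odot>\<^bsub>D\<^esub> \<psi> x"
      and onto: "\<psi> ` Y = carrier D"
      and ker: "\<And>x. x \<in> Y \<Longrightarrow> \<psi> x = \<zero>\<^bsub>D\<^esub> \<longleftrightarrow> x \<in> U"
      by (simp_all add: module_epi_def)
    have \<psi>D: "\<psi> y \<in> carrier D" if "y \<in> Y" for y using that onto by blast
    have ex: "\<exists>d\<in>carrier D'. \<psi> (j x) = jD d" if "x \<in> ?Y" for x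
    proof -
      have "\<psi> (j x) = e \<odot>\<^bsub>D\<^esub> \<psi> (j x)" using sm[of e "j x"] that by (simp add: cp)
      then show ?thesis using D.e_smult_in_image[of "\<psi> (j x)"] \<psi>D that by (auto simp: cp)
    qed
    define \<psi>' where "\<psi>' = (\<lambda>x. SOME d. d \<in> carrier D' \<and> \<psi> (j x) = jD d)"
    have "\<psi>' x \<in> carrier D' \<and> \<psi> (j x) = jD (\<psi>' x)" if "x \<in> ?Y" for x
      unfolding \<psi>'_def by (rule someI_ex) (use ex[OF that] in blast)
    then have \<psi>'1: "\<psi>' x \<in> carrier D'" and \<psi>'2: "jD (\<psi>' x) = \<psi> (j x)" if "x \<in> ?Y" for x
      using that by simp_all
    have "module_epi H (M\<lparr>carrier := ?Y\<rparr>) ?U D' \<psi>'"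
      unfolding module_epi_def
    proof (intro conjI ballI)
      fix x y assume "x \<in> carrier (M\<lparr>carrier := ?Y\<rparr>)" "y \<in> carrier (M\<lparr>carrier := ?Y\<rparr>)"
      then have xy: "x \<in> ?Y" "y \<in> ?Y" "x \<oplus>\<^bsub>M\<^esub> y \<in> ?Y" using N.M.submoduleD(3)[OF UY'(2)] by auto
      have "jD (\<psi>' (x \<oplus>\<^bsub>M\<^esub> y)) = jD (\<psi>' x \<oplus>\<^bsub>D'\<^esub> \<psi>' y)"
        using xy by (simp add: \<psi>'2 \<psi>'1 D.j_add) (use xy in \<open>simp add: cp N.j_add add\<close>)
      then show "\<psi>' (x \<oplus>\<^bsub>M\<lparr>carrier := ?Y\<rparr>\<^esub> y) = \<psi>' x \<oplus>\<^bsub>D'\<^esub> \<psi>' y"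
        using xy \<psi>'1 D.j_eq_iff by simp
    next
      fix h x assume "h \<in> carrier H" "x \<in> carrier (M\<lparr>carrier := ?Y\<rparr>)"
      then have hx: "h \<in> carrier H" "x \<in> ?Y" "h \<odot>\<^bsub>M\<^esub> x \<in> ?Y" using N.M.submoduleD(6)[OF UY'(2)] by auto
      have "jD (\<psi>' (h \<odot>\<^bsub>M\<^esub> x)) = jD (h \<odot>\<^bsub>D'\<^esub> \<psi>' x)"
        using hx by (simp add: \<psi>'2 \<psi>'1 D.j_smult) (use hx in \<open>simp add: cp N.j_smult sm\<close>)
      then show "\<psi>' (h \<odot>\<^bsub>M\<lparr>carrier := ?Y\<rparr>\<^esub> x) = h \<odot>\<^bsub>D'\<^esub> \<psi>' x"
        using hx \<psi>'1 D.j_eq_iff by simp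
    next
      show "\<psi>' ` carrier (M\<lparr>carrier := ?Y\<rparr>) = carrier D'"
      proof
        show "\<psi>' ` carrier (M\<lparr>carrier := ?Y\<rparr>) \<subseteq> carrier D'" using \<psi>'1 by auto
        show "carrier D' \<subseteq> \<psi>' ` carrier (M\<lparr>carrier := ?Y\<rparr>)"
        proof
          fix d assume d: "d \<in> carrier D'"
          then have "jD d \<in> \<psi> ` Y" using onto by simp
          then obtain y where y: "y \<in> Y" "jD d = \<psi> y" by blast
          obtain x where x: "x \<in> carrier M" "e \<odot>\<^bsub>N\<^esub> y = j x" using N.e_smult_in_image YN[OF y(1)] by blast
          have "j x \<in> Y" using x Yd(6)[of e y] y by simp
          then have xY: "x \<in> ?Y" using x by (simp add: cp)
          have "jD (\<psi>' x) = e \<odot>\<^bsub>D\<^esub> \<psi> y" using \<psi>'2[OF xY] sm[of e y] y x by simp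
          also have "\<dots> = jD d" using y d by (metis D.e_j)
          finally have "\<psi>' x = d" using \<psi>'1[OF xY] d by simp
          then show "d \<in> \<psi>' ` carrier (M\<lparr>carrier := ?Y\<rparr>)" using xY by auto
        qed
      qed
    next
      fix x assume "x \<in> carrier (M\<lparr>carrier := ?Y\<rparr>)"
      then have x: "x \<in> ?Y" by simp
      have "\<psi>' x = \<zero>\<^bsub>D'\<^esub> \<longleftrightarrow> jD (\<psi>' x) = jD \<zero>\<^bsub>D'\<^esub>"
        using \<psi>'1[OF x] D.j_eq_iff[of "\<psi>' x" "\<zero>\<^bsub>D'\<^esub>"] by simp
      also have "\<dots> \<longleftrightarrow> j x \<in> U" using \<psi>'2[OF x] ker[of "j x"] x by (simp add: cp)
      finally show "\<psi>' x = \<zero>\<^bsub>D'\<^esub> \<longleftrightarrow> x \<in> ?U" using x by (simp add: cp cpU)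
    qed
    then show "\<exists>\<psi>. module_epi H (M\<lparr>carrier := ?Y\<rparr>) ?U D' \<psi>" by blast
  next
    assume "\<exists>\<psi>. module_epi H (M\<lparr>carrier := ?Y\<rparr>) ?U D' \<psi>"
    then obtain \<psi> where "module_epi H (M\<lparr>carrier := ?Y\<rparr>) ?U D' \<psi>" by blast
    then have add: "\<And>x y. \<lbrakk>x \<in> ?Y; y \<in> ?Y\<rbrakk> \<Longrightarrow> \<psi> (x \<oplus>\<^bsub>M\<^esub> y) = \<psi> x \<oplus>\<^bsub>D'\<^esub> \<psi> y"
      and sm: "\<And>a x. \<lbrakk>a \<in> carrier H; x \<in> ?Y\<rbrakk> \<Longrightarrow> \<psi> (a \<odot>\<^bsub>M\<^esub> x) = a \<odot>\<^bsub>D'\<^esub> \<psi> x"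
      and onto: "\<psi> ` ?Y = carrier D'"
      and ker: "\<And>x. x \<in> ?Y \<Longrightarrow> \<psi> x = \<zero>\<^bsub>D'\<^esub> \<longleftrightarrow> x \<in> ?U"
      by (simp_all add: module_epi_def)
    have \<psi>D: "\<psi> y \<in> carrier D'" if "y \<in> ?Y" for y using that onto by blast
    have YM: "x \<in> carrier M" if "x \<in> ?Y" for x using that by (simp add: cp)
    note Yc = N.M.submoduleD[OF UY'(2)]
    define T where "T = (\<lambda>y d. y \<in> Y \<and> d \<in> carrier D \<and>
      (\<forall>b\<in>carrier B. \<exists>x\<in>?Y. e \<odot>\<^bsub>N\<^esub> (b \<odot>\<^bsub>N\<^esub> y) = j x \<and> e \<odot>\<^bsub>D\<^esub> (b \<odot>\<^bsub>D\<^esub> d) = jD (\<psi> x)))"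
    have Tc: "y \<in> Y" "y \<in> carrier N" "d \<in> carrier D" if "T y d" for y d
      using that YN by (auto simp: T_def)
    have T0: "T \<zero>\<^bsub>N\<^esub> \<zero>\<^bsub>D\<^esub>"
    proof -
      have "\<zero>\<^bsub>M\<^esub> \<in> ?Y" "\<psi> \<zero>\<^bsub>M\<^esub> = \<zero>\<^bsub>D'\<^esub>"
        using ker[of "\<zero>\<^bsub>M\<^esub>"] Yc(2) N.M.submoduleD(2)[OF UY'(1)] by auto
      then show ?thesis using Yd(2) by (auto simp: T_def intro!: bexI[of _ "\<zero>\<^bsub>M\<^esub>"])
    qed
    have Tadd: "T (y \<oplus>\<^bsub>N\<^esub> y') (d \<oplus>\<^bsub>D\<^esub> d')" if t: "T y d" "T y' d'" for y y' d d'
      unfolding T_def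
    proof (intro conjI ballI)
      show "y \<oplus>\<^bsub>N\<^esub> y' \<in> Y" "d \<oplus>\<^bsub>D\<^esub> d' \<in> carrier D" using Tc[OF t(1)] Tc[OF t(2)] Yd(3) by auto
      fix b assume b: "b \<in> carrier B"
      obtain x where x: "x \<in> ?Y" "e \<odot>\<^bsub>N\<^esub> (b \<odot>\<^bsub>N\<^esub> y) = j x" "e \<odot>\<^bsub>D\<^esub> (b \<odot>\<^bsub>D\<^esub> d) = jD (\<psi> x)"
        using t(1) b by (auto simp: T_def)
      obtain x' where x': "x' \<in> ?Y" "e \<odot>\<^bsub>N\<^esub> (b \<odot>\<^bsub>N\<^esub> y') = j x'" "e \<odot>\<^bsub>D\<^esub> (b \<odot>\<^bsub>D\<^esub> d') = jD (\<psi> x')"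
        using t(2) b by (auto simp: T_def)
      have "e \<odot>\<^bsub>N\<^esub> (b \<odot>\<^bsub>N\<^esub> (y \<oplus>\<^bsub>N\<^esub> y')) = j (x \<oplus>\<^bsub>M\<^esub> x')"
        using Tc[OF t(1)] Tc[OF t(2)] b x x' YM by (simp add: N.N.smult_r_distr N.j_add)
      moreover have "e \<odot>\<^bsub>D\<^esub> (b \<odot>\<^bsub>D\<^esub> (d \<oplus>\<^bsub>D\<^esub> d')) = jD (\<psi> (x \<oplus>\<^bsub>M\<^esub> x'))"
        using Tc[OF t(1)] Tc[OF t(2)] b x x' \<psi>D by (simp add: D.N.smult_r_distr D.j_add add)
      ultimately show "\<exists>x\<in>?Y. e \<odot>\<^bsub>N\<^esub> (b \<odot>\<^bsub>N\<^esub> (y \<oplus>\<^bsub>N\<^esub> y')) = j x \<and>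
          e \<odot>\<^bsub>D\<^esub> (b \<odot>\<^bsub>D\<^esub> (d \<oplus>\<^bsub>D\<^esub> d')) = jD (\<psi> x)"
        using Yc(3) x(1) x'(1) by blast
    qed
    have Tsm: "T (a \<odot>\<^bsub>N\<^esub> y) (a \<odot>\<^bsub>D\<^esub> d)" if t: "T y d" and a: "a \<in> carrier B" for a y d
      unfolding T_def
    proof (intro conjI ballI)
      show "a \<odot>\<^bsub>N\<^esub> y \<in> Y" "a \<odot>\<^bsub>D\<^esub> d \<in> carrier D" using Tc[OF t] a Yd(6) by auto
      fix b assume b: "b \<in> carrier B"
      then have "b \<otimes>\<^bsub>B\<^esub> a \<in> carrier B" using a by simp
      then have "\<exists>x\<in>?Y. e \<odot>\<^bsub>N\<^esub> ((b \<otimes>\<^bsub>B\<^esub> a) \<odot>\<^bsub>N\<^esub> y) = j x \<and> e \<odot>\<^bsub>D\<^esub> ((b \<otimes>\<^bsub>B\<^esub> a) \<odot>\<^bsub>D\<^esub> d) = jD (\<psi> x)"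
        using t by (simp add: T_def)
      then show "\<exists>x\<in>?Y. e \<odot>\<^bsub>N\<^esub> (b \<odot>\<^bsub>N\<^esub> (a \<odot>\<^bsub>N\<^esub> y)) = j x \<and> e \<odot>\<^bsub>D\<^esub> (b \<odot>\<^bsub>D\<^esub> (a \<odot>\<^bsub>D\<^esub> d)) = jD (\<psi> x)"
        using Tc[OF t] a b by (simp add: N.N.smult_assoc D.N.smult_assoc)
    qed
    have Tj: "T (j x) (jD (\<psi> x))" if x: "x \<in> ?Y" for x
      unfolding T_def
    proof (intro conjI ballI)
      show "j x \<in> Y" "jD (\<psi> x) \<in> carrier D" using x \<psi>D by (auto simp: cp)
      fix b assume b: "b \<in> carrier B"
      obtain h \<kappa> where h: "h \<in> carrier H" "\<kappa> \<in> K" "e \<otimes>\<^bsub>B\<^esub> b \<otimes>\<^bsub>B\<^esub> e = \<theta> h \<oplus>\<^bsub>B\<^esub> \<kappa>"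
        using N.corner_mod_K[OF b] by blast
      have "e \<odot>\<^bsub>N\<^esub> (b \<odot>\<^bsub>N\<^esub> j x) = j (h \<odot>\<^bsub>M\<^esub> x)" by (rule N.compress[OF b h YM[OF x]])
      moreover have "e \<odot>\<^bsub>D\<^esub> (b \<odot>\<^bsub>D\<^esub> jD (\<psi> x)) = jD (\<psi> (h \<odot>\<^bsub>M\<^esub> x))"
        using D.compress[OF b h \<psi>D[OF x]] sm[OF h(1) x] by simp
      ultimately show "\<exists>x'\<in>?Y. e \<odot>\<^bsub>N\<^esub> (b \<odot>\<^bsub>N\<^esub> j x) = j x' \<and>
          e \<odot>\<^bsub>D\<^esub> (b \<odot>\<^bsub>D\<^esub> jD (\<psi> x)) = jD (\<psi> x')"
        using Yc(6)[OF h(1) x] by blast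
    qed
    have Tdiff: "T (y \<ominus>\<^bsub>N\<^esub> y') (d \<ominus>\<^bsub>D\<^esub> d')" if t: "T y d" "T y' d'" for y y' d d'
    proof -
      have "T ((\<ominus>\<^bsub>B\<^esub> \<one>\<^bsub>B\<^esub>) \<odot>\<^bsub>N\<^esub> y') ((\<ominus>\<^bsub>B\<^esub> \<one>\<^bsub>B\<^esub>) \<odot>\<^bsub>D\<^esub> d')" using Tsm[OF t(2)] by simp
      then have "T (\<ominus>\<^bsub>N\<^esub> y') (\<ominus>\<^bsub>D\<^esub> d')"
        using Tc[OF t(2)] by (simp add: N.N.smult_l_minus D.N.smult_l_minus)
      from Tadd[OF t(1) this] show ?thesis by (simp add: N.N.minus_eq D.N.minus_eq)
    qed
    have TU: "T y \<zero>\<^bsub>D\<^esub>" if y: "y \<in> U" for y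
      unfolding T_def
    proof (intro conjI ballI)
      show "y \<in> Y" "\<zero>\<^bsub>D\<^esub> \<in> carrier D" using y UY(3) by auto
      fix b assume b: "b \<in> carrier B"
      then obtain x where "x \<in> ?U" "e \<odot>\<^bsub>N\<^esub> (b \<odot>\<^bsub>N\<^esub> y) = j x"
        using N.subset_coinduced_corner_part[OF UY(1)] y unfolding N.coinduced_def by blast
      then show "\<exists>x\<in>?Y. e \<odot>\<^bsub>N\<^esub> (b \<odot>\<^bsub>N\<^esub> y) = j x \<and> e \<odot>\<^bsub>D\<^esub> (b \<odot>\<^bsub>D\<^esub> \<zero>\<^bsub>D\<^esub>) = jD (\<psi> x)"
        using b ker[of x] UY'(3) by (intro bexI[of _ x]) auto
    qed
    have nz: "\<exists>x\<in>?Y. \<psi> x \<noteq> \<zero>\<^bsub>D'\<^esub>"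
    proof (rule ccontr)
      assume "\<not> ?thesis"
      then have "carrier D' \<subseteq> {\<zero>\<^bsub>D'\<^esub>}" using onto by auto
      then show False using ne D.M.zero_closed by blast
    qed
    then obtain x0 where x0: "x0 \<in> ?Y" "\<psi> x0 \<noteq> \<zero>\<^bsub>D'\<^esub>" by blast
    have jx0: "jD (\<psi> x0) \<noteq> \<zero>\<^bsub>D\<^esub>"
      using D.j_eq_iff[of "\<psi> x0" "\<zero>\<^bsub>D'\<^esub>"] x0 \<psi>D by simp
    have simpleD: "Z = {\<zero>\<^bsub>D\<^esub>} \<or> Z = carrier D" if "submodule Z B D" for Z
      using simple that by (auto simp: simple_module_def)
    have between: "Z = U \<or> Z = Y" if "submodule Z B N" "U \<subseteq> Z" "Z \<subseteq> Y" for Z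
      using sec that by (auto simp: simple_section_def)
    \<comment> \<open>The intersections with the two summands miss \<open>j x0\<close> and its counterpart in \<open>D\<close>.\<close>
    have ker0: "{y. T y \<zero>\<^bsub>D\<^esub>} = U"
    proof -
      have "submodule {y. T y \<zero>\<^bsub>D\<^esub>} B N"
        using T0 Tc Tadd[of _ "\<zero>\<^bsub>D\<^esub>" _ "\<zero>\<^bsub>D\<^esub>"] Tsm[of _ "\<zero>\<^bsub>D\<^esub>"] by (intro N.N.submoduleI) auto
      then have "{y. T y \<zero>\<^bsub>D\<^esub>} = U \<or> {y. T y \<zero>\<^bsub>D\<^esub>} = Y" by (rule between) (use TU Tc in auto)
      moreover have "\<not> T (j x0) \<zero>\<^bsub>D\<^esub>"
      proof
        assume "T (j x0) \<zero>\<^bsub>D\<^esub>"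
        then obtain x where x: "x \<in> ?Y" "e \<odot>\<^bsub>N\<^esub> (\<one>\<^bsub>B\<^esub> \<odot>\<^bsub>N\<^esub> j x0) = j x"
          "e \<odot>\<^bsub>D\<^esub> (\<one>\<^bsub>B\<^esub> \<odot>\<^bsub>D\<^esub> \<zero>\<^bsub>D\<^esub>) = jD (\<psi> x)" unfolding T_def using N.B.one_closed by blast
        then have "x = x0" using x0 YM by simp
        then show False using x jx0 by simp
      qed
      ultimately show ?thesis using x0 by (auto simp: cp)
    qed
    have fun0: "d = \<zero>\<^bsub>D\<^esub>" if "T \<zero>\<^bsub>N\<^esub> d" for d
    proof -
      have "submodule {d. T \<zero>\<^bsub>N\<^esub> d} B D"
        using T0 Tc Tadd[of "\<zero>\<^bsub>N\<^esub>" _ "\<zero>\<^bsub>N\<^esub>"] Tsm[of "\<zero>\<^bsub>N\<^esub>"] by (intro D.N.submoduleI) auto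
      then have "{d. T \<zero>\<^bsub>N\<^esub> d} = {\<zero>\<^bsub>D\<^esub>} \<or> {d. T \<zero>\<^bsub>N\<^esub> d} = carrier D" by (rule simpleD)
      moreover have "\<not> T \<zero>\<^bsub>N\<^esub> (jD (\<psi> x0))"
      proof
        assume "T \<zero>\<^bsub>N\<^esub> (jD (\<psi> x0))"
        then obtain x where x: "x \<in> ?Y" "e \<odot>\<^bsub>N\<^esub> (\<one>\<^bsub>B\<^esub> \<odot>\<^bsub>N\<^esub> \<zero>\<^bsub>N\<^esub>) = j x"
          "e \<odot>\<^bsub>D\<^esub> (\<one>\<^bsub>B\<^esub> \<odot>\<^bsub>D\<^esub> jD (\<psi> x0)) = jD (\<psi> x)" unfolding T_def using N.B.one_closed by blast
        then have "x = \<zero>\<^bsub>M\<^esub>" using N.j_eq_iff[of x "\<zero>\<^bsub>M\<^esub>"] YM by simp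
        moreover have "\<psi> x = \<psi> x0" using x(3) x0 \<psi>D[OF x(1)] \<psi>D[OF x0(1)] by simp
        ultimately show False using ker[OF x(1)] N.M.submoduleD(2)[OF UY'(1)] x0 by simp
      qed
      ultimately show ?thesis using that \<psi>D[OF x0(1)] D.j_closed by blast
    qed
    \<comment> \<open>Both projections contain the truncations, which are not zero.\<close>
    have domT: "\<exists>d. T y d" if "y \<in> Y" for y
    proof -
      have "submodule {y. \<exists>d. T y d} B N"
      proof (rule N.N.submoduleI)
        show "{y. \<exists>d. T y d} \<subseteq> carrier N" using Tc(2) by blast
        show "\<zero>\<^bsub>N\<^esub> \<in> {y. \<exists>d. T y d}" using T0 by blast
        show "x \<oplus>\<^bsub>N\<^esub> y \<in> {y. \<exists>d. T y d}" if "x \<in> {y. \<exists>d. T y d}" "y \<in> {y. \<exists>d. T y d}" for x y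
          using that Tadd by (simp only: mem_Collect_eq) metis
        show "a \<odot>\<^bsub>N\<^esub> x \<in> {y. \<exists>d. T y d}" if "a \<in> carrier B" "x \<in> {y. \<exists>d. T y d}" for a x
          using that Tsm by (simp only: mem_Collect_eq) metis
      qed
      then have "{y. \<exists>d. T y d} = U \<or> {y. \<exists>d. T y d} = Y" by (rule between) (use TU Tc in auto)
      moreover have "j x0 \<notin> U"
        using ker[OF x0(1)] x0 by (simp add: cp cpU)
      ultimately show ?thesis using Tj[OF x0(1)] that by blast
    qed
    have ranT: "\<exists>y. T y d" if "d \<in> carrier D" for d
    proof -
      have "submodule {d. \<exists>y. T y d} B D"
      proof (rule D.N.submoduleI)
        show "{d. \<exists>y. T y d} \<subseteq> carrier D" using Tc(3) by blast
        show "\<zero>\<^bsub>D\<^esub> \<in> {d. \<exists>y. T y d}" using T0 by blast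
        show "x \<oplus>\<^bsub>D\<^esub> y \<in> {d. \<exists>y. T y d}" if "x \<in> {d. \<exists>y. T y d}" "y \<in> {d. \<exists>y. T y d}" for x y
          using that Tadd by (simp only: mem_Collect_eq) metis
        show "a \<odot>\<^bsub>D\<^esub> x \<in> {d. \<exists>y. T y d}" if "a \<in> carrier B" "x \<in> {d. \<exists>y. T y d}" for a x
          using that Tsm by (simp only: mem_Collect_eq) metis
      qed
      then have "{d. \<exists>y. T y d} = {\<zero>\<^bsub>D\<^esub>} \<or> {d. \<exists>y. T y d} = carrier D" by (rule simpleD)
      then show ?thesis using Tj[OF x0(1)] jx0 that by blast
    qed
    have uniq: "d = d'" if "T y d" "T y d'" for y d d'
    proof -
      have "T \<zero>\<^bsub>N\<^esub> (d \<ominus>\<^bsub>D\<^esub> d')"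
        using Tdiff[OF that] Tc[OF that(1)] N.N.eq_iff_diff_zero[of y y] by simp
      then show ?thesis using fun0 Tc that D.N.eq_iff_diff_zero[of d d'] by blast
    qed
    define f where "f = (\<lambda>y. THE d. T y d)"
    have fT: "T y (f y)" if "y \<in> Y" for y
      unfolding f_def by (rule theI') (use domT[OF that] uniq in blast)
    have f_eq: "f y = d" if "T y d" for y d using fT Tc that uniq by blast
    have "module_epi B (N\<lparr>carrier := Y\<rparr>) U D f"
      unfolding module_epi_def
    proof (intro conjI ballI)
      fix x y assume "x \<in> carrier (N\<lparr>carrier := Y\<rparr>)" "y \<in> carrier (N\<lparr>carrier := Y\<rparr>)"
      then show "f (x \<oplus>\<^bsub>N\<lparr>carrier := Y\<rparr>\<^esub> y) = f x \<oplus>\<^bsub>D\<^esub> f y"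
        using f_eq[OF Tadd[OF fT fT]] by simp
    next
      fix a x assume "a \<in> carrier B" "x \<in> carrier (N\<lparr>carrier := Y\<rparr>)"
      then show "f (a \<odot>\<^bsub>N\<lparr>carrier := Y\<rparr>\<^esub> x) = a \<odot>\<^bsub>D\<^esub> f x"
        using f_eq[OF Tsm[OF fT]] by simp
    next
      show "f ` carrier (N\<lparr>carrier := Y\<rparr>) = carrier D"
      proof
        show "f ` carrier (N\<lparr>carrier := Y\<rparr>) \<subseteq> carrier D" using Tc(3)[OF fT] by auto
        show "carrier D \<subseteq> f ` carrier (N\<lparr>carrier := Y\<rparr>)"
        proof
          fix d assume "d \<in> carrier D"
          then obtain y where "T y d" using ranT by blast
          then have "d = f y" "y \<in> Y" using f_eq Tc(1) by auto
          then show "d \<in> f ` carrier (N\<lparr>carrier := Y\<rparr>)" by simp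
        qed
      qed
    next
      fix y assume "y \<in> carrier (N\<lparr>carrier := Y\<rparr>)"
      then have y: "y \<in> Y" by simp
      have "f y = \<zero>\<^bsub>D\<^esub> \<longleftrightarrow> T y \<zero>\<^bsub>D\<^esub>"
      proof
        assume "f y = \<zero>\<^bsub>D\<^esub>"
        then show "T y \<zero>\<^bsub>D\<^esub>" using fT[OF y] by simp
      qed (rule f_eq)
      then show "f y = \<zero>\<^bsub>D\<^esub> \<longleftrightarrow> y \<in> U" using ker0 by blast
    qed
    then show "\<exists>\<psi>. module_epi B (N\<lparr>carrier := Y\<rparr>) U D \<psi>" by blast
  qed
qed

lemma not_section_isomorphic_refl:
  assumes "left_module A M" "left_module A D" "submodule U A M" "carrier D \<noteq> {\<zero>\<^bsub>D\<^esub>}"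
  shows "\<not> section_isomorphic A M U U D"
proof -
  interpret left_module A M by fact
  interpret D: left_module A D by fact
  interpret U: left_module A "M\<lparr>carrier := U\<rparr>" by (rule submodule_is_left_module[OF assms(3)])
  have "submodule U A (M\<lparr>carrier := U\<rparr>)" using assms(3) by (simp add: submodule_of_submodule)
  from U.quotient_isomorphic_iff[OF this assms(2)] show ?thesis
  proof (simp, intro allI notI)
    fix \<psi> assume "module_epi A (M\<lparr>carrier := U\<rparr>) U D \<psi>"
    then have "\<psi> ` U = carrier D" "\<And>x. x \<in> U \<Longrightarrow> \<psi> x = \<zero>\<^bsub>D\<^esub>" by (auto simp: module_epi_def)
    then have "carrier D \<subseteq> {\<zero>\<^bsub>D\<^esub>}" by auto
    then show False using assms(4) D.zero_closed by blast
  qed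
qed

text \<open>The counts attained by composition series of \<open>N\<close> and of \<open>M\<close> are the same. Truncation gives
  one inclusion (\<open>down\<close>); for the other (\<open>up\<close>), each step of a series of \<open>M\<close> is coinduced and
  refined, and truncating the refinement shows that it contributes what the step did. The submodule
  coinduced from zero truncates to zero and contributes nothing.\<close>

theorem composition_mult_corner:
  fixes \<rho> :: "'n set \<Rightarrow> nat" and N :: "('b, 'n) module"
  assumes N: "corner_pair B H e \<theta> K N M j" and D: "corner_pair B H e \<theta> K D D' jD"
    and simple: "simple_module B D" and ne: "carrier D' \<noteq> {\<zero>\<^bsub>D'\<^esub>}"
    and rank: "\<And>U Y. \<lbrakk>submodule U B N; submodule Y B N; U \<subset> Y\<rbrakk> \<Longrightarrow> \<rho> U < \<rho> Y"
  shows "composition_mult B N D = composition_mult H M D'"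
proof -
  interpret N: corner_pair B H e \<theta> K N M j by (rule N)
  interpret D: corner_pair B H e \<theta> K D D' jD by (rule D)
  let ?tr = "N.corner_part" and ?R = "N.coinduced"
  have down: "mult_series H M D' (?tr U) (?tr Y) c" if "mult_series B N D U Y c" for U Y c
    using that
  proof induction
    case (refl U)
    then show ?case by (intro mult_series.refl N.corner_part_submodule)
  next
    case (step U Y c Z)
    have iff: "section_isomorphic B N Y Z D \<longleftrightarrow> section_isomorphic H M (?tr Y) (?tr Z) D'"
      by (rule section_isomorphic_corner_part[OF N D simple ne step.hyps(2)])
    show ?case
    proof (cases "?tr Y = ?tr Z")
      case True
      then have "\<not> section_isomorphic B N Y Z D"
        unfolding iff using N.corner_part_submodule[OF mult_series_submodule(2)[OF step.hyps(1)]]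
          not_section_isomorphic_refl[OF N.M.left_module_axioms D.M.left_module_axioms _ ne] by metis
      then show ?thesis using step.IH True by simp
    next
      case False
      from mult_series.step[OF step.IH N.corner_part_simple_section[OF step.hyps(2) False]]
      show ?thesis using iff by simp
    qed
  qed
  have ex: "\<exists>c. mult_series B N D U Y c"
    if "submodule U B N" "submodule Y B N" "U \<subseteq> Y" for U Y
    using that by (intro mult_series_exists[where \<rho>=\<rho>] rank)
  have up: "mult_series B N D (?R W) (?R W') c" if "mult_series H M D' W W' c" for W W' c
    using that
  proof induction
    case (refl W)
    then show ?case by (intro mult_series.refl N.coinduced_submodule)
  next
    case (step W Y c Z)
    have YZ: "submodule Y H M" "submodule Z H M" "Y \<subseteq> Z"
      using step.hyps by (auto simp: simple_section_def)
    obtain c' where c': "mult_series B N D (?R Y) (?R Z) c'"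
      using ex[OF N.coinduced_submodule[OF YZ(1)] N.coinduced_submodule[OF YZ(2)]
          N.coinduced_mono[OF YZ(3)]] by blast
    then have "mult_series H M D' Y Z c'"
      using down[OF c'] YZ by (simp add: N.corner_part_coinduced)
    then have "c' = of_bool (section_isomorphic H M Y Z D')"
      using mult_series_simple_section_count step.hyps(2) by blast
    then show ?case using mult_series_trans[OF c' step.IH] by simp
  qed
  have tr0: "?tr {\<zero>\<^bsub>N\<^esub>} = {\<zero>\<^bsub>M\<^esub>}"
    using N.j_eq_iff[of _ "\<zero>\<^bsub>M\<^esub>"] by (auto simp: N.corner_part_def)
  have tr1: "?tr (carrier N) = carrier M" by (auto simp: N.corner_part_def)
  have R0: "mult_series B N D {\<zero>\<^bsub>N\<^esub>} (?R {\<zero>\<^bsub>M\<^esub>}) 0"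
  proof -
    have sub: "submodule (?R {\<zero>\<^bsub>M\<^esub>}) B N"
      by (rule N.coinduced_submodule[OF N.M.submodule_zero])
    then obtain c where c: "mult_series B N D {\<zero>\<^bsub>N\<^esub>} (?R {\<zero>\<^bsub>M\<^esub>}) c"
      using ex[OF N.N.submodule_zero sub] N.N.submoduleD(2)[OF sub] by blast
    have "mult_series H M D' {\<zero>\<^bsub>M\<^esub>} {\<zero>\<^bsub>M\<^esub>} c"
      using down[OF c] N.corner_part_coinduced[OF N.M.submodule_zero] tr0 by simp
    then show ?thesis using c mult_series_refl_count by blast
  qed
  have "mult_series B N D {\<zero>\<^bsub>N\<^esub>} (carrier N) c \<longleftrightarrow> mult_series H M D' {\<zero>\<^bsub>M\<^esub>} (carrier M) c" for c
    using down[of "{\<zero>\<^bsub>N\<^esub>}" "carrier N" c] up[of "{\<zero>\<^bsub>M\<^esub>}" "carrier M" c]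
      mult_series_trans[OF _ R0, of "carrier N" c]
    unfolding tr0 tr1 N.coinduced_carrier by auto
  then show ?thesis
    unfolding composition_mult_def N.N.composition_series_iff_mult_series
      N.M.composition_series_iff_mult_series by simp
qed

section \<open>Tensor products\<close>

text \<open>Closure under the operations that occur in the relators makes these relators elements of the free
  abelian group on the pairs.\<close>

locale tensor_pair =
  fixes S :: "('s, 'x) ring_scheme" and M :: "('s, 'm) module" and N :: "('s, 'n) module"
  assumes M_add: "\<lbrakk>x \<in> carrier M; x' \<in> carrier M\<rbrakk> \<Longrightarrow> x \<oplus>\<^bsub>M\<^esub> x' \<in> carrier M"
    and N_add: "\<lbrakk>y \<in> carrier N; y' \<in> carrier N\<rbrakk> \<Longrightarrow> y \<oplus>\<^bsub>N\<^esub> y' \<in> carrier N"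
    and M_smult: "\<lbrakk>s \<in> carrier S; x \<in> carrier M\<rbrakk> \<Longrightarrow> s \<odot>\<^bsub>M\<^esub> x \<in> carrier M"
    and N_smult: "\<lbrakk>s \<in> carrier S; y \<in> carrier N\<rbrakk> \<Longrightarrow> s \<odot>\<^bsub>N\<^esub> y \<in> carrier N"
begin

abbreviation "F \<equiv> tensor_free M N"
abbreviation "Null \<equiv> tensor_null S M N"
abbreviation "T \<equiv> tensor S M N"
abbreviation "pt \<equiv> pure_tensor S M N"

lemma F_comm: "comm_group F" and F_group: "group F"
  by (simp_all add: tensor_free_def abelian_free_Abelian_group)

lemma F_carrier: "w \<in> carrier F \<longleftrightarrow> Poly_Mapping.keys w \<subseteq> carrier M \<times> carrier N"
  and F_mult [simp]: "a \<otimes>\<^bsub>F\<^esub> b = a + b" and F_one [simp]: "\<one>\<^bsub>F\<^esub> = 0"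
  and F_inv: "w \<in> carrier F \<Longrightarrow> inv\<^bsub>F\<^esub> w = - w"
  by (simp_all add: tensor_free_def)

lemma frag_of_F [simp]: "frag_of p \<in> carrier F \<longleftrightarrow> p \<in> carrier M \<times> carrier N"
  by (simp only: tensor_free_def frag_of_in_free_Abelian_group)

lemma F_diff: "a \<in> carrier F \<Longrightarrow> b \<in> carrier F \<Longrightarrow> a - b \<in> carrier F"
  using keys_diff[of a b] by (auto simp: F_carrier)

lemma F_add: "a \<in> carrier F \<Longrightarrow> b \<in> carrier F \<Longrightarrow> a + b \<in> carrier F"
  using keys_add[of a b] by (auto simp: F_carrier)

lemma relators_closed: "tensor_relators S M N \<subseteq> carrier F"
  unfolding tensor_relators_def using M_add N_add M_smult N_smult
  by (auto intro!: F_diff simp del: frag_of_F simp: frag_of_F)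

lemma Null_subgroup: "subgroup Null F"
  unfolding tensor_null_def by (rule group.generate_is_subgroup[OF F_group relators_closed])

lemma Null_normal: "Null \<lhd> F"
  by (rule comm_group.subgroup_imp_normal[OF F_comm Null_subgroup])

lemma relator_in_Null: "w \<in> tensor_relators S M N \<Longrightarrow> w \<in> Null"
  unfolding tensor_null_def by (rule generate.incl)

lemma T_group: "group T"
  unfolding tensor_def by (rule normal.factorgroup_is_group[OF Null_normal])

lemma coset_mem: "z \<in> Null #>\<^bsub>F\<^esub> w \<longleftrightarrow> (\<exists>u\<in>Null. z = u + w)"
  by (auto simp: r_coset_def)

lemma coset_self: "w \<in> Null #>\<^bsub>F\<^esub> w"
  using subgroup.one_closed[OF Null_subgroup] by (auto simp: coset_mem intro: bexI[of _ 0])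

lemma Null_minus: "u \<in> Null \<Longrightarrow> - u \<in> Null"
  using subgroup.m_inv_closed[OF Null_subgroup] subgroup.subset[OF Null_subgroup] F_inv by fastforce

lemma Null_add: "u \<in> Null \<Longrightarrow> u' \<in> Null \<Longrightarrow> u + u' \<in> Null"
  using subgroup.m_closed[OF Null_subgroup] by fastforce

lemma coset_eq: "Null #>\<^bsub>F\<^esub> a = Null #>\<^bsub>F\<^esub> b \<longleftrightarrow> a - b \<in> Null"
proof
  assume "Null #>\<^bsub>F\<^esub> a = Null #>\<^bsub>F\<^esub> b"
  then show "a - b \<in> Null" using coset_self[of a] by (auto simp: coset_mem)
next
  assume ab: "a - b \<in> Null"
  have sub: "Null #>\<^bsub>F\<^esub> a \<subseteq> Null #>\<^bsub>F\<^esub> b" if "a - b \<in> Null" for a b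
  proof
    fix z assume "z \<in> Null #>\<^bsub>F\<^esub> a"
    then obtain u where "u \<in> Null" "z = u + a" by (auto simp: coset_mem)
    then have "u + (a - b) \<in> Null" "z = (u + (a - b)) + b" using Null_add \<open>a - b \<in> Null\<close> by auto
    then show "z \<in> Null #>\<^bsub>F\<^esub> b" unfolding coset_mem by (rule bexI[rotated])
  qed
  show "Null #>\<^bsub>F\<^esub> a = Null #>\<^bsub>F\<^esub> b"
    using sub[OF ab] sub[of b a] Null_minus[OF ab] by auto
qed

lemma T_carrier: "t \<in> carrier T \<longleftrightarrow> (\<exists>w\<in>carrier F. t = Null #>\<^bsub>F\<^esub> w)"
  by (auto simp: tensor_def FactGroup_def RCOSETS_def)

lemma T_one: "\<one>\<^bsub>T\<^esub> = Null #>\<^bsub>F\<^esub> 0"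
  using subgroup.rcos_const[OF Null_subgroup F_group subgroup.one_closed[OF Null_subgroup]]
  by (simp add: tensor_def FactGroup_def)

lemma T_mult: "a \<in> carrier F \<Longrightarrow> b \<in> carrier F \<Longrightarrow>
    (Null #>\<^bsub>F\<^esub> a) \<otimes>\<^bsub>T\<^esub> (Null #>\<^bsub>F\<^esub> b) = Null #>\<^bsub>F\<^esub> (a + b)"
  using normal.rcos_sum[OF Null_normal, of a b] by (simp add: tensor_def)

lemma T_inv: "a \<in> carrier F \<Longrightarrow> inv\<^bsub>T\<^esub> (Null #>\<^bsub>F\<^esub> a) = Null #>\<^bsub>F\<^esub> (- a)"
proof -
  assume a: "a \<in> carrier F"
  then have b: "- a \<in> carrier F" by (simp add: F_carrier)
  have "(Null #>\<^bsub>F\<^esub> (- a)) \<otimes>\<^bsub>T\<^esub> (Null #>\<^bsub>F\<^esub> a) = \<one>\<^bsub>T\<^esub>"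
    using T_mult[OF b a] T_one by simp
  then show ?thesis using group.inv_equality[OF T_group] a b T_carrier by blast
qed

lemma pure_closed: "\<lbrakk>x \<in> carrier M; y \<in> carrier N\<rbrakk> \<Longrightarrow> pt x y \<in> carrier T"
  unfolding T_carrier pure_tensor_def by (rule bexI[of _ "frag_of (x, y)"]) simp_all

lemma pure_add_l:
  assumes "x \<in> carrier M" "x' \<in> carrier M" "y \<in> carrier N"
  shows "pt (x \<oplus>\<^bsub>M\<^esub> x') y = pt x y \<otimes>\<^bsub>T\<^esub> pt x' y"
proof -
  have "frag_of (x \<oplus>\<^bsub>M\<^esub> x', y) - frag_of (x, y) - frag_of (x', y) \<in> Null"
    using assms by (intro relator_in_Null) (auto simp: tensor_relators_def)
  then show ?thesis
    unfolding pure_tensor_def using assms by (simp add: T_mult coset_eq diff_diff_eq)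
qed

lemma pure_add_r:
  assumes "x \<in> carrier M" "y \<in> carrier N" "y' \<in> carrier N"
  shows "pt x (y \<oplus>\<^bsub>N\<^esub> y') = pt x y \<otimes>\<^bsub>T\<^esub> pt x y'"
proof -
  have "frag_of (x, y \<oplus>\<^bsub>N\<^esub> y') - frag_of (x, y) - frag_of (x, y') \<in> Null"
    using assms by (intro relator_in_Null) (auto simp: tensor_relators_def)
  then show ?thesis
    unfolding pure_tensor_def using assms by (simp add: T_mult coset_eq diff_diff_eq)
qed

lemma pure_balanced:
  assumes "s \<in> carrier S" "x \<in> carrier M" "y \<in> carrier N"
  shows "pt (s \<odot>\<^bsub>M\<^esub> x) y = pt x (s \<odot>\<^bsub>N\<^esub> y)"
proof -
  have "frag_of (s \<odot>\<^bsub>M\<^esub> x, y) - frag_of (x, s \<odot>\<^bsub>N\<^esub> y) \<in> Null"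
    using assms by (intro relator_in_Null) (auto simp: tensor_relators_def)
  then show ?thesis unfolding pure_tensor_def by (simp add: coset_eq)
qed

lemma tensor_induct [consumes 1, case_names one pure mult]:
  assumes "t \<in> carrier T" and "P \<one>\<^bsub>T\<^esub>"
    and "\<And>x y. \<lbrakk>x \<in> carrier M; y \<in> carrier N\<rbrakk> \<Longrightarrow> P (pt x y)"
    and "\<And>t t'. \<lbrakk>t \<in> carrier T; t' \<in> carrier T; P t; P t'\<rbrakk> \<Longrightarrow> P (t \<otimes>\<^bsub>T\<^esub> inv\<^bsub>T\<^esub> t')"
  shows "P t"
proof -
  obtain w where w: "w \<in> carrier F" "t = Null #>\<^bsub>F\<^esub> w" using assms(1) T_carrier by blast
  have "P (Null #>\<^bsub>F\<^esub> w)"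
  proof (rule free_Abelian_group_induct[where P="\<lambda>w. P (Null #>\<^bsub>F\<^esub> w)"])
    show "Poly_Mapping.keys w \<subseteq> carrier M \<times> carrier N" using w(1) by (simp only: F_carrier)
    show "P (Null #>\<^bsub>F\<^esub> 0)" using assms(2) T_one by simp
  next
    fix x y assume "Poly_Mapping.keys x \<subseteq> carrier M \<times> carrier N"
      "Poly_Mapping.keys y \<subseteq> carrier M \<times> carrier N"
      and P: "P (Null #>\<^bsub>F\<^esub> x)" "P (Null #>\<^bsub>F\<^esub> y)"
    then have xy: "x \<in> carrier F" "y \<in> carrier F" by (auto simp: F_carrier)
    then have "(Null #>\<^bsub>F\<^esub> x) \<otimes>\<^bsub>T\<^esub> inv\<^bsub>T\<^esub> (Null #>\<^bsub>F\<^esub> y) = Null #>\<^bsub>F\<^esub> (x - y)"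
      using T_mult[of x "- y"] T_inv by (simp add: F_carrier)
    moreover have "Null #>\<^bsub>F\<^esub> x \<in> carrier T" "Null #>\<^bsub>F\<^esub> y \<in> carrier T"
      using xy T_carrier by blast+
    ultimately show "P (Null #>\<^bsub>F\<^esub> (x - y))" using assms(4) P by metis
  next
    fix p assume "p \<in> carrier M \<times> carrier N"
    then show "P (Null #>\<^bsub>F\<^esub> frag_of p)"
      using assms(3)[of "fst p" "snd p"] by (auto simp: pure_tensor_def)
  qed
  then show ?thesis using w by simp
qed

lemma tensor_universal:
  assumes G: "comm_group G"
    and f: "\<And>x y. \<lbrakk>x \<in> carrier M; y \<in> carrier N\<rbrakk> \<Longrightarrow> f x y \<in> carrier G"
    and add_l: "\<And>x x' y. \<lbrakk>x \<in> carrier M; x' \<in> carrier M; y \<in> carrier N\<rbrakk> \<Longrightarrow>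
      f (x \<oplus>\<^bsub>M\<^esub> x') y = f x y \<otimes>\<^bsub>G\<^esub> f x' y"
    and add_r: "\<And>x y y'. \<lbrakk>x \<in> carrier M; y \<in> carrier N; y' \<in> carrier N\<rbrakk> \<Longrightarrow>
      f x (y \<oplus>\<^bsub>N\<^esub> y') = f x y \<otimes>\<^bsub>G\<^esub> f x y'"
    and bal: "\<And>s x y. \<lbrakk>s \<in> carrier S; x \<in> carrier M; y \<in> carrier N\<rbrakk> \<Longrightarrow>
      f (s \<odot>\<^bsub>M\<^esub> x) y = f x (s \<odot>\<^bsub>N\<^esub> y)"
  shows "\<exists>g \<in> hom T G. \<forall>x\<in>carrier M. \<forall>y\<in>carrier N. g (pt x y) = f x y"
proof -
  interpret G: comm_group G by (rule G)
  interpret F: comm_group F by (rule F_comm)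
  have im: "(\<lambda>p. f (fst p) (snd p)) ` (carrier M \<times> carrier N) \<subseteq> carrier G" using f by auto
  obtain h where h: "h \<in> hom F G" "\<And>p. p \<in> carrier M \<times> carrier N \<Longrightarrow> h (frag_of p) = f (fst p) (snd p)"
    using G.free_Abelian_group_universal[OF im] unfolding tensor_free_def by blast
  interpret h: group_hom F G h using h(1) by unfold_locales (simp_all add: hom_def)
  have hd: "h (a - b) = h a \<otimes>\<^bsub>G\<^esub> inv\<^bsub>G\<^esub> h b" if "a \<in> carrier F" "b \<in> carrier F" for a b
  proof -
    have "a - b = a \<otimes>\<^bsub>F\<^esub> inv\<^bsub>F\<^esub> b" using that by (simp add: F_inv)
    then show ?thesis using that by (metis F.inv_closed h.hom_inv h.hom_mult)
  qed
  have hf: "h (frag_of (x, y)) = f x y" "frag_of (x, y) \<in> carrier F"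
    if "x \<in> carrier M" "y \<in> carrier N" for x y using that h(2)[of "(x, y)"] by simp_all
  have comm: "a \<otimes>\<^bsub>G\<^esub> b \<otimes>\<^bsub>G\<^esub> inv\<^bsub>G\<^esub> a \<otimes>\<^bsub>G\<^esub> inv\<^bsub>G\<^esub> b = \<one>\<^bsub>G\<^esub>"
    if "a \<in> carrier G" "b \<in> carrier G" for a b
    using that G.m_comm[of a b] by (simp add: G.m_assoc)
  have "tensor_relators S M N \<subseteq> kernel F G h"
  proof
    fix w assume "w \<in> tensor_relators S M N"
    then consider
      (l) x x' y where "w = frag_of (x \<oplus>\<^bsub>M\<^esub> x', y) - frag_of (x, y) - frag_of (x', y)"
        "x \<in> carrier M" "x' \<in> carrier M" "y \<in> carrier N"
    | (r) x y y' where "w = frag_of (x, y \<oplus>\<^bsub>N\<^esub> y') - frag_of (x, y) - frag_of (x, y')"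
        "x \<in> carrier M" "y \<in> carrier N" "y' \<in> carrier N"
    | (b) s x y where "w = frag_of (s \<odot>\<^bsub>M\<^esub> x, y) - frag_of (x, s \<odot>\<^bsub>N\<^esub> y)"
        "s \<in> carrier S" "x \<in> carrier M" "y \<in> carrier N"
      unfolding tensor_relators_def by blast
    then have "h w = \<one>\<^bsub>G\<^esub>"
    proof cases
      case l
      then show ?thesis using M_add hf F_diff f by (simp add: hd add_l comm)

    next
      case r
      then show ?thesis using N_add hf F_diff f by (simp add: hd add_r comm)

    next
      case b
      then show ?thesis using M_smult N_smult hf f by (simp add: hd bal)
    qed
    moreover have "w \<in> carrier F" using \<open>w \<in> tensor_relators S M N\<close> relators_closed by blast
    ultimately show "w \<in> kernel F G h" by (simp add: kernel_def)
  qed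
  then have "Null \<subseteq> kernel F G h"
    unfolding tensor_null_def by (rule F.generate_subgroup_incl[OF _ h.subgroup_kernel])
  from h.FactGroup_universal_kernel[OF Null_normal this]
  obtain g where g: "g \<in> hom T G" "\<And>w. w \<in> carrier F \<Longrightarrow> g (Null #>\<^bsub>F\<^esub> w) = h w"
    unfolding tensor_def by blast
  then have "g (pt x y) = f x y" if "x \<in> carrier M" "y \<in> carrier N" for x y
    using hf[OF that] by (simp add: pure_tensor_def)
  then show ?thesis using g(1) by blast
qed

text \<open>The map induced by \<open>h\<close> is the union of the cosets of the images of all representatives.
  Once this union is known to be a single coset, any representative can be used to compute it.\<close>

lemma tensor_map_coset:
  assumes "tensor_map S M N h C \<in> carrier T" and w: "w \<in> C"
  shows "tensor_map S M N h C = Null #>\<^bsub>F\<^esub> frag_extend (\<lambda>p. frag_of (h p)) w"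
    and "frag_extend (\<lambda>p. frag_of (h p)) w \<in> carrier F"
proof -
  let ?w = "frag_extend (\<lambda>p. frag_of (h p)) w"
  obtain u where u: "u \<in> carrier F" "tensor_map S M N h C = Null #>\<^bsub>F\<^esub> u"
    using assms(1) T_carrier by blast
  have "?w \<in> tensor_map S M N h C"
    unfolding tensor_map_def using w coset_self[of ?w] by blast
  then obtain z where z: "z \<in> Null" "?w = z + u" using u coset_mem by auto
  then have "Null #>\<^bsub>F\<^esub> ?w = Null #>\<^bsub>F\<^esub> u" by (simp add: coset_eq)
  then show "tensor_map S M N h C = Null #>\<^bsub>F\<^esub> ?w" using u by simp
  show "?w \<in> carrier F"
    using z u subgroup.subset[OF Null_subgroup] F_add by auto
qed

lemma tensor_map_pure:
  assumes "tensor_map S M N h (pt x y) \<in> carrier T"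
  shows "tensor_map S M N h (pt x y) = pt (fst (h (x, y))) (snd (h (x, y)))"
    and "fst (h (x, y)) \<in> carrier M" "snd (h (x, y)) \<in> carrier N"
proof -
  have "frag_of (x, y) \<in> pt x y" unfolding pure_tensor_def by (rule coset_self)
  note * = tensor_map_coset[OF assms this]
  show "tensor_map S M N h (pt x y) = pt (fst (h (x, y))) (snd (h (x, y)))"
    using *(1) by (simp add: pure_tensor_def)
  show "fst (h (x, y)) \<in> carrier M" "snd (h (x, y)) \<in> carrier N"
    using *(2) by (auto simp: mem_Times_iff)
qed

end

section \<open>Algebras with an involution\<close>

lemma ring_of_type_algebra_simps [simp]:
  "carrier ring_of_type_algebra = UNIV"
  "x \<otimes>\<^bsub>ring_of_type_algebra\<^esub> y = x * y" "x \<oplus>\<^bsub>ring_of_type_algebra\<^esub> y = x + y"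
  "\<one>\<^bsub>ring_of_type_algebra\<^esub> = 1" "\<zero>\<^bsub>ring_of_type_algebra\<^esub> = 0"
  by (simp_all add: ring_of_type_algebra_def)

locale field_algebra = ring A + V: left_module ring_of_type_algebra A
  for A :: "('r::field, 'a) module" (structure) +
  assumes smult_mult_l: "\<lbrakk>x \<in> carrier A; y \<in> carrier A\<rbrakk> \<Longrightarrow> (c \<odot> x) \<otimes> y = c \<odot> (x \<otimes> y)"
    and smult_mult_r: "\<lbrakk>x \<in> carrier A; y \<in> carrier A\<rbrakk> \<Longrightarrow> x \<otimes> (c \<odot> y) = c \<odot> (x \<otimes> y)"
begin

lemma smult_as_mult: "x \<in> carrier A \<Longrightarrow> c \<odot> x = (c \<odot> \<one>) \<otimes> x"
  by (simp add: smult_mult_l)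

lemma smult_smult: "x \<in> carrier A \<Longrightarrow> c \<odot> (d \<odot> x) = (c * d) \<odot> x"
  using V.smult_assoc[of c d x] by simp

lemma smult_add_l: "x \<in> carrier A \<Longrightarrow> (c + d) \<odot> x = c \<odot> x \<oplus> d \<odot> x"
  using V.smult_l_distr[of c d x] by simp

lemma smult_add_r: "x \<in> carrier A \<Longrightarrow> y \<in> carrier A \<Longrightarrow> c \<odot> (x \<oplus> y) = c \<odot> x \<oplus> c \<odot> y"
  using V.smult_r_distr[of c x y] by simp

lemma smult_carrier [simp]: "x \<in> carrier A \<Longrightarrow> c \<odot> x \<in> carrier A"
  using V.smult_closed[of c x] by simp

lemma smult_1 [simp]: "x \<in> carrier A \<Longrightarrow> 1 \<odot> x = x"
  using V.smult_one[of x] by simp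

lemma smult_0_l [simp]: "x \<in> carrier A \<Longrightarrow> 0 \<odot> x = \<zero>"
  using V.smult_l_null[of x] by simp

lemma smult_0_r [simp]: "c \<odot> \<zero> = \<zero>"
  using V.smult_r_null[of c] by simp

lemma smult_eq_zero:
  assumes "c \<odot> x = \<zero>" "x \<in> carrier A" "x \<noteq> \<zero>" shows "c = 0"
proof (rule ccontr)
  assume "c \<noteq> 0"
  then have "x = inverse c \<odot> (c \<odot> x)" using assms(2) by (simp add: smult_smult)
  then show False using assms by simp
qed

lemma smult_eq_iff:
  assumes "x \<in> carrier A" "x \<noteq> \<zero>" shows "c \<odot> x = d \<odot> x \<longleftrightarrow> c = d"
proof
  assume eq: "c \<odot> x = d \<odot> x"
  have "(c - d) \<odot> x \<oplus> d \<odot> x = \<zero> \<oplus> d \<odot> x"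
    using assms eq smult_add_l[of x "c - d" d] by simp
  then have "(c - d) \<odot> x = \<zero>" using assms by (simp add: add.r_cancel)
  then show "c = d" using smult_eq_zero assms by fastforce
qed simp

text \<open>A subspace of \<open>L\<close> that is maximal among those avoiding \<open>y0\<close> is a complement of the line
  through \<open>y0\<close>, and the functional is the coordinate along that line.\<close>

lemma ex_linear_functional:
  assumes L: "submodule L ring_of_type_algebra A" and y0: "y0 \<in> L" "y0 \<noteq> \<zero>"
  shows "\<exists>g. (\<forall>x\<in>L. \<forall>y\<in>L. g (x \<oplus> y) = g x + g y) \<and> (\<forall>c. \<forall>x\<in>L. g (c \<odot> x) = c * g x) \<and> g y0 = 1"
proof -
  note Ld = V.submoduleD[OF L]
  have LA: "x \<in> carrier A" if "x \<in> L" for x using that Ld(1) by auto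
  define \<U> where "\<U> = {U. submodule U ring_of_type_algebra A \<and> U \<subseteq> L \<and> y0 \<notin> U}"
  have "\<exists>U\<in>\<U>. \<forall>Y\<in>\<U>. U \<subseteq> Y \<longrightarrow> Y = U"
  proof (rule subset_Zorn_nonempty)
    have "{\<zero>} \<in> \<U>" using V.submodule_zero Ld(2) y0(2) by (simp add: \<U>_def)
    then show "\<U> \<noteq> {}" by blast
    fix \<C> assume "\<C> \<noteq> {}" and "subset.chain \<U> \<C>"
    then have sub: "\<C> \<subseteq> \<U>" and ch: "\<And>U Y. U \<in> \<C> \<Longrightarrow> Y \<in> \<C> \<Longrightarrow> U \<subseteq> Y \<or> Y \<subseteq> U"
      by (auto simp: subset_chain_def)
    have smod: "submodule U ring_of_type_algebra A" if "U \<in> \<C>" for U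
      using that sub by (auto simp: \<U>_def)
    have sL: "\<Union>\<C> \<subseteq> L" and y0C: "y0 \<notin> \<Union>\<C>" using sub by (auto simp: \<U>_def)
    have "submodule (\<Union>\<C>) ring_of_type_algebra A"
    proof (rule V.submoduleI)
      show "\<Union>\<C> \<subseteq> carrier A" using sL Ld(1) by blast
      show "\<zero> \<in> \<Union>\<C>" using \<open>\<C> \<noteq> {}\<close> V.submoduleD(2)[OF smod] by blast
      show "x \<oplus> y \<in> \<Union>\<C>" if xy: "x \<in> \<Union>\<C>" "y \<in> \<Union>\<C>" for x y
      proof -
        obtain U Y where UY: "U \<in> \<C>" "x \<in> U" "Y \<in> \<C>" "y \<in> Y" using xy by blast
        then consider "U \<subseteq> Y" | "Y \<subseteq> U" using ch by blast
        then show ?thesis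
        proof cases
          case 1
          then have "x \<oplus> y \<in> Y" using UY V.submoduleD(3)[OF smod[OF UY(3)]] by blast
          then show ?thesis using UY by blast
        next
          case 2
          then have "x \<oplus> y \<in> U" using UY V.submoduleD(3)[OF smod[OF UY(1)]] by blast
          then show ?thesis using UY by blast
        qed
      qed
      show "c \<odot> x \<in> \<Union>\<C>" if c: "c \<in> carrier ring_of_type_algebra" "x \<in> \<Union>\<C>" for c x
      proof -
        obtain U where "U \<in> \<C>" "x \<in> U" using c by blast
        then show ?thesis using V.submoduleD(6)[OF smod[of U] c(1)] by blast
      qed
    qed
    then show "\<Union>\<C> \<in> \<U>" using sL y0C by (simp add: \<U>_def)
  qed
  then obtain U where "U \<in> \<U>" and max: "\<And>Y. Y \<in> \<U> \<Longrightarrow> U \<subseteq> Y \<Longrightarrow> Y = U" by blast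
  then have U: "submodule U ring_of_type_algebra A" and UL: "U \<subseteq> L" and y0U: "y0 \<notin> U"
    by (auto simp: \<U>_def)
  note Ud = V.submoduleD[OF U]
  have UA: "u \<in> carrier A" if "u \<in> U" for u using that Ud(1) by auto
  have Usm: "c \<odot> u \<in> U" if "u \<in> U" for c u using that Ud(6)[of c u] by simp
  have Lsm: "c \<odot> u \<in> L" if "u \<in> L" for c u using that Ld(6)[of c u] by simp
  note y0A = LA[OF y0(1)]
  have ex: "\<exists>c. \<exists>u\<in>U. x = u \<oplus> c \<odot> y0" if x: "x \<in> L" for x
  proof (cases "x \<in> U")
    case True
    then show ?thesis using y0A UA[OF True] by (intro exI[of _ 0] bexI[of _ x]) simp_all
  next
    case False
    note xA = LA[OF x]
    \<comment> \<open>Adjoining \<open>x\<close> to the maximal subspace brings in \<open>y0\<close>; solve for \<open>x\<close>.\<close>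
    let ?Y = "{z. \<exists>d. \<exists>u\<in>U. z = u \<oplus> d \<odot> x}"
    have Ysub: "submodule ?Y ring_of_type_algebra A"
    proof (rule V.submoduleI)
      show "?Y \<subseteq> carrier A" using UA xA by auto
      have "\<zero> = \<zero> \<oplus> 0 \<odot> x" using xA by simp
      then show "\<zero> \<in> ?Y" using Ud(2) by blast
      show "z \<oplus> z' \<in> ?Y" if z: "z \<in> ?Y" "z' \<in> ?Y" for z z'
      proof -
        obtain d u where 1: "u \<in> U" "z = u \<oplus> d \<odot> x" using z(1) by blast
        obtain d' u' where 2: "u' \<in> U" "z' = u' \<oplus> d' \<odot> x" using z(2) by blast
        have "z \<oplus> z' = (u \<oplus> u') \<oplus> (d + d') \<odot> x"
          using 1 2 UA xA by (simp add: smult_add_l a_ac)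
        then show ?thesis using Ud(3)[OF 1(1) 2(1)] by blast
      qed
      show "c \<odot> z \<in> ?Y" if c: "c \<in> carrier ring_of_type_algebra" "z \<in> ?Y" for c z
      proof -
        obtain d u where 1: "u \<in> U" "z = u \<oplus> d \<odot> x" using c(2) by blast
        have "c \<odot> z = c \<odot> u \<oplus> (c * d) \<odot> x"
          using 1 UA xA by (simp add: smult_add_r smult_smult)
        then show ?thesis using Usm[OF 1(1)] by blast
      qed
    qed
    have YL: "?Y \<subseteq> L" using Lsm[OF x] Ld(3) UL by blast
    have UY: "U \<subseteq> ?Y"
    proof
      fix u assume u: "u \<in> U"
      then have "u = u \<oplus> 0 \<odot> x" using UA xA by simp
      then show "u \<in> ?Y" using u by blast
    qed
    have "x = \<zero> \<oplus> 1 \<odot> x" using xA by simp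
    then have "x \<in> ?Y" using Ud(2) by blast
    then have "?Y \<noteq> U" using False by blast
    then have "?Y \<notin> \<U>" using max UY by blast
    then have "y0 \<in> ?Y" using Ysub YL by (simp add: \<U>_def)
    then obtain d u where du: "u \<in> U" "y0 = u \<oplus> d \<odot> x" by blast
    have d: "d \<noteq> 0" using du y0U UA xA by auto
    have "inverse d \<odot> y0 = inverse d \<odot> u \<oplus> x"
      using du d UA xA by (simp add: smult_add_r smult_smult)
    then have "x = \<ominus> (inverse d \<odot> u) \<oplus> inverse d \<odot> y0"
      using UA[OF du(1)] xA by (simp add: a_assoc[symmetric] l_neg)
    then show ?thesis using Ud(4)[OF Usm[OF du(1)]] by blast
  qed
  have uniq: "c = c'" if u: "u \<in> U" "u' \<in> U" and eq: "u \<oplus> c \<odot> y0 = u' \<oplus> c' \<odot> y0" for c c' u u'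
  proof (rule ccontr)
    assume "c \<noteq> c'"
    note uA = UA[OF u(1)] UA[OF u(2)]
    have "(u \<oplus> (c - c') \<odot> y0) \<oplus> c' \<odot> y0 = u' \<oplus> c' \<odot> y0"
      using uA y0A eq by (simp add: a_assoc smult_add_l[OF y0A, symmetric])
    then have "u \<oplus> (c - c') \<odot> y0 = u'"
      using add.r_cancel[of "c' \<odot> y0" "u \<oplus> (c - c') \<odot> y0" u'] uA y0A by simp
    then have "(c - c') \<odot> y0 \<oplus> u = u'" using uA y0A by (simp only: a_comm smult_carrier)
    then have "(c - c') \<odot> y0 \<in> U"
      using V.submodule_add_iff[OF U u(1), of "(c - c') \<odot> y0"] u y0A by simp
    then have "inverse (c - c') \<odot> ((c - c') \<odot> y0) \<in> U" by (rule Usm)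
    then show False using \<open>c \<noteq> c'\<close> y0A y0U by (simp add: smult_smult)
  qed
  define g where "g = (\<lambda>x. THE c. \<exists>u\<in>U. x = u \<oplus> c \<odot> y0)"
  have g_eq: "g x = c" if "u \<in> U" "x = u \<oplus> c \<odot> y0" for x u c
    unfolding g_def by (rule the_equality) (use that uniq in blast)+
  have g: "\<exists>u\<in>U. x = u \<oplus> g x \<odot> y0" if "x \<in> L" for x
    using ex[OF that] g_eq by metis
  have "g (x \<oplus> y) = g x + g y" if xy: "x \<in> L" "y \<in> L" for x y
  proof -
    obtain u where u: "u \<in> U" "x = u \<oplus> g x \<odot> y0" using g[OF xy(1)] by blast
    obtain u' where u': "u' \<in> U" "y = u' \<oplus> g y \<odot> y0" using g[OF xy(2)] by blast
    have "x \<oplus> y = (u \<oplus> g x \<odot> y0) \<oplus> (u' \<oplus> g y \<odot> y0)" using u(2) u'(2) by simp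
    also have "\<dots> = (u \<oplus> u') \<oplus> (g x + g y) \<odot> y0"
      using UA[OF u(1)] UA[OF u'(1)] y0A by (simp add: smult_add_l a_ac)
    finally show ?thesis by (rule g_eq[OF Ud(3)[OF u(1) u'(1)]])
  qed
  moreover have "g (c \<odot> x) = c * g x" if x: "x \<in> L" for c x
  proof -
    obtain u where u: "u \<in> U" "x = u \<oplus> g x \<odot> y0" using g[OF x] by blast
    have "c \<odot> x = c \<odot> (u \<oplus> g x \<odot> y0)" using u(2) by simp
    also have "\<dots> = c \<odot> u \<oplus> (c * g x) \<odot> y0"
      using UA[OF u(1)] y0A by (simp add: smult_add_r smult_smult)
    finally show ?thesis by (rule g_eq[OF Usm[OF u(1)]])
  qed
  moreover have "g y0 = 1" by (rule g_eq[OF Ud(2)]) (use y0A in simp)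
  ultimately show ?thesis by blast
qed

end

locale involutive_algebra = field_algebra A
  for A :: "('r::field, 'a) module" (structure) +
  fixes \<iota> :: "'a \<Rightarrow> 'a"
  assumes inv_closed [simp]: "x \<in> carrier A \<Longrightarrow> \<iota> x \<in> carrier A"
    and inv_add: "\<lbrakk>x \<in> carrier A; y \<in> carrier A\<rbrakk> \<Longrightarrow> \<iota> (x \<oplus> y) = \<iota> x \<oplus> \<iota> y"
    and inv_smult: "x \<in> carrier A \<Longrightarrow> \<iota> (c \<odot> x) = c \<odot> \<iota> x"
    and inv_mult: "\<lbrakk>x \<in> carrier A; y \<in> carrier A\<rbrakk> \<Longrightarrow> \<iota> (x \<otimes> y) = \<iota> y \<otimes> \<iota> x"
    and inv_inv [simp]: "x \<in> carrier A \<Longrightarrow> \<iota> (\<iota> x) = x"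

section \<open>The form on a cell ideal\<close>

locale cell_ideal_of = involutive_algebra A \<iota>
  for A :: "('r::field, 'a) module" (structure) and \<iota> :: "'a \<Rightarrow> 'a" +
  fixes J L :: "'a set" and \<alpha> :: "'a \<Rightarrow> ('a \<times> 'a \<Rightarrow>\<^sub>0 int) set"
  assumes cell: "cell_ideal A \<iota> J L \<alpha>"
begin

lemma J_ideal: "ideal J A" and J_inv: "\<iota> ` J = J" and L_subgroup: "additive_subgroup L A"
  and L_mult: "\<lbrakk>a \<in> carrier A; x \<in> L\<rbrakk> \<Longrightarrow> a \<otimes> x \<in> L" and L_J: "L \<subseteq> J"
  and \<alpha>_iso: "\<alpha> \<in> iso (add_monoid (A\<lparr>carrier := J\<rparr>)) (tensor_inv A \<iota> L)"
  and \<alpha>_mult: "\<lbrakk>a \<in> carrier A; b \<in> carrier A; z \<in> J\<rbrakk> \<Longrightarrow>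
        \<alpha> (a \<otimes> z \<otimes> b) = tensor_inv_map A \<iota> L (\<lambda>(x, w). (a \<otimes> x, w \<otimes> b)) (\<alpha> z)"
  and \<alpha>_inv: "z \<in> J \<Longrightarrow> \<alpha> (\<iota> z) = tensor_inv_map A \<iota> L (\<lambda>(x, w). (\<iota> w, \<iota> x)) (\<alpha> z)"
  using cell by (simp_all add: cell_ideal_def)

lemma JA: "x \<in> J \<Longrightarrow> x \<in> carrier A"
  using additive_subgroup.a_subset[OF ideal.axioms(1)[OF J_ideal]] by auto

lemma LA: "x \<in> L \<Longrightarrow> x \<in> carrier A"
  using L_J JA by auto

lemma L_add: "\<lbrakk>x \<in> L; y \<in> L\<rbrakk> \<Longrightarrow> x \<oplus> y \<in> L"
  by (rule additive_subgroup.a_closed[OF L_subgroup])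

lemma L_smult: "x \<in> L \<Longrightarrow> c \<odot> x \<in> L"
  using L_mult[of "c \<odot> \<one>" x] LA by (simp add: smult_mult_l)

lemma L_zero: "\<zero> \<in> L"
  by (rule additive_subgroup.zero_closed[OF L_subgroup])

lemma L_submodule: "submodule L ring_of_type_algebra A"
  using LA L_zero L_add L_smult by (intro V.submoduleI) auto

lemma J_add: "\<lbrakk>x \<in> J; y \<in> J\<rbrakk> \<Longrightarrow> x \<oplus> y \<in> J"
  by (rule additive_subgroup.a_closed[OF ideal.axioms(1)[OF J_ideal]])

lemma J_mult: "\<lbrakk>a \<in> carrier A; x \<in> J\<rbrakk> \<Longrightarrow> a \<otimes> x \<in> J" "\<lbrakk>a \<in> carrier A; x \<in> J\<rbrakk> \<Longrightarrow> x \<otimes> a \<in> J"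
  using ideal.I_l_closed[OF J_ideal] ideal.I_r_closed[OF J_ideal] by auto

abbreviation "T \<equiv> tensor_inv A \<iota> L"

definition pinv where
  "pinv = pure_tensor ring_of_type_algebra (A\<lparr>carrier := L\<rparr>) (A\<lparr>carrier := \<iota> ` L\<rparr>)"

sublocale tp: tensor_pair ring_of_type_algebra "A\<lparr>carrier := L\<rparr>" "A\<lparr>carrier := \<iota> ` L\<rparr>"
proof
  fix y y' assume "y \<in> carrier (A\<lparr>carrier := \<iota> ` L\<rparr>)" "y' \<in> carrier (A\<lparr>carrier := \<iota> ` L\<rparr>)"
  then obtain x x' where x: "x \<in> L" "y = \<iota> x" "x' \<in> L" "y' = \<iota> x'" by auto
  then have "y \<oplus> y' = \<iota> (x \<oplus> x')" using LA inv_add by simp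
  then show "y \<oplus>\<^bsub>A\<lparr>carrier := \<iota> ` L\<rparr>\<^esub> y' \<in> carrier (A\<lparr>carrier := \<iota> ` L\<rparr>)"
    using L_add[OF x(1,3)] by simp
next
  fix s y assume "y \<in> carrier (A\<lparr>carrier := \<iota> ` L\<rparr>)"
  then obtain x where x: "x \<in> L" "y = \<iota> x" by auto
  then have "s \<odot> y = \<iota> (s \<odot> x)" using LA inv_smult by simp
  then show "s \<odot>\<^bsub>A\<lparr>carrier := \<iota> ` L\<rparr>\<^esub> y \<in> carrier (A\<lparr>carrier := \<iota> ` L\<rparr>)"
    using L_smult[OF x(1)] by simp
qed (simp_all add: L_add L_smult)

lemma T_eq: "tp.T = T" by (simp add: tensor_inv_def)

lemma pinv_closed: "\<lbrakk>x \<in> L; y \<in> L\<rbrakk> \<Longrightarrow> pinv x (\<iota> y) \<in> carrier T"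
  using tp.pure_closed[of x "\<iota> y"] by (simp add: pinv_def T_eq)

lemma \<alpha>_bij: "bij_betw \<alpha> J (carrier T)"
  and \<alpha>_add: "\<lbrakk>x \<in> J; y \<in> J\<rbrakk> \<Longrightarrow> \<alpha> (x \<oplus> y) = \<alpha> x \<otimes>\<^bsub>T\<^esub> \<alpha> y"
  using \<alpha>_iso by (auto simp: iso_def hom_def)

lemma \<alpha>_closed: "x \<in> J \<Longrightarrow> \<alpha> x \<in> carrier T"
  using \<alpha>_bij by (auto simp: bij_betw_def)

lemma \<alpha>_eq: "\<lbrakk>x \<in> J; y \<in> J; \<alpha> x = \<alpha> y\<rbrakk> \<Longrightarrow> x = y"
  using \<alpha>_bij by (auto simp: bij_betw_def inj_on_def)

text \<open>\<open>E x y\<close> is the element \<open>x \<otimes> \<iota> y\<close>. These elements multiply like matrix units, up to the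
  form: the left factor \<open>x\<close> sees left multiplication, and \<open>y\<close> sees right multiplication through
  the involution.\<close>

abbreviation E where "E \<equiv> cell_element A \<iota> J L \<alpha>"

lemma E_closed: "\<lbrakk>x \<in> L; y \<in> L\<rbrakk> \<Longrightarrow> E x y \<in> J"
  and \<alpha>_E: "\<lbrakk>x \<in> L; y \<in> L\<rbrakk> \<Longrightarrow> \<alpha> (E x y) = pinv x (\<iota> y)"
proof -
  assume xy: "x \<in> L" "y \<in> L"
  have "pinv x (\<iota> y) \<in> \<alpha> ` J" using pinv_closed[OF xy] \<alpha>_bij by (simp add: bij_betw_def)
  from inv_into_into[OF this] f_inv_into_f[OF this]
  show "E x y \<in> J" "\<alpha> (E x y) = pinv x (\<iota> y)" by (simp_all add: cell_element_def pinv_def)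
qed

lemma E_A: "\<lbrakk>x \<in> L; y \<in> L\<rbrakk> \<Longrightarrow> E x y \<in> carrier A"
  using E_closed JA by blast

lemma E_eqI: "\<lbrakk>z \<in> J; x \<in> L; y \<in> L; \<alpha> z = pinv x (\<iota> y)\<rbrakk> \<Longrightarrow> z = E x y"
  using \<alpha>_eq E_closed \<alpha>_E by metis

lemma E_mult:
  assumes "a \<in> carrier A" "b \<in> carrier A" "x \<in> L" "y \<in> L"
  shows "a \<otimes> E x y \<otimes> b = E (a \<otimes> x) (\<iota> b \<otimes> y)"
proof (rule E_eqI)
  let ?h = "\<lambda>(x, w). (a \<otimes> x, w \<otimes> b)"
  show J: "a \<otimes> E x y \<otimes> b \<in> J" using assms E_closed J_mult by simp
  show L: "a \<otimes> x \<in> L" "\<iota> b \<otimes> y \<in> L" using assms L_mult by auto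
  have 1: "\<alpha> (a \<otimes> E x y \<otimes> b) = tensor_inv_map A \<iota> L ?h (pinv x (\<iota> y))"
    using \<alpha>_mult[OF assms(1,2) E_closed[OF assms(3,4)]] \<alpha>_E[OF assms(3,4)] by simp
  then have "tensor_inv_map A \<iota> L ?h (pinv x (\<iota> y)) \<in> carrier T" using \<alpha>_closed[OF J] by simp
  then have "tensor_inv_map A \<iota> L ?h (pinv x (\<iota> y)) = pinv (a \<otimes> x) (\<iota> y \<otimes> b)"
    using tp.tensor_map_pure(1)[of ?h x "\<iota> y"] by (simp add: tensor_inv_map_def T_eq pinv_def)
  also have "\<iota> y \<otimes> b = \<iota> (\<iota> b \<otimes> y)" using assms LA by (simp add: inv_mult)
  finally show "\<alpha> (a \<otimes> E x y \<otimes> b) = pinv (a \<otimes> x) (\<iota> (\<iota> b \<otimes> y))" using 1 by simp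
qed

lemma inv_one: "\<iota> \<one> = \<one>"
proof -
  have "\<iota> \<one> = \<iota> (\<iota> \<one>) \<otimes> \<iota> \<one>" by simp
  also have "\<dots> = \<iota> (\<one> \<otimes> \<iota> \<one>)" by (rule inv_mult[symmetric]) simp_all
  finally show ?thesis by simp
qed

lemma E_mult_l: "\<lbrakk>a \<in> carrier A; x \<in> L; y \<in> L\<rbrakk> \<Longrightarrow> a \<otimes> E x y = E (a \<otimes> x) y"
  using E_mult[of a \<one> x y] E_A LA by (simp add: inv_one)

lemma E_mult_r: "\<lbrakk>a \<in> carrier A; x \<in> L; y \<in> L\<rbrakk> \<Longrightarrow> E x y \<otimes> a = E x (\<iota> a \<otimes> y)"
  using E_mult[of \<one> a x y] E_A LA by simp

lemma E_smult_l: "\<lbrakk>x \<in> L; y \<in> L\<rbrakk> \<Longrightarrow> E (c \<odot> x) y = c \<odot> E x y"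
  using E_mult_l[of "c \<odot> \<one>" x y] E_A LA by (simp add: smult_mult_l)

lemma E_smult_r: "\<lbrakk>x \<in> L; y \<in> L\<rbrakk> \<Longrightarrow> E x (c \<odot> y) = c \<odot> E x y"
  using E_mult_r[of "c \<odot> \<one>" x y] E_A LA by (simp add: smult_mult_l smult_mult_r inv_smult inv_one)

lemma E_add_r: "\<lbrakk>x \<in> L; y \<in> L; y' \<in> L\<rbrakk> \<Longrightarrow> E x (y \<oplus> y') = E x y \<oplus> E x y'"
  using tp.pure_add_r[of x "\<iota> y" "\<iota> y'"] E_closed J_add L_add LA
  by (intro E_eqI[symmetric]) (simp_all add: \<alpha>_add \<alpha>_E inv_add T_eq pinv_def)

lemma inv_E: "\<lbrakk>x \<in> L; y \<in> L\<rbrakk> \<Longrightarrow> \<iota> (E x y) = E y x"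
proof (rule E_eqI)
  assume xy: "x \<in> L" "y \<in> L"
  let ?h = "\<lambda>(x, w). (\<iota> w, \<iota> x)"
  show J: "\<iota> (E x y) \<in> J" using J_inv E_closed[OF xy] by blast
  have 1: "\<alpha> (\<iota> (E x y)) = tensor_inv_map A \<iota> L ?h (pinv x (\<iota> y))"
    using \<alpha>_inv[OF E_closed[OF xy]] \<alpha>_E[OF xy] by simp
  then have "tensor_inv_map A \<iota> L ?h (pinv x (\<iota> y)) \<in> carrier T" using \<alpha>_closed[OF J] by simp
  then have "tensor_inv_map A \<iota> L ?h (pinv x (\<iota> y)) = pinv y (\<iota> x)"
    using tp.tensor_map_pure(1)[of ?h x "\<iota> y"] LA xy by (simp add: tensor_inv_map_def T_eq pinv_def)
  then show "\<alpha> (\<iota> (E x y)) = pinv y (\<iota> x)" using 1 by simp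
qed

lemma ideal_induct [consumes 1, case_names zero E diff]:
  assumes "a \<in> J" and zero: "P \<zero>" and E: "\<And>x y. \<lbrakk>x \<in> L; y \<in> L\<rbrakk> \<Longrightarrow> P (E x y)"
    and diff: "\<And>a b. \<lbrakk>a \<in> J; b \<in> J; P a; P b\<rbrakk> \<Longrightarrow> P (a \<ominus> b)"
  shows "P a"
proof -
  have J0: "\<zero> \<in> J" by (rule additive_subgroup.zero_closed[OF ideal.axioms(1)[OF J_ideal]])
  have \<alpha>0: "\<alpha> \<zero> = \<one>\<^bsub>T\<^esub>"
  proof -
    interpret T: group T using tp.T_group by (simp add: T_eq)
    have "\<alpha> \<zero> \<otimes>\<^bsub>T\<^esub> \<alpha> \<zero> = \<alpha> \<zero>" using \<alpha>_add[OF J0 J0] by simp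
    then show ?thesis using \<alpha>_closed[OF J0] T.l_cancel_one by blast
  qed
  have "\<exists>a\<in>J. \<alpha> a = t \<and> P a" if "t \<in> carrier tp.T" for t
    using that
  proof (induction t rule: tp.tensor_induct)
    case one
    then show ?case using J0 \<alpha>0 zero T_eq by metis
  next
    case (pure x w)
    then obtain y where "x \<in> L" "y \<in> L" "w = \<iota> y" by auto
    then show ?case using E E_closed \<alpha>_E unfolding pinv_def by blast
  next
    case (mult t t')
    interpret T: group T using tp.T_group by (simp add: T_eq)
    obtain a where a: "a \<in> J" "\<alpha> a = t" "P a" using mult(3) by blast
    obtain b where b: "b \<in> J" "\<alpha> b = t'" "P b" using mult(4) by blast
    have ab: "a \<ominus> b \<in> J"
      using J_add a b additive_subgroup.a_inv_closed[OF ideal.axioms(1)[OF J_ideal]]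
      by (simp add: minus_eq)
    have "a \<ominus> b \<oplus> b = a" using JA a b by (simp add: minus_eq a_assoc l_neg)
    then have "\<alpha> (a \<ominus> b) \<otimes>\<^bsub>T\<^esub> t' = t" using \<alpha>_add[OF ab b(1)] a b by simp
    then have "\<alpha> (a \<ominus> b) = t \<otimes>\<^bsub>T\<^esub> inv\<^bsub>T\<^esub> t'"
      using \<alpha>_closed[OF ab] \<alpha>_closed[OF b(1)] b(2) by (auto simp: T.m_assoc)
    then show ?case using ab diff[OF a(1) b(1) a(3) b(3)] unfolding T_eq by blast
  qed
  then obtain b where "b \<in> J" "\<alpha> b = \<alpha> a" "P b" using \<alpha>_closed[OF assms(1)] T_eq by metis
  then show ?thesis using \<alpha>_eq assms(1) by metis
qed

text \<open>Contraction of the second tensor factor with a linear functional.\<close>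

lemma evaluate_second_factor:
  assumes g: "\<And>x y. \<lbrakk>x \<in> L; y \<in> L\<rbrakk> \<Longrightarrow> g (x \<oplus> y) = g x + g y"
    "\<And>c x. x \<in> L \<Longrightarrow> g (c \<odot> x) = c * g x"
  shows "\<exists>G. \<forall>x\<in>L. \<forall>y\<in>L. G (E x y) = g y \<odot> x"
proof -
  have "\<exists>h\<in>hom tp.T (add_monoid A). \<forall>x\<in>carrier (A\<lparr>carrier := L\<rparr>). \<forall>w\<in>carrier (A\<lparr>carrier := \<iota> ` L\<rparr>).
      h (tp.pt x w) = g (\<iota> w) \<odot> x"
  proof (rule tp.tensor_universal)
    show "comm_group (add_monoid A)" by (rule a_comm_group)
  next
    fix s x w assume "x \<in> carrier (A\<lparr>carrier := L\<rparr>)" "w \<in> carrier (A\<lparr>carrier := \<iota> ` L\<rparr>)"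
    then obtain y where "x \<in> L" "y \<in> L" "w = \<iota> y" by auto
    then show "g (\<iota> w) \<odot> (s \<odot>\<^bsub>A\<lparr>carrier := L\<rparr>\<^esub> x) = g (\<iota> (s \<odot>\<^bsub>A\<lparr>carrier := \<iota> ` L\<rparr>\<^esub> w)) \<odot> x"
      using LA by (simp add: inv_smult g smult_smult mult.commute)
  qed (auto simp: LA g inv_add smult_add_l smult_add_r)
  then obtain h where h: "\<forall>x\<in>L. \<forall>w\<in>\<iota> ` L. h (tp.pt x w) = g (\<iota> w) \<odot> x" by auto
  have "h (\<alpha> (E x y)) = g y \<odot> x" if "x \<in> L" "y \<in> L" for x y
    using h that LA by (simp add: \<alpha>_E pinv_def)
  then show ?thesis by (intro exI[of _ "\<lambda>a. h (\<alpha> a)"]) blast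
qed

text \<open>The product of \<open>E x y\<close> and \<open>E x' y'\<close> can be computed in the first or in the second factor,
  as \<open>E (E x y \<otimes> x') y'\<close> or as \<open>E x (E y' x' \<otimes> y)\<close>. Contracting the second factor with a
  functional that takes the value \<open>1\<close> at \<open>y' = y0\<close> shows that \<open>E x y \<otimes> x'\<close> is a multiple of \<open>x\<close>,
  and the multiplier is a bilinear form in \<open>y\<close> and \<open>x'\<close>. Applying the involution to a product shows
  that the form is symmetric.\<close>

lemma form_exists_and_acts:
  assumes "y0 \<in> L" "y0 \<noteq> \<zero>"
  shows "\<exists>\<Phi>. is_cell_form A \<iota> J L \<alpha> \<Phi>"
    and "\<lbrakk>is_cell_form A \<iota> J L \<alpha> \<Phi>; x \<in> L; y \<in> L; x' \<in> L\<rbrakk> \<Longrightarrow> E x y \<otimes> x' = \<Phi> y x' \<odot> x"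
    and "\<lbrakk>is_cell_form A \<iota> J L \<alpha> \<Phi>; x \<in> L; y \<in> L\<rbrakk> \<Longrightarrow> \<Phi> x y = \<Phi> y x"
proof -
  obtain g where g: "\<And>x y. \<lbrakk>x \<in> L; y \<in> L\<rbrakk> \<Longrightarrow> g (x \<oplus> y) = g x + g y"
    "\<And>c x. x \<in> L \<Longrightarrow> g (c \<odot> x) = c * g x" "g y0 = 1"
    using ex_linear_functional[OF L_submodule assms] by metis
  obtain G where G: "\<And>x y. \<lbrakk>x \<in> L; y \<in> L\<rbrakk> \<Longrightarrow> G (E x y) = g y \<odot> x"
    using evaluate_second_factor[OF g(1,2)] by metis
  have Ex': "E x y \<otimes> x' \<in> L" if "x \<in> L" "y \<in> L" "x' \<in> L" for x y x'
    using that E_A L_mult by blast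
  \<comment> \<open>The product computed in the two factors.\<close>
  have two: "E (E x y \<otimes> x') y' = E x (E y' x' \<otimes> y)" if "x \<in> L" "y \<in> L" "x' \<in> L" "y' \<in> L" for x y x' y'
    using that E_mult_l[of "E x y" x' y'] E_mult_r[of "E x' y'" x y] E_A inv_E by simp
  have E0: "G (E u y0) = u" if "u \<in> L" for u using G[OF that assms(1)] g(3) LA that by simp
  \<comment> \<open>The multiplier of \<open>x\<close> in \<open>E x y \<otimes> x'\<close>, read off after contraction with \<open>g\<close>.\<close>
  define \<Phi>0 where "\<Phi>0 = (\<lambda>y x'. g (E y0 x' \<otimes> y))"
  have act0: "E x y \<otimes> x' = \<Phi>0 y x' \<odot> x" if "x \<in> L" "y \<in> L" "x' \<in> L" for x y x'
    using two[OF that assms(1)] E0[OF Ex'[OF that]] G[OF that(1) Ex'[OF assms(1) that(3,2)]]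
    by (simp add: \<Phi>0_def)
  have "is_cell_form A \<iota> J L \<alpha> \<Phi>0"
    unfolding is_cell_form_def
  proof (intro conjI ballI allI)
    fix x y z assume xyz: "x \<in> L" "y \<in> L" "z \<in> L"
    show "\<Phi>0 (x \<oplus> y) z = \<Phi>0 x z + \<Phi>0 y z"
      using xyz E_A assms LA Ex' g by (simp add: \<Phi>0_def r_distr)
    show "\<Phi>0 z (x \<oplus> y) = \<Phi>0 z x + \<Phi>0 z y"
      using xyz E_A assms LA Ex' g by (simp add: \<Phi>0_def l_distr E_add_r)
  next
    fix c x y assume xy: "x \<in> L" "y \<in> L"
    show "\<Phi>0 (c \<odot> x) y = c * \<Phi>0 x y"
      using xy E_A assms LA Ex' g by (simp add: \<Phi>0_def smult_mult_r)
    show "\<Phi>0 x (c \<odot> y) = c * \<Phi>0 x y"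
      using xy E_A assms LA Ex' g by (simp add: \<Phi>0_def smult_mult_l E_smult_r)
  next
    fix x y x' y' assume *: "x \<in> L" "y \<in> L" "x' \<in> L" "y' \<in> L"
    have "E x y \<otimes> E x' y' = E (E x y \<otimes> x') y'" using * E_mult_l[of "E x y" x' y'] E_A by simp
    also have "\<dots> = \<Phi>0 y x' \<odot> E x y'" using * act0 E_smult_l by simp
    finally show "E x y \<otimes> E x' y' = \<Phi>0 y x' \<odot> E x y'" .
  qed
  then show "\<exists>\<Phi>. is_cell_form A \<iota> J L \<alpha> \<Phi>" by blast
  have prod: "E x y \<otimes> E x' y' = \<Phi> y x' \<odot> E x y'"
    if "is_cell_form A \<iota> J L \<alpha> \<Phi>" "x \<in> L" "y \<in> L" "x' \<in> L" "y' \<in> L" for \<Phi> x y x' y'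
    using that by (simp add: is_cell_form_def)
  show "E x y \<otimes> x' = \<Phi> y x' \<odot> x" if "is_cell_form A \<iota> J L \<alpha> \<Phi>" "x \<in> L" "y \<in> L" "x' \<in> L"
    for \<Phi> x y x'
  proof -
    have "E (E x y \<otimes> x') y0 = E x y \<otimes> E x' y0" using that assms E_mult_l[of "E x y" x' y0] E_A by simp
    also have "\<dots> = E (\<Phi> y x' \<odot> x) y0" using that assms prod E_smult_l by simp
    finally have "G (E (E x y \<otimes> x') y0) = G (E (\<Phi> y x' \<odot> x) y0)" by simp
    then show ?thesis using E0 Ex' L_smult that by simp
  qed
  show "\<Phi> x y = \<Phi> y x" if \<Phi>: "is_cell_form A \<iota> J L \<alpha> \<Phi>" and xy: "x \<in> L" "y \<in> L" for \<Phi> x y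
  proof -
    have "\<Phi> x y \<odot> E y0 y0 = \<iota> (\<Phi> x y \<odot> E y0 y0)"
      using inv_smult inv_E E_A assms by simp
    also have "\<dots> = \<iota> (E y0 x \<otimes> E y y0)" using prod[OF \<Phi>] xy assms by simp
    also have "\<dots> = E y0 y \<otimes> E x y0" using inv_mult inv_E E_A xy assms by simp
    also have "\<dots> = \<Phi> y x \<odot> E y0 y0" using prod[OF \<Phi>] xy assms by simp
    finally have eq: "\<Phi> x y \<odot> E y0 y0 = \<Phi> y x \<odot> E y0 y0" .
    have "E y0 y0 \<noteq> \<zero>"
    proof
      assume "E y0 y0 = \<zero>"
      then have "E (0 \<odot> y0) y0 = E y0 y0" using E_smult_l[of y0 y0 0] E_A assms by simp
      then have "0 \<odot> y0 = y0" using E0[OF L_smult[OF assms(1)]] E0[OF assms(1)] by metis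
      then show False using assms LA by simp
    qed
    then show ?thesis using eq smult_eq_iff E_A assms by blast
  qed
qed

lemma is_cell_form_zero:
  assumes "L = {\<zero>}" shows "is_cell_form A \<iota> J L \<alpha> (\<lambda>_ _. 0)"
proof -
  have "E \<zero> \<zero> = \<zero>" using E_smult_l[of \<zero> \<zero> 0] L_zero E_A by simp
  then show ?thesis using assms by (simp add: is_cell_form_def)
qed

lemma is_cell_form_cell_form: "is_cell_form A \<iota> J L \<alpha> (cell_form A \<iota> J L \<alpha>)"
proof -
  have "\<exists>\<Phi>. is_cell_form A \<iota> J L \<alpha> \<Phi>"
    using form_exists_and_acts(1) is_cell_form_zero L_zero by blast
  then show ?thesis unfolding cell_form_def by (rule someI_ex)
qed

text \<open>Since \<open>E u y\<close> sends \<open>x\<close> to \<open>\<Phi> y x\<close> times \<open>u\<close>, and these elements generate the ideal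
  additively, the radical is the annihilator of the ideal in the cell module. It is defined with the
  other order of the arguments of \<open>\<Phi>\<close>, whence the symmetry is used.\<close>

theorem cell_rad_eq_annihilated: "cell_rad A \<iota> J L \<alpha> = {x \<in> L. \<forall>a\<in>J. a \<otimes> x = \<zero>}"
proof (cases "L = {\<zero>}")
  case True
  have "cell_form A \<iota> J L \<alpha> \<zero> \<zero> = cell_form A \<iota> J L \<alpha> (0 \<odot> \<zero>) \<zero>" by simp
  also have "\<dots> = 0" using is_cell_form_cell_form L_zero unfolding is_cell_form_def by (metis mult_zero_left)
  finally show ?thesis unfolding cell_rad_def True using JA by auto
next
  case False
  then obtain y0 where y0: "y0 \<in> L" "y0 \<noteq> \<zero>" using L_zero by blast
  let ?\<Phi> = "cell_form A \<iota> J L \<alpha>"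
  note act = form_exists_and_acts(2)[OF y0 is_cell_form_cell_form]
  note sym = form_exists_and_acts(3)[OF y0 is_cell_form_cell_form]
  have "(\<forall>y\<in>L. ?\<Phi> x y = 0) \<longleftrightarrow> (\<forall>a\<in>J. a \<otimes> x = \<zero>)" if x: "x \<in> L" for x
  proof
    assume L: "\<forall>y\<in>L. ?\<Phi> x y = 0"
    show "\<forall>a\<in>J. a \<otimes> x = \<zero>"
    proof
      fix a assume "a \<in> J"
      then show "a \<otimes> x = \<zero>"
      proof (induction a rule: ideal_induct)
        case zero
        then show ?case using x LA by simp
      next
        case (E u y)
        then show ?case using act[OF E x] sym[OF E(2) x] L LA by simp
      next
        case (diff a b)
        then show ?case using x LA JA by (simp add: minus_eq l_distr l_minus)
      qed
    qed
  next
    assume R: "\<forall>a\<in>J. a \<otimes> x = \<zero>"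
    show "\<forall>y\<in>L. ?\<Phi> x y = 0"
    proof
      fix y assume y: "y \<in> L"
      have "?\<Phi> y x \<odot> y0 = \<zero>" using act[OF y0(1) y x] R E_closed[OF y0(1) y] by simp
      then have "?\<Phi> y x = 0" using smult_eq_zero y0 LA by blast
      then show "?\<Phi> x y = 0" using sym x y by simp
    qed
  qed
  then show ?thesis unfolding cell_rad_def by blast
qed

text \<open>Some \<open>\<Phi> y x\<close> is invertible, so a multiple of \<open>E z y\<close> sends \<open>x\<close> to \<open>z\<close>.\<close>

theorem cell_generated_outside_rad:
  assumes x: "x \<in> L" "x \<notin> cell_rad A \<iota> J L \<alpha>" and z: "z \<in> L"
  shows "\<exists>a\<in>J. a \<otimes> x = z"
proof -
  have "x \<noteq> \<zero>"
  proof
    assume "x = \<zero>"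
    then have "x \<in> cell_rad A \<iota> J L \<alpha>" using L_zero JA by (simp add: cell_rad_eq_annihilated)
    then show False using x by simp
  qed
  note act = form_exists_and_acts(2)[OF x(1) this is_cell_form_cell_form]
    and sym = form_exists_and_acts(3)[OF x(1) this is_cell_form_cell_form]
  let ?\<Phi> = "cell_form A \<iota> J L \<alpha>"
  obtain y where y: "y \<in> L" "?\<Phi> x y \<noteq> 0" using x by (auto simp: cell_rad_def)
  let ?u = "inverse (?\<Phi> y x) \<odot> z"
  have "E ?u y \<otimes> x = ?\<Phi> y x \<odot> ?u" by (rule act) (use L_smult z y x in auto)
  also have "\<dots> = z" using y x z LA sym[OF x(1) y(1)] by (simp add: smult_smult)
  finally show ?thesis using E_closed[OF L_smult[OF z] y(1)] by blast
qed

end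

section \<open>Cell chains\<close>

lemma left_module_cong:
  assumes "left_module A M" "carrier M' = carrier M" "\<zero>\<^bsub>M'\<^esub> = \<zero>\<^bsub>M\<^esub>" "ring.add M' = ring.add M" "module.smult M' = module.smult M"
  shows "left_module A M'"
  using assms by (simp add: left_module_def left_module_axioms_def abelian_group_def
      abelian_monoid_def abelian_group_axioms_def)

context involutive_algebra
begin

lemma ideal_submodule:
  assumes "ideal I A" shows "submodule I ring_of_type_algebra A"
proof -
  interpret I: ideal I A by fact
  have "c \<odot> x \<in> I" if "x \<in> I" for c x
    using I.I_l_closed[OF that, of "c \<odot> \<one>"] I.a_subset that smult_as_mult[of x c] by auto
  then show ?thesis using I.a_subset by (intro V.submoduleI) auto
qed

lemma quotient_algebra_simps:
  "carrier (quotient_algebra A I) = carrier (quotient_module A I)"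
  "\<zero>\<^bsub>quotient_algebra A I\<^esub> = \<zero>\<^bsub>quotient_module A I\<^esub>"
  "ring.add (quotient_algebra A I) = ring.add (quotient_module A I)"
  "module.smult (quotient_algebra A I) = module.smult (quotient_module A I)"
  "monoid.mult (quotient_algebra A I) = rcoset_mult A I"
  "\<one>\<^bsub>quotient_algebra A I\<^esub> = I +> \<one>"
  by (simp_all add: quotient_algebra_def quotient_module_def FactRing_def ring.extend_def module.fields_def)

lemma inv_coset:
  assumes "ideal I A" "\<iota> ` I = I" "x \<in> carrier A" shows "\<iota> ` (I +> x) = I +> \<iota> x"
proof -
  interpret I: ideal I A by fact
  have *: "\<iota> (h \<oplus> x) = \<iota> h \<oplus> \<iota> x" if "h \<in> I" for h using that assms(3) I.a_subset inv_add by auto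
  have "\<iota> ` (I +> x) = (\<lambda>h. \<iota> h \<oplus> \<iota> x) ` I"
    using * by (auto simp: a_r_coset_def' image_iff)
  also have "\<dots> = (\<lambda>h. h \<oplus> \<iota> x) ` (\<iota> ` I)" by (simp add: image_image)
  also have "\<dots> = I +> \<iota> x" unfolding assms(2) by (auto simp: a_r_coset_def')
  finally show ?thesis .
qed

lemma quotient_involutive_algebra:
  assumes I: "ideal I A" and inv: "\<iota> ` I = I"
  shows "involutive_algebra (quotient_algebra A I) ((`) \<iota>)"
proof -
  let ?Q = "quotient_algebra A I"
  let ?q = "\<lambda>x. I +> x"
  interpret I: ideal I A by fact
  note sub = ideal_submodule[OF I]
  note sel = quotient_algebra_simps[of I]
  have c: "carrier ?Q = ?q ` carrier A" using V.quotient_carrier[of I] sel by simp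
  have rep: "\<exists>x\<in>carrier A. Z = ?q x" if "Z \<in> carrier ?Q" for Z using that c by auto
  have qadd: "?q x \<oplus>\<^bsub>?Q\<^esub> ?q y = ?q (x \<oplus> y)" if "x \<in> carrier A" "y \<in> carrier A" for x y
    using V.quotient_add[OF sub that] sel by simp
  have qsm: "k \<odot>\<^bsub>?Q\<^esub> ?q x = ?q (k \<odot> x)" if "x \<in> carrier A" for k x
    using V.quotient_smult[OF sub _ that, of k] sel by simp
  have qmult: "?q x \<otimes>\<^bsub>?Q\<^esub> ?q y = ?q (x \<otimes> y)" if "x \<in> carrier A" "y \<in> carrier A" for x y
    using I.rcoset_mult_add[OF that] sel by simp
  have lm: "left_module ring_of_type_algebra ?Q"
    by (rule left_module_cong[OF V.quotient_left_module[OF sub] sel(1-4)])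
  have R: "ring ?Q"
  proof (rule ringI)
    show "abelian_group ?Q" using lm by (simp add: left_module_def)
    show "Group.monoid ?Q"
    proof (rule monoidI)
      show "\<one>\<^bsub>?Q\<^esub> \<in> carrier ?Q" by (simp add: sel(6)) (simp add: c)
      fix x y z assume "x \<in> carrier ?Q" "y \<in> carrier ?Q" "z \<in> carrier ?Q"
      then obtain a b d where abd: "a \<in> carrier A" "x = ?q a" "b \<in> carrier A" "y = ?q b"
        "d \<in> carrier A" "z = ?q d" using rep by metis
      show "x \<otimes>\<^bsub>?Q\<^esub> y \<in> carrier ?Q" using abd by (simp add: qmult) (simp add: c)
      show "x \<otimes>\<^bsub>?Q\<^esub> y \<otimes>\<^bsub>?Q\<^esub> z = x \<otimes>\<^bsub>?Q\<^esub> (y \<otimes>\<^bsub>?Q\<^esub> z)" using abd by (simp add: qmult m_assoc)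
      show "\<one>\<^bsub>?Q\<^esub> \<otimes>\<^bsub>?Q\<^esub> x = x" "x \<otimes>\<^bsub>?Q\<^esub> \<one>\<^bsub>?Q\<^esub> = x" using abd by (simp_all add: sel(6) qmult)
    qed
    fix x y z assume "x \<in> carrier ?Q" "y \<in> carrier ?Q" "z \<in> carrier ?Q"
    then obtain a b d where abd: "a \<in> carrier A" "x = ?q a" "b \<in> carrier A" "y = ?q b"
      "d \<in> carrier A" "z = ?q d" using rep by metis
    show "(x \<oplus>\<^bsub>?Q\<^esub> y) \<otimes>\<^bsub>?Q\<^esub> z = x \<otimes>\<^bsub>?Q\<^esub> z \<oplus>\<^bsub>?Q\<^esub> y \<otimes>\<^bsub>?Q\<^esub> z"
      "z \<otimes>\<^bsub>?Q\<^esub> (x \<oplus>\<^bsub>?Q\<^esub> y) = z \<otimes>\<^bsub>?Q\<^esub> x \<oplus>\<^bsub>?Q\<^esub> z \<otimes>\<^bsub>?Q\<^esub> y"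
      using abd by (simp_all add: qmult qadd l_distr r_distr)
  qed
  have "field_algebra_axioms ?Q"
  proof
    fix x y k assume "x \<in> carrier ?Q" "y \<in> carrier ?Q"
    then obtain a b where ab: "a \<in> carrier A" "x = ?q a" "b \<in> carrier A" "y = ?q b"
      using rep by metis
    show "(k \<odot>\<^bsub>?Q\<^esub> x) \<otimes>\<^bsub>?Q\<^esub> y = k \<odot>\<^bsub>?Q\<^esub> (x \<otimes>\<^bsub>?Q\<^esub> y)" "x \<otimes>\<^bsub>?Q\<^esub> (k \<odot>\<^bsub>?Q\<^esub> y) = k \<odot>\<^bsub>?Q\<^esub> (x \<otimes>\<^bsub>?Q\<^esub> y)"
      using ab by (simp_all add: qmult qsm smult_mult_l smult_mult_r)
  qed
  moreover have "involutive_algebra_axioms ?Q ((`) \<iota>)"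
  proof
    note invc = inv_coset[OF I inv]
    fix x assume "x \<in> carrier ?Q"
    then obtain a where a: "a \<in> carrier A" "x = ?q a" using rep by metis
    show "\<iota> ` x \<in> carrier ?Q" using a by (simp add: invc) (simp add: c)
    show "\<iota> ` (k \<odot>\<^bsub>?Q\<^esub> x) = k \<odot>\<^bsub>?Q\<^esub> \<iota> ` x" for k using a by (simp add: invc qsm inv_smult)
    show "\<iota> ` \<iota> ` x = x" using a by (simp add: invc)
    fix y assume "y \<in> carrier ?Q"
    then obtain b where b: "b \<in> carrier A" "y = ?q b" using rep by metis
    show "\<iota> ` (x \<oplus>\<^bsub>?Q\<^esub> y) = \<iota> ` x \<oplus>\<^bsub>?Q\<^esub> \<iota> ` y" using a b by (simp add: invc qadd inv_add)
    show "\<iota> ` (x \<otimes>\<^bsub>?Q\<^esub> y) = \<iota> ` y \<otimes>\<^bsub>?Q\<^esub> \<iota> ` x" using a b by (simp add: invc qmult inv_mult)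
  qed
  ultimately show ?thesis
    using R lm by (simp add: involutive_algebra_def field_algebra_def)
qed

end

text \<open>The \<open>j\<close>-th cell module of a chain, as a module over the algebra itself. The facts about cell
  ideals apply to the quotient by the \<open>j\<close>-th ideal, and are restated in terms of the action of the
  algebra.\<close>

locale cell_layer = involutive_algebra A \<iota>
  for A :: "('r::field, 'a) module" (structure) and \<iota> :: "'a \<Rightarrow> 'a" +
  fixes C :: "'a cell_data" and j :: nat
  assumes chain: "cell_chain A \<iota> C" and j: "j < chain_length C"
begin

abbreviation "I \<equiv> chain_ideal C j"
abbreviation "I' \<equiv> chain_ideal C (Suc j)"
abbreviation "Q \<equiv> quotient_algebra A I"
abbreviation "P \<equiv> cell_module A C j"

lemma I_ideal: "ideal I A" and I'_ideal: "ideal I' A"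
  and I_inv: "\<iota> ` I = I"
  and layer_cell_ideal: "cell_ideal Q ((`) \<iota>) (chain_layer A C j) (chain_left C j) (chain_iso C j)"
  using chain j by (simp_all add: cell_chain_def)

sublocale Q: cell_ideal_of Q "(`) \<iota>" "chain_layer A C j" "chain_left C j" "chain_iso C j"
proof -
  show "cell_ideal_of Q ((`) \<iota>) (chain_layer A C j) (chain_left C j) (chain_iso C j)"
    by (intro cell_ideal_of.intro cell_ideal_of_axioms.intro
        quotient_involutive_algebra[OF I_ideal I_inv] layer_cell_ideal)
qed

lemma q_closed: "x \<in> carrier A \<Longrightarrow> I +> x \<in> carrier Q"
  using V.quotient_carrier[of I] by (simp add: quotient_algebra_simps)

lemma Q_rep: "Z \<in> carrier Q \<Longrightarrow> \<exists>x\<in>carrier A. Z = I +> x"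
  using V.quotient_carrier[of I] by (auto simp: quotient_algebra_simps)

lemma q_add: "\<lbrakk>x \<in> carrier A; y \<in> carrier A\<rbrakk> \<Longrightarrow> (I +> x) \<oplus>\<^bsub>Q\<^esub> (I +> y) = I +> (x \<oplus> y)"
  using V.quotient_add[OF ideal_submodule[OF I_ideal]] by (simp add: quotient_algebra_simps)

lemma q_mult: "\<lbrakk>x \<in> carrier A; y \<in> carrier A\<rbrakk> \<Longrightarrow> (I +> x) \<otimes>\<^bsub>Q\<^esub> (I +> y) = I +> (x \<otimes> y)"
  using ideal.rcoset_mult_add[OF I_ideal] by (simp add: quotient_algebra_simps)

lemma q_one: "\<one>\<^bsub>Q\<^esub> = I +> \<one>" by (simp add: quotient_algebra_simps)

lemma q_zero_iff: "x \<in> carrier A \<Longrightarrow> I +> x = \<zero>\<^bsub>Q\<^esub> \<longleftrightarrow> x \<in> I"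
  using V.quotient_coset_eq_zero_iff[OF ideal_submodule[OF I_ideal]] by (simp add: quotient_algebra_simps)

lemma P_simps [simp]: "carrier P = chain_left C j" "\<zero>\<^bsub>P\<^esub> = \<zero>\<^bsub>Q\<^esub>" "x \<oplus>\<^bsub>P\<^esub> y = x \<oplus>\<^bsub>Q\<^esub> y"
  "a \<odot>\<^bsub>P\<^esub> z = (I +> a) \<otimes>\<^bsub>Q\<^esub> z"
  by (simp_all add: cell_module_def Let_def)

sublocale P: left_module A P
proof -
  interpret L: left_module ring_of_type_algebra "Q\<lparr>carrier := chain_left C j\<rparr>"
    by (rule Q.V.submodule_is_left_module[OF Q.L_submodule])
  have "abelian_group P"
  proof (rule abelian_groupI)
    show "\<exists>y\<in>carrier P. y \<oplus>\<^bsub>P\<^esub> x = \<zero>\<^bsub>P\<^esub>" if "x \<in> carrier P" for x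
      using L.l_neg[of x] L.a_inv_closed[of x] that by auto
    show "x \<oplus>\<^bsub>P\<^esub> y = y \<oplus>\<^bsub>P\<^esub> x" if "x \<in> carrier P" "y \<in> carrier P" for x y
      using L.a_comm[of x y] that by simp
    show "x \<oplus>\<^bsub>P\<^esub> y \<oplus>\<^bsub>P\<^esub> z = x \<oplus>\<^bsub>P\<^esub> (y \<oplus>\<^bsub>P\<^esub> z)"
      if "x \<in> carrier P" "y \<in> carrier P" "z \<in> carrier P" for x y z
      using L.a_assoc[of x y z] that by simp
  qed (use Q.L_add Q.L_zero Q.LA in simp_all)
  moreover have "left_module_axioms A P"
  proof
    fix a x assume a: "a \<in> carrier A" and x: "x \<in> carrier P"
    then have xQ: "x \<in> carrier Q" using Q.LA by simp
    show "a \<odot>\<^bsub>P\<^esub> x \<in> carrier P" using a x Q.L_mult q_closed by simp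
    show "(a \<oplus> b) \<odot>\<^bsub>P\<^esub> x = a \<odot>\<^bsub>P\<^esub> x \<oplus>\<^bsub>P\<^esub> b \<odot>\<^bsub>P\<^esub> x" if "b \<in> carrier A" for b
      using a that xQ q_closed by (simp add: q_add[symmetric] Q.l_distr)
    show "(a \<otimes> b) \<odot>\<^bsub>P\<^esub> x = a \<odot>\<^bsub>P\<^esub> (b \<odot>\<^bsub>P\<^esub> x)" if "b \<in> carrier A" for b
      using a that xQ q_closed by (simp add: q_mult[symmetric] Q.m_assoc)
    fix y assume "y \<in> carrier P"
    then show "a \<odot>\<^bsub>P\<^esub> (x \<oplus>\<^bsub>P\<^esub> y) = a \<odot>\<^bsub>P\<^esub> x \<oplus>\<^bsub>P\<^esub> a \<odot>\<^bsub>P\<^esub> y"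
      using a xQ Q.LA q_closed by (simp add: Q.r_distr)
  next
    fix x assume "x \<in> carrier P"
    then show "\<one> \<odot>\<^bsub>P\<^esub> x = x" using Q.LA by (simp add: q_one[symmetric])
  qed
  ultimately show "left_module A P" by (intro left_module.intro ring_axioms)
qed

lemma I'_closed: "a \<in> I' \<Longrightarrow> a \<in> carrier A"
  using additive_subgroup.a_subset[OF ideal.axioms(1)[OF I'_ideal]] by auto

lemma cell_radical_eq_annihilated:
  "cell_radical A \<iota> C j = {x \<in> carrier P. \<forall>a\<in>I'. a \<odot>\<^bsub>P\<^esub> x = \<zero>\<^bsub>P\<^esub>}"
proof -
  have "(\<forall>a\<in>chain_layer A C j. a \<otimes>\<^bsub>Q\<^esub> x = \<zero>\<^bsub>Q\<^esub>) \<longleftrightarrow> (\<forall>a\<in>I'. (I +> a) \<otimes>\<^bsub>Q\<^esub> x = \<zero>\<^bsub>Q\<^esub>)" for x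
    unfolding chain_layer_def by simp
  then show ?thesis unfolding cell_radical_def Q.cell_rad_eq_annihilated by simp
qed

lemma generated_outside_radical:
  assumes "x \<in> carrier P" "x \<notin> cell_radical A \<iota> C j" "y \<in> carrier P"
  shows "\<exists>a\<in>I'. a \<odot>\<^bsub>P\<^esub> x = y"
proof -
  have "\<exists>a\<in>chain_layer A C j. a \<otimes>\<^bsub>Q\<^esub> x = y"
    by (rule Q.cell_generated_outside_rad) (use assms in \<open>simp_all add: cell_radical_def\<close>)
  then show ?thesis unfolding chain_layer_def by simp
qed

lemma cell_module_annihilated:
  assumes "a \<in> I" "x \<in> carrier P" shows "a \<odot>\<^bsub>P\<^esub> x = \<zero>\<^bsub>P\<^esub>"
proof -
  have "a \<in> carrier A" using assms additive_subgroup.a_subset[OF ideal.axioms(1)[OF I_ideal]] by auto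
  then have "I +> a = \<zero>\<^bsub>Q\<^esub>" using assms q_zero_iff by simp
  then show ?thesis using assms Q.LA by simp
qed

lemma radical_submodule: "submodule (cell_radical A \<iota> C j) A P"
proof (rule P.submoduleI)
  have in_rad: "x \<in> cell_radical A \<iota> C j \<longleftrightarrow> x \<in> carrier P \<and> (\<forall>a\<in>I'. a \<odot>\<^bsub>P\<^esub> x = \<zero>\<^bsub>P\<^esub>)" for x
    by (simp only: cell_radical_eq_annihilated mem_Collect_eq)
  show "cell_radical A \<iota> C j \<subseteq> carrier P" using in_rad by blast
  show "\<zero>\<^bsub>P\<^esub> \<in> cell_radical A \<iota> C j"
    unfolding in_rad using P.zero_closed P.smult_r_null I'_closed by blast
  show "x \<oplus>\<^bsub>P\<^esub> y \<in> cell_radical A \<iota> C j"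
    if xy: "x \<in> cell_radical A \<iota> C j" "y \<in> cell_radical A \<iota> C j" for x y
  proof -
    have xy': "x \<in> carrier P" "y \<in> carrier P" using xy in_rad by blast+
    have "a \<odot>\<^bsub>P\<^esub> (x \<oplus>\<^bsub>P\<^esub> y) = \<zero>\<^bsub>P\<^esub>" if a: "a \<in> I'" for a
    proof -
      have "a \<odot>\<^bsub>P\<^esub> (x \<oplus>\<^bsub>P\<^esub> y) = a \<odot>\<^bsub>P\<^esub> x \<oplus>\<^bsub>P\<^esub> a \<odot>\<^bsub>P\<^esub> y"
        by (rule P.smult_r_distr[OF I'_closed[OF a] xy'])
      also have "\<dots> = \<zero>\<^bsub>P\<^esub> \<oplus>\<^bsub>P\<^esub> \<zero>\<^bsub>P\<^esub>" using xy a in_rad by metis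
      finally show ?thesis using P.l_zero[OF P.zero_closed] by metis
    qed
    then show ?thesis unfolding in_rad using P.add.m_closed[OF xy'] by blast
  qed
  show "b \<odot>\<^bsub>P\<^esub> x \<in> cell_radical A \<iota> C j" if b: "b \<in> carrier A" and x: "x \<in> cell_radical A \<iota> C j" for b x
  proof -
    have x': "x \<in> carrier P" using x in_rad by blast
    have "a \<odot>\<^bsub>P\<^esub> (b \<odot>\<^bsub>P\<^esub> x) = \<zero>\<^bsub>P\<^esub>" if a: "a \<in> I'" for a
    proof -
      have "a \<otimes> b \<in> I'" using ideal.I_r_closed[OF I'_ideal a b] .
      then have "(a \<otimes> b) \<odot>\<^bsub>P\<^esub> x = \<zero>\<^bsub>P\<^esub>" using x in_rad by blast
      then show ?thesis using P.smult_assoc[OF I'_closed[OF a] b x'] by metis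
    qed
    then show ?thesis unfolding in_rad using P.smult_closed[OF b x'] by blast
  qed
qed

text \<open>A submodule of a cell module consists of cosets, hence is determined by its union, a subspace
  of the algebra.\<close>

lemma Union_submodule:
  assumes "submodule U A P" shows "submodule (\<Union>U) ring_of_type_algebra A"
proof -
  note Ud = P.submoduleD[OF assms]
  have UQ: "Z \<in> carrier Q" if "Z \<in> U" for Z using that Ud(1) Q.LA by auto
  have mem: "x \<in> \<Union>U \<longleftrightarrow> x \<in> carrier A \<and> I +> x \<in> U" for x
  proof
    assume "x \<in> \<Union>U"
    then obtain Z where Z: "Z \<in> U" "x \<in> Z" by blast
    then obtain y where y: "y \<in> carrier A" "Z = I +> y" using Q_rep[OF UQ] by blast
    then show "x \<in> carrier A \<and> I +> x \<in> U"
      using Z V.mem_coset_iff[OF ideal_submodule[OF I_ideal], of y x] by simp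
  next
    assume x: "x \<in> carrier A \<and> I +> x \<in> U"
    then have "x \<in> I +> x" using V.mem_coset_iff[OF ideal_submodule[OF I_ideal], of x x] by simp
    then show "x \<in> \<Union>U" using x by blast
  qed
  show ?thesis
  proof (rule V.submoduleI)
    show "\<Union>U \<subseteq> carrier A" using mem by blast
    have "I +> \<zero> = \<zero>\<^bsub>P\<^esub>" using q_zero_iff[of \<zero>] ideal_submodule[OF I_ideal] V.submoduleD(2) by simp
    then show "\<zero> \<in> \<Union>U" unfolding mem using Ud(2) by simp
    show "x \<oplus> y \<in> \<Union>U" if "x \<in> \<Union>U" "y \<in> \<Union>U" for x y
      using that q_add[of x y] Ud(3)[of "I +> x" "I +> y"] unfolding mem by simp
    show "c \<odot> x \<in> \<Union>U" if "x \<in> \<Union>U" for c x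
    proof -
      have x: "x \<in> carrier A" "I +> x \<in> U" using that mem by blast+
      have "(c \<odot> \<one>) \<odot>\<^bsub>P\<^esub> (I +> x) = I +> (c \<odot> x)"
        using x q_mult[of "c \<odot> \<one>" x] by (simp add: smult_mult_l)
      then have "I +> (c \<odot> x) \<in> U" using Ud(6)[of "c \<odot> \<one>" "I +> x"] x by simp
      then show ?thesis unfolding mem using x by simp
    qed
  qed
qed

lemma Union_strict_mono:
  assumes "submodule U A P" "submodule Y A P" "U \<subset> Y" shows "\<Union>U \<subset> \<Union>Y"
proof -
  have cos: "\<exists>x\<in>carrier A. Z = I +> x" if "Z \<in> Y" for Z
    using that P.submoduleD(1)[OF assms(2)] Q.LA Q_rep by (metis P_simps(1) subsetD)
  obtain Z where Z: "Z \<in> Y" "Z \<notin> U" using assms(3) by blast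
  obtain x where x: "x \<in> carrier A" "Z = I +> x" using cos[OF Z(1)] by blast
  note mem = V.mem_coset_iff[OF ideal_submodule[OF I_ideal]]
  have "x \<in> \<Union>Y" using Z(1) x mem[of x x] by blast
  moreover have "x \<notin> \<Union>U"
  proof
    assume "x \<in> \<Union>U"
    then obtain Z' where Z': "Z' \<in> U" "x \<in> Z'" by blast
    then obtain y where "y \<in> carrier A" "Z' = I +> y" using cos assms(3) by blast
    then have "Z' = Z" using mem[of y x] Z' x by simp
    then show False using Z Z' by simp
  qed
  ultimately show ?thesis using assms(3) by blast
qed

end

section \<open>Algebras with a distinguished basis\<close>

text \<open>The pivot positions of a subspace in echelon form, with respect to the order of coordinates given
  by \<open>\<kappa>\<close>. Their number is the dimension.\<close>

definition pivots :: "('x \<Rightarrow> nat) \<Rightarrow> 'x set \<Rightarrow> ('x \<Rightarrow> 'r::field) set \<Rightarrow> 'x set" where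
  "pivots \<kappa> Z W = {z \<in> Z. \<exists>f\<in>W. f z \<noteq> 0 \<and> (\<forall>y\<in>Z. \<kappa> y < \<kappa> z \<longrightarrow> f y = 0)}"

text \<open>If the pivots of \<open>W\<close> and \<open>W'\<close> agree, then elimination of leading coefficients by means of
  elements of \<open>W\<close> reduces each element of \<open>W'\<close> to zero.\<close>

lemma pivots_strict_mono:
  fixes W W' :: "('x \<Rightarrow> 'r::field) set"
  assumes fin: "finite Z" and inj: "inj_on \<kappa> Z"
    and supp: "\<And>f z. f \<in> W' \<Longrightarrow> z \<notin> Z \<Longrightarrow> f z = 0"
    and W': "\<And>f g c. f \<in> W' \<Longrightarrow> g \<in> W' \<Longrightarrow> (\<lambda>z. f z + c * g z) \<in> W'"
    and W: "\<And>f g c. f \<in> W \<Longrightarrow> g \<in> W \<Longrightarrow> (\<lambda>z. f z + c * g z) \<in> W" "(\<lambda>_. 0) \<in> W"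
    and "W \<subset> W'"
  shows "pivots \<kappa> Z W \<subset> pivots \<kappa> Z W'"
proof -
  have sub: "pivots \<kappa> Z W \<subseteq> pivots \<kappa> Z W'" using \<open>W \<subset> W'\<close> unfolding pivots_def by blast
  have "pivots \<kappa> Z W \<noteq> pivots \<kappa> Z W'"
  proof
    assume eq: "pivots \<kappa> Z W = pivots \<kappa> Z W'"
    have key: "f \<in> W" if "f \<in> W'" for f
      using that
    proof (induction "card {z\<in>Z. \<exists>y\<in>Z. f y \<noteq> 0 \<and> \<kappa> y \<le> \<kappa> z}" arbitrary: f rule: less_induct)
      case less
      show ?case
      proof (cases "\<exists>y\<in>Z. f y \<noteq> 0")
        case False
        then have "f = (\<lambda>_. 0)" using supp[OF less.prems] by blast
        then show ?thesis using W(2) by simp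
      next
        case True
        then obtain z where z: "z \<in> Z" "f z \<noteq> 0" and min: "\<And>y. y \<in> Z \<Longrightarrow> f y \<noteq> 0 \<Longrightarrow> \<kappa> z \<le> \<kappa> y"
          using exists_least_iff[of "\<lambda>m. \<exists>y\<in>Z. f y \<noteq> 0 \<and> \<kappa> y = m"] by (metis not_less)
        then have "z \<in> pivots \<kappa> Z W'" using less.prems by (force simp: pivots_def)
        then obtain g where g: "g \<in> W" "g z \<noteq> 0" "\<And>y. y \<in> Z \<Longrightarrow> \<kappa> y < \<kappa> z \<Longrightarrow> g y = 0"
          unfolding eq[symmetric] by (auto simp: pivots_def)
        \<comment> \<open>Eliminate the leading coefficient of \<open>f\<close>, which sits at \<open>z\<close>.\<close>
        define f' where "f' = (\<lambda>y. f y + (- (f z / g z)) * g y)"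
        have f': "f' \<in> W'" unfolding f'_def using W' less.prems g(1) \<open>W \<subset> W'\<close> by blast
        have zero: "f' y = 0" if "y \<in> Z" "\<kappa> y \<le> \<kappa> z" for y
        proof (cases "y = z")
          case True
          then show ?thesis using g(2) by (simp add: f'_def)
        next
          case False
          then have "\<kappa> y < \<kappa> z" using that inj z by (metis inj_onD le_neq_implies_less)
          then show ?thesis using g(3) min that by (force simp: f'_def)
        qed
        have "{x\<in>Z. \<exists>y\<in>Z. f' y \<noteq> 0 \<and> \<kappa> y \<le> \<kappa> x} \<subset> {x\<in>Z. \<exists>y\<in>Z. f y \<noteq> 0 \<and> \<kappa> y \<le> \<kappa> x}"
        proof
          show "{x\<in>Z. \<exists>y\<in>Z. f' y \<noteq> 0 \<and> \<kappa> y \<le> \<kappa> x} \<subseteq> {x\<in>Z. \<exists>y\<in>Z. f y \<noteq> 0 \<and> \<kappa> y \<le> \<kappa> x}"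
            using zero z by (auto simp: not_le) (metis le_less_trans less_imp_le not_le)
          have "z \<in> {x\<in>Z. \<exists>y\<in>Z. f y \<noteq> 0 \<and> \<kappa> y \<le> \<kappa> x}" using z by blast
          moreover have "z \<notin> {x\<in>Z. \<exists>y\<in>Z. f' y \<noteq> 0 \<and> \<kappa> y \<le> \<kappa> x}" using zero by blast
          ultimately show "{x\<in>Z. \<exists>y\<in>Z. f' y \<noteq> 0 \<and> \<kappa> y \<le> \<kappa> x} \<noteq> {x\<in>Z. \<exists>y\<in>Z. f y \<noteq> 0 \<and> \<kappa> y \<le> \<kappa> x}"
            by blast
        qed
        then have "card {x\<in>Z. \<exists>y\<in>Z. f' y \<noteq> 0 \<and> \<kappa> y \<le> \<kappa> x} < card {x\<in>Z. \<exists>y\<in>Z. f y \<noteq> 0 \<and> \<kappa> y \<le> \<kappa> x}"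
          using fin by (intro psubset_card_mono) auto
        then have "f' \<in> W" using less.hyps f' by blast
        then have "(\<lambda>y. f' y + (f z / g z) * g y) \<in> W" using W(1) g(1) by blast
        moreover have "(\<lambda>y. f' y + (f z / g z) * g y) = f" by (auto simp: f'_def)
        ultimately show ?thesis by simp
      qed
    qed
    then show False using \<open>W \<subset> W'\<close> by blast
  qed
  then show ?thesis using sub by blast
qed

lemma based_algebra_simps [simp]:
  "f \<in> carrier (based_algebra Z c p u) \<longleftrightarrow> (\<forall>a. a \<notin> Z \<longrightarrow> f a = 0)"
  "\<zero>\<^bsub>based_algebra Z c p u\<^esub> = (\<lambda>_. 0)"
  "f \<oplus>\<^bsub>based_algebra Z c p u\<^esub> g = (\<lambda>z. f z + g z)"
  "r \<odot>\<^bsub>based_algebra Z c p u\<^esub> f = (\<lambda>z. r * f z)"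
  "\<one>\<^bsub>based_algebra Z c p u\<^esub> = (\<lambda>z. if z = u then 1 else 0)"
  by (simp_all add: based_algebra_def)

lemma based_algebra_mult:
  "f \<otimes>\<^bsub>based_algebra Z c p u\<^esub> g = (\<lambda>z. \<Sum>a\<in>Z. \<Sum>b\<in>Z. if p a b = z then c a b * f a * g b else 0)"
  by (simp add: based_algebra_def)

lemma based_field_algebra:
  fixes c :: "'x \<Rightarrow> 'x \<Rightarrow> 'r::field"
  assumes R: "ring (based_algebra Z c p u)"
  shows "field_algebra (based_algebra Z c p u)"
proof -
  let ?A = "based_algebra Z c p u"
  interpret ring ?A by (rule R)
  have K: "ring (ring_of_type_algebra :: 'r ring)" by (rule ring_from_type_algebra)
  have "left_module_axioms ring_of_type_algebra ?A"
    by unfold_locales (auto simp: algebra_simps)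
  then have lm: "left_module ring_of_type_algebra ?A"
    by (intro left_module.intro K abelian_group_axioms)
  have "field_algebra_axioms ?A"
    by unfold_locales (auto simp: based_algebra_mult sum_distrib_left fun_eq_iff algebra_simps if_distrib cong: if_cong
        intro!: sum.cong)
  then show ?thesis using lm by (intro field_algebra.intro R)
qed

lemma based_involutive_algebra:
  fixes c :: "'x \<Rightarrow> 'x \<Rightarrow> 'r::field"
  assumes R: "ring (based_algebra Z c p u)"
    and s: "\<And>z. z \<in> Z \<Longrightarrow> s z \<in> Z" "\<And>z. z \<in> Z \<Longrightarrow> s (s z) = z"
    and p: "\<And>a b. a \<in> Z \<Longrightarrow> b \<in> Z \<Longrightarrow> p a b \<in> Z" "\<And>a b. a \<in> Z \<Longrightarrow> b \<in> Z \<Longrightarrow> p (s b) (s a) = s (p a b)"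
      "\<And>a b. a \<in> Z \<Longrightarrow> b \<in> Z \<Longrightarrow> c (s b) (s a) = c a b"
    and \<iota>: "\<And>f z. f \<in> carrier (based_algebra Z c p u) \<Longrightarrow> \<iota> f z = (if z \<in> Z then f (s z) else 0)"
  shows "involutive_algebra (based_algebra Z c p u) \<iota>"
proof -
  let ?A = "based_algebra Z c p u"
  interpret field_algebra ?A by (rule based_field_algebra[OF R])
  have inj: "inj_on s Z" using s(2) by (metis inj_onI)
  have im: "s ` Z = Z" using s by (auto simp: image_iff) metis
  have "involutive_algebra_axioms ?A \<iota>"
  proof
    fix x y k assume x: "x \<in> carrier ?A"
    show ix: "\<iota> x \<in> carrier ?A" using \<iota>[OF x] by simp
    have "k \<odot>\<^bsub>?A\<^esub> x \<in> carrier ?A" using x by simp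
    then show "\<iota> (k \<odot>\<^bsub>?A\<^esub> x) = k \<odot>\<^bsub>?A\<^esub> \<iota> x" using \<iota>[of x] \<iota>[of "k \<odot>\<^bsub>?A\<^esub> x"] x by auto
    show "\<iota> (\<iota> x) = x" using \<iota>[OF x] \<iota>[OF ix] s x by auto
    assume y: "y \<in> carrier ?A"
    have "x \<oplus>\<^bsub>?A\<^esub> y \<in> carrier ?A" using x y by simp
    then show "\<iota> (x \<oplus>\<^bsub>?A\<^esub> y) = \<iota> x \<oplus>\<^bsub>?A\<^esub> \<iota> y"
      using \<iota>[OF x] \<iota>[OF y] \<iota>[of "x \<oplus>\<^bsub>?A\<^esub> y"] by auto
    have iy: "\<iota> y \<in> carrier ?A" using \<iota>[OF y] by simp
    have xy: "x \<otimes>\<^bsub>?A\<^esub> y \<in> carrier ?A" using x y by (rule m_closed)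
    show "\<iota> (x \<otimes>\<^bsub>?A\<^esub> y) = \<iota> y \<otimes>\<^bsub>?A\<^esub> \<iota> x"
    proof
      fix z
      show "\<iota> (x \<otimes>\<^bsub>?A\<^esub> y) z = (\<iota> y \<otimes>\<^bsub>?A\<^esub> \<iota> x) z"
      proof (cases "z \<in> Z")
        case False
        then show ?thesis using \<iota>[OF xy] m_closed[OF iy ix] by simp
      next
        case True
        have "(\<iota> y \<otimes>\<^bsub>?A\<^esub> \<iota> x) z =
          (\<Sum>a\<in>Z. \<Sum>b\<in>Z. if p a b = z then c a b * y (s a) * x (s b) else 0)"
          unfolding based_algebra_mult using \<iota>[OF x] \<iota>[OF y] by (intro sum.cong) auto
        also have "\<dots> = (\<Sum>b\<in>Z. \<Sum>a\<in>Z. if p a b = z then c a b * y (s a) * x (s b) else 0)"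
          by (rule sum.swap)
        also have "\<dots> = (\<Sum>b\<in>s ` Z. \<Sum>a\<in>s ` Z. if p a b = z then c a b * y (s a) * x (s b) else 0)"
          unfolding im ..
        also have "\<dots> = (\<Sum>b\<in>Z. \<Sum>a\<in>Z. if p (s a) (s b) = z then c (s a) (s b) * y (s (s a)) * x (s (s b)) else 0)"
          by (simp add: sum.reindex[OF inj])
        also have "\<dots> = (\<Sum>b\<in>Z. \<Sum>a\<in>Z. if p b a = s z then c b a * x b * y a else 0)"
        proof (intro sum.cong HOL.refl)
          fix b a assume ab: "b \<in> Z" "a \<in> Z"
          have "p (s a) (s b) = z \<longleftrightarrow> p b a = s z"
            using p(1,2)[OF ab] s True by metis
          then show "(if p (s a) (s b) = z then c (s a) (s b) * y (s (s a)) * x (s (s b)) else 0) =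
            (if p b a = s z then c b a * x b * y a else 0)"
            using p(3)[OF ab] s ab by simp
        qed
        also have "\<dots> = \<iota> (x \<otimes>\<^bsub>?A\<^esub> y) z" using \<iota>[OF xy] True by (simp add: based_algebra_mult)
        finally show ?thesis by simp
      qed
    qed
  qed
  then show ?thesis by (intro involutive_algebra.intro field_algebra_axioms)
qed

text \<open>The product of two basis elements is a non-zero multiple of a single one, which belongs to the
  basis because the ring is closed under multiplication.\<close>

lemma ring_based_product_closed:
  assumes R: "ring (based_algebra Z (c :: 'x \<Rightarrow> 'x \<Rightarrow> 'r::field) p u)" and fin: "finite Z"
    and ab: "a \<in> Z" "b \<in> Z" and c: "c a b \<noteq> 0"
  shows "p a b \<in> Z"
proof (rule ccontr)
  assume no: "p a b \<notin> Z"
  let ?A = "based_algebra Z c p u"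
  interpret ring ?A by (rule R)
  let ?f = "\<lambda>z. if z = a then 1 else 0 :: 'r" and ?g = "\<lambda>z. if z = b then 1 else 0 :: 'r"
  have "?f \<otimes>\<^bsub>?A\<^esub> ?g \<in> carrier ?A" using ab by (intro m_closed) auto
  then have "(?f \<otimes>\<^bsub>?A\<^esub> ?g) (p a b) = 0" using no by simp
  moreover have "(?f \<otimes>\<^bsub>?A\<^esub> ?g) (p a b) = c a b"
  proof -
    have "(?f \<otimes>\<^bsub>?A\<^esub> ?g) (p a b) =
      (\<Sum>x\<in>Z. if x = a then (\<Sum>y\<in>Z. if y = b then c a b else 0) else 0)"
      unfolding based_algebra_mult by (intro sum.cong HOL.refl) (auto intro!: sum.cong sum.neutral)
    also have "\<dots> = c a b" using fin ab by (simp add: sum.delta)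
    finally show ?thesis .
  qed
  ultimately show False using c by simp
qed

text \<open>Submodules of a cell module unite to subspaces of a finite-dimensional space, whose dimension
  serves as rank.\<close>

lemma cell_module_rank:
  fixes c :: "'x \<Rightarrow> 'x \<Rightarrow> 'r::field"
  assumes layer: "cell_layer (based_algebra Z c p u) \<iota> C j" and fin: "finite Z"
  shows "\<exists>\<rho> :: ('x \<Rightarrow> 'r) set set \<Rightarrow> nat. \<forall>U Y.
    submodule U (based_algebra Z c p u) (cell_module (based_algebra Z c p u) C j) \<and>
    submodule Y (based_algebra Z c p u) (cell_module (based_algebra Z c p u) C j) \<and> U \<subset> Y \<longrightarrow> \<rho> U < \<rho> Y"
proof -
  let ?A = "based_algebra Z c p u"
  interpret cell_layer ?A \<iota> C j by (rule layer)
  obtain \<kappa> :: "'x \<Rightarrow> nat" where \<kappa>: "inj_on \<kappa> Z" using finite_imp_inj_to_nat_seg[OF fin] by blast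
  let ?\<rho> = "\<lambda>U. card (pivots \<kappa> Z (\<Union>U))"
  have lin: "(\<lambda>z. f z + k * g z) \<in> \<Union>U" if "submodule U ?A P" "f \<in> \<Union>U" "g \<in> \<Union>U" for U f g k
  proof -
    note Ud = V.submoduleD[OF Union_submodule[OF that(1)]]
    have "f \<oplus>\<^bsub>?A\<^esub> (k \<odot>\<^bsub>?A\<^esub> g) \<in> \<Union>U" by (intro Ud(3) Ud(6) that(2,3)) simp
    then show ?thesis by simp
  qed
  have "?\<rho> U < ?\<rho> Y" if UY: "submodule U ?A P" "submodule Y ?A P" "U \<subset> Y" for U Y
  proof -
    have "pivots \<kappa> Z (\<Union>U) \<subset> pivots \<kappa> Z (\<Union>Y)"
    proof (rule pivots_strict_mono[OF fin \<kappa> _ lin[OF UY(2)] lin[OF UY(1)] _ Union_strict_mono[OF UY]])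
      show "f z = 0" if "f \<in> \<Union>Y" "z \<notin> Z" for f z
        using that V.submoduleD(1)[OF Union_submodule[OF UY(2)]] by auto
      show "(\<lambda>_. 0) \<in> \<Union>U" using V.submoduleD(2)[OF Union_submodule[OF UY(1)]] by simp
    qed
    moreover have "finite (pivots \<kappa> Z (\<Union>Y))" using fin by (simp add: pivots_def)
    ultimately show ?thesis by (rule psubset_card_mono[rotated])
  qed
  then show ?thesis by (intro exI[of _ ?\<rho>]) blast
qed

section \<open>Diagrams of a layer\<close>

lemma rank_less:
  assumes "finite S" "i \<in> S" "j \<in> S" "i < j" shows "rank S i < rank S j"
proof -
  have "{x \<in> S. x \<le> i} \<subset> {x \<in> S. x \<le> j}"
  proof
    show "{x \<in> S. x \<le> i} \<subseteq> {x \<in> S. x \<le> j}" using assms(4) by auto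
    have "j \<in> {x \<in> S. x \<le> j}" "j \<notin> {x \<in> S. x \<le> i}" using assms by auto
    then show "{x \<in> S. x \<le> i} \<noteq> {x \<in> S. x \<le> j}" by blast
  qed
  then show ?thesis unfolding rank_def using assms(1) by (intro psubset_card_mono) auto
qed

lemma rank_bij: "finite S \<Longrightarrow> bij_betw (rank S) S {1..card S}"
proof -
  assume fin: "finite S"
  have inj: "inj_on (rank S) S"
  proof (rule inj_onI)
    fix i j assume "i \<in> S" "j \<in> S" "rank S i = rank S j"
    then show "i = j" using rank_less[OF fin, of i j] rank_less[OF fin, of j i] by (cases i j rule: linorder_cases) auto
  qed
  have "rank S ` S \<subseteq> {1..card S}"
  proof
    fix r assume "r \<in> rank S ` S"
    then obtain j where j: "j \<in> S" "r = rank S j" by blast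
    have "j \<in> {i\<in>S. i \<le> j}" using j by simp
    then have "0 < card {i\<in>S. i \<le> j}" using fin by (auto simp: card_gt_0_iff)
    moreover have "card {i\<in>S. i \<le> j} \<le> card S" using fin by (intro card_mono) auto
    ultimately show "r \<in> {1..card S}" using j by (simp add: rank_def)
  qed
  then have "rank S ` S = {1..card S}"
    using card_image[OF inj] by (intro card_subset_eq) auto
  then show ?thesis using inj by (simp add: bij_betw_def)
qed

text \<open>The reflection reverses the order of a symmetric set, so the \<open>r\<close>-th element from the left becomes
  the \<open>r\<close>-th from the right. This is why the permutations attached to symmetric diagrams commute with the
  reflection, and conversely.\<close>

lemma rank_reflect:
  assumes S: "S \<subseteq> {1..N}" and sym: "\<And>j. j \<in> S \<Longrightarrow> N + 1 - j \<in> S" and j: "j \<in> S"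
  shows "rank S (N + 1 - j) = card S + 1 - rank S j"
proof -
  have fin: "finite S" using S finite_subset by blast
  have le: "1 \<le> i \<and> i \<le> N" if "i \<in> S" for i using that S by auto
  have "bij_betw (\<lambda>i. N + 1 - i) {i\<in>S. i \<le> N + 1 - j} {i\<in>S. j \<le> i}"
  proof (rule bij_betw_byWitness[where f'="\<lambda>i. N + 1 - i"])
    have "N + 1 - (N + 1 - i) = i" if "i \<in> S" for i using le[OF that] by linarith
    then show "\<forall>i\<in>{i\<in>S. i \<le> N + 1 - j}. N + 1 - (N + 1 - i) = i"
      "\<forall>i\<in>{i\<in>S. j \<le> i}. N + 1 - (N + 1 - i) = i" by blast+
    have "j \<le> N + 1 - i" if "i \<in> S" "i \<le> N + 1 - j" for i using le[OF that(1)] le[OF j] that(2) by linarith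
    then show "(\<lambda>i. N + 1 - i) ` {i\<in>S. i \<le> N + 1 - j} \<subseteq> {i\<in>S. j \<le> i}" using sym by blast
    have "N + 1 - i \<le> N + 1 - j" if "j \<le> i" for i using that by linarith
    then show "(\<lambda>i. N + 1 - i) ` {i\<in>S. j \<le> i} \<subseteq> {i\<in>S. i \<le> N + 1 - j}" using sym by blast
  qed
  then have "rank S (N + 1 - j) = card {i\<in>S. j \<le> i}"
    unfolding rank_def by (rule bij_betw_same_card)
  moreover have "card S = card {i\<in>S. i < j} + card {i\<in>S. j \<le> i}"
  proof -
    have "{i\<in>S. i < j} \<union> {i\<in>S. j \<le> i} = S" by auto
    moreover have "card ({i\<in>S. i < j} \<union> {i\<in>S. j \<le> i}) = card {i\<in>S. i < j} + card {i\<in>S. j \<le> i}"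
    proof (rule card_Un_disjoint)
      show "finite {i\<in>S. i < j}" by (rule finite_subset[OF _ fin]) blast
      show "finite {i\<in>S. j \<le> i}" by (rule finite_subset[OF _ fin]) blast
      show "{i\<in>S. i < j} \<inter> {i\<in>S. j \<le> i} = {}" by (auto simp: not_le)
    qed
    ultimately show ?thesis by (simp only:)
  qed
  moreover have "rank S j = Suc (card {i\<in>S. i < j})"
  proof -
    have "{i\<in>S. i \<le> j} = insert j {i\<in>S. i < j}" using j by auto
    then show ?thesis using fin by (simp add: rank_def)
  qed
  ultimately show ?thesis by simp
qed

definition free_nodes :: "nat set set \<Rightarrow> nat set" where
  "free_nodes e = {j. {j} \<in> e}"

definition arcs :: "nat set set \<Rightarrow> nat set set" where
  "arcs e = {b\<in>e. card b = 2}"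

lemma dangle_facts:
  assumes e: "e \<in> dangles n k"
  shows "free_nodes e \<subseteq> {1..2*n}" "finite (arcs e)" "card (arcs e) = k" "k \<le> n"
    "card (free_nodes e) = 2 * (n - k)"
    "\<And>j. j \<in> free_nodes e \<Longrightarrow> 2*n + 1 - j \<in> free_nodes e"
    "\<And>b. b \<in> arcs e \<Longrightarrow> (\<lambda>j. 2*n + 1 - j) ` b \<in> arcs e"
    "\<And>b. b \<in> arcs e \<Longrightarrow> b \<subseteq> {1..2*n}"
    "\<Union>(arcs e) \<union> free_nodes e = {1..2*n}"
    "\<And>b. b \<in> arcs e \<Longrightarrow> b \<inter> free_nodes e = {}"
    "\<And>b b'. b \<in> arcs e \<Longrightarrow> b' \<in> arcs e \<Longrightarrow> b \<inter> b' \<noteq> {} \<Longrightarrow> b = b'"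
    "e = arcs e \<union> (\<lambda>j. {j}) ` free_nodes e"
proof -
  have part: "partition_on {1..2*n} e" and cards: "\<And>b. b \<in> e \<Longrightarrow> card b = 1 \<or> card b = 2"
    and k: "card {b\<in>e. card b = 2} = k" and sym: "(`) (\<lambda>j. 2*n + 1 - j) ` e = e"
    using e by (auto simp: dangles_def)
  have U: "\<Union>e = {1..2*n}" and dis: "disjoint e" using part by (auto simp: partition_on_def)
  have fine: "finite e" using finite_elements[OF _ part] by simp
  have symb: "(\<lambda>j. 2*n + 1 - j) ` b \<in> e" if "b \<in> e" for b using sym that by blast
  have finb: "finite b" if "b \<in> e" for b using that U by (metis Union_upper finite_atLeastAtMost finite_subset)
  show sub: "free_nodes e \<subseteq> {1..2*n}" using U by (auto simp: free_nodes_def)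
  show fa: "finite (arcs e)" using fine by (simp add: arcs_def)
  show ca: "card (arcs e) = k" using k by (simp add: arcs_def)
  show sb: "b \<subseteq> {1..2*n}" if "b \<in> arcs e" for b using that U by (auto simp: arcs_def)
  show split: "e = arcs e \<union> (\<lambda>j. {j}) ` free_nodes e"
  proof
    show "e \<subseteq> arcs e \<union> (\<lambda>j. {j}) ` free_nodes e"
    proof
      fix b assume b: "b \<in> e"
      from cards[OF b] show "b \<in> arcs e \<union> (\<lambda>j. {j}) ` free_nodes e"
      proof
        assume "card b = 1"
        then obtain j where "b = {j}" by (rule card_1_singletonE)
        then show ?thesis using b by (simp add: free_nodes_def)
      qed (use b in \<open>simp add: arcs_def\<close>)
    qed
  qed (auto simp: arcs_def free_nodes_def)
  show "\<Union>(arcs e) \<union> free_nodes e = {1..2*n}"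
  proof -
    have "\<Union>(arcs e \<union> (\<lambda>j. {j}) ` free_nodes e) = {1..2*n}" using U by (simp only: split[symmetric])
    then show ?thesis by simp
  qed
  show "2*n + 1 - j \<in> free_nodes e" if "j \<in> free_nodes e" for j
    using symb[of "{j}"] that by (simp add: free_nodes_def)
  show "(\<lambda>j. 2*n + 1 - j) ` b \<in> arcs e" if "b \<in> arcs e" for b
  proof -
    have "inj_on (\<lambda>j. 2*n + 1 - j) {1..2*n}"
    proof (rule inj_onI)
      fix i j assume "i \<in> {1..2*n}" "j \<in> {1..2*n}" "2*n + 1 - i = 2*n + 1 - j"
      then show "i = j" unfolding atLeastAtMost_iff by linarith
    qed
    then have "inj_on (\<lambda>j. 2*n + 1 - j) b" by (rule inj_on_subset) (rule sb[OF that])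
    then have "card ((\<lambda>j. 2*n + 1 - j) ` b) = card b" by (rule card_image)
    moreover have "b \<in> e" "card b = 2" using that by (auto simp only: arcs_def mem_Collect_eq)
    ultimately show ?thesis using symb[of b] unfolding arcs_def by (simp only: mem_Collect_eq simp_thms)
  qed
  show ds: "b \<inter> free_nodes e = {}" if "b \<in> arcs e" for b
  proof (rule ccontr)
    assume "b \<inter> free_nodes e \<noteq> {}"
    then obtain j where j: "j \<in> b" "{j} \<in> e" by (auto simp: free_nodes_def)
    have "b \<in> e" using that by (simp add: arcs_def)
    then have "b = {j} \<or> b \<inter> {j} = {}" using disjointD[OF dis _ j(2)] by metis
    then have "b = {j}" using j(1) by blast
    then show False using that by (simp add: arcs_def)
  qed
  show "b = b'" if "b \<in> arcs e" "b' \<in> arcs e" "b \<inter> b' \<noteq> {}" for b b'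
    using that dis by (auto simp: disjoint_def arcs_def)
  have "card (\<Union>e) = (\<Sum>b\<in>e. card b)"
    using dis finb by (intro card_Union_disjoint) (auto simp: disjoint_def pairwise_def disjnt_def)
  also have "\<dots> = (\<Sum>b\<in>arcs e. card b) + (\<Sum>b\<in>(\<lambda>j. {j}) ` free_nodes e. card b)"
  proof -
    have "sum card e = sum card (arcs e \<union> (\<lambda>j. {j}) ` free_nodes e)"
      by (rule arg_cong[OF split, where f="sum card"])
    also have "\<dots> = sum card (arcs e) + sum card ((\<lambda>j. {j}) ` free_nodes e)"
      using fa sub finite_subset by (intro sum.union_disjoint) (auto simp: arcs_def)
    finally show ?thesis .
  qed
  also have "(\<Sum>b\<in>arcs e. card b) = 2 * k" using ca by (simp add: arcs_def)
  also have "(\<Sum>b\<in>(\<lambda>j. {j}) ` free_nodes e. card b) = card (free_nodes e)"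
    by (subst sum.reindex) (auto simp: inj_on_def)
  finally have "2 * n = 2 * k + card (free_nodes e)" using U by simp
  then show "k \<le> n" "card (free_nodes e) = 2 * (n - k)" by auto
qed

text \<open>The relation between the free nodes of the two rows in the diagram with dangles \<open>e\<close>, \<open>f\<close> and
  through permutation \<open>\<pi>\<close>. The diagram, \<open>layer_diagram e f \<pi>\<close>, is the preimage of
  \<open>e \<otimes> f \<otimes> \<pi>\<close> under \<open>\<psi>\<^sub>k\<close>.\<close>

definition strand :: "nat set set \<Rightarrow> nat set set \<Rightarrow> (nat \<Rightarrow> nat) \<Rightarrow> nat \<Rightarrow> nat \<Rightarrow> bool" where
  "strand e f \<pi> i j \<longleftrightarrow> i \<in> free_nodes e \<and> j \<in> free_nodes f \<and>
     \<pi> (rank (free_nodes e) i) = rank (free_nodes f) j"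

definition layer_diagram :: "nat set set \<Rightarrow> nat set set \<Rightarrow> (nat \<Rightarrow> nat) \<Rightarrow> node set set" where
  "layer_diagram e f \<pi> = (`) Top ` arcs e \<union> (`) Bot ` arcs f \<union> {{Top i, Bot j} | i j. strand e f \<pi> i j}"

lemma inj_image: "inj g \<Longrightarrow> inj ((`) g)"
  by (rule injI) (simp add: inj_image_eq_iff)

lemma arc_nonempty: "a \<in> arcs d \<Longrightarrow> a \<noteq> {}"
  by (auto simp: arcs_def)

locale dangle_pair =
  fixes n k :: nat and e f :: "nat set set" and \<pi> :: "nat \<Rightarrow> nat"
  assumes e: "e \<in> dangles n k" and f: "f \<in> dangles n k" and \<pi>: "\<pi> \<in> hyperoctahedral (n - k)"
begin

lemma \<pi>_permutes: "\<pi> permutes {1..2*(n-k)}"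
  and \<pi>_reflect: "j \<in> {1..2*(n-k)} \<Longrightarrow> \<pi> (2*(n-k) + 1 - j) = 2*(n-k) + 1 - \<pi> j"
  using \<pi> by (auto simp: hyperoctahedral_def)

lemma finite_free: "finite (free_nodes e)" "finite (free_nodes f)"
  using dangle_facts(1)[OF e] dangle_facts(1)[OF f] finite_subset by blast+

lemma rank_bij_e: "bij_betw (rank (free_nodes e)) (free_nodes e) {1..2*(n-k)}"
  and rank_bij_f: "bij_betw (rank (free_nodes f)) (free_nodes f) {1..2*(n-k)}"
  using rank_bij[OF finite_free(1)] rank_bij[OF finite_free(2)] dangle_facts(5)[OF e] dangle_facts(5)[OF f]
  by simp_all

lemma strand_free: "strand e f \<pi> i j \<Longrightarrow> i \<in> free_nodes e" "strand e f \<pi> i j \<Longrightarrow> j \<in> free_nodes f"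
  by (auto simp: strand_def)

lemma strand_range: "strand e f \<pi> i j \<Longrightarrow> i \<in> {1..2*n} \<and> j \<in> {1..2*n}"
  using strand_free dangle_facts(1)[OF e] dangle_facts(1)[OF f] by blast

lemma strand_unique_r: "\<lbrakk>strand e f \<pi> i j; strand e f \<pi> i j'\<rbrakk> \<Longrightarrow> j = j'"
  using rank_bij_f by (auto simp: strand_def bij_betw_def inj_on_def)

lemma strand_unique_l: "\<lbrakk>strand e f \<pi> i j; strand e f \<pi> i' j\<rbrakk> \<Longrightarrow> i = i'"
proof -
  assume *: "strand e f \<pi> i j" "strand e f \<pi> i' j"
  then have "\<pi> (rank (free_nodes e) i) = \<pi> (rank (free_nodes e) i')" by (simp add: strand_def)
  then have "rank (free_nodes e) i = rank (free_nodes e) i'"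
    using permutes_inj[OF \<pi>_permutes] by (simp add: inj_eq)
  then show ?thesis using rank_bij_e * by (auto simp: strand_def bij_betw_def inj_on_def)
qed

lemma strand_ex_r: "i \<in> free_nodes e \<Longrightarrow> \<exists>j. strand e f \<pi> i j"
proof -
  assume i: "i \<in> free_nodes e"
  then have "rank (free_nodes e) i \<in> {1..2*(n-k)}" using rank_bij_e by (auto simp: bij_betw_def)
  then have "\<pi> (rank (free_nodes e) i) \<in> {1..2*(n-k)}" using permutes_in_image[OF \<pi>_permutes] by blast
  then have "\<pi> (rank (free_nodes e) i) \<in> rank (free_nodes f) ` free_nodes f"
    using rank_bij_f by (simp add: bij_betw_def)
  then show ?thesis using i by (auto simp: strand_def)
qed

lemma strand_ex_l: "j \<in> free_nodes f \<Longrightarrow> \<exists>i. strand e f \<pi> i j"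
proof -
  assume j: "j \<in> free_nodes f"
  then have "rank (free_nodes f) j \<in> {1..2*(n-k)}" using rank_bij_f by (auto simp: bij_betw_def)
  then have "rank (free_nodes f) j \<in> \<pi> ` {1..2*(n-k)}" using permutes_image[OF \<pi>_permutes] by blast
  then obtain r where r: "r \<in> {1..2*(n-k)}" "rank (free_nodes f) j = \<pi> r" by blast
  then have "r \<in> rank (free_nodes e) ` free_nodes e" using rank_bij_e by (simp add: bij_betw_def)
  then show ?thesis using j r by (auto simp: strand_def)
qed

lemma strand_reflect:
  assumes "strand e f \<pi> i j" shows "strand e f \<pi> (2*n + 1 - i) (2*n + 1 - j)"
proof -
  have ij: "i \<in> free_nodes e" "j \<in> free_nodes f" "\<pi> (rank (free_nodes e) i) = rank (free_nodes f) j"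
    using assms by (auto simp: strand_def)
  have "rank (free_nodes e) i \<in> {1..2*(n-k)}" using rank_bij_e ij(1) by (auto simp: bij_betw_def)
  then have "\<pi> (rank (free_nodes e) (2*n + 1 - i)) = rank (free_nodes f) (2*n + 1 - j)"
    using rank_reflect[OF dangle_facts(1)[OF e] dangle_facts(6)[OF e] ij(1)]
      rank_reflect[OF dangle_facts(1)[OF f] dangle_facts(6)[OF f] ij(2)]
      \<pi>_reflect ij(3) dangle_facts(5)[OF e] dangle_facts(5)[OF f] by simp
  then show ?thesis
    using ij dangle_facts(6)[OF e] dangle_facts(6)[OF f] by (simp add: strand_def)
qed

abbreviation "D \<equiv> layer_diagram e f \<pi>"

lemma D_cases:
  assumes "b \<in> D"
  obtains (top) a where "a \<in> arcs e" "b = Top ` a" | (bot) a where "a \<in> arcs f" "b = Bot ` a"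
    | (strand) i j where "strand e f \<pi> i j" "b = {Top i, Bot j}"
  using assms unfolding layer_diagram_def by blast

lemma arc_elements: "a \<in> arcs e \<Longrightarrow> x \<in> a \<Longrightarrow> x \<in> {1..2*n} \<and> x \<notin> free_nodes e"
  "a \<in> arcs f \<Longrightarrow> x \<in> a \<Longrightarrow> x \<in> {1..2*n} \<and> x \<notin> free_nodes f"
proof -
  show "x \<in> {1..2*n} \<and> x \<notin> free_nodes e" if "a \<in> arcs e" "x \<in> a"
    using subsetD[OF dangle_facts(8)[OF e that(1)] that(2)] dangle_facts(10)[OF e that(1)] that(2) by blast
  show "x \<in> {1..2*n} \<and> x \<notin> free_nodes f" if "a \<in> arcs f" "x \<in> a"
    using subsetD[OF dangle_facts(8)[OF f that(1)] that(2)] dangle_facts(10)[OF f that(1)] that(2) by blast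
qed

lemma D_intros: "a \<in> arcs e \<Longrightarrow> Top ` a \<in> D" "a \<in> arcs f \<Longrightarrow> Bot ` a \<in> D"
  "strand e f \<pi> i j \<Longrightarrow> {Top i, Bot j} \<in> D"
  by (auto simp: layer_diagram_def)

text \<open>A node of the top row lies on an arc of \<open>e\<close>, or is free and then lies on one strand, since the
  ranks and the permutation are bijections; likewise for the bottom row.\<close>

lemma D_partition: "partition_on (Top ` {1..2*n} \<union> Bot ` {1..2*n}) D"
  unfolding partition_on_def
proof (intro conjI)
  show "\<Union>D = Top ` {1..2*n} \<union> Bot ` {1..2*n}"
  proof
    show "\<Union>D \<subseteq> Top ` {1..2*n} \<union> Bot ` {1..2*n}"
    proof
      fix x assume "x \<in> \<Union>D"
      then obtain b where b: "b \<in> D" "x \<in> b" by blast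
      from b(1) show "x \<in> Top ` {1..2*n} \<union> Bot ` {1..2*n}"
      proof (cases rule: D_cases)
        case (top a)
        then obtain i where "i \<in> a" "x = Top i" using b(2) by auto
        then show ?thesis using arc_elements(1)[OF top(1)] by simp
      next
        case (bot a)
        then obtain i where "i \<in> a" "x = Bot i" using b(2) by auto
        then show ?thesis using arc_elements(2)[OF bot(1)] by simp
      next
        case (strand i j)
        then show ?thesis using b(2) strand_range[OF strand(1)] by auto
      qed
    qed
    show "Top ` {1..2*n} \<union> Bot ` {1..2*n} \<subseteq> \<Union>D"
    proof
      fix x assume "x \<in> Top ` {1..2*n} \<union> Bot ` {1..2*n}"
      then consider i where "x = Top i" "i \<in> {1..2*n}" | i where "x = Bot i" "i \<in> {1..2*n}" by blast
      then show "x \<in> \<Union>D"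
      proof cases
        case 1
        then have "i \<in> \<Union>(arcs e) \<union> free_nodes e" using dangle_facts(9)[OF e] by simp
        then show ?thesis
        proof
          assume "i \<in> \<Union>(arcs e)"
          then obtain a where "a \<in> arcs e" "i \<in> a" by blast
          then show ?thesis using D_intros(1)[of a] 1(1) by blast
        next
          assume "i \<in> free_nodes e"
          then obtain j where "strand e f \<pi> i j" using strand_ex_r by blast
          then show ?thesis using D_intros(3)[of i j] 1(1) by blast
        qed
      next
        case 2
        then have "i \<in> \<Union>(arcs f) \<union> free_nodes f" using dangle_facts(9)[OF f] by simp
        then show ?thesis
        proof
          assume "i \<in> \<Union>(arcs f)"
          then obtain a where "a \<in> arcs f" "i \<in> a" by blast
          then show ?thesis using D_intros(2)[of a] 2(1) by blast
        next
          assume "i \<in> free_nodes f"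
          then obtain j where "strand e f \<pi> j i" using strand_ex_l by blast
          then show ?thesis using D_intros(3)[of j i] 2(1) by blast
        qed
      qed
    qed
  qed
  show "disjoint D"
    unfolding disjoint_def
  proof (intro ballI impI)
    fix b b' assume bD: "b \<in> D" "b' \<in> D" and ne: "b \<noteq> b'"
    show "b \<inter> b' = {}"
    proof (rule ccontr)
      assume "b \<inter> b' \<noteq> {}"
      then obtain x where x: "x \<in> b" "x \<in> b'" by blast
      from bD(1) show False
      proof (cases rule: D_cases)
        case b: (top a)
        from bD(2) show ?thesis
        proof (cases rule: D_cases)
          case (top a')
          then have "a \<inter> a' \<noteq> {}" using x b(2) by auto
          then show ?thesis
            using b(2) ne dangle_facts(11)[OF e b(1) top(1)] top(2) by simp
        next
          case (bot a')
          then show ?thesis using x b(2) by auto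
        next
          case (strand i j)
          then have "i \<in> a" using x b(2) by auto
          then show ?thesis using arc_elements(1)[OF b(1)] strand_free(1)[OF strand(1)] by blast
        qed
      next
        case b: (bot a)
        from bD(2) show ?thesis
        proof (cases rule: D_cases)
          case (bot a')
          then have "a \<inter> a' \<noteq> {}" using x b(2) by auto
          then show ?thesis
            using b(2) ne dangle_facts(11)[OF f b(1) bot(1)] bot(2) by simp
        next
          case (top a')
          then show ?thesis using x b(2) by auto
        next
          case (strand i j)
          then have "j \<in> a" using x b(2) by auto
          then show ?thesis using arc_elements(2)[OF b(1)] strand_free(2)[OF strand(1)] by blast
        qed
      next
        case b: (strand i j)
        from bD(2) show ?thesis
        proof (cases rule: D_cases)
          case (strand i' j')
          have "i = i' \<or> j = j'" using x strand(2) b(2) by auto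
          then have "i = i' \<and> j = j'"
            using strand(1) b(1) strand_unique_l[of i j i'] strand_unique_r[of i j j'] by auto
          then show ?thesis using ne strand(2) b(2) by simp
        next
          case (top a')
          then have "i \<in> a'" using x b(2) by auto
          then show ?thesis using arc_elements(1)[OF top(1)] strand_free(1)[OF b(1)] by blast
        next
          case (bot a')
          then have "j \<in> a'" using x b(2) by auto
          then show ?thesis using arc_elements(2)[OF bot(1)] strand_free(2)[OF b(1)] by blast
        qed
      qed
    qed
  qed
  show "{} \<notin> D"
  proof
    assume "{} \<in> D"
    then show False by (cases rule: D_cases) (auto simp: arcs_def)
  qed
qed

lemma D_card: "b \<in> D \<Longrightarrow> card b = 2"
  by (erule D_cases) (auto simp: arcs_def card_image inj_on_def)

lemma D_reflect: "b \<in> D \<Longrightarrow> reflect n ` b \<in> D"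
proof (erule D_cases)
  fix a assume a: "a \<in> arcs e" "b = Top ` a"
  then have "reflect n ` b = Top ` (\<lambda>j. 2*n + 1 - j) ` a" by (simp add: image_image)
  then show ?thesis using dangle_facts(7)[OF e a(1)] by (auto simp: layer_diagram_def)
next
  fix a assume a: "a \<in> arcs f" "b = Bot ` a"
  then have "reflect n ` b = Bot ` (\<lambda>j. 2*n + 1 - j) ` a" by (simp add: image_image)
  then show ?thesis using dangle_facts(7)[OF f a(1)] by (auto simp: layer_diagram_def)
next
  fix i j assume a: "strand e f \<pi> i j" "b = {Top i, Bot j}"
  then have "reflect n ` b = {Top (2*n + 1 - i), Bot (2*n + 1 - j)}" by simp
  then show ?thesis using strand_reflect[OF a(1)] unfolding layer_diagram_def by blast
qed

lemma D_sym: "D \<in> sym_diagrams n"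
proof -
  have "(`) (reflect n) ` D = D"
  proof
    show "(`) (reflect n) ` D \<subseteq> D" using D_reflect by blast
    show "D \<subseteq> (`) (reflect n) ` D"
    proof
      fix b assume b: "b \<in> D"
      then have "b \<subseteq> Top ` {1..2*n} \<union> Bot ` {1..2*n}" using D_partition by (auto simp: partition_on_def)
      then have "reflect n (reflect n x) = x" if "x \<in> b" for x using that by auto
      then have "reflect n ` reflect n ` b = b" by (force simp: image_image)
      then show "b \<in> (`) (reflect n) ` D" using D_reflect[OF b] by (metis image_eqI)
    qed
  qed
  then show ?thesis using D_partition D_card by (simp add: sym_diagrams_def brauer_diagrams_def)
qed

lemma D_top_arcs: "{b\<in>D. b \<subseteq> range Top} = (`) Top ` arcs e"
proof
  show "{b\<in>D. b \<subseteq> range Top} \<subseteq> (`) Top ` arcs e"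
  proof
    fix b assume "b \<in> {b\<in>D. b \<subseteq> range Top}"
    then have "b \<in> D" "b \<subseteq> range Top" by auto
    then show "b \<in> (`) Top ` arcs e"
      by (cases rule: D_cases) (auto simp: arcs_def dest!: card_2_iff[THEN iffD1])
  qed
qed (auto simp: layer_diagram_def)

lemma D_bot_arcs: "{b\<in>D. b \<subseteq> range Bot} = (`) Bot ` arcs f"
proof
  show "{b\<in>D. b \<subseteq> range Bot} \<subseteq> (`) Bot ` arcs f"
  proof
    fix b assume "b \<in> {b\<in>D. b \<subseteq> range Bot}"
    then have "b \<in> D" "b \<subseteq> range Bot" by auto
    then show "b \<in> (`) Bot ` arcs f"
      by (cases rule: D_cases) (auto simp: arcs_def dest!: card_2_iff[THEN iffD1])
  qed
qed (auto simp: layer_diagram_def)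

lemma inj_image_Top: "inj ((`) Top)" and inj_image_Bot: "inj ((`) Bot)"
  by (rule inj_image; simp add: inj_def)+

lemma D_layer: "D \<in> layer_diagrams n k"
proof -
  have "card ((`) Top ` arcs e) = k"
    using card_image[OF inj_on_subset[OF inj_image_Top subset_UNIV]] dangle_facts(3)[OF e] by simp
  moreover have "card ((`) Bot ` arcs f) = k"
    using card_image[OF inj_on_subset[OF inj_image_Bot subset_UNIV]] dangle_facts(3)[OF f] by simp
  ultimately show ?thesis
    using D_sym by (simp add: layer_diagrams_def top_arcs_def bot_arcs_def D_top_arcs D_bot_arcs)
qed

lemma vimage_block:
  "Top -` (Top ` a) = a" "Top -` (Bot ` a) = {}" "Top -` {Top i, Bot j} = {i}"
  "Bot -` (Bot ` a) = a" "Bot -` (Top ` a) = {}" "Bot -` {Top i, Bot j} = {j}"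
  by auto

lemma D_top_dangle: "top_dangle D = e"
proof
  show "top_dangle D \<subseteq> e"
  proof
    fix x assume "x \<in> top_dangle D"
    then obtain b where b: "b \<in> D" "x = Top -` b" "x \<noteq> {}" unfolding top_dangle_def by blast
    from b(1) show "x \<in> e"
    proof (cases rule: D_cases)
      case (top a)
      then show ?thesis using b(2) vimage_block(1)[of a] by (simp add: arcs_def)
    next
      case (bot a)
      then show ?thesis using b(2,3) vimage_block(2)[of a] by simp
    next
      case (strand i j)
      then show ?thesis using b(2) vimage_block(3)[of i j] by (simp add: strand_def free_nodes_def)
    qed
  qed
  show "e \<subseteq> top_dangle D"
  proof
    fix x assume "x \<in> e"
    then have "x \<in> arcs e \<or> x \<in> (\<lambda>j. {j}) ` free_nodes e" using dangle_facts(12)[OF e] by blast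
    then obtain b where "b \<in> D" "x = Top -` b"
    proof
      assume "x \<in> arcs e"
      then show thesis using that[OF D_intros(1)] vimage_block(1)[of x] by simp
    next
      assume "x \<in> (\<lambda>j. {j}) ` free_nodes e"
      then obtain i where i: "i \<in> free_nodes e" "x = {i}" by blast
      then obtain j where "strand e f \<pi> i j" using strand_ex_r by blast
      then show thesis using that[OF D_intros(3)] vimage_block(3)[of i j] i by simp
    qed
    moreover have "x \<noteq> {}" using \<open>x \<in> arcs e \<or> _\<close> arc_nonempty by auto
    ultimately show "x \<in> top_dangle D" unfolding top_dangle_def by blast
  qed
qed

lemma D_bot_dangle: "bot_dangle D = f"
proof
  show "bot_dangle D \<subseteq> f"
  proof
    fix x assume "x \<in> bot_dangle D"
    then obtain b where b: "b \<in> D" "x = Bot -` b" "x \<noteq> {}" unfolding bot_dangle_def by blast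
    from b(1) show "x \<in> f"
    proof (cases rule: D_cases)
      case (top a)
      then show ?thesis using b(2,3) vimage_block(5)[of a] by simp
    next
      case (bot a)
      then show ?thesis using b(2) vimage_block(4)[of a] by (simp add: arcs_def)
    next
      case (strand i j)
      then show ?thesis using b(2) vimage_block(6)[of i j] by (simp add: strand_def free_nodes_def)
    qed
  qed
  show "f \<subseteq> bot_dangle D"
  proof
    fix x assume "x \<in> f"
    then have "x \<in> arcs f \<or> x \<in> (\<lambda>j. {j}) ` free_nodes f" using dangle_facts(12)[OF f] by blast
    then obtain b where "b \<in> D" "x = Bot -` b"
    proof
      assume "x \<in> arcs f"
      then show thesis using that[OF D_intros(2)] vimage_block(4)[of x] by simp
    next
      assume "x \<in> (\<lambda>j. {j}) ` free_nodes f"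
      then obtain i where i: "i \<in> free_nodes f" "x = {i}" by blast
      then obtain j where "strand e f \<pi> j i" using strand_ex_l by blast
      then show thesis using that[OF D_intros(3)] vimage_block(6)[of j i] i by simp
    qed
    moreover have "x \<noteq> {}" using \<open>x \<in> arcs f \<or> _\<close> arc_nonempty by auto
    ultimately show "x \<in> bot_dangle D" unfolding bot_dangle_def by blast
  qed
qed

lemma D_strand_iff: "{Top i, Bot j} \<in> D \<longleftrightarrow> strand e f \<pi> i j"
proof
  assume "{Top i, Bot j} \<in> D"
  then show "strand e f \<pi> i j" by (cases rule: D_cases) (auto simp: doubleton_eq_iff)
qed (rule D_intros(3))

lemma D_free: "free_top D = free_nodes e" "free_bot D = free_nodes f"
  unfolding free_top_def free_bot_def D_strand_iff using strand_ex_r strand_ex_l strand_free by blast+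

text \<open>The ranks of free nodes exhaust the range on which a permutation can act, so the strands determine
  it.\<close>

lemma D_through_perm: "through_perm D = \<pi>"
  unfolding through_perm_def D_free D_strand_iff dangle_facts(5)[OF e]
proof (rule the_equality)
  show "\<pi> permutes {1..2*(n-k)} \<and>
    (\<forall>j i. strand e f \<pi> j i \<longrightarrow> \<pi> (rank (free_nodes e) j) = rank (free_nodes f) i)"
    using \<pi>_permutes by (simp add: strand_def)
next
  fix \<sigma> assume \<sigma>: "\<sigma> permutes {1..2*(n-k)} \<and>
    (\<forall>j i. strand e f \<pi> j i \<longrightarrow> \<sigma> (rank (free_nodes e) j) = rank (free_nodes f) i)"
  show "\<sigma> = \<pi>"
  proof
    fix r
    show "\<sigma> r = \<pi> r"
    proof (cases "r \<in> {1..2*(n-k)}")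
      case True
      then have "r \<in> rank (free_nodes e) ` free_nodes e" using rank_bij_e by (simp add: bij_betw_def)
      then obtain i where i: "i \<in> free_nodes e" "r = rank (free_nodes e) i" by blast
      then obtain j where "strand e f \<pi> i j" using strand_ex_r by blast
      then show ?thesis using \<sigma> i by (simp add: strand_def)
    next
      case False
      then show ?thesis using \<sigma> \<pi>_permutes by (simp add: permutes_def)
    qed
  qed
qed

end

section \<open>Products of diagrams\<close>

text \<open>A partition into connected sets, each of which absorbs the blocks that it meets, is the partition into
  components.\<close>

lemma quotient_connected:
  assumes U: "\<Union>\<P> = \<Union>S" and dis: "disjoint \<P>" and ne: "{} \<notin> \<P>"
    and sub: "\<And>b. b \<in> S \<Longrightarrow> \<exists>P\<in>\<P>. b \<subseteq> P"
    and con: "\<And>P x y. \<lbrakk>P \<in> \<P>; x \<in> P; y \<in> P\<rbrakk> \<Longrightarrow> (x, y) \<in> {(x, y). \<exists>b\<in>S. x \<in> b \<and> y \<in> b}\<^sup>+"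
  shows "\<Union>S // {(x, y). \<exists>b\<in>S. x \<in> b \<and> y \<in> b}\<^sup>+ = \<P>"
proof -
  let ?R = "{(x, y). \<exists>b\<in>S. x \<in> b \<and> y \<in> b}"
  have class_eq: "?R\<^sup>+ `` {x} = P" if P: "P \<in> \<P>" "x \<in> P" for P x
  proof
    show "P \<subseteq> ?R\<^sup>+ `` {x}" using con[OF P] by blast
    show "?R\<^sup>+ `` {x} \<subseteq> P"
    proof
      fix y assume "y \<in> ?R\<^sup>+ `` {x}"
      then have "(x, y) \<in> ?R\<^sup>+" by blast
      have step: "z \<in> P" if yz: "(y, z) \<in> ?R" "y \<in> P" for y z
      proof -
        obtain b where b: "b \<in> S" "y \<in> b" "z \<in> b" using yz(1) by blast
        obtain P' where P': "P' \<in> \<P>" "b \<subseteq> P'" using sub[OF b(1)] by blast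
        then have "P' \<inter> P \<noteq> {}" using b yz(2) by blast
        then have "P' = P" using dis P'(1) P(1) by (auto simp: disjoint_def)
        then show ?thesis using P' b by blast
      qed
      from \<open>(x, y) \<in> ?R\<^sup>+\<close> show "y \<in> P"
        by (induction rule: trancl_induct) (use step P(2) in blast)+
    qed
  qed
  show ?thesis
  proof
    show "\<Union>S // ?R\<^sup>+ \<subseteq> \<P>"
    proof
      fix C assume "C \<in> \<Union>S // ?R\<^sup>+"
      then obtain x where x: "x \<in> \<Union>S" "C = ?R\<^sup>+ `` {x}" by (elim quotientE)
      then obtain P where "P \<in> \<P>" "x \<in> P" using U by blast
      then show "C \<in> \<P>" using class_eq x by simp
    qed
    show "\<P> \<subseteq> \<Union>S // ?R\<^sup>+"
    proof
      fix P assume P: "P \<in> \<P>"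
      then obtain x where x: "x \<in> P" using ne by (metis ex_in_conv)
      then have "x \<in> \<Union>S" using U P by blast
      then have "?R\<^sup>+ `` {x} \<in> \<Union>S // ?R\<^sup>+" by (rule quotientI)
      then show "P \<in> \<Union>S // ?R\<^sup>+" unfolding class_eq[OF P x] .
    qed
  qed
qed

text \<open>When the dangles in the middle agree, each arc of the middle dangle is doubled and closes to a loop,
  the arcs of the outer rows stay as they are, and the strands are joined at their common free node. These
  are the components of the stacked diagrams.\<close>

lemma layer_diagram_mult:
  assumes e: "e \<in> dangles n k" and g: "g \<in> dangles n k" and f: "f \<in> dangles n k"
    and \<pi>: "\<pi> \<in> hyperoctahedral (n - k)" and \<rho>: "\<rho> \<in> hyperoctahedral (n - k)"
  shows "diagram_mult (layer_diagram e g \<pi>) (layer_diagram g f \<rho>) = layer_diagram e f (\<rho> \<circ> \<pi>)"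
    and "closed_loops (layer_diagram e g \<pi>) (layer_diagram g f \<rho>) = k"
proof -
  interpret U: dangle_pair n k e g \<pi> using e g \<pi> by unfold_locales
  interpret L: dangle_pair n k g f \<rho> using g f \<rho> by unfold_locales
  let ?S = "stacked (layer_diagram e g \<pi>) (layer_diagram g f \<rho>)"
  \<comment> \<open>The components other than arcs: pairs of strands joined in the middle row.\<close>
  define W where "W = {{Top i, Mid c, Bot j} | i c j. strand e g \<pi> i c \<and> strand g f \<rho> c j}"
  define \<P> where "\<P> = (`) Top ` arcs e \<union> (`) Mid ` arcs g \<union> (`) Bot ` arcs f \<union> W"
  let ?R = "{(x, y). \<exists>b\<in>?S. x \<in> b \<and> y \<in> b}"
  have up: "(`) to_upper ` layer_diagram e g \<pi> =
      (`) Top ` arcs e \<union> (`) Mid ` arcs g \<union> {{Top i, Mid c} | i c. strand e g \<pi> i c}"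
  proof -
    have "(`) to_upper ` {{Top i, Bot j} | i j. strand e g \<pi> i j} = {{Top i, Mid c} | i c. strand e g \<pi> i c}"
    proof
      show "(`) to_upper ` {{Top i, Bot j} | i j. strand e g \<pi> i j} \<subseteq> {{Top i, Mid c} | i c. strand e g \<pi> i c}"
      proof
        fix b assume "b \<in> (`) to_upper ` {{Top i, Bot j} | i j. strand e g \<pi> i j}"
        then obtain i j where "strand e g \<pi> i j" "b = to_upper ` {Top i, Bot j}" by blast
        then have "strand e g \<pi> i j" "b = {Top i, Mid j}" by simp_all
        then show "b \<in> {{Top i, Mid c} | i c. strand e g \<pi> i c}" by blast
      qed
      show "{{Top i, Mid c} | i c. strand e g \<pi> i c} \<subseteq> (`) to_upper ` {{Top i, Bot j} | i j. strand e g \<pi> i j}"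
      proof
        fix b assume "b \<in> {{Top i, Mid c} | i c. strand e g \<pi> i c}"
        then obtain i c where "strand e g \<pi> i c" "b = {Top i, Mid c}" by blast
        then have "strand e g \<pi> i c" "b = to_upper ` {Top i, Bot c}" by simp_all
        then show "b \<in> (`) to_upper ` {{Top i, Bot j} | i j. strand e g \<pi> i j}" by blast
      qed
    qed
    then show ?thesis by (simp add: layer_diagram_def image_Un image_image)
  qed
  have lo: "(`) to_lower ` layer_diagram g f \<rho> =
      (`) Mid ` arcs g \<union> (`) Bot ` arcs f \<union> {{Mid c, Bot j} | c j. strand g f \<rho> c j}"
  proof -
    have "(`) to_lower ` {{Top i, Bot j} | i j. strand g f \<rho> i j} = {{Mid c, Bot j} | c j. strand g f \<rho> c j}"
    proof
      show "(`) to_lower ` {{Top i, Bot j} | i j. strand g f \<rho> i j} \<subseteq> {{Mid c, Bot j} | c j. strand g f \<rho> c j}"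
      proof
        fix b assume "b \<in> (`) to_lower ` {{Top i, Bot j} | i j. strand g f \<rho> i j}"
        then obtain i j where "strand g f \<rho> i j" "b = to_lower ` {Top i, Bot j}" by blast
        then have "strand g f \<rho> i j" "b = {Mid i, Bot j}" by simp_all
        then show "b \<in> {{Mid c, Bot j} | c j. strand g f \<rho> c j}" by blast
      qed
      show "{{Mid c, Bot j} | c j. strand g f \<rho> c j} \<subseteq> (`) to_lower ` {{Top i, Bot j} | i j. strand g f \<rho> i j}"
      proof
        fix b assume "b \<in> {{Mid c, Bot j} | c j. strand g f \<rho> c j}"
        then obtain i c where "strand g f \<rho> i c" "b = {Mid i, Bot c}" by blast
        then have "strand g f \<rho> i c" "b = to_lower ` {Top i, Bot c}" by simp_all
        then show "b \<in> (`) to_lower ` {{Top i, Bot j} | i j. strand g f \<rho> i j}" by blast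
      qed
    qed
    then show ?thesis by (simp add: layer_diagram_def image_Un image_image)
  qed
  have S: "?S = (`) Top ` arcs e \<union> (`) Mid ` arcs g \<union> (`) Bot ` arcs f \<union>
      {{Top i, Mid c} | i c. strand e g \<pi> i c} \<union> {{Mid c, Bot j} | c j. strand g f \<rho> c j}"
    unfolding stacked_def up lo by blast
  have S_cases: thesis if "b \<in> ?S" "\<And>a. a \<in> arcs e \<Longrightarrow> b = Top ` a \<Longrightarrow> thesis"
      "\<And>a. a \<in> arcs g \<Longrightarrow> b = Mid ` a \<Longrightarrow> thesis" "\<And>a. a \<in> arcs f \<Longrightarrow> b = Bot ` a \<Longrightarrow> thesis"
      "\<And>i c. strand e g \<pi> i c \<Longrightarrow> b = {Top i, Mid c} \<Longrightarrow> thesis"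
      "\<And>c j. strand g f \<rho> c j \<Longrightarrow> b = {Mid c, Bot j} \<Longrightarrow> thesis" for b thesis
  proof -
    have "(\<exists>a\<in>arcs e. b = Top ` a) \<or> (\<exists>a\<in>arcs g. b = Mid ` a) \<or> (\<exists>a\<in>arcs f. b = Bot ` a) \<or>
        (\<exists>i c. strand e g \<pi> i c \<and> b = {Top i, Mid c}) \<or> (\<exists>c j. strand g f \<rho> c j \<and> b = {Mid c, Bot j})"
      using that(1) unfolding S Un_iff image_iff mem_Collect_eq by (elim disjE) blast+
    then show thesis
      by (elim disjE bexE exE conjE) 
        (rule that(2), assumption, assumption, rule that(3), assumption, assumption,
         rule that(4), assumption, assumption, rule that(5), assumption, assumption,
         rule that(6), assumption, assumption)
  qed
  have P_cases: thesis if "P \<in> \<P>" "\<And>a. a \<in> arcs e \<Longrightarrow> P = Top ` a \<Longrightarrow> thesis"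
      "\<And>a. a \<in> arcs g \<Longrightarrow> P = Mid ` a \<Longrightarrow> thesis" "\<And>a. a \<in> arcs f \<Longrightarrow> P = Bot ` a \<Longrightarrow> thesis"
      "\<And>i c j. strand e g \<pi> i c \<Longrightarrow> strand g f \<rho> c j \<Longrightarrow> P = {Top i, Mid c, Bot j} \<Longrightarrow> thesis"
    for P thesis
  proof -
    have "(\<exists>a\<in>arcs e. P = Top ` a) \<or> (\<exists>a\<in>arcs g. P = Mid ` a) \<or> (\<exists>a\<in>arcs f. P = Bot ` a) \<or>
        (\<exists>i c j. strand e g \<pi> i c \<and> strand g f \<rho> c j \<and> P = {Top i, Mid c, Bot j})"
      using that(1) unfolding \<P>_def W_def Un_iff image_iff mem_Collect_eq by (elim disjE) blast+
    then show thesis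
      by (elim disjE bexE exE conjE)
        (rule that(2), assumption, assumption, rule that(3), assumption, assumption,
         rule that(4), assumption, assumption, rule that(5), assumption, assumption, assumption)
  qed
  have W_in: "{Top i, Mid c, Bot j} \<in> \<P>" if "strand e g \<pi> i c" "strand g f \<rho> c j" for i c j
    unfolding \<P>_def by (rule UnI2) (use that in \<open>auto simp only: W_def mem_Collect_eq\<close>)
  have S_in: "{Top i, Mid c} \<in> ?S" if "strand e g \<pi> i c" for i c
    unfolding S by (rule UnI1, rule UnI2) (use that in \<open>auto simp only: mem_Collect_eq\<close>)
  have S_in': "{Mid c, Bot j} \<in> ?S" if "strand g f \<rho> c j" for c j
    unfolding S by (rule UnI2) (use that in \<open>auto simp only: mem_Collect_eq\<close>)
  have arc_in: "Top ` a \<in> ?S \<and> Top ` a \<in> \<P>" if "a \<in> arcs e" for a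
    using imageI[OF that, of "(`) Top"] by (simp add: S \<P>_def)
  have arc_in2: "Mid ` a \<in> ?S \<and> Mid ` a \<in> \<P>" if "a \<in> arcs g" for a
    using imageI[OF that, of "(`) Mid"] by (simp add: S \<P>_def)
  have arc_in3: "Bot ` a \<in> ?S \<and> Bot ` a \<in> \<P>" if "a \<in> arcs f" for a
    using imageI[OF that, of "(`) Bot"] by (simp add: S \<P>_def)
  have sub: "\<exists>P\<in>\<P>. b \<subseteq> P" if "b \<in> ?S" for b
    using that
  proof (rule S_cases)
    fix i c assume ic: "strand e g \<pi> i c" "b = {Top i, Mid c}"
    then obtain j where "strand g f \<rho> c j" using L.strand_ex_r U.strand_free(2) by blast
    then show ?thesis using W_in[OF ic(1)] ic(2) by (intro bexI[of _ "{Top i, Mid c, Bot j}"]) auto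
  next
    fix c j assume ic: "strand g f \<rho> c j" "b = {Mid c, Bot j}"
    then obtain i where "strand e g \<pi> i c" using U.strand_ex_l L.strand_free(1) by blast
    then show ?thesis using W_in[OF _ ic(1)] ic(2) by (intro bexI[of _ "{Top i, Mid c, Bot j}"]) auto
  qed (use arc_in arc_in2 arc_in3 in blast)+
  have PS: "P \<subseteq> \<Union>?S" if "P \<in> \<P>" for P
    using that
  proof (rule P_cases)
    fix i c j assume "strand e g \<pi> i c" "strand g f \<rho> c j" "P = {Top i, Mid c, Bot j}"
    then show ?thesis using S_in[of i c] S_in'[of c j] by blast
  qed (use arc_in arc_in2 arc_in3 in blast)+
  have UP: "\<Union>\<P> = \<Union>?S" using sub PS by blast
  have comps: "stack_components (layer_diagram e g \<pi>) (layer_diagram g f \<rho>) = \<P>"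
    unfolding stack_components_def
  proof (rule quotient_connected[OF UP])
    show "{} \<notin> \<P>"
    proof
      assume "{} \<in> \<P>"
      then show False by (rule P_cases) (auto simp: arcs_def)
    qed
    show "disjoint \<P>"
      unfolding disjoint_def
    proof (intro ballI impI)
      fix P P' assume P: "P \<in> \<P>" "P' \<in> \<P>" "P \<noteq> P'"
      show "P \<inter> P' = {}"
      proof (rule ccontr)
        assume "P \<inter> P' \<noteq> {}"
        then obtain x where x: "x \<in> P" "x \<in> P'" by blast
        have one: "P = P'" if "Top i \<in> P" "Top i \<in> P'" for i
        proof -
          have *: "(\<exists>a. a \<in> arcs e \<and> i \<in> a \<and> Q = Top ` a) \<or>
              (\<exists>c j. strand e g \<pi> i c \<and> strand g f \<rho> c j \<and> Q = {Top i, Mid c, Bot j})"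
            if "Q \<in> \<P>" "Top i \<in> Q" for Q
            using that(1) by (rule P_cases) (use that(2) in auto)
          from *[OF P(1) that(1)] show ?thesis
          proof (elim disjE exE conjE)
            fix a assume a: "a \<in> arcs e" "i \<in> a" "P = Top ` a"
            from *[OF P(2) that(2)] show ?thesis
            proof (elim disjE exE conjE)
              fix a' assume "a' \<in> arcs e" "i \<in> a'" "P' = Top ` a'"
              then show ?thesis using a dangle_facts(11)[OF e a(1), of a'] by blast
            next
              fix c assume "strand e g \<pi> i c"
              then show ?thesis using U.arc_elements(1)[OF a(1,2)] U.strand_free(1) by blast
            qed
          next
            fix c j assume a: "strand e g \<pi> i c" "strand g f \<rho> c j" "P = {Top i, Mid c, Bot j}"
            from *[OF P(2) that(2)] show ?thesis
            proof (elim disjE exE conjE)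
              fix a' assume "a' \<in> arcs e" "i \<in> a'"
              then show ?thesis using U.arc_elements(1) U.strand_free(1)[OF a(1)] by blast
            next
              fix c' j' assume "strand e g \<pi> i c'" "strand g f \<rho> c' j'" "P' = {Top i, Mid c', Bot j'}"
              then show ?thesis using a U.strand_unique_r L.strand_unique_r by blast
            qed
          qed
        qed
        have two: "P = P'" if "Bot i \<in> P" "Bot i \<in> P'" for i
        proof -
          have *: "(\<exists>a. a \<in> arcs f \<and> i \<in> a \<and> Q = Bot ` a) \<or>
              (\<exists>c j. strand e g \<pi> j c \<and> strand g f \<rho> c i \<and> Q = {Top j, Mid c, Bot i})"
            if "Q \<in> \<P>" "Bot i \<in> Q" for Q
            using that(1) by (rule P_cases) (use that(2) in auto)
          from *[OF P(1) that(1)] show ?thesis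
          proof (elim disjE exE conjE)
            fix a assume a: "a \<in> arcs f" "i \<in> a" "P = Bot ` a"
            from *[OF P(2) that(2)] show ?thesis
            proof (elim disjE exE conjE)
              fix a' assume "a' \<in> arcs f" "i \<in> a'" "P' = Bot ` a'"
              then show ?thesis using a dangle_facts(11)[OF f a(1), of a'] by blast
            next
              fix c assume "strand g f \<rho> c i"
              then show ?thesis using L.arc_elements(2)[OF a(1,2)] L.strand_free(2) by blast
            qed
          next
            fix c j assume a: "strand e g \<pi> j c" "strand g f \<rho> c i" "P = {Top j, Mid c, Bot i}"
            from *[OF P(2) that(2)] show ?thesis
            proof (elim disjE exE conjE)
              fix a' assume "a' \<in> arcs f" "i \<in> a'"
              then show ?thesis using L.arc_elements(2) L.strand_free(2)[OF a(2)] by blast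
            next
              fix c' j' assume "strand e g \<pi> j' c'" "strand g f \<rho> c' i" "P' = {Top j', Mid c', Bot i}"
              then show ?thesis using a U.strand_unique_l L.strand_unique_l by blast
            qed
          qed
        qed
        have three: "P = P'" if "Mid i \<in> P" "Mid i \<in> P'" for i
        proof -
          have *: "(\<exists>a. a \<in> arcs g \<and> i \<in> a \<and> Q = Mid ` a) \<or>
              (\<exists>c j. strand e g \<pi> j i \<and> strand g f \<rho> i c \<and> Q = {Top j, Mid i, Bot c})"
            if "Q \<in> \<P>" "Mid i \<in> Q" for Q
            using that(1) by (rule P_cases) (use that(2) in auto)
          from *[OF P(1) that(1)] show ?thesis
          proof (elim disjE exE conjE)
            fix a assume a: "a \<in> arcs g" "i \<in> a" "P = Mid ` a"
            from *[OF P(2) that(2)] show ?thesis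
            proof (elim disjE exE conjE)
              fix a' assume "a' \<in> arcs g" "i \<in> a'" "P' = Mid ` a'"
              then show ?thesis using a dangle_facts(11)[OF g a(1), of a'] by blast
            next
              fix c assume "strand g f \<rho> i c"
              then show ?thesis using L.arc_elements(1)[OF a(1,2)] L.strand_free(1) by blast
            qed
          next
            fix c j assume a: "strand e g \<pi> j i" "strand g f \<rho> i c" "P = {Top j, Mid i, Bot c}"
            from *[OF P(2) that(2)] show ?thesis
            proof (elim disjE exE conjE)
              fix a' assume "a' \<in> arcs g" "i \<in> a'"
              then show ?thesis using L.arc_elements(1) L.strand_free(1)[OF a(2)] by blast
            next
              fix c' j' assume "strand e g \<pi> j' i" "strand g f \<rho> i c'" "P' = {Top j', Mid i, Bot c'}"
              then show ?thesis using a U.strand_unique_l L.strand_unique_r by blast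
            qed
          qed
        qed
        show False using x one two three P(3) by (cases x) auto
      qed
    qed
    fix P x y assume P: "P \<in> \<P>" "x \<in> P" "y \<in> P"
    have block: "(x, y) \<in> ?R\<^sup>+" if "b \<in> ?S" "x \<in> b" "y \<in> b" for x y b
      using that by (intro r_into_trancl) blast
    from P(1) show "(x, y) \<in> ?R\<^sup>+"
    proof (rule P_cases)
      fix i c j assume *: "strand e g \<pi> i c" "strand g f \<rho> c j" "P = {Top i, Mid c, Bot j}"
      have to_mid: "(z, Mid c) \<in> ?R\<^sup>+ \<and> (Mid c, z) \<in> ?R\<^sup>+" if "z \<in> P" for z
      proof -
        have "z = Top i \<or> z = Mid c \<or> z = Bot j" using that unfolding *(3) by blast
        then show ?thesis
        proof (elim disjE)
          assume "z = Bot j"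
          then show ?thesis by (intro conjI block[OF S_in'[OF *(2)]]) simp_all
        qed (intro conjI block[OF S_in[OF *(1)]]; simp)+
      qed
      show ?thesis by (rule trancl_trans[OF conjunct1[OF to_mid[OF P(2)]] conjunct2[OF to_mid[OF P(3)]]])
    next
      fix a assume "a \<in> arcs e" "P = Top ` a"
      then show ?thesis using arc_in by (intro block[of P] P(2,3)) simp
    next
      fix a assume "a \<in> arcs g" "P = Mid ` a"
      then show ?thesis using arc_in2 by (intro block[of P] P(2,3)) simp
    next
      fix a assume "a \<in> arcs f" "P = Bot ` a"
      then show ?thesis using arc_in3 by (intro block[of P] P(2,3)) simp
    qed
  next
    show "\<exists>P\<in>\<P>. b \<subseteq> P" if "b \<in> ?S" for b by (rule sub[OF that])
  qed
  have comp: "strand e f (\<rho> \<circ> \<pi>) i j \<longleftrightarrow> (\<exists>c. strand e g \<pi> i c \<and> strand g f \<rho> c j)" for i j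
  proof
    assume *: "strand e f (\<rho> \<circ> \<pi>) i j"
    then obtain c where "strand e g \<pi> i c" using U.strand_ex_r by (auto simp: strand_def)
    then show "\<exists>c. strand e g \<pi> i c \<and> strand g f \<rho> c j" using * by (intro exI[of _ c]) (auto simp: strand_def)
  qed (auto simp: strand_def)
  show "diagram_mult (layer_diagram e g \<pi>) (layer_diagram g f \<rho>) = layer_diagram e f (\<rho> \<circ> \<pi>)"
    unfolding diagram_mult_def comps
  proof
    show "{C - range Mid | C. C \<in> \<P>} - {{}} \<subseteq> layer_diagram e f (\<rho> \<circ> \<pi>)"
    proof
      fix b assume "b \<in> {C - range Mid | C. C \<in> \<P>} - {{}}"
      then obtain P where P: "P \<in> \<P>" "b = P - range Mid" "b \<noteq> {}" by blast
      from P(1) show "b \<in> layer_diagram e f (\<rho> \<circ> \<pi>)"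
      proof (rule P_cases)
        fix a assume a: "a \<in> arcs e" "P = Top ` a"
        then have "b = Top ` a" using P by auto
        then show ?thesis using a by (simp add: layer_diagram_def)
      next
        fix a assume a: "a \<in> arcs g" "P = Mid ` a"
        then show ?thesis using P by auto
      next
        fix a assume a: "a \<in> arcs f" "P = Bot ` a"
        then have "b = Bot ` a" using P by auto
        then show ?thesis using a by (simp add: layer_diagram_def)
      next
        fix i c j assume a: "strand e g \<pi> i c" "strand g f \<rho> c j" "P = {Top i, Mid c, Bot j}"
        then have "b = {Top i, Bot j}" using P by auto
        moreover have "strand e f (\<rho> \<circ> \<pi>) i j" using comp a by blast
        ultimately show ?thesis unfolding layer_diagram_def by blast
      qed
    qed
    show "layer_diagram e f (\<rho> \<circ> \<pi>) \<subseteq> {C - range Mid | C. C \<in> \<P>} - {{}}"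
    proof
      fix b assume "b \<in> layer_diagram e f (\<rho> \<circ> \<pi>)"
      then consider a where "a \<in> arcs e" "b = Top ` a" | a where "a \<in> arcs f" "b = Bot ` a"
        | i j where "strand e f (\<rho> \<circ> \<pi>) i j" "b = {Top i, Bot j}" unfolding layer_diagram_def by blast
      then have "\<exists>C\<in>\<P>. b = C - range Mid \<and> b \<noteq> {}"
      proof cases
        case 1
        then show ?thesis using arc_in[OF 1(1)] arc_nonempty[OF 1(1)] by (intro bexI[of _ b]) auto
      next
        case 2
        then show ?thesis using arc_in3[OF 2(1)] arc_nonempty[OF 2(1)] by (intro bexI[of _ b]) auto
      next
        case 3
        then obtain c where "strand e g \<pi> i c" "strand g f \<rho> c j" using comp by blast
        from W_in[OF this] show ?thesis using 3 by (intro bexI[of _ "{Top i, Mid c, Bot j}"]) auto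
      qed
      then show "b \<in> {C - range Mid | C. C \<in> \<P>} - {{}}" by blast
    qed
  qed
  have "{C \<in> \<P>. C \<subseteq> range Mid} = (`) Mid ` arcs g"
  proof
    show "{C \<in> \<P>. C \<subseteq> range Mid} \<subseteq> (`) Mid ` arcs g"
    proof
      fix C assume "C \<in> {C \<in> \<P>. C \<subseteq> range Mid}"
      then have C: "C \<in> \<P>" "C \<subseteq> range Mid" by auto
      from C(1) show "C \<in> (`) Mid ` arcs g"
      proof (rule P_cases)
        fix a assume a: "a \<in> arcs e" "C = Top ` a"
        then show ?thesis using C(2) arc_nonempty[OF a(1)] by auto
      next
        fix a assume a: "a \<in> arcs f" "C = Bot ` a"
        then show ?thesis using C(2) arc_nonempty[OF a(1)] by auto
      qed (use C(2) in auto)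
    qed
  qed (use arc_in2 in auto)
  moreover have "inj ((`) Mid)" by (rule inj_image) (simp add: inj_def)
  ultimately show "closed_loops (layer_diagram e g \<pi>) (layer_diagram g f \<rho>) = k"
    unfolding closed_loops_def comps
    using card_image[of "(`) Mid" "arcs g"] dangle_facts(3)[OF g] by (simp add: inj_on_subset[OF _ subset_UNIV])
qed


text \<open>Exchange of the two rows reverses products, which gives the anti-automorphism of the algebra and
  reduces statements on bottom rows to statements on top rows.\<close>

abbreviation swap_diagram :: "node set set \<Rightarrow> node set set" where
  "swap_diagram d \<equiv> (`) swap_rows ` d"

lemma swap_rows_swap_rows [simp]: "swap_rows (swap_rows x) = x"
  by (cases x) auto

lemma swap_image_swap_image [simp]: "swap_rows ` swap_rows ` b = b"
  by (simp add: image_image)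

lemma swap_diagram_swap_diagram [simp]: "swap_diagram (swap_diagram d) = d"
  by (simp add: image_image)

lemma inj_swap: "inj swap_rows"
  by (rule inj_on_inverseI[where g=swap_rows]) simp

lemma swap_image_Mid: "swap_rows ` b \<subseteq> range Mid \<longleftrightarrow> b \<subseteq> range Mid"
  "swap_rows ` b - range Mid = swap_rows ` (b - range Mid)"
proof -
  have *: "swap_rows x \<in> range Mid \<longleftrightarrow> x \<in> range Mid" for x by (cases x) auto
  show "swap_rows ` b \<subseteq> range Mid \<longleftrightarrow> b \<subseteq> range Mid"
    unfolding image_subset_iff by (simp only: * subset_eq)
  show "swap_rows ` b - range Mid = swap_rows ` (b - range Mid)"
  proof -
    have "swap_rows ` range Mid = range Mid" by (simp add: image_image)
    then show ?thesis using image_set_diff[OF inj_swap, of b "range Mid"] by simp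
  qed
qed

lemma swap_image_Top: "swap_rows ` b \<subseteq> range Top \<longleftrightarrow> b \<subseteq> range Bot"
proof -
  have *: "swap_rows x \<in> range Top \<longleftrightarrow> x \<in> range Bot" for x by (cases x) auto
  show ?thesis unfolding image_subset_iff by (simp only: * subset_eq)
qed

lemma stacked_swap: "stacked (swap_diagram e) (swap_diagram d) = swap_diagram (stacked d e)"
proof -
  have 1: "to_upper (swap_rows x) = swap_rows (to_lower x)" for x by (cases x) auto
  have 2: "to_lower (swap_rows x) = swap_rows (to_upper x)" for x by (cases x) auto
  show ?thesis unfolding stacked_def image_Un image_image 1 2 by (rule Un_commute)
qed

text \<open>One implication is enough for both, because the exchange of rows is an involution.\<close>

lemma trancl_swap:
  assumes "(x, y) \<in> {(x, y). \<exists>b\<in>S. x \<in> b \<and> y \<in> b}\<^sup>+"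
  shows "(swap_rows x, swap_rows y) \<in> {(x, y). \<exists>b\<in>swap_diagram S. x \<in> b \<and> y \<in> b}\<^sup>+"
  using assms
proof (induction rule: trancl_induct)
  case (base y)
  then show ?case by (intro r_into_trancl) blast
next
  case (step y z)
  then have "(swap_rows y, swap_rows z) \<in> {(x, y). \<exists>b\<in>swap_diagram S. x \<in> b \<and> y \<in> b}" by blast
  then show ?case by (rule trancl_into_trancl[OF step.IH])
qed

lemma stack_components_swap:
  "stack_components (swap_diagram e) (swap_diagram d) = swap_diagram (stack_components d e)"
proof -
  let ?R = "\<lambda>S. {(x, y). \<exists>b\<in>S. x \<in> b \<and> y \<in> b} :: (node \<times> node) set"
  let ?S = "stacked d e"
  have cls: "(?R (swap_diagram ?S))\<^sup>+ `` {swap_rows x} = swap_rows ` ((?R ?S)\<^sup>+ `` {x})" for x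
  proof
    show "swap_rows ` ((?R ?S)\<^sup>+ `` {x}) \<subseteq> (?R (swap_diagram ?S))\<^sup>+ `` {swap_rows x}"
    proof
      fix y assume "y \<in> swap_rows ` ((?R ?S)\<^sup>+ `` {x})"
      then obtain z where "y = swap_rows z" "(x, z) \<in> (?R ?S)\<^sup>+" by blast
      then show "y \<in> (?R (swap_diagram ?S))\<^sup>+ `` {swap_rows x}" using trancl_swap[of x z ?S] by simp
    qed
    show "(?R (swap_diagram ?S))\<^sup>+ `` {swap_rows x} \<subseteq> swap_rows ` ((?R ?S)\<^sup>+ `` {x})"
    proof
      fix y assume "y \<in> (?R (swap_diagram ?S))\<^sup>+ `` {swap_rows x}"
      then have "(x, swap_rows y) \<in> (?R ?S)\<^sup>+"
        using trancl_swap[of "swap_rows x" y "swap_diagram ?S"] by simp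
      then have "swap_rows (swap_rows y) \<in> swap_rows ` ((?R ?S)\<^sup>+ `` {x})" by (intro imageI) simp
      then show "y \<in> swap_rows ` ((?R ?S)\<^sup>+ `` {x})" by simp
    qed
  qed
  have U: "\<Union>(swap_diagram ?S) = swap_rows ` \<Union>?S" by blast
  have quot: "A // r = (\<lambda>x. r `` {x}) ` A" for A :: "node set" and r unfolding quotient_def by blast
  show ?thesis
    unfolding stack_components_def stacked_swap U quot image_image cls ..
qed

lemma diagram_mult_swap: "diagram_mult (swap_diagram e) (swap_diagram d) = swap_diagram (diagram_mult d e)"
proof -
  have img: "diagram_mult d e = (\<lambda>C. C - range Mid) ` stack_components d e - {{}}" for d e
    unfolding diagram_mult_def by blast
  have "(\<lambda>C. C - range Mid) ` swap_diagram (stack_components d e) =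
      swap_diagram ((\<lambda>C. C - range Mid) ` stack_components d e)"
    by (simp add: image_image swap_image_Mid)
  moreover have "swap_diagram A - {{}} = swap_diagram (A - {{}})" for A by auto
  ultimately show ?thesis unfolding img stack_components_swap by simp
qed

lemma closed_loops_swap: "closed_loops (swap_diagram e) (swap_diagram d) = closed_loops d e"
proof -
  have "{C \<in> swap_diagram (stack_components d e). C \<subseteq> range Mid} =
      swap_diagram {C \<in> stack_components d e. C \<subseteq> range Mid}"
    using swap_image_Mid(1) by blast
  then show ?thesis
    unfolding closed_loops_def stack_components_swap
    using card_image[OF inj_on_subset[OF inj_image[OF inj_swap] subset_UNIV]] by simp
qed

lemma sym_diagram_facts:
  assumes "d \<in> sym_diagrams n"
  shows "\<Union>d = Top ` {1..2*n} \<union> Bot ` {1..2*n}" "disjoint d" "{} \<notin> d"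
    "\<And>b. b \<in> d \<Longrightarrow> card b = 2" "finite d"
proof -
  have p: "partition_on (Top ` {1..2*n} \<union> Bot ` {1..2*n}) d" "\<And>b. b \<in> d \<Longrightarrow> card b = 2"
    using assms by (simp_all add: sym_diagrams_def brauer_diagrams_def)
  show "\<Union>d = Top ` {1..2*n} \<union> Bot ` {1..2*n}" "disjoint d" "{} \<notin> d" "\<And>b. b \<in> d \<Longrightarrow> card b = 2"
    using p by (simp_all add: partition_on_def)
  show "finite d" by (rule finite_elements[OF _ p(1)]) simp
qed

lemma finite_sym_diagrams: "finite (sym_diagrams n)"
proof (rule finite_subset)
  show "sym_diagrams n \<subseteq> Pow (Pow (Top ` {1..2*n} \<union> Bot ` {1..2*n}))"
    using sym_diagram_facts(1) by blast
qed simp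

lemma swap_sym_diagram:
  assumes d: "d \<in> sym_diagrams n" shows "swap_diagram d \<in> sym_diagrams n"
proof -
  note f = sym_diagram_facts[OF d]
  have sw: "swap_rows ` (Top ` {1..2*n} \<union> Bot ` {1..2*n}) = Top ` {1..2*n} \<union> Bot ` {1..2*n}"
    by (simp add: image_Un image_image Un_commute)
  have "\<Union>(swap_diagram d) = swap_rows ` \<Union>d" by blast
  then have U: "\<Union>(swap_diagram d) = Top ` {1..2*n} \<union> Bot ` {1..2*n}" by (simp only: f(1) sw)
  have dis: "disjoint (swap_diagram d)"
  proof (rule disjointI)
    fix a b assume "a \<in> swap_diagram d" "b \<in> swap_diagram d" "a \<noteq> b"
    then obtain a' b' where ab: "a' \<in> d" "a = swap_rows ` a'" "b' \<in> d" "b = swap_rows ` b'" "a' \<noteq> b'" by blast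
    then have "a' \<inter> b' = {}" using disjointD[OF f(2)] by blast
    then show "a \<inter> b = {}" using ab image_Int[OF inj_swap, of a' b'] by simp
  qed
  have cards: "card b = 2" if b: "b \<in> swap_diagram d" for b
  proof -
    obtain b' where b': "b' \<in> d" "b = swap_rows ` b'" using b by blast
    then show ?thesis using f(4) card_image[OF inj_on_subset[OF inj_swap subset_UNIV], of b'] by simp
  qed
  have "reflect n (swap_rows x) = swap_rows (reflect n x)" for x by (cases x) auto
  then have "(`) (reflect n) ` swap_diagram d = swap_diagram ((`) (reflect n) ` d)"
    by (simp add: image_image)
  also have "(`) (reflect n) ` d = d" using d by (simp add: sym_diagrams_def)
  finally show ?thesis
    using U dis cards f(3) by (auto simp: sym_diagrams_def brauer_diagrams_def partition_on_def)
qed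

text \<open>In the stacked diagrams a node of the top row meets only blocks of the upper diagram, so an arc of
  the top row is a component by itself.\<close>

lemma top_arc_persists:
  assumes d: "d \<in> sym_diagrams n" and b: "b \<in> d" "b \<subseteq> range Top"
  shows "b \<in> diagram_mult d d'"
proof -
  let ?R = "{(x, y). \<exists>b\<in>stacked d d'. x \<in> b \<and> y \<in> b}"
  have ub: "to_upper ` b = b"
  proof -
    have "to_upper x = x" if "x \<in> b" for x using that b(2) by auto
    then show ?thesis by simp
  qed
  then have bS: "b \<in> stacked d d'" unfolding stacked_def using b(1) by (intro UnI1) (metis imageI)
  have up_Top: "w = Top i" if "to_upper w = Top i" for w i using that by (cases w) auto
  have lo_Top: "to_lower w \<noteq> Top i" for w i by (cases w) auto
  have step: "z \<in> b" if yz: "(y, z) \<in> ?R" "y \<in> b" for y z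
  proof -
    obtain i where i: "y = Top i" using yz(2) b(2) by blast
    obtain c where c: "c \<in> stacked d d'" "y \<in> c" "z \<in> c" using yz(1) by blast
    from c(1) consider b' where "b' \<in> d" "c = to_upper ` b'" | b' where "c = to_lower ` b'"
      unfolding stacked_def by blast
    then show ?thesis
    proof cases
      case 1
      then obtain w where "w \<in> b'" "to_upper w = Top i" using c(2) i by auto
      then have "y \<in> b'" using up_Top i by blast
      then have "b' = b" using disjointD[OF sym_diagram_facts(2)[OF d] 1(1) b(1)] yz(2) by blast
      then show ?thesis using 1 c(3) ub by simp
    next
      case 2
      then show ?thesis using c(2) i lo_Top by (metis imageE)
    qed
  qed
  obtain x where x: "x \<in> b" using sym_diagram_facts(3)[OF d] b(1) by (metis ex_in_conv)
  have "?R\<^sup>+ `` {x} = b"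
  proof
    show "b \<subseteq> ?R\<^sup>+ `` {x}" using bS x by (auto intro!: r_into_trancl)
    show "?R\<^sup>+ `` {x} \<subseteq> b"
    proof
      fix y assume "y \<in> ?R\<^sup>+ `` {x}"
      then have "(x, y) \<in> ?R\<^sup>+" by simp
      then show "y \<in> b" by (induction rule: trancl_induct) (use step x in blast)+
    qed
  qed
  moreover have "?R\<^sup>+ `` {x} \<in> stack_components d d'"
    unfolding stack_components_def using bS x by (intro quotientI) blast
  ultimately have comp: "b \<in> stack_components d d'" by simp
  moreover have "b - range Mid = b" using b(2) by auto
  ultimately show ?thesis using x unfolding diagram_mult_def by blast
qed

text \<open>The nodes of the top row that are on no arc of the row are the free ones.\<close>

lemma top_dangle_from_arcs:
  assumes d: "d \<in> sym_diagrams n"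
  shows "top_dangle d = (\<lambda>b. Top -` b) ` {b\<in>d. b \<subseteq> range Top} \<union>
    (\<lambda>i. {i}) ` {i\<in>{1..2*n}. Top i \<notin> \<Union>{b\<in>d. b \<subseteq> range Top}}" (is "_ = ?A \<union> ?B")
proof -
  note f = sym_diagram_facts[OF d]
  have node: "x \<in> Top ` {1..2*n} \<union> Bot ` {1..2*n}" if "b \<in> d" "x \<in> b" for b x
    using that f(1) by blast
  have through: "Top -` b = {i}" if b: "b \<in> d" "Top i \<in> b" "\<not> b \<subseteq> range Top" for b i
  proof -
    obtain x y where xy: "b = {x, y}" using f(4)[OF b(1)] by (auto simp: card_2_iff)
    then show ?thesis using b(2,3) by auto
  qed
  show ?thesis
  proof
    show "top_dangle d \<subseteq> ?A \<union> ?B"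
    proof
      fix u assume "u \<in> top_dangle d"
      then obtain b where b: "b \<in> d" "u = Top -` b" "u \<noteq> {}" unfolding top_dangle_def by blast
      show "u \<in> ?A \<union> ?B"
      proof (cases "b \<subseteq> range Top")
        case True
        then show ?thesis using b by blast
      next
        case False
        obtain i where i: "Top i \<in> b" using b by blast
        then have u: "u = {i}" using through[OF b(1) _ False] b(2) by blast
        have "i \<in> {1..2*n}" using node[OF b(1) i] by auto
        moreover have "Top i \<notin> \<Union>{b\<in>d. b \<subseteq> range Top}"
        proof
          assume "Top i \<in> \<Union>{b\<in>d. b \<subseteq> range Top}"
          then obtain b' where b': "b' \<in> d" "b' \<subseteq> range Top" "Top i \<in> b'" by blast
          then have "b' = b" using disjointD[OF f(2) b'(1) b(1)] i by blast
          then show False using b'(2) False by simp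
        qed
        ultimately show ?thesis using u by blast
      qed
    qed
    show "?A \<union> ?B \<subseteq> top_dangle d"
    proof
      fix u assume "u \<in> ?A \<union> ?B"
      then show "u \<in> top_dangle d"
      proof
        assume "u \<in> ?A"
        then obtain b where b: "b \<in> d" "b \<subseteq> range Top" "u = Top -` b" by blast
        moreover have "b \<noteq> {}" using f(3) b(1) by metis
        ultimately have "u \<noteq> {}" by blast
        then show ?thesis using b unfolding top_dangle_def by blast
      next
        assume "u \<in> ?B"
        then obtain i where i: "i \<in> {1..2*n}" "Top i \<notin> \<Union>{b\<in>d. b \<subseteq> range Top}" "u = {i}" by blast
        then have "Top i \<in> \<Union>d" unfolding f(1) by blast
        then obtain b where b: "b \<in> d" "Top i \<in> b" by blast
        then have "\<not> b \<subseteq> range Top" using i(2) by blast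
        then have "Top -` b = u" using through[OF b] i(3) by simp
        then show ?thesis using b(1) i(3) unfolding top_dangle_def by blast
      qed
    qed
  qed
qed

text \<open>The product has at least the arcs of the upper factor; if it stays in the layer then it has
  as many, hence the same.\<close>

lemma top_dangle_mult:
  assumes a: "a \<in> sym_diagrams n" "top_arcs a = k" and c: "diagram_mult a b \<in> layer_diagrams n k"
  shows "top_dangle (diagram_mult a b) = top_dangle a"
proof -
  let ?c = "diagram_mult a b"
  have c': "?c \<in> sym_diagrams n" "top_arcs ?c = k" using c by (simp_all add: layer_diagrams_def)
  have "{b\<in>a. b \<subseteq> range Top} = {b\<in>?c. b \<subseteq> range Top}"
  proof (rule card_subset_eq)
    show "finite {b\<in>?c. b \<subseteq> range Top}" using sym_diagram_facts(5)[OF c'(1)] by simp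
    show "{b\<in>a. b \<subseteq> range Top} \<subseteq> {b\<in>?c. b \<subseteq> range Top}" using top_arc_persists[OF a(1)] by blast
    show "card {b\<in>a. b \<subseteq> range Top} = card {b\<in>?c. b \<subseteq> range Top}"
      using a(2) c'(2) by (simp add: top_arcs_def)
  qed
  then show ?thesis using top_dangle_from_arcs[OF a(1)] top_dangle_from_arcs[OF c'(1)] by simp
qed

lemma top_arcs_swap: "top_arcs (swap_diagram d) = bot_arcs d"
proof -
  have "{b \<in> swap_diagram d. b \<subseteq> range Top} = swap_diagram {b\<in>d. b \<subseteq> range Bot}"
    using swap_image_Top by blast
  then show ?thesis
    unfolding top_arcs_def bot_arcs_def
    using card_image[OF inj_on_subset[OF inj_image[OF inj_swap] subset_UNIV]] by simp
qed

lemma bot_arcs_swap: "bot_arcs (swap_diagram d) = top_arcs d"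
  using top_arcs_swap[of "swap_diagram d"] by simp

lemma top_dangle_swap: "top_dangle (swap_diagram d) = bot_dangle d"
proof -
  have vim: "Top -` (swap_rows ` b) = Bot -` b" for b
  proof
    show "Bot -` b \<subseteq> Top -` (swap_rows ` b)"
    proof
      fix i assume "i \<in> Bot -` b"
      then have "swap_rows (Bot i) \<in> swap_rows ` b" by (intro imageI) simp
      then show "i \<in> Top -` (swap_rows ` b)" by simp
    qed
    show "Top -` (swap_rows ` b) \<subseteq> Bot -` b"
    proof
      fix i assume "i \<in> Top -` (swap_rows ` b)"
      then obtain x where "x \<in> b" "Top i = swap_rows x" by auto
      then have "x = Bot i" by (cases x) auto
      then show "i \<in> Bot -` b" using \<open>x \<in> b\<close> by simp
    qed
  qed
  have "{Top -` b | b. b \<in> swap_diagram d} = {Bot -` b | b. b \<in> d}"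
    unfolding Setcompr_eq_image image_image vim ..
  then show ?thesis by (simp only: top_dangle_def bot_dangle_def)
qed

lemma bot_dangle_mult:
  assumes b: "b \<in> sym_diagrams n" "bot_arcs b = k" and c: "diagram_mult a b \<in> layer_diagrams n k"
  shows "bot_dangle (diagram_mult a b) = bot_dangle b"
proof -
  have "diagram_mult (swap_diagram b) (swap_diagram a) \<in> layer_diagrams n k"
    using c swap_sym_diagram[of "diagram_mult a b" n] unfolding diagram_mult_swap
    by (simp only: layer_diagrams_def mem_Collect_eq top_arcs_swap bot_arcs_swap simp_thms)
  from top_dangle_mult[OF swap_sym_diagram[OF b(1)] _ this] show ?thesis
    using b(2) by (simp only: top_arcs_swap diagram_mult_swap top_dangle_swap)
qed

lemma finite_hyperoctahedral: "finite (hyperoctahedral m)"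
  by (rule finite_subset[OF _ finite_permutations[of "{1..2*m}"]]) (auto simp: hyperoctahedral_def)

lemma finite_dangles: "finite (dangles n k)"
proof (rule finite_subset)
  show "dangles n k \<subseteq> Pow (Pow {1..2*n})" unfolding dangles_def partition_on_def by blast
qed simp

section \<open>Transport of module structures\<close>

lemma left_module_iso_transfer:
  assumes P: "left_module A P" and bij: "bij_betw \<phi> (carrier P) (carrier G)"
    and add: "\<And>x y. \<lbrakk>x \<in> carrier P; y \<in> carrier P\<rbrakk> \<Longrightarrow> \<phi> (x \<oplus>\<^bsub>P\<^esub> y) = \<phi> x \<oplus>\<^bsub>G\<^esub> \<phi> y"
    and sm: "\<And>a x. \<lbrakk>a \<in> carrier A; x \<in> carrier P\<rbrakk> \<Longrightarrow> \<phi> (a \<odot>\<^bsub>P\<^esub> x) = a \<odot>\<^bsub>G\<^esub> \<phi> x"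
    and zero: "\<phi> \<zero>\<^bsub>P\<^esub> = \<zero>\<^bsub>G\<^esub>"
  shows "left_module A G"
proof -
  interpret P: left_module A P by (rule P)
  have im: "\<phi> x \<in> carrier G" if "x \<in> carrier P" for x using bij that by (auto simp: bij_betw_def)
  have rep: "\<exists>x\<in>carrier P. z = \<phi> x" if "z \<in> carrier G" for z using bij that by (auto simp: bij_betw_def)
  have "abelian_group G"
  proof (rule abelian_groupI)
    show "\<zero>\<^bsub>G\<^esub> \<in> carrier G" using im[OF P.zero_closed] zero by simp
  next
    fix x y z assume "x \<in> carrier G" "y \<in> carrier G" "z \<in> carrier G"
    then obtain a b c where "a \<in> carrier P" "x = \<phi> a" "b \<in> carrier P" "y = \<phi> b" "c \<in> carrier P" "z = \<phi> c"
      using rep by metis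
    then show "x \<oplus>\<^bsub>G\<^esub> y \<oplus>\<^bsub>G\<^esub> z = x \<oplus>\<^bsub>G\<^esub> (y \<oplus>\<^bsub>G\<^esub> z)" by (simp add: add[symmetric] P.a_assoc)
  next
    fix x y assume "x \<in> carrier G" "y \<in> carrier G"
    then obtain a b where ab: "a \<in> carrier P" "x = \<phi> a" "b \<in> carrier P" "y = \<phi> b" using rep by metis
    show "x \<oplus>\<^bsub>G\<^esub> y \<in> carrier G" using ab im[of "a \<oplus>\<^bsub>P\<^esub> b"] by (simp add: add[symmetric])
    show "x \<oplus>\<^bsub>G\<^esub> y = y \<oplus>\<^bsub>G\<^esub> x" using ab P.a_comm[of a b] by (simp add: add[symmetric])
  next
    fix x assume "x \<in> carrier G"
    then obtain a where a: "a \<in> carrier P" "x = \<phi> a" using rep by metis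
    show "\<zero>\<^bsub>G\<^esub> \<oplus>\<^bsub>G\<^esub> x = x" using a by (simp add: add[symmetric] zero[symmetric])
    have "\<phi> (\<ominus>\<^bsub>P\<^esub> a) \<oplus>\<^bsub>G\<^esub> x = \<zero>\<^bsub>G\<^esub>" using a by (simp add: add[symmetric] zero[symmetric] P.l_neg)
    then show "\<exists>y\<in>carrier G. y \<oplus>\<^bsub>G\<^esub> x = \<zero>\<^bsub>G\<^esub>" using im[of "\<ominus>\<^bsub>P\<^esub> a"] a by blast
  qed
  moreover have "left_module_axioms A G"
  proof
    fix a x assume a: "a \<in> carrier A" and "x \<in> carrier G"
    then obtain u where u: "u \<in> carrier P" "x = \<phi> u" using rep by metis
    show "a \<odot>\<^bsub>G\<^esub> x \<in> carrier G" using u a im[of "a \<odot>\<^bsub>P\<^esub> u"] by (simp add: sm)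
    show "(a \<oplus>\<^bsub>A\<^esub> b) \<odot>\<^bsub>G\<^esub> x = a \<odot>\<^bsub>G\<^esub> x \<oplus>\<^bsub>G\<^esub> b \<odot>\<^bsub>G\<^esub> x" if "b \<in> carrier A" for b
      using u a that by (simp add: sm[symmetric] add[symmetric] P.smult_l_distr)
    show "(a \<otimes>\<^bsub>A\<^esub> b) \<odot>\<^bsub>G\<^esub> x = a \<odot>\<^bsub>G\<^esub> (b \<odot>\<^bsub>G\<^esub> x)" if "b \<in> carrier A" for b
      using u a that by (simp add: sm[symmetric] P.smult_assoc)
    fix y assume "y \<in> carrier G"
    then obtain w where "w \<in> carrier P" "y = \<phi> w" using rep by metis
    then show "a \<odot>\<^bsub>G\<^esub> (x \<oplus>\<^bsub>G\<^esub> y) = a \<odot>\<^bsub>G\<^esub> x \<oplus>\<^bsub>G\<^esub> a \<odot>\<^bsub>G\<^esub> y"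
      using u a by (simp add: sm[symmetric] add[symmetric] P.smult_r_distr)
  next
    fix x assume "x \<in> carrier G"
    then obtain u where u: "u \<in> carrier P" "x = \<phi> u" using rep by metis
    then show "\<one>\<^bsub>A\<^esub> \<odot>\<^bsub>G\<^esub> x = x" by (simp add: sm[symmetric])
  qed
  ultimately show ?thesis by (intro left_module.intro P.A.ring_axioms)
qed

text \<open>Truncation is exact: the truncation of a quotient is the quotient of the truncations.\<close>

lemma (in corner_pair) corner_pair_epi:
  assumes D: "left_module B D" and U: "submodule U B N" and q: "module_epi B N U D q"
  shows "\<exists>jD. corner_pair B H e \<theta> K D (quotient_module M (corner_part U)) jD"
proof -
  interpret D: left_module B D by (rule D)
  let ?W = "corner_part U"
  let ?Q = "quotient_module M ?W"
  have W: "submodule ?W H M" by (rule corner_part_submodule[OF U])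
  interpret Q: left_module H ?Q by (rule M.quotient_left_module[OF W])
  have qadd: "\<And>x y. \<lbrakk>x \<in> carrier N; y \<in> carrier N\<rbrakk> \<Longrightarrow> q (x \<oplus>\<^bsub>N\<^esub> y) = q x \<oplus>\<^bsub>D\<^esub> q y"
    and qsm: "\<And>a x. \<lbrakk>a \<in> carrier B; x \<in> carrier N\<rbrakk> \<Longrightarrow> q (a \<odot>\<^bsub>N\<^esub> x) = a \<odot>\<^bsub>D\<^esub> q x"
    and qonto: "q ` carrier N = carrier D"
    and qker: "\<And>x. x \<in> carrier N \<Longrightarrow> q x = \<zero>\<^bsub>D\<^esub> \<longleftrightarrow> x \<in> U"
    using q by (simp_all add: module_epi_def)
  have qD: "q x \<in> carrier D" if "x \<in> carrier N" for x using qonto that by blast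
  have eq: "q (j x) = q (j y) \<longleftrightarrow> ?W +>\<^bsub>M\<^esub> x = ?W +>\<^bsub>M\<^esub> y" if xy: "x \<in> carrier M" "y \<in> carrier M" for x y
  proof -
    have xyM: "x \<ominus>\<^bsub>M\<^esub> y \<in> carrier M" using xy by simp
    have "x \<ominus>\<^bsub>M\<^esub> y \<oplus>\<^bsub>M\<^esub> y = x" using xy by (simp add: M.minus_eq M.a_assoc M.l_neg)
    then have "q (j x) = q (j (x \<ominus>\<^bsub>M\<^esub> y)) \<oplus>\<^bsub>D\<^esub> q (j y)"
      using j_add[OF xyM xy(2)] qadd[of "j (x \<ominus>\<^bsub>M\<^esub> y)" "j y"] xyM xy by simp
    then have "q (j x) = q (j y) \<longleftrightarrow> q (j (x \<ominus>\<^bsub>M\<^esub> y)) = \<zero>\<^bsub>D\<^esub>"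
      using D.add.r_cancel_one[of "q (j y)" "q (j (x \<ominus>\<^bsub>M\<^esub> y))"] qD xyM xy by auto
    also have "\<dots> \<longleftrightarrow> x \<ominus>\<^bsub>M\<^esub> y \<in> ?W" using qker xyM by (simp add: corner_part_def)
    finally show ?thesis using M.coset_eq_iff[OF W xy] by simp
  qed
  define jD where "jD = (\<lambda>Z. q (j (SOME x. x \<in> carrier M \<and> Z = ?W +>\<^bsub>M\<^esub> x)))"
  have jD: "jD (?W +>\<^bsub>M\<^esub> x) = q (j x)" if x: "x \<in> carrier M" for x
  proof -
    let ?y = "SOME y. y \<in> carrier M \<and> ?W +>\<^bsub>M\<^esub> x = ?W +>\<^bsub>M\<^esub> y"
    have "?y \<in> carrier M \<and> ?W +>\<^bsub>M\<^esub> x = ?W +>\<^bsub>M\<^esub> ?y"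
      by (rule someI[where x=x]) (simp add: x)
    then show ?thesis using eq[of ?y x] x by (simp add: jD_def)
  qed
  have rep: "\<exists>x\<in>carrier M. Z = ?W +>\<^bsub>M\<^esub> x" if "Z \<in> carrier ?Q" for Z
    using that by (auto simp: M.quotient_carrier)
  have "corner_pair_axioms H e \<theta> K D ?Q jD"
  proof
    fix \<kappa> z assume \<kappa>: "\<kappa> \<in> K" and "z \<in> carrier D"
    then obtain x where x: "x \<in> carrier N" "z = q x" using qonto by blast
    have "\<kappa> \<odot>\<^bsub>D\<^esub> z = q (\<kappa> \<odot>\<^bsub>N\<^esub> x)" using qsm[of \<kappa> x] x \<kappa> K_closed by auto
    also have "\<dots> = \<zero>\<^bsub>D\<^esub>" using K_null[OF \<kappa> x(1)] qker[of "\<zero>\<^bsub>N\<^esub>"] N.submoduleD(2)[OF U] by simp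
    finally show "\<kappa> \<odot>\<^bsub>D\<^esub> z = \<zero>\<^bsub>D\<^esub>" .
  next
    fix Z Y assume "Z \<in> carrier ?Q" "Y \<in> carrier ?Q"
    then obtain x y where "x \<in> carrier M" "Z = ?W +>\<^bsub>M\<^esub> x" "y \<in> carrier M" "Y = ?W +>\<^bsub>M\<^esub> y"
      using rep by metis
    then show "jD (Z \<oplus>\<^bsub>?Q\<^esub> Y) = jD Z \<oplus>\<^bsub>D\<^esub> jD Y"
      by (simp add: M.quotient_add[OF W] jD j_add qadd)
  next
    fix h Z assume h: "h \<in> carrier H" and "Z \<in> carrier ?Q"
    then obtain x where "x \<in> carrier M" "Z = ?W +>\<^bsub>M\<^esub> x" using rep by metis
    then show "jD (h \<odot>\<^bsub>?Q\<^esub> Z) = \<theta> h \<odot>\<^bsub>D\<^esub> jD Z"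
      using h by (simp add: M.quotient_smult[OF W] jD j_smult qsm)
  next
    show "inj_on jD (carrier ?Q)"
    proof (rule inj_onI)
      fix Z Y assume "Z \<in> carrier ?Q" "Y \<in> carrier ?Q" and e: "jD Z = jD Y"
      then obtain x y where "x \<in> carrier M" "Z = ?W +>\<^bsub>M\<^esub> x" "y \<in> carrier M" "Y = ?W +>\<^bsub>M\<^esub> y"
        using rep by metis
      then show "Z = Y" using e eq jD by simp
    qed
    have "jD ` carrier ?Q = q ` (j ` carrier M)"
      unfolding M.quotient_carrier image_image by (rule image_cong) (simp_all add: jD)
    also have "\<dots> = (\<lambda>z. e \<odot>\<^bsub>D\<^esub> z) ` (q ` carrier N)"
      unfolding j_image image_image by (rule image_cong) (simp_all add: qsm)
    finally show "jD ` carrier ?Q = (\<lambda>z. e \<odot>\<^bsub>D\<^esub> z) ` carrier D" unfolding qonto .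
  qed
  then show ?thesis
    by (intro exI[of _ jD] corner_pair.intro corner_axioms D Q.left_module_axioms)
qed

section \<open>Linear combinations of basis elements\<close>

text \<open>The combination of the basis elements \<open>d i\<close> with coefficients \<open>\<alpha> i\<close>. Indices with the same
  value of \<open>d\<close> add up, so products of combinations are again of this form without further
  conditions.\<close>

definition comb :: "'i set \<Rightarrow> ('i \<Rightarrow> 'r::field) \<Rightarrow> ('i \<Rightarrow> 'x) \<Rightarrow> 'x \<Rightarrow> 'r" where
  "comb I \<alpha> d = (\<lambda>z. \<Sum>i\<in>I. if d i = z then \<alpha> i else 0)"

lemma sum_comb:
  assumes "finite Z" "d ` I \<subseteq> Z"
  shows "(\<Sum>a\<in>Z. comb I \<alpha> d a * f a) = (\<Sum>i\<in>I. \<alpha> i * f (d i))"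
proof -
  have "(\<Sum>a\<in>Z. comb I \<alpha> d a * f a) = (\<Sum>a\<in>Z. \<Sum>i\<in>I. if d i = a then \<alpha> i * f a else 0)"
    unfolding comb_def sum_distrib_right by (intro sum.cong) auto
  also have "\<dots> = (\<Sum>i\<in>I. \<Sum>a\<in>Z. if d i = a then \<alpha> i * f a else 0)" by (rule sum.swap)
  also have "\<dots> = (\<Sum>i\<in>I. \<alpha> i * f (d i))"
    using assms by (intro sum.cong HOL.refl) (auto simp: sum.delta)
  finally show ?thesis .
qed

lemma comb_mult:
  assumes Z: "finite Z" and I: "d ` I \<subseteq> Z" and J: "d' ` J \<subseteq> Z"
  shows "comb I \<alpha> d \<otimes>\<^bsub>based_algebra Z c p u\<^esub> comb J \<beta> d' =
    comb (I \<times> J) (\<lambda>(i, j). c (d i) (d' j) * \<alpha> i * \<beta> j) (\<lambda>(i, j). p (d i) (d' j))"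
proof
  fix z
  have "(comb I \<alpha> d \<otimes>\<^bsub>based_algebra Z c p u\<^esub> comb J \<beta> d') z =
    (\<Sum>a\<in>Z. comb I \<alpha> d a * (\<Sum>b\<in>Z. comb J \<beta> d' b * (if p a b = z then c a b else 0)))"
    unfolding based_algebra_mult sum_distrib_left by (intro sum.cong) auto
  also have "\<dots> = (\<Sum>i\<in>I. \<Sum>j\<in>J. \<alpha> i * (\<beta> j * (if p (d i) (d' j) = z then c (d i) (d' j) else 0)))"
    unfolding sum_comb[OF Z J] unfolding sum_comb[OF Z I] unfolding sum_distrib_left ..
  also have "\<dots> = comb (I \<times> J) (\<lambda>(i, j). c (d i) (d' j) * \<alpha> i * \<beta> j) (\<lambda>(i, j). p (d i) (d' j)) z"
    unfolding comb_def sum.cartesian_product by (intro sum.cong) auto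
  finally show "(comb I \<alpha> d \<otimes>\<^bsub>based_algebra Z c p u\<^esub> comb J \<beta> d') z = \<dots>" .
qed

lemma based_mult_support:
  assumes "(x \<otimes>\<^bsub>based_algebra Z c p u\<^esub> y) z \<noteq> 0"
  shows "\<exists>a\<in>Z. \<exists>b\<in>Z. x a \<noteq> 0 \<and> y b \<noteq> 0 \<and> p a b = z"
proof (rule ccontr)
  assume no: "\<not> ?thesis"
  have "(x \<otimes>\<^bsub>based_algebra Z c p u\<^esub> y) z = 0"
    unfolding based_algebra_mult using no by (intro sum.neutral ballI) auto
  then show False using assms by simp
qed

lemma layer_map_comb:
  assumes "\<And>i. i \<in> I \<Longrightarrow> d i \<in> layer_diagrams n k"
  shows "layer_map n k (comb I \<alpha> d) = comb I \<alpha> (\<lambda>i. (top_dangle (d i), bot_dangle (d i), through_perm (d i)))"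
proof
  fix t
  have fin: "finite {c \<in> layer_diagrams n k. (top_dangle c, bot_dangle c, through_perm c) = t}"
    by (rule finite_subset[OF _ finite_sym_diagrams[of n]]) (auto simp: layer_diagrams_def)
  have "layer_map n k (comb I \<alpha> d) t =
    (\<Sum>i\<in>I. \<Sum>c\<in>{c \<in> layer_diagrams n k. (top_dangle c, bot_dangle c, through_perm c) = t}.
      if d i = c then \<alpha> i else 0)"
    unfolding layer_map_def comb_def by (rule sum.swap)
  also have "\<dots> = (\<Sum>i\<in>I. if (top_dangle (d i), bot_dangle (d i), through_perm (d i)) = t then \<alpha> i else 0)"
    using fin assms by (intro sum.cong HOL.refl) (simp add: sum.delta)
  finally show "layer_map n k (comb I \<alpha> d) t =
    comb I \<alpha> (\<lambda>i. (top_dangle (d i), bot_dangle (d i), through_perm (d i))) t" by (simp add: comb_def)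
qed

lemma layer_map_add: "layer_map n k (\<lambda>z. x z + y z) = (\<lambda>t. layer_map n k x t + layer_map n k y t)"
  by (simp add: layer_map_def sum.distrib)

lemma hyp_inverse:
  assumes "\<pi> \<in> hyperoctahedral m" shows "inv_into UNIV \<pi> \<in> hyperoctahedral m"
proof -
  have p: "\<pi> permutes {1..2*m}" and r: "\<And>j. j \<in> {1..2*m} \<Longrightarrow> \<pi> (2*m + 1 - j) = 2*m + 1 - \<pi> j"
    using assms by (simp_all add: hyperoctahedral_def)
  have "inv_into UNIV \<pi> (2*m + 1 - j) = 2*m + 1 - inv_into UNIV \<pi> j" if j: "j \<in> {1..2*m}" for j
  proof -
    let ?i = "inv_into UNIV \<pi> j"
    have "?i \<in> {1..2*m}" using permutes_in_image[OF permutes_inv[OF p]] j by blast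
    then have "\<pi> (2*m + 1 - ?i) = 2*m + 1 - j" using r permutes_inverses(1)[OF p] by simp
    then show ?thesis using permutes_inverses(2)[OF p] by metis
  qed
  then show ?thesis using permutes_inv[OF p] by (simp add: hyperoctahedral_def)
qed

lemma id_hyp: "id \<in> hyperoctahedral m"
  by (simp add: hyperoctahedral_def permutes_id)

lemma hyp_comp: "\<pi> \<in> hyperoctahedral m \<Longrightarrow> \<rho> \<in> hyperoctahedral m \<Longrightarrow> \<rho> \<circ> \<pi> \<in> hyperoctahedral m"
proof -
  assume *: "\<pi> \<in> hyperoctahedral m" "\<rho> \<in> hyperoctahedral m"
  have "\<pi> j \<in> {1..2*m}" if "j \<in> {1..2*m}" for j
    using * that permutes_in_image by (fastforce simp: hyperoctahedral_def)
  then show ?thesis using * permutes_compose[of \<pi> "{1..2*m}" \<rho>] by (simp add: hyperoctahedral_def)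
qed

lemma hyp_involutive:
  assumes "ring (hyp_algebra m :: ('r::field, _) module)"
  shows "involutive_algebra (hyp_algebra m :: ('r, _) module) (hyp_inv m)"
  unfolding hyp_algebra_def
proof (rule based_involutive_algebra[where s="inv_into UNIV"])
  show "ring (based_algebra (hyperoctahedral m) (\<lambda>_ _. 1 :: 'r) (\<lambda>\<pi> \<rho>. \<rho> \<circ> \<pi>) id)"
    using assms by (simp add: hyp_algebra_def)
  have bij: "bij \<pi>" if "\<pi> \<in> hyperoctahedral m" for \<pi>
    using that permutes_bij by (auto simp: hyperoctahedral_def)
  show "inv_into UNIV (inv_into UNIV z) = z" if "z \<in> hyperoctahedral m" for z
    using inv_inv_eq[OF bij[OF that]] .
  show "inv_into UNIV a \<circ> inv_into UNIV b = inv_into UNIV (b \<circ> a)"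
    if "a \<in> hyperoctahedral m" "b \<in> hyperoctahedral m" for a b
    using o_inv_distrib[OF bij[OF that(2)] bij[OF that(1)]] by simp
qed (auto simp: hyp_inverse hyp_comp hyp_inv_def)

lemma brauer_involutive:
  assumes R: "ring (brauer_C n (\<delta> :: 'r::field))" and \<delta>: "\<delta> \<noteq> 0"
  shows "involutive_algebra (brauer_C n \<delta>) brauer_inv"
  unfolding brauer_C_def
proof (rule based_involutive_algebra[where s=swap_diagram])
  show R': "ring (based_algebra (sym_diagrams n) (\<lambda>d e. \<delta> ^ closed_loops d e) diagram_mult (identity_diagram (2*n)))"
    using R by (simp add: brauer_C_def)
  show "diagram_mult a b \<in> sym_diagrams n" if "a \<in> sym_diagrams n" "b \<in> sym_diagrams n" for a b
    using ring_based_product_closed[OF R' finite_sym_diagrams that] \<delta> by simp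
  show "diagram_mult (swap_diagram b) (swap_diagram a) = swap_diagram (diagram_mult a b)" for a b
    by (rule diagram_mult_swap)
  show "\<delta> ^ closed_loops (swap_diagram b) (swap_diagram a) = \<delta> ^ closed_loops a b" for a b
    by (simp only: closed_loops_swap)
  show "swap_diagram z \<in> sym_diagrams n" if "z \<in> sym_diagrams n" for z by (rule swap_sym_diagram[OF that])
  show "swap_diagram (swap_diagram z) = z" for z by simp
  fix f :: "node set set \<Rightarrow> 'r" and z
  assume f: "f \<in> carrier (based_algebra (sym_diagrams n) (\<lambda>d e. \<delta> ^ closed_loops d e) diagram_mult (identity_diagram (2*n)))"
  show "brauer_inv f z = (if z \<in> sym_diagrams n then f (swap_diagram z) else 0)"
  proof (cases "z \<in> sym_diagrams n")
    case False
    then have "swap_diagram z \<notin> sym_diagrams n" using swap_sym_diagram swap_diagram_swap_diagram by metis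
    then show ?thesis using f False by (simp add: brauer_inv_def)
  qed (simp add: brauer_inv_def)
qed

section \<open>One layer of the Brauer algebra\<close>

lemma comb_cong:
  "(\<And>i. i \<in> I \<Longrightarrow> \<alpha> i = \<beta> i) \<Longrightarrow> (\<And>i. i \<in> I \<Longrightarrow> d i = d' i) \<Longrightarrow> comb I \<alpha> d = comb I \<beta> d'"
  unfolding comb_def by (intro ext sum.cong) auto

text \<open>The dangle \<open>g\<close> is the one on which the idempotent is built. It has to be in the support of
  \<open>v\<^sub>k\<close>, because an element \<open>e \<otimes> v\<^sub>k \<otimes> h\<close> is recovered from its coefficients at \<open>g\<close>.\<close>

locale brauer_layer =
  fixes n k :: nat and \<delta> :: "'r::field"
    and C :: "nat \<Rightarrow> ((nat \<Rightarrow> nat) \<Rightarrow> 'r) cell_data"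
    and v :: "nat \<Rightarrow> nat set set \<Rightarrow> 'r"
    and E :: "(node set set \<Rightarrow> 'r) cell_data"
    and g :: "nat set set"
  assumes \<delta>: "\<delta> \<noteq> 0" and k: "k \<le> n"
    and chainH: "\<And>m. cell_chain (hyp_algebra m) (hyp_inv m) (C m)"
    and v_space: "v k \<in> dangle_space n k" and v_g: "v k g \<noteq> 0"
    and structE: "brauer_cell_structure n \<delta> C v E"
begin

abbreviation "B \<equiv> brauer_C n \<delta>"
abbreviation H :: "('r, (nat \<Rightarrow> nat) \<Rightarrow> 'r) module" where "H \<equiv> hyp_algebra (n - k)"
abbreviation "Hyp \<equiv> hyperoctahedral (n - k)"
abbreviation "V \<equiv> v k"
abbreviation "CH \<equiv> C (n - k)"
abbreviation "start \<equiv> layer_start C (n - k)"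
abbreviation "W \<equiv> layer_column n k V"
abbreviation "act \<equiv> layer_smult n \<delta> k"
abbreviation "\<psi> \<equiv> layer_map n k"

lemma V_out: "f \<notin> dangles n k \<Longrightarrow> V f = 0"
  using v_space by (simp add: dangle_space_def)

lemma g: "g \<in> dangles n k"
  using V_out v_g by blast

lemma ring_H: "ring H"
proof -
  have "ideal (chain_ideal CH 0) H" using chainH[of "n - k"] unfolding cell_chain_def by blast
  then show ?thesis by (rule ideal.axioms(2))
qed

lemma chainE: "cell_chain B brauer_inv E"
  and lengthE: "chain_length E = layer_start C (Suc n)"
  and idealE: "j \<le> chain_length CH \<Longrightarrow> chain_ideal E (start + j) = layer_preimage n k (chain_ideal CH j)"
  and isoE: "j < chain_length CH \<Longrightarrow>
    module_isomorphic B (cell_module B E (start + j)) (inflated_module n \<delta> k V (cell_module H CH j))"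
  using structE k by (simp_all add: brauer_cell_structure_def)

lemma ring_B: "ring B"
proof -
  have "ideal (chain_ideal E 0) B" using chainE unfolding cell_chain_def by blast
  then show ?thesis by (rule ideal.axioms(2))
qed

sublocale H: involutive_algebra H "hyp_inv (n - k)" by (rule hyp_involutive[OF ring_H])
sublocale B: involutive_algebra B brauer_inv by (rule brauer_involutive[OF ring_B \<delta>])

lemma position_le: "j \<le> chain_length CH \<Longrightarrow> start + j \<le> chain_length E"
proof -
  assume j: "j \<le> chain_length CH"
  have "start + chain_length CH = (\<Sum>l<Suc (n - k). chain_length (C l))"
    by (simp add: layer_start_def)
  also have "\<dots> \<le> (\<Sum>l<Suc n. chain_length (C l))" by (rule sum_mono2) auto
  finally show ?thesis using j lengthE by (simp add: layer_start_def)
qed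

lemma position_less: "j < chain_length CH \<Longrightarrow> start + j < chain_length E"
  using position_le[of "Suc j"] by simp

lemma preimage_ideal: "j \<le> chain_length CH \<Longrightarrow> ideal (layer_preimage n k (chain_ideal CH j)) B"
  using chainE position_le[of j] unfolding cell_chain_def idealE[of j, symmetric] by simp

text \<open>The elements of \<open>J\<^sub>k\<close> that vanish in the layer, and those whose image in the layer is supported on
  \<open>V \<otimes> V \<otimes> RH\<^sub>n\<^sub>-\<^sub>k\<close>. They are the first and the last ideal of the part of the given
  cell chain that belongs to the layer.\<close>

definition "below_layer = layer_preimage n k {\<zero>\<^bsub>H\<^esub>}"
definition "upto_layer = layer_preimage n k (carrier H)"

lemma below_layer_ideal: "ideal below_layer B" and upto_layer_ideal: "ideal upto_layer B"
  using preimage_ideal[of 0] preimage_ideal[of "chain_length CH"] chainH[of "n - k"]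
  by (simp_all add: cell_chain_def below_layer_def upto_layer_def)

lemma upto_layer_B: "x \<in> upto_layer \<Longrightarrow> x \<in> carrier B"
  using additive_subgroup.a_subset[OF ideal.axioms(1)[OF upto_layer_ideal]] by auto

lemma B_add: "x \<oplus>\<^bsub>B\<^esub> y = (\<lambda>d. x d + y d)"
  by (simp add: brauer_C_def)

lemma H_add: "x \<oplus>\<^bsub>H\<^esub> y = (\<lambda>\<pi>. x \<pi> + y \<pi>)" and H_smult: "c \<odot>\<^bsub>H\<^esub> x = (\<lambda>\<pi>. c * x \<pi>)"
  and H_zero: "\<zero>\<^bsub>H\<^esub> = (\<lambda>_. 0)" and H_one: "\<one>\<^bsub>H\<^esub> = (\<lambda>\<pi>. if \<pi> = id then 1 else 0)"
  and H_carrier: "h \<in> carrier H \<longleftrightarrow> (\<forall>\<pi>. \<pi> \<notin> Hyp \<longrightarrow> h \<pi> = 0)"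
  by (simp_all add: hyp_algebra_def)

lemma B_minus: "x \<in> carrier B \<Longrightarrow> y \<in> carrier B \<Longrightarrow> x \<ominus>\<^bsub>B\<^esub> y = (\<lambda>d. x d - y d)"
proof -
  assume xy: "x \<in> carrier B" "y \<in> carrier B"
  have "x \<ominus>\<^bsub>B\<^esub> y \<oplus>\<^bsub>B\<^esub> y = x" using xy by (simp add: B.minus_eq B.a_assoc B.l_neg)
  then have "(x \<ominus>\<^bsub>B\<^esub> y) d + y d = x d" for d unfolding B_add by (rule fun_cong)
  then show ?thesis by (auto simp: fun_eq_iff eq_diff_eq)
qed

lemma preimage_iff: "x \<in> layer_preimage n k I \<longleftrightarrow> x \<in> arc_ideal n k \<and> (\<forall>e f. (\<lambda>\<pi>. \<psi> x (e, f, \<pi>)) \<in> I)"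
  by (simp add: layer_preimage_def)

lemma diff_in_below_layer:
  assumes "x \<in> upto_layer" "y \<in> upto_layer" "\<psi> x = \<psi> y" shows "x \<ominus>\<^bsub>B\<^esub> y \<in> below_layer"
proof -
  have "x \<ominus>\<^bsub>B\<^esub> y \<in> upto_layer"
    using additive_subgroup.a_closed[OF ideal.axioms(1)[OF upto_layer_ideal] assms(1)]
      additive_subgroup.a_inv_closed[OF ideal.axioms(1)[OF upto_layer_ideal] assms(2)] by (simp add: B.minus_eq)
  moreover have "\<psi> (x \<ominus>\<^bsub>B\<^esub> y) = (\<lambda>_. 0)"
  proof -
    have "x = (\<lambda>d. (x \<ominus>\<^bsub>B\<^esub> y) d + y d)" unfolding B_minus[OF upto_layer_B[OF assms(1)] upto_layer_B[OF assms(2)]] by simp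
    then have "\<psi> x = (\<lambda>t. \<psi> (x \<ominus>\<^bsub>B\<^esub> y) t + \<psi> y t)" by (metis layer_map_add)
    then have "\<psi> (x \<ominus>\<^bsub>B\<^esub> y) t + \<psi> y t = \<psi> x t" for t by metis
    then show ?thesis using assms(3) by auto
  qed
  ultimately show ?thesis unfolding below_layer_def upto_layer_def preimage_iff by (simp add: H_zero)
qed

text \<open>The action on the layer is defined with an arbitrary preimage under \<open>\<psi>\<close>. Another preimage differs
  by an element of an ideal on which \<open>\<psi>\<close> vanishes.\<close>

lemma layer_smult_layer_map:
  assumes b: "b \<in> carrier B" and x: "x \<in> upto_layer"
  shows "act b (\<psi> x) = \<psi> (b \<otimes>\<^bsub>B\<^esub> x)"
proof -
  let ?y = "inv_into (arc_ideal n k) \<psi> (\<psi> x)"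
  have "x \<in> arc_ideal n k" using x by (simp add: upto_layer_def preimage_iff)
  then have im: "\<psi> x \<in> \<psi> ` arc_ideal n k" by (rule imageI)
  note y = inv_into_into[OF im] f_inv_into_f[OF im]
  then have yJ: "?y \<in> upto_layer" using x by (simp add: upto_layer_def preimage_iff)
  have "?y \<ominus>\<^bsub>B\<^esub> x \<in> below_layer" by (rule diff_in_below_layer[OF yJ x y(2)])
  then have K: "b \<otimes>\<^bsub>B\<^esub> (?y \<ominus>\<^bsub>B\<^esub> x) \<in> below_layer" by (rule ideal.I_l_closed[OF below_layer_ideal _ b])
  have c: "?y \<in> carrier B" "x \<in> carrier B" using upto_layer_B yJ x by auto
  have "b \<otimes>\<^bsub>B\<^esub> ?y = b \<otimes>\<^bsub>B\<^esub> (?y \<ominus>\<^bsub>B\<^esub> x) \<oplus>\<^bsub>B\<^esub> b \<otimes>\<^bsub>B\<^esub> x"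
  proof -
    have "?y \<ominus>\<^bsub>B\<^esub> x \<oplus>\<^bsub>B\<^esub> x = ?y" using c by (simp add: B.minus_eq B.a_assoc B.l_neg)
    then show ?thesis using B.r_distr[of "?y \<ominus>\<^bsub>B\<^esub> x" x b] b c by simp
  qed
  then have "\<psi> (b \<otimes>\<^bsub>B\<^esub> ?y) = (\<lambda>t. \<psi> (b \<otimes>\<^bsub>B\<^esub> (?y \<ominus>\<^bsub>B\<^esub> x)) t + \<psi> (b \<otimes>\<^bsub>B\<^esub> x) t)"
    unfolding B_add by (simp only: layer_map_add)
  moreover have "\<psi> (b \<otimes>\<^bsub>B\<^esub> (?y \<ominus>\<^bsub>B\<^esub> x)) = (\<lambda>_. 0)"
  proof
    fix t :: "nat set set \<times> nat set set \<times> (nat \<Rightarrow> nat)"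
    obtain e f \<pi> where t: "t = (e, f, \<pi>)" by (cases t)
    have "(\<lambda>\<pi>. \<psi> (b \<otimes>\<^bsub>B\<^esub> (?y \<ominus>\<^bsub>B\<^esub> x)) (e, f, \<pi>)) = (\<lambda>_. 0)"
      using K unfolding below_layer_def preimage_iff H_zero by simp
    then show "\<psi> (b \<otimes>\<^bsub>B\<^esub> (?y \<ominus>\<^bsub>B\<^esub> x)) t = 0" unfolding t by (rule fun_cong)
  qed
  ultimately show ?thesis by (simp add: layer_smult_def)
qed

abbreviation "diagram_of \<equiv> \<lambda>(e, f, \<pi>). layer_diagram e f \<pi>"

lemma dangle_pair: "e \<in> dangles n k \<Longrightarrow> f \<in> dangles n k \<Longrightarrow> \<pi> \<in> Hyp \<Longrightarrow> dangle_pair n k e f \<pi>"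
  by unfold_locales

abbreviation "\<Omega> \<equiv> dangles n k \<times> dangles n k \<times> Hyp"

lemma diagram_of_layer: "t \<in> \<Omega> \<Longrightarrow> diagram_of t \<in> layer_diagrams n k"
  using dangle_pair.D_layer[OF dangle_pair] by auto

lemma diagram_of_coords: "t \<in> \<Omega> \<Longrightarrow> (top_dangle (diagram_of t), bot_dangle (diagram_of t), through_perm (diagram_of t)) = t"
  using dangle_pair.D_top_dangle[OF dangle_pair] dangle_pair.D_bot_dangle[OF dangle_pair]
    dangle_pair.D_through_perm[OF dangle_pair] by auto

lemma layer_sym: "d \<in> layer_diagrams n k \<Longrightarrow> d \<in> sym_diagrams n"
  by (simp add: layer_diagrams_def)

lemma layer_comb:
  assumes "t ` I \<subseteq> \<Omega>"
  shows "\<psi> (comb I \<alpha> (\<lambda>i. diagram_of (t i))) = comb I \<alpha> t" and "comb I \<alpha> (\<lambda>i. diagram_of (t i)) \<in> upto_layer"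
proof -
  have t: "t i \<in> \<Omega>" if "i \<in> I" for i using assms that by blast
  have "\<psi> (comb I \<alpha> (\<lambda>i. diagram_of (t i))) =
    comb I \<alpha> (\<lambda>i. (top_dangle (diagram_of (t i)), bot_dangle (diagram_of (t i)), through_perm (diagram_of (t i))))"
    by (rule layer_map_comb) (rule diagram_of_layer[OF t])
  also have "\<dots> = comb I \<alpha> t" unfolding comb_def by (intro ext sum.cong HOL.refl) (simp only: diagram_of_coords[OF t])
  finally show 1: "\<psi> (comb I \<alpha> (\<lambda>i. diagram_of (t i))) = comb I \<alpha> t" .
  have "comb I \<alpha> (\<lambda>i. diagram_of (t i)) \<in> arc_ideal n k"
    unfolding arc_ideal_def
  proof (intro CollectI allI impI)
    fix d assume "comb I \<alpha> (\<lambda>i. diagram_of (t i)) d \<noteq> 0"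
    then have "\<exists>i\<in>I. (if diagram_of (t i) = d then \<alpha> i else 0) \<noteq> 0"
      unfolding comb_def by (rule contrapos_np) (rule sum.neutral, blast)
    then obtain i where "i \<in> I" "diagram_of (t i) = d" by (auto split: if_splits)
    then have "d \<in> layer_diagrams n k" using diagram_of_layer[OF t] by blast
    then show "d \<in> sym_diagrams n \<and> k \<le> top_arcs d \<and> k \<le> bot_arcs d" by (simp add: layer_diagrams_def)
  qed
  moreover have "(\<lambda>\<pi>. comb I \<alpha> t (e, f, \<pi>)) \<in> carrier H" for e f
    unfolding H_carrier comb_def using t by (force intro!: sum.neutral)
  ultimately show "comb I \<alpha> (\<lambda>i. diagram_of (t i)) \<in> upto_layer" unfolding upto_layer_def preimage_iff 1 by blast
qed

lemma comb_diagram_of_mult: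
  assumes "t ` I \<subseteq> \<Omega>" "s ` J \<subseteq> \<Omega>" "\<And>i j. i \<in> I \<Longrightarrow> j \<in> J \<Longrightarrow> fst (snd (t i)) = fst (s j)"
  shows "comb I \<alpha> (\<lambda>i. diagram_of (t i)) \<otimes>\<^bsub>B\<^esub> comb J \<beta> (\<lambda>j. diagram_of (s j)) =
    comb (I \<times> J) (\<lambda>(i, j). \<delta> ^ k * \<alpha> i * \<beta> j)
      (\<lambda>(i, j). diagram_of (fst (t i), fst (snd (s j)), snd (snd (s j)) \<circ> snd (snd (t i))))"
proof -
  have I: "(\<lambda>i. diagram_of (t i)) ` I \<subseteq> sym_diagrams n" using assms(1) diagram_of_layer layer_sym by blast
  have J: "(\<lambda>j. diagram_of (s j)) ` J \<subseteq> sym_diagrams n" using assms(2) diagram_of_layer layer_sym by blast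
  have prod: "diagram_mult (diagram_of (t i)) (diagram_of (s j)) =
      diagram_of (fst (t i), fst (snd (s j)), snd (snd (s j)) \<circ> snd (snd (t i)))"
    "closed_loops (diagram_of (t i)) (diagram_of (s j)) = k" if "i \<in> I" "j \<in> J" for i j
  proof -
    obtain e f \<pi> where t: "t i = (e, f, \<pi>)" by (cases "t i")
    obtain f' h \<rho> where s: "s j = (f', h, \<rho>)" by (cases "s j")
    have "t i \<in> \<Omega>" "s j \<in> \<Omega>" using assms(1,2) imageI[OF that(1), of t] imageI[OF that(2), of s] by auto
    moreover have "f' = f" using assms(3)[OF that] t s by simp
    ultimately have "t i \<in> \<Omega>" "s j \<in> \<Omega>" "f' = f" by auto
    then show "diagram_mult (diagram_of (t i)) (diagram_of (s j)) =
      diagram_of (fst (t i), fst (snd (s j)), snd (snd (s j)) \<circ> snd (snd (t i)))"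
      "closed_loops (diagram_of (t i)) (diagram_of (s j)) = k"
      using layer_diagram_mult[of e n k f h \<pi> \<rho>] unfolding t s by auto
  qed
  show ?thesis
    unfolding brauer_C_def comb_mult[OF finite_sym_diagrams I J] unfolding comb_def
    by (intro ext sum.cong HOL.refl) (auto simp: prod)
qed

text \<open>The lift of \<open>h\<close> to the corner. A product of two diagrams that meet in \<open>g\<close> carries the factor
  \<open>\<delta>\<^sup>k\<close>, which is compensated here.\<close>

definition \<theta> :: "((nat \<Rightarrow> nat) \<Rightarrow> 'r) \<Rightarrow> node set set \<Rightarrow> 'r" where
  "\<theta> h = comb Hyp (\<lambda>\<pi>. h \<pi> / \<delta> ^ k) (\<lambda>\<pi>. diagram_of (g, g, \<pi>))"

definition "base_idem = \<theta> \<one>\<^bsub>H\<^esub>"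

lemma \<theta>_upto_layer: "\<theta> h \<in> upto_layer" and \<psi>_\<theta>: "\<psi> (\<theta> h) = comb Hyp (\<lambda>\<pi>. h \<pi> / \<delta> ^ k) (\<lambda>\<pi>. (g, g, \<pi>))"
proof -
  have *: "(\<lambda>\<pi>. (g, g, \<pi>)) ` Hyp \<subseteq> \<Omega>" using g by auto
  show "\<theta> h \<in> upto_layer" "\<psi> (\<theta> h) = comb Hyp (\<lambda>\<pi>. h \<pi> / \<delta> ^ k) (\<lambda>\<pi>. (g, g, \<pi>))"
    unfolding \<theta>_def by (rule layer_comb[OF *])+
qed

lemma comb_Hyp_eval: "comb Hyp \<alpha> (\<lambda>\<pi>. (e', f', \<pi>)) (e, f, \<pi>) = (if e = e' \<and> f = f' \<and> \<pi> \<in> Hyp then \<alpha> \<pi> else 0)"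
proof -
  have "comb Hyp \<alpha> (\<lambda>\<pi>. (e', f', \<pi>)) (e, f, \<pi>) = (\<Sum>\<rho>\<in>Hyp. if \<rho> = \<pi> then (if e = e' \<and> f = f' then \<alpha> \<pi> else 0) else 0)"
    unfolding comb_def by (intro sum.cong HOL.refl) auto
  also have "\<dots> = (if e = e' \<and> f = f' \<and> \<pi> \<in> Hyp then \<alpha> \<pi> else 0)"
    using finite_hyperoctahedral[of "n - k"] by (simp add: sum.delta)
  finally show ?thesis .
qed

lemma base_idem_single: "base_idem = comb {id} (\<lambda>_. 1 / \<delta> ^ k) (\<lambda>\<pi>. diagram_of (g, g, \<pi>))"
proof
  fix d
  have "base_idem d = (\<Sum>\<pi>\<in>Hyp. if \<pi> = id then (if diagram_of (g, g, id) = d then 1 / \<delta> ^ k else 0) else 0)"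
    unfolding base_idem_def \<theta>_def comb_def H_one by (intro sum.cong HOL.refl) auto
  also have "\<dots> = comb {id} (\<lambda>_. 1 / \<delta> ^ k) (\<lambda>\<pi>. diagram_of (g, g, \<pi>)) d"
    using id_hyp[of "n - k"] finite_hyperoctahedral[of "n - k"] by (simp add: sum.delta comb_def)
  finally show "base_idem d = comb {id} (\<lambda>_. 1 / \<delta> ^ k) (\<lambda>\<pi>. diagram_of (g, g, \<pi>)) d" .
qed

lemma base_idem_support: "base_idem d \<noteq> 0 \<Longrightarrow> d = layer_diagram g g id"
  unfolding base_idem_single comb_def by (simp split: if_splits)

lemma base_idem_idem: "base_idem \<otimes>\<^bsub>B\<^esub> base_idem = base_idem"
proof -
  have *: "(\<lambda>\<pi>. (g, g, \<pi>)) ` {id} \<subseteq> \<Omega>" using g id_hyp by auto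
  show ?thesis
    unfolding base_idem_single using comb_diagram_of_mult[OF * *, of "\<lambda>_. 1 / \<delta> ^ k" "\<lambda>_. 1 / \<delta> ^ k"] \<delta>
    by (simp add: comb_def cong: if_cong)
qed

lemma gg_layer: "layer_diagram g g id \<in> layer_diagrams n k"
  using diagram_of_layer[of "(g, g, id)"] g id_hyp by simp

lemma base_idem_left_support:
  assumes "d \<in> layer_diagrams n k" "(base_idem \<otimes>\<^bsub>B\<^esub> x) d \<noteq> 0" shows "top_dangle d = g"
proof -
  obtain a b where "base_idem a \<noteq> 0" "diagram_mult a b = d"
    using based_mult_support[where x=base_idem and y=x and z=d] assms(2) unfolding brauer_C_def by blast
  then have d: "d = diagram_mult (layer_diagram g g id) b" using base_idem_support by blast
  have "top_dangle d = top_dangle (layer_diagram g g id)"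
    unfolding d by (rule top_dangle_mult[where n=n and k=k]) (use gg_layer assms(1) d in \<open>simp_all add: layer_diagrams_def\<close>)
  then show ?thesis using dangle_pair.D_top_dangle[OF dangle_pair[OF g g id_hyp]] by simp
qed

lemma base_idem_right_support:
  assumes "d \<in> layer_diagrams n k" "(x \<otimes>\<^bsub>B\<^esub> base_idem) d \<noteq> 0" shows "bot_dangle d = g"
proof -
  obtain a b where "base_idem b \<noteq> 0" "diagram_mult a b = d"
    using based_mult_support[where x=x and y=base_idem and z=d] assms(2) unfolding brauer_C_def by blast
  then have d: "d = diagram_mult a (layer_diagram g g id)" using base_idem_support by blast
  have "bot_dangle d = bot_dangle (layer_diagram g g id)"
    unfolding d by (rule bot_dangle_mult[where n=n and k=k]) (use gg_layer assms(1) d in \<open>simp_all add: layer_diagrams_def\<close>)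
  then show ?thesis using dangle_pair.D_bot_dangle[OF dangle_pair[OF g g id_hyp]] by simp
qed

lemma layer_map_nonzero:
  assumes "\<psi> x t \<noteq> 0"
  shows "\<exists>d\<in>layer_diagrams n k. (top_dangle d, bot_dangle d, through_perm d) = t \<and> x d \<noteq> 0"
proof (rule ccontr)
  assume no: "\<not> ?thesis"
  have "\<psi> x t = 0" unfolding layer_map_def using no by (intro sum.neutral) auto
  then show False using assms by simp
qed

lemma base_idem_B: "base_idem \<in> carrier B" and \<theta>_B: "\<theta> h \<in> carrier B"
  using \<theta>_upto_layer upto_layer_B by (auto simp: base_idem_def)

text \<open>The element \<open>ebe\<close> is in \<open>J\<^sub>k\<close>, and the diagrams of the layer that occur in it have the dangle
  \<open>g\<close> on both rows. So its image under \<open>\<psi>\<close> has the form \<open>g \<otimes> g \<otimes> h'\<close>, and \<open>\<theta> h\<close>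
  with \<open>h = \<delta>\<^sup>k h'\<close> has the same image.\<close>

lemma corner_element:
  assumes b: "b \<in> carrier B"
  shows "\<exists>h\<in>carrier H. \<exists>\<kappa>\<in>below_layer. base_idem \<otimes>\<^bsub>B\<^esub> b \<otimes>\<^bsub>B\<^esub> base_idem = \<theta> h \<oplus>\<^bsub>B\<^esub> \<kappa>"
proof -
  let ?y = "base_idem \<otimes>\<^bsub>B\<^esub> b \<otimes>\<^bsub>B\<^esub> base_idem"
  have yJ: "?y \<in> upto_layer"
    using ideal.I_l_closed[OF upto_layer_ideal] \<theta>_upto_layer b base_idem_B unfolding base_idem_def by simp
  define h where "h = (\<lambda>\<pi>. \<delta> ^ k * \<psi> ?y (g, g, \<pi>))"
  have "(\<lambda>\<pi>. \<psi> ?y (g, g, \<pi>)) \<in> carrier H" using yJ by (simp add: upto_layer_def preimage_iff)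
  then have h: "h \<in> carrier H" by (simp add: H_carrier h_def)
  have "\<psi> ?y = \<psi> (\<theta> h)"
  proof
    fix t :: "nat set set \<times> nat set set \<times> (nat \<Rightarrow> nat)"
    obtain e f \<pi> where t: "t = (e, f, \<pi>)" by (cases t)
    have zero: "\<psi> ?y (e, f, \<pi>) = 0" if "\<not> (e = g \<and> f = g \<and> \<pi> \<in> Hyp)"
    proof (rule ccontr)
      assume nz: "\<psi> ?y (e, f, \<pi>) \<noteq> 0"
      then obtain d where d: "d \<in> layer_diagrams n k" "top_dangle d = e" "bot_dangle d = f" "?y d \<noteq> 0"
        using layer_map_nonzero by blast
      have "?y = base_idem \<otimes>\<^bsub>B\<^esub> (b \<otimes>\<^bsub>B\<^esub> base_idem)" using b base_idem_B by (simp add: B.m_assoc)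
      then have "top_dangle d = g" using base_idem_left_support[OF d(1)] d(4) by simp
      moreover have "bot_dangle d = g" using base_idem_right_support[OF d(1)] d(4) by simp
      moreover have "\<pi> \<in> Hyp" using nz yJ by (auto simp: upto_layer_def preimage_iff H_carrier)
      ultimately show False using that d by simp
    qed
    show "\<psi> ?y t = \<psi> (\<theta> h) t"
      unfolding t \<psi>_\<theta> comb_Hyp_eval using zero \<delta> by (auto simp: h_def)
  qed
  then have K: "?y \<ominus>\<^bsub>B\<^esub> \<theta> h \<in> below_layer" by (rule diff_in_below_layer[OF yJ \<theta>_upto_layer])
  have y: "?y \<in> carrier B" by (rule upto_layer_B[OF yJ])
  then have "?y \<ominus>\<^bsub>B\<^esub> \<theta> h \<oplus>\<^bsub>B\<^esub> \<theta> h = ?y" using \<theta>_B by (simp add: B.minus_eq B.a_assoc B.l_neg)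
  then have "?y = \<theta> h \<oplus>\<^bsub>B\<^esub> (?y \<ominus>\<^bsub>B\<^esub> \<theta> h)"
    using B.a_comm[OF \<theta>_B, of "?y \<ominus>\<^bsub>B\<^esub> \<theta> h" h] B.minus_closed[OF y \<theta>_B] by simp
  then show ?thesis using h K by blast
qed

sublocale corner B H base_idem \<theta> below_layer
proof (intro corner.intro corner_axioms.intro ring_B ring_H)
  show "below_layer \<subseteq> carrier B" using additive_subgroup.a_subset[OF ideal.axioms(1)[OF below_layer_ideal]] .
qed (use base_idem_B \<theta>_B base_idem_idem corner_element in auto)

text \<open>\<open>e' \<otimes> v\<^sub>k \<otimes> h\<close> as a function on triples. As a right module, \<open>V \<otimes> v\<^sub>k \<otimes> RH\<^sub>n\<^sub>-\<^sub>k\<close>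
  is free on the elements \<open>e' \<otimes> v\<^sub>k \<otimes> 1\<close>.\<close>

definition column :: "nat set set \<Rightarrow> ((nat \<Rightarrow> nat) \<Rightarrow> 'r) \<Rightarrow> 'r layer" where
  "column e' h = (\<lambda>(e, f, \<pi>). if e = e' then V f * h \<pi> else 0)"

lemma W_carrier: "F \<in> carrier W \<longleftrightarrow>
    (\<exists>G. (\<forall>e\<in>dangles n k. G e \<in> carrier H) \<and> F = (\<lambda>(e, f, \<pi>). if e \<in> dangles n k then V f * G e \<pi> else 0))"
  by (auto simp: layer_column_def)

lemma W_add: "F \<oplus>\<^bsub>W\<^esub> F' = (\<lambda>t. F t + F' t)"
  and W_smult: "h \<odot>\<^bsub>W\<^esub> F = (\<lambda>(e, f, \<pi>). ((\<lambda>\<rho>. F (e, f, \<rho>)) \<otimes>\<^bsub>H\<^esub> h) \<pi>)"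
  by (simp_all add: layer_column_def)

lemma column_W:
  assumes "e' \<in> dangles n k" "h \<in> carrier H" shows "column e' h \<in> carrier W"
  unfolding W_carrier column_def
proof (intro exI[of _ "\<lambda>e. if e = e' then h else \<zero>\<^bsub>H\<^esub>"] conjI ballI)
  show "(if e = e' then h else \<zero>\<^bsub>H\<^esub>) \<in> carrier H" for e using assms(2) H.zero_closed by simp
qed (use assms(1) in \<open>auto simp: H_zero fun_eq_iff\<close>)

lemma scaled_mult: "G \<in> carrier H \<Longrightarrow> h \<in> carrier H \<Longrightarrow> (\<lambda>\<rho>. c * G \<rho>) \<otimes>\<^bsub>H\<^esub> h = (\<lambda>\<pi>. c * (G \<otimes>\<^bsub>H\<^esub> h) \<pi>)"
  using H.smult_mult_l[of G h c] by (simp only: H_smult)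

lemma zero_mult: "h \<in> carrier H \<Longrightarrow> (\<lambda>_. 0) \<otimes>\<^bsub>H\<^esub> h = (\<lambda>_. 0)"
  using H.l_null[of h] by (simp only: H_zero)

lemma W_smult_form:
  assumes h: "h \<in> carrier H" and G: "\<And>e. e \<in> dangles n k \<Longrightarrow> G e \<in> carrier H"
  shows "h \<odot>\<^bsub>W\<^esub> (\<lambda>(e, f, \<pi>). if e \<in> dangles n k then V f * G e \<pi> else 0) =
    (\<lambda>(e, f, \<pi>). if e \<in> dangles n k then V f * (G e \<otimes>\<^bsub>H\<^esub> h) \<pi> else 0)"
proof -
  have "((\<lambda>\<rho>. if e \<in> dangles n k then V f * G e \<rho> else 0) \<otimes>\<^bsub>H\<^esub> h) \<pi> =
      (if e \<in> dangles n k then V f * (G e \<otimes>\<^bsub>H\<^esub> h) \<pi> else 0)" for e f \<pi>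
    using scaled_mult[OF G h] zero_mult[OF h] by (cases "e \<in> dangles n k") simp_all
  then show ?thesis unfolding W_smult by (intro ext) (simp only: split_paired_all prod.case)
qed

lemma column_smult:
  assumes "e' \<in> dangles n k" "h \<in> carrier H" "h' \<in> carrier H"
  shows "h \<odot>\<^bsub>W\<^esub> column e' h' = column e' (h' \<otimes>\<^bsub>H\<^esub> h)"
proof -
  have "((\<lambda>\<rho>. if e = e' then V f * h' \<rho> else 0) \<otimes>\<^bsub>H\<^esub> h) \<pi> = (if e = e' then V f * (h' \<otimes>\<^bsub>H\<^esub> h) \<pi> else 0)" for e f \<pi>
    using scaled_mult[OF assms(3,2)] zero_mult[OF assms(2)] by (cases "e = e'") simp_all
  then show ?thesis unfolding W_smult column_def by (intro ext) (simp only: split_paired_all prod.case)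
qed

lemma tensor_pair_W:
  assumes "left_module H M" shows "tensor_pair H W M"
proof -
  interpret M: left_module H M by (rule assms)
  show ?thesis
  proof
    fix F F' assume "F \<in> carrier W" "F' \<in> carrier W"
    then obtain G G' where G: "\<forall>e\<in>dangles n k. G e \<in> carrier H" "\<forall>e\<in>dangles n k. G' e \<in> carrier H"
      "F = (\<lambda>(e, f, \<pi>). if e \<in> dangles n k then V f * G e \<pi> else 0)"
      "F' = (\<lambda>(e, f, \<pi>). if e \<in> dangles n k then V f * G' e \<pi> else 0)" unfolding W_carrier by blast
    then show "F \<oplus>\<^bsub>W\<^esub> F' \<in> carrier W"
      unfolding W_carrier W_add
      by (intro exI[of _ "\<lambda>e. G e \<oplus>\<^bsub>H\<^esub> G' e"]) (auto simp: H_add H_carrier distrib_left)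
  next
    fix h F assume h: "h \<in> carrier H" and "F \<in> carrier W"
    then obtain G where G: "\<And>e. e \<in> dangles n k \<Longrightarrow> G e \<in> carrier H"
      "F = (\<lambda>(e, f, \<pi>). if e \<in> dangles n k then V f * G e \<pi> else 0)" unfolding W_carrier by blast
    have "h \<odot>\<^bsub>W\<^esub> F = (\<lambda>(e, f, \<pi>). if e \<in> dangles n k then V f * (G e \<otimes>\<^bsub>H\<^esub> h) \<pi> else 0)"
      unfolding G(2) by (rule W_smult_form[OF h]) (rule G(1))
    then show "h \<odot>\<^bsub>W\<^esub> F \<in> carrier W"
      unfolding W_carrier
      by (intro exI[of _ "\<lambda>e. G e \<otimes>\<^bsub>H\<^esub> h"] conjI ballI H.m_closed G(1) h)
  qed (use M.smult_closed in auto)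
qed

text \<open>A preimage of \<open>g \<otimes> v\<^sub>k \<otimes> 1\<close> under \<open>\<psi>\<close>.\<close>

definition "base_lift = comb (dangles n k) V (\<lambda>f. diagram_of (g, f, id))"

lemma base_lift_upto_layer: "base_lift \<in> upto_layer" and \<psi>_base_lift: "\<psi> base_lift = column g \<one>\<^bsub>H\<^esub>"
proof -
  have *: "(\<lambda>f. (g, f, id)) ` dangles n k \<subseteq> \<Omega>" using g id_hyp by auto
  show "base_lift \<in> upto_layer" unfolding base_lift_def by (rule layer_comb(2)[OF *])
  have "comb (dangles n k) V (\<lambda>f. (g, f, id)) (e, f, \<pi>) = column g \<one>\<^bsub>H\<^esub> (e, f, \<pi>)" for e f \<pi>
  proof -
    have "comb (dangles n k) V (\<lambda>f. (g, f, id)) (e, f, \<pi>) =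
      (\<Sum>f'\<in>dangles n k. if f' = f then (if e = g \<and> \<pi> = id then V f else 0) else 0)"
      unfolding comb_def by (intro sum.cong HOL.refl) auto
    also have "\<dots> = (if f \<in> dangles n k then (if e = g \<and> \<pi> = id then V f else 0) else 0)"
      using finite_dangles[of n k] by (simp add: sum.delta)
    also have "\<dots> = column g \<one>\<^bsub>H\<^esub> (e, f, \<pi>)" using V_out by (auto simp: column_def H_one)
    finally show ?thesis .
  qed
  then show "\<psi> base_lift = column g \<one>\<^bsub>H\<^esub>" unfolding base_lift_def layer_comb(1)[OF *] by auto
qed

lemma \<theta>_column:
  assumes h: "h \<in> carrier H" shows "act (\<theta> h) (column g \<one>\<^bsub>H\<^esub>) = column g h"
proof -
  have I: "(\<lambda>\<pi>. (g, g, \<pi>)) ` Hyp \<subseteq> \<Omega>" and J: "(\<lambda>f. (g, f, id)) ` dangles n k \<subseteq> \<Omega>" using g id_hyp by auto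
  have IJ: "(\<lambda>(\<pi>, f). (g, f, \<pi>)) ` (Hyp \<times> dangles n k) \<subseteq> \<Omega>" using g by auto
  have "act (\<theta> h) (column g \<one>\<^bsub>H\<^esub>) = \<psi> (\<theta> h \<otimes>\<^bsub>B\<^esub> base_lift)"
    using layer_smult_layer_map[OF \<theta>_B base_lift_upto_layer] \<psi>_base_lift by simp
  also have "\<theta> h \<otimes>\<^bsub>B\<^esub> base_lift = comb (Hyp \<times> dangles n k) (\<lambda>(\<pi>, f). h \<pi> * V f) (\<lambda>i. diagram_of ((\<lambda>(\<pi>, f). (g, f, \<pi>)) i))"
    unfolding \<theta>_def base_lift_def
    by (subst comb_diagram_of_mult[OF I J]) (use \<delta> in \<open>auto intro!: comb_cong\<close>)
  also have "\<psi> \<dots> = comb (Hyp \<times> dangles n k) (\<lambda>(\<pi>, f). h \<pi> * V f) (\<lambda>(\<pi>, f). (g, f, \<pi>))"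
    by (rule layer_comb(1)[OF IJ])
  also have "\<dots> = column g h"
  proof -
    have "comb (Hyp \<times> dangles n k) (\<lambda>(\<pi>, f). h \<pi> * V f) (\<lambda>(\<pi>, f). (g, f, \<pi>)) (e, f, \<pi>) = column g h (e, f, \<pi>)" for e f \<pi>
    proof -
      have "comb (Hyp \<times> dangles n k) (\<lambda>(\<pi>, f). h \<pi> * V f) (\<lambda>(\<pi>, f). (g, f, \<pi>)) (e, f, \<pi>) =
        (\<Sum>x\<in>Hyp \<times> dangles n k. if x = (\<pi>, f) then (if e = g then h \<pi> * V f else 0) else 0)"
        unfolding comb_def by (intro sum.cong HOL.refl) auto
      also have "\<dots> = (if (\<pi>, f) \<in> Hyp \<times> dangles n k then (if e = g then h \<pi> * V f else 0) else 0)"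
        using finite_dangles[of n k] finite_hyperoctahedral[of "n - k"] by (simp only: sum.delta finite_cartesian_product)
      also have "\<dots> = column g h (e, f, \<pi>)" using V_out h by (auto simp: column_def H_carrier)
      finally show ?thesis .
    qed
    then show ?thesis by auto
  qed
  finally show ?thesis .
qed

end

section \<open>Truncation of the inflated cell modules\<close>

locale inflated_layer = brauer_layer n k \<delta> C v E g
  for n k :: nat and \<delta> :: "'r::field" and C v E g +
  fixes l :: nat
  assumes l: "l < chain_length CH"
begin

abbreviation "M \<equiv> cell_module H CH l"
abbreviation "G \<equiv> inflated_module n \<delta> k V M"
abbreviation "P \<equiv> cell_module B E (start + l)"

sublocale HL: cell_layer H "hyp_inv (n - k)" CH l
  by unfold_locales (use chainH l in auto)

sublocale BL: cell_layer B brauer_inv E "start + l"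
  by unfold_locales (use chainE position_less[OF l] in auto)

sublocale tp: tensor_pair H W M
  by (rule tensor_pair_W[OF HL.P.left_module_axioms])

lemma G_simps: "carrier G = carrier tp.T" "\<zero>\<^bsub>G\<^esub> = \<one>\<^bsub>tp.T\<^esub>" "x \<oplus>\<^bsub>G\<^esub> y = x \<otimes>\<^bsub>tp.T\<^esub> y"
  "b \<odot>\<^bsub>G\<^esub> z = tensor_map H W M (\<lambda>(F, x). (act b F, x)) z"
  by (simp_all add: inflated_module_def Let_def)

text \<open>The cell structure identifies the inflated module with a cell module of the Brauer algebra. Module
  axioms, annihilation by the ideal below the layer, and finite length are transferred along such an
  isomorphism.\<close>

lemma ex_iso: "\<exists>\<phi>. bij_betw \<phi> (carrier P) (carrier G) \<and>
    (\<forall>x\<in>carrier P. \<forall>y\<in>carrier P. \<phi> (x \<oplus>\<^bsub>P\<^esub> y) = \<phi> x \<oplus>\<^bsub>G\<^esub> \<phi> y) \<and>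
    (\<forall>a\<in>carrier B. \<forall>x\<in>carrier P. \<phi> (a \<odot>\<^bsub>P\<^esub> x) = a \<odot>\<^bsub>G\<^esub> \<phi> x) \<and> \<phi> \<zero>\<^bsub>P\<^esub> = \<zero>\<^bsub>G\<^esub>"
proof -
  obtain \<phi> where \<phi>: "\<phi> \<in> iso (add_monoid P) (add_monoid G)"
    "\<forall>a\<in>carrier B. \<forall>x\<in>carrier P. \<phi> (a \<odot>\<^bsub>P\<^esub> x) = a \<odot>\<^bsub>G\<^esub> \<phi> x"
    using isoE[OF l] unfolding module_isomorphic_def by blast
  have bij: "bij_betw \<phi> (carrier P) (carrier G)"
    and hom: "\<phi> \<in> hom (add_monoid P) (add_monoid G)" using \<phi>(1) by (simp_all add: iso_def)
  have add: "\<phi> (x \<oplus>\<^bsub>P\<^esub> y) = \<phi> x \<oplus>\<^bsub>G\<^esub> \<phi> y" if "x \<in> carrier P" "y \<in> carrier P" for x y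
    using hom_mult[OF hom, of x y] that by (simp del: BL.P_simps)
  have "\<phi> \<zero>\<^bsub>P\<^esub> = \<zero>\<^bsub>G\<^esub>"
  proof -
    interpret T: group tp.T by (rule tp.T_group)
    have z: "\<phi> \<zero>\<^bsub>P\<^esub> \<in> carrier tp.T"
      using bij BL.P.zero_closed G_simps(1) by (auto simp: bij_betw_def simp del: BL.P_simps)
    have "\<phi> \<zero>\<^bsub>P\<^esub> \<otimes>\<^bsub>tp.T\<^esub> \<phi> \<zero>\<^bsub>P\<^esub> = \<phi> \<zero>\<^bsub>P\<^esub>"
      using add[OF BL.P.zero_closed BL.P.zero_closed] BL.P.l_zero[OF BL.P.zero_closed]
      unfolding G_simps(3) by (simp only:)
    then show ?thesis using z T.l_cancel_one[of "\<phi> \<zero>\<^bsub>P\<^esub>" "\<phi> \<zero>\<^bsub>P\<^esub>"] unfolding G_simps(2) by blast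
  qed
  then show ?thesis using bij add \<phi>(2) by (intro exI[of _ \<phi>] conjI ballI) simp_all
qed

sublocale G: left_module B G
proof -
  obtain \<phi> where "bij_betw \<phi> (carrier P) (carrier G)"
    "\<And>x y. \<lbrakk>x \<in> carrier P; y \<in> carrier P\<rbrakk> \<Longrightarrow> \<phi> (x \<oplus>\<^bsub>P\<^esub> y) = \<phi> x \<oplus>\<^bsub>G\<^esub> \<phi> y"
    "\<And>a x. \<lbrakk>a \<in> carrier B; x \<in> carrier P\<rbrakk> \<Longrightarrow> \<phi> (a \<odot>\<^bsub>P\<^esub> x) = a \<odot>\<^bsub>G\<^esub> \<phi> x" "\<phi> \<zero>\<^bsub>P\<^esub> = \<zero>\<^bsub>G\<^esub>"
    using ex_iso by blast
  then show "left_module B G" by (rule left_module_iso_transfer[OF BL.P.left_module_axioms])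
qed

lemma below_layer_null:
  assumes \<kappa>: "\<kappa> \<in> below_layer" and z: "z \<in> carrier G" shows "\<kappa> \<odot>\<^bsub>G\<^esub> z = \<zero>\<^bsub>G\<^esub>"
proof -
  obtain \<phi> where \<phi>: "bij_betw \<phi> (carrier P) (carrier G)"
    "\<And>a x. \<lbrakk>a \<in> carrier B; x \<in> carrier P\<rbrakk> \<Longrightarrow> \<phi> (a \<odot>\<^bsub>P\<^esub> x) = a \<odot>\<^bsub>G\<^esub> \<phi> x" "\<phi> \<zero>\<^bsub>P\<^esub> = \<zero>\<^bsub>G\<^esub>"
    using ex_iso by blast
  obtain x where x: "x \<in> carrier P" "z = \<phi> x" using \<phi>(1) z unfolding bij_betw_def by blast
  have "\<zero>\<^bsub>H\<^esub> \<in> chain_ideal CH l"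
    by (rule additive_subgroup.zero_closed[OF ideal.axioms(1)[OF HL.I_ideal]])
  then have "\<kappa> \<in> layer_preimage n k (chain_ideal CH l)"
    using \<kappa> unfolding below_layer_def preimage_iff by auto
  then have "\<kappa> \<in> chain_ideal E (start + l)" using idealE[of l] l by simp
  then have "\<kappa> \<odot>\<^bsub>P\<^esub> x = \<zero>\<^bsub>P\<^esub>" using BL.cell_module_annihilated x(1) by blast
  moreover have "\<kappa> \<in> carrier B" using \<kappa> K_closed by blast
  ultimately show ?thesis using \<phi>(2,3) x by metis
qed

text \<open>The right hand side of the definition of the action is a union of cosets. It is a single coset, as it
  is an element of the module, and so it is computed by the representative at hand.\<close>

lemma smult_pure:
  assumes "b \<in> carrier B" "F \<in> carrier W" "x \<in> carrier M"
  shows "b \<odot>\<^bsub>G\<^esub> tp.pt F x = tp.pt (act b F) x" and "act b F \<in> carrier W"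
proof -
  have "tp.pt F x \<in> carrier G" using tp.pure_closed assms by (simp only: G_simps)
  then have "b \<odot>\<^bsub>G\<^esub> tp.pt F x \<in> carrier G" using assms by (intro G.smult_closed)
  then have c: "tensor_map H W M (\<lambda>(F, x). (act b F, x)) (tp.pt F x) \<in> carrier tp.T"
    by (simp only: G_simps)
  show "b \<odot>\<^bsub>G\<^esub> tp.pt F x = tp.pt (act b F) x" "act b F \<in> carrier W"
    using tp.tensor_map_pure[OF c] by (simp_all only: G_simps prod.case fst_conv snd_conv)
qed

lemma column1_W: "column g \<one>\<^bsub>H\<^esub> \<in> carrier W"
  by (rule column_W[OF g H.one_closed])

lemma pure_column:
  assumes "e' \<in> dangles n k" "h \<in> carrier H" "x \<in> carrier M"
  shows "tp.pt (column e' h) x = tp.pt (column e' \<one>\<^bsub>H\<^esub>) (h \<odot>\<^bsub>M\<^esub> x)"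
proof -
  have "column e' h = h \<odot>\<^bsub>W\<^esub> column e' \<one>\<^bsub>H\<^esub>" using column_smult[of e' h "\<one>\<^bsub>H\<^esub>"] assms by simp
  then show ?thesis using tp.pure_balanced[OF assms(2) column_W[OF assms(1) H.one_closed] assms(3)] by simp
qed

definition "corner_embed = (\<lambda>x. tp.pt (column g \<one>\<^bsub>H\<^esub>) x)"

lemma \<theta>_corner_embed:
  assumes "h \<in> carrier H" "x \<in> carrier M" shows "\<theta> h \<odot>\<^bsub>G\<^esub> corner_embed x = corner_embed (h \<odot>\<^bsub>M\<^esub> x)"
  unfolding corner_embed_def smult_pure(1)[OF \<theta>_B column1_W assms(2)] \<theta>_column[OF assms(1)]
  by (rule pure_column[OF g assms])

text \<open>The coordinate of \<open>F\<close> at \<open>(g, g)\<close>, divided by \<open>v\<^sub>k(g)\<close>, is linear for the right action, so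
  \<open>F \<otimes> x\<close> can be mapped to that coordinate applied to \<open>x\<close>. This is a left inverse of the
  embedding.\<close>

lemma corner_embed_inj: "inj_on corner_embed (carrier M)"
proof (rule inj_onI)
  fix x y assume xy: "x \<in> carrier M" "y \<in> carrier M" "corner_embed x = corner_embed y"
  let ?f = "\<lambda>F x. (\<lambda>\<pi>. F (g, g, \<pi>) / V g) \<odot>\<^bsub>M\<^esub> x"
  have cH: "(\<lambda>\<pi>. F (g, g, \<pi>) / V g) \<in> carrier H" if "F \<in> carrier W" for F
    using that g v_g unfolding W_carrier by (auto simp: H_carrier)
  have "\<exists>p\<in>hom tp.T (add_monoid M). \<forall>F\<in>carrier W. \<forall>x\<in>carrier M. p (tp.pt F x) = ?f F x"
  proof (rule tp.tensor_universal)
    show "comm_group (add_monoid M)" by (rule HL.P.a_comm_group)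
  next
    fix F x assume "F \<in> carrier W" "x \<in> carrier M"
    then show "?f F x \<in> carrier (add_monoid M)" using HL.P.smult_closed[OF cH] by simp
  next
    fix F F' x assume *: "F \<in> carrier W" "F' \<in> carrier W" "x \<in> carrier M"
    have "(\<lambda>\<pi>. (F \<oplus>\<^bsub>W\<^esub> F') (g, g, \<pi>) / V g) = (\<lambda>\<pi>. F (g, g, \<pi>) / V g) \<oplus>\<^bsub>H\<^esub> (\<lambda>\<pi>. F' (g, g, \<pi>) / V g)"
      by (simp add: W_add H_add add_divide_distrib)
    then show "?f (F \<oplus>\<^bsub>W\<^esub> F') x = ?f F x \<otimes>\<^bsub>add_monoid M\<^esub> ?f F' x"
      using HL.P.smult_l_distr[OF cH[OF *(1)] cH[OF *(2)] *(3)] by (simp del: HL.P_simps)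
  next
    fix F x y assume *: "F \<in> carrier W" "x \<in> carrier M" "y \<in> carrier M"
    show "?f F (x \<oplus>\<^bsub>M\<^esub> y) = ?f F x \<otimes>\<^bsub>add_monoid M\<^esub> ?f F y"
      using HL.P.smult_r_distr[OF cH[OF *(1)] *(2,3)] by (simp del: HL.P_simps)
  next
    fix h F x assume *: "h \<in> carrier H" "F \<in> carrier W" "x \<in> carrier M"
    then obtain G where G: "\<And>e. e \<in> dangles n k \<Longrightarrow> G e \<in> carrier H"
      "F = (\<lambda>(e, f, \<pi>). if e \<in> dangles n k then V f * G e \<pi> else 0)" unfolding W_carrier by blast
    have 1: "(\<lambda>\<pi>. F (g, g, \<pi>) / V g) = G g" using G(2) g v_g by simp
    have "h \<odot>\<^bsub>W\<^esub> F = (\<lambda>(e, f, \<pi>). if e \<in> dangles n k then V f * (G e \<otimes>\<^bsub>H\<^esub> h) \<pi> else 0)"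
      unfolding G(2) by (rule W_smult_form[OF *(1)]) (rule G(1))
    then have 2: "(\<lambda>\<pi>. (h \<odot>\<^bsub>W\<^esub> F) (g, g, \<pi>) / V g) = G g \<otimes>\<^bsub>H\<^esub> h" using g v_g by simp
    show "?f (h \<odot>\<^bsub>W\<^esub> F) x = ?f F (h \<odot>\<^bsub>M\<^esub> x)"
      unfolding 1 2 by (rule HL.P.smult_assoc[OF G(1)[OF g] *(1,3)])
  qed
  then obtain p where p: "\<And>F x. \<lbrakk>F \<in> carrier W; x \<in> carrier M\<rbrakk> \<Longrightarrow> p (tp.pt F x) = ?f F x" by blast
  have "(\<lambda>\<pi>. column g \<one>\<^bsub>H\<^esub> (g, g, \<pi>) / V g) = \<one>\<^bsub>H\<^esub>" using v_g by (simp add: column_def)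
  then have "p (corner_embed z) = z" if "z \<in> carrier M" for z
    unfolding corner_embed_def p[OF column1_W that] using HL.P.smult_one[OF that] by simp
  then show "x = y" using xy by metis
qed

lemma W_lift:
  assumes "F \<in> carrier W" shows "\<exists>x\<in>upto_layer. \<psi> x = F"
proof -
  obtain G where G: "\<And>e. e \<in> dangles n k \<Longrightarrow> G e \<in> carrier H"
    "F = (\<lambda>(e, f, \<pi>). if e \<in> dangles n k then V f * G e \<pi> else 0)" using assms unfolding W_carrier by blast
  have fin: "finite \<Omega>" using finite_dangles finite_hyperoctahedral by blast
  have out: "F t = 0" if "t \<notin> \<Omega>" for t
    using that G(1) V_out unfolding G(2) by (auto simp: H_carrier split: prod.splits)
  have "comb \<Omega> F (\<lambda>t. t) = F"
  proof
    fix t show "comb \<Omega> F (\<lambda>t. t) t = F t"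
      using fin out[of t] unfolding comb_def by (simp only: sum.delta) auto
  qed
  then have "\<psi> (comb \<Omega> F (\<lambda>t. diagram_of t)) = F" using layer_comb(1)[of "\<lambda>t. t" \<Omega> F] by simp
  moreover have "comb \<Omega> F (\<lambda>t. diagram_of t) \<in> upto_layer" using layer_comb(2)[of "\<lambda>t. t" \<Omega> F] by simp
  ultimately show ?thesis by blast
qed

text \<open>Left multiplication by the idempotent leaves only the top dangle \<open>g\<close>.\<close>

lemma base_idem_W:
  assumes "F \<in> carrier W" "x \<in> carrier M" shows "\<exists>h\<in>carrier H. act base_idem F = column g h"
proof -
  obtain x' where x': "x' \<in> upto_layer" "\<psi> x' = F" using W_lift[OF assms(1)] by blast
  have eF: "act base_idem F = \<psi> (base_idem \<otimes>\<^bsub>B\<^esub> x')" using layer_smult_layer_map[OF base_idem_B x'(1)] x'(2) by simp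
  obtain G where G: "\<And>e. e \<in> dangles n k \<Longrightarrow> G e \<in> carrier H"
    "act base_idem F = (\<lambda>(e, f, \<pi>). if e \<in> dangles n k then V f * G e \<pi> else 0)"
    using smult_pure(2)[OF base_idem_B assms] unfolding W_carrier by blast
  have "act base_idem F (e, f, \<pi>) = column g (G g) (e, f, \<pi>)" for e f \<pi>
  proof (cases "e = g")
    case True
    then show ?thesis using G(2) g by (simp add: column_def)
  next
    case False
    have "act base_idem F (e, f, \<pi>) = 0"
    proof (rule ccontr)
      assume "act base_idem F (e, f, \<pi>) \<noteq> 0"
      then obtain d where "d \<in> layer_diagrams n k" "top_dangle d = e" "(base_idem \<otimes>\<^bsub>B\<^esub> x') d \<noteq> 0"
        using layer_map_nonzero unfolding eF by blast
      then show False using base_idem_left_support False by blast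
    qed
    then show ?thesis using False by (simp add: column_def)
  qed
  then have "act base_idem F = column g (G g)" by auto
  then show ?thesis using G(1)[OF g] by blast
qed

lemma corner_embed_add:
  assumes "x \<in> carrier M" "y \<in> carrier M" shows "corner_embed (x \<oplus>\<^bsub>M\<^esub> y) = corner_embed x \<oplus>\<^bsub>G\<^esub> corner_embed y"
  unfolding corner_embed_def G_simps by (rule tp.pure_add_r[OF column1_W assms])

lemma corner_embed_closed: "x \<in> carrier M \<Longrightarrow> corner_embed x \<in> carrier G"
  unfolding corner_embed_def G_simps by (rule tp.pure_closed[OF column1_W])

lemma corner_embed_zero: "corner_embed \<zero>\<^bsub>M\<^esub> = \<zero>\<^bsub>G\<^esub>"
proof -
  have "corner_embed \<zero>\<^bsub>M\<^esub> \<oplus>\<^bsub>G\<^esub> corner_embed \<zero>\<^bsub>M\<^esub> = corner_embed \<zero>\<^bsub>M\<^esub>"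
    using corner_embed_add[OF HL.P.zero_closed HL.P.zero_closed] HL.P.l_zero[OF HL.P.zero_closed] by (simp only:)
  then show ?thesis using G.add.l_cancel_one[OF corner_embed_closed[OF HL.P.zero_closed] corner_embed_closed[OF HL.P.zero_closed]] by blast
qed

lemma base_idem_jj: "x \<in> carrier M \<Longrightarrow> base_idem \<odot>\<^bsub>G\<^esub> corner_embed x = corner_embed x"
  unfolding base_idem_def using \<theta>_corner_embed[OF H.one_closed, of x] HL.P.smult_one[of x] by (simp only:)

text \<open>On pure tensors this follows from the effect of the idempotent on the column, and the image of the
  embedding is closed under differences.\<close>

lemma base_idem_image:
  assumes "z \<in> carrier tp.T" shows "\<exists>x\<in>carrier M. base_idem \<odot>\<^bsub>G\<^esub> z = corner_embed x"
  using assms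
proof (induction z rule: tp.tensor_induct)
  case one
  have "base_idem \<odot>\<^bsub>G\<^esub> \<zero>\<^bsub>G\<^esub> = corner_embed \<zero>\<^bsub>M\<^esub>" unfolding corner_embed_zero by (rule G.smult_r_null[OF base_idem_B])
  then show ?case unfolding G_simps(2) using HL.P.zero_closed by blast
next
  case (pure F x)
  obtain h where h: "h \<in> carrier H" "act base_idem F = column g h" using base_idem_W[OF pure] by blast
  have "base_idem \<odot>\<^bsub>G\<^esub> tp.pt F x = corner_embed (h \<odot>\<^bsub>M\<^esub> x)"
    unfolding smult_pure(1)[OF base_idem_B pure] h(2) corner_embed_def by (rule pure_column[OF g h(1) pure(2)])
  then show ?case using HL.P.smult_closed[OF h(1) pure(2)] by blast
next
  case (mult t t')
  interpret T: group tp.T by (rule tp.T_group)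
  obtain x where x: "x \<in> carrier M" "base_idem \<odot>\<^bsub>G\<^esub> t = corner_embed x" using mult by blast
  obtain x' where x': "x' \<in> carrier M" "base_idem \<odot>\<^bsub>G\<^esub> t' = corner_embed x'" using mult by blast
  let ?w = "t \<otimes>\<^bsub>tp.T\<^esub> inv\<^bsub>tp.T\<^esub> t'"
  have w: "?w \<in> carrier G" "t' \<in> carrier G" using mult(1,2) by (simp_all add: G_simps)
  have "?w \<oplus>\<^bsub>G\<^esub> t' = t" using mult(1,2) by (simp add: G_simps T.m_assoc)
  then have "base_idem \<odot>\<^bsub>G\<^esub> ?w \<oplus>\<^bsub>G\<^esub> corner_embed x' = corner_embed x" using G.smult_r_distr[OF base_idem_B w] x x' by simp
  moreover have "corner_embed (x \<ominus>\<^bsub>M\<^esub> x') \<oplus>\<^bsub>G\<^esub> corner_embed x' = corner_embed x"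
  proof -
    have "x \<ominus>\<^bsub>M\<^esub> x' \<oplus>\<^bsub>M\<^esub> x' = x" using x x' HL.P.minus_closed[OF x(1) x'(1)]
      by (simp only: HL.P.minus_eq HL.P.a_assoc HL.P.a_inv_closed HL.P.l_neg HL.P.r_zero)
    then show ?thesis using corner_embed_add[OF HL.P.minus_closed[OF x(1) x'(1)] x'(1)] by simp
  qed
  ultimately have "base_idem \<odot>\<^bsub>G\<^esub> ?w = corner_embed (x \<ominus>\<^bsub>M\<^esub> x')"
    using G.add.right_cancel[OF corner_embed_closed[OF x'(1)] G.smult_closed[OF base_idem_B w(1)]
      corner_embed_closed[OF HL.P.minus_closed[OF x(1) x'(1)]]] by simp
  then show ?case using HL.P.minus_closed[OF x(1) x'(1)] by blast
qed

sublocale cp: corner_pair B H base_idem \<theta> below_layer G M corner_embed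
proof (intro corner_pair.intro corner_pair_axioms.intro corner_axioms G.left_module_axioms
    HL.P.left_module_axioms corner_embed_inj)
  show "corner_embed ` carrier M = (\<lambda>z. base_idem \<odot>\<^bsub>G\<^esub> z) ` carrier G"
  proof
    show "corner_embed ` carrier M \<subseteq> (\<lambda>z. base_idem \<odot>\<^bsub>G\<^esub> z) ` carrier G"
      using base_idem_jj corner_embed_closed by (metis (no_types, lifting) image_eqI image_subsetI)
    show "(\<lambda>z. base_idem \<odot>\<^bsub>G\<^esub> z) ` carrier G \<subseteq> corner_embed ` carrier M"
      using base_idem_image unfolding G_simps(1) by blast
  qed
qed (use below_layer_null corner_embed_add \<theta>_corner_embed in metis)+

lemma pure_zero: "x \<in> carrier M \<Longrightarrow> tp.pt (\<lambda>_. 0) x = \<zero>\<^bsub>G\<^esub>"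
proof -
  assume x: "x \<in> carrier M"
  interpret T: group tp.T by (rule tp.T_group)
  have zW: "(\<lambda>_. 0) \<in> carrier W"
    unfolding W_carrier by (rule exI[of _ "\<lambda>_. \<zero>\<^bsub>H\<^esub>"]) (use H.zero_closed in \<open>auto simp: H_zero\<close>)
  have "tp.pt (\<lambda>_. 0) x \<otimes>\<^bsub>tp.T\<^esub> tp.pt (\<lambda>_. 0) x = tp.pt (\<lambda>_. 0) x"
    using tp.pure_add_l[OF zW zW x] by (simp add: W_add)
  then show ?thesis unfolding G_simps(2) using T.l_cancel_one tp.pure_closed[OF zW x] by blast
qed

text \<open>If \<open>F\<close> is the sum of \<open>e \<otimes> v\<^sub>k \<otimes> c e\<close> over the dangles \<open>e\<close>, then \<open>F \<otimes> x\<close> is the sum of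
  \<open>(e \<otimes> v\<^sub>k \<otimes> 1) \<otimes> (c e)x\<close>.\<close>

lemma pure_eq_zero:
  assumes G: "\<And>e. e \<in> dangles n k \<Longrightarrow> c e \<in> carrier H" and x: "x \<in> carrier M"
    and ann: "\<And>e. e \<in> dangles n k \<Longrightarrow> c e \<odot>\<^bsub>M\<^esub> x = \<zero>\<^bsub>M\<^esub>"
  shows "tp.pt (\<lambda>(e, f, \<pi>). if e \<in> dangles n k then V f * c e \<pi> else 0) x = \<zero>\<^bsub>G\<^esub>"
proof -
  let ?F = "\<lambda>A. (\<lambda>(e, f, \<pi>). if e \<in> A then V f * c e \<pi> else 0)"
  have "finite A \<Longrightarrow> A \<subseteq> dangles n k \<Longrightarrow> tp.pt (?F A) x = \<zero>\<^bsub>G\<^esub> \<and> ?F A \<in> carrier W" for A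
  proof (induction A rule: finite_induct)
    case empty
    have "?F {} = (\<lambda>_. 0)" by auto
    moreover have "(\<lambda>_. 0) \<in> carrier W"
      unfolding W_carrier by (rule exI[of _ "\<lambda>_. \<zero>\<^bsub>H\<^esub>"]) (use H.zero_closed in \<open>auto simp: H_zero\<close>)
    ultimately show ?case using pure_zero[OF x] by simp
  next
    case (insert a A)
    then have a: "a \<in> dangles n k" and IH: "tp.pt (?F A) x = \<zero>\<^bsub>G\<^esub>" "?F A \<in> carrier W" by auto
    have F: "?F (insert a A) = ?F A \<oplus>\<^bsub>W\<^esub> column a (c a)"
      using insert.hyps(2) by (auto simp: W_add column_def fun_eq_iff)
    have col: "column a (c a) \<in> carrier W" by (rule column_W[OF a G[OF a]])
    have cz: "tp.pt (column a (c a)) x = \<zero>\<^bsub>G\<^esub>"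
    proof -
      have cW: "column a \<one>\<^bsub>H\<^esub> \<in> carrier W" by (rule column_W[OF a H.one_closed])
      have "tp.pt (column a (c a)) x = tp.pt (column a \<one>\<^bsub>H\<^esub>) \<zero>\<^bsub>M\<^esub>"
        using pure_column[OF a G[OF a] x] ann[OF a] by simp
      moreover have "tp.pt (column a \<one>\<^bsub>H\<^esub>) \<zero>\<^bsub>M\<^esub> = \<zero>\<^bsub>G\<^esub>"
      proof -
        interpret T: group tp.T by (rule tp.T_group)
        have "tp.pt (column a \<one>\<^bsub>H\<^esub>) \<zero>\<^bsub>M\<^esub> \<otimes>\<^bsub>tp.T\<^esub> tp.pt (column a \<one>\<^bsub>H\<^esub>) \<zero>\<^bsub>M\<^esub> = tp.pt (column a \<one>\<^bsub>H\<^esub>) \<zero>\<^bsub>M\<^esub>"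
          using tp.pure_add_r[OF cW HL.P.zero_closed HL.P.zero_closed] HL.P.l_zero[OF HL.P.zero_closed] by metis
        then show ?thesis unfolding G_simps(2) using T.l_cancel_one tp.pure_closed[OF cW HL.P.zero_closed] by blast
      qed
      ultimately show ?thesis by simp
    qed
    have "tp.pt (?F (insert a A)) x = \<zero>\<^bsub>G\<^esub> \<oplus>\<^bsub>G\<^esub> \<zero>\<^bsub>G\<^esub>"
      unfolding F tp.pure_add_l[OF IH(2) col x] IH(1) cz G_simps(3) ..
    moreover have "?F (insert a A) \<in> carrier W" unfolding F by (rule tp.M_add[OF IH(2) col])
    ultimately show ?case using G.l_zero[OF G.zero_closed] by simp
  qed
  from this[OF finite_dangles subset_refl] show ?thesis by blast
qed

abbreviation "radical_part \<equiv> {z \<in> carrier G. \<forall>a\<in>chain_ideal E (Suc (start + l)). a \<odot>\<^bsub>G\<^esub> z = \<zero>\<^bsub>G\<^esub>}"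

text \<open>Let \<open>I\<close> be the ideal of \<open>RH\<^sub>n\<^sub>-\<^sub>k\<close> at the upper end of the cell and \<open>J\<close> its preimage. As
  \<open>\<theta> h\<close> is in \<open>J\<close> for \<open>h \<in> I\<close>, an element killed by \<open>J\<close> is killed by \<open>I\<close>. Conversely,
  for \<open>a \<in> J\<close> the product of \<open>a\<close> with \<open>g \<otimes> v\<^sub>k \<otimes> 1\<close> is again in \<open>J\<close>, so its coordinates
  are in \<open>I\<close> up to non-zero values of \<open>v\<^sub>k\<close>; hence they kill \<open>x\<close> as soon as \<open>I\<close> does.\<close>

lemma corner_part_radical: "cp.corner_part radical_part = cell_radical H (hyp_inv (n - k)) CH l"
proof -
  have J: "chain_ideal E (Suc (start + l)) = layer_preimage n k (chain_ideal CH (Suc l))"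
    using idealE[of "Suc l"] l by simp
  interpret I: ideal "chain_ideal CH (Suc l)" H by (rule HL.I'_ideal)
  have "(\<forall>a\<in>chain_ideal E (Suc (start + l)). a \<odot>\<^bsub>G\<^esub> corner_embed x = \<zero>\<^bsub>G\<^esub>) \<longleftrightarrow>
      (\<forall>h\<in>chain_ideal CH (Suc l). h \<odot>\<^bsub>M\<^esub> x = \<zero>\<^bsub>M\<^esub>)" if x: "x \<in> carrier M" for x
  proof
    assume L: "\<forall>a\<in>chain_ideal E (Suc (start + l)). a \<odot>\<^bsub>G\<^esub> corner_embed x = \<zero>\<^bsub>G\<^esub>"
    show "\<forall>h\<in>chain_ideal CH (Suc l). h \<odot>\<^bsub>M\<^esub> x = \<zero>\<^bsub>M\<^esub>"
    proof
      fix h assume h: "h \<in> chain_ideal CH (Suc l)"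
      have hH: "h \<in> carrier H" by (rule HL.I'_closed[OF h])
      have "(1 / \<delta> ^ k) \<odot>\<^bsub>H\<^esub> h \<in> chain_ideal CH (Suc l)"
        using H.V.submoduleD(6)[OF H.ideal_submodule[OF HL.I'_ideal], of "1 / \<delta> ^ k" h] h by simp
      then have h': "(\<lambda>\<pi>. h \<pi> / \<delta> ^ k) \<in> chain_ideal CH (Suc l)" by (simp add: H_smult)
      have "(\<lambda>\<pi>. \<psi> (\<theta> h) (e, f, \<pi>)) \<in> chain_ideal CH (Suc l)" for e f
      proof (cases "e = g \<and> f = g")
        case True
        then have "(\<lambda>\<pi>. \<psi> (\<theta> h) (e, f, \<pi>)) = (\<lambda>\<pi>. h \<pi> / \<delta> ^ k)"
          using hH unfolding \<psi>_\<theta> comb_Hyp_eval by (auto simp: H_carrier)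
        then show ?thesis using h' by simp
      next
        case False
        then have "(\<lambda>\<pi>. \<psi> (\<theta> h) (e, f, \<pi>)) = \<zero>\<^bsub>H\<^esub>"
          unfolding \<psi>_\<theta> comb_Hyp_eval H_zero by auto
        then show ?thesis using I.zero_closed by simp
      qed
      then have "\<theta> h \<in> chain_ideal E (Suc (start + l))"
        using \<theta>_upto_layer[of h] unfolding J upto_layer_def preimage_iff by blast
      then have "corner_embed (h \<odot>\<^bsub>M\<^esub> x) = corner_embed \<zero>\<^bsub>M\<^esub>" using L \<theta>_corner_embed[OF hH x] corner_embed_zero by metis
      then show "h \<odot>\<^bsub>M\<^esub> x = \<zero>\<^bsub>M\<^esub>"
        by (rule inj_onD[OF corner_embed_inj _ HL.P.smult_closed[OF hH x] HL.P.zero_closed])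
    qed
  next
    assume R: "\<forall>h\<in>chain_ideal CH (Suc l). h \<odot>\<^bsub>M\<^esub> x = \<zero>\<^bsub>M\<^esub>"
    show "\<forall>a\<in>chain_ideal E (Suc (start + l)). a \<odot>\<^bsub>G\<^esub> corner_embed x = \<zero>\<^bsub>G\<^esub>"
    proof
      fix a assume a: "a \<in> chain_ideal E (Suc (start + l))"
      have aB: "a \<in> carrier B" by (rule BL.I'_closed[OF a])
      have "a \<otimes>\<^bsub>B\<^esub> base_lift \<in> chain_ideal E (Suc (start + l))"
        by (rule ideal.I_r_closed[OF BL.I'_ideal a upto_layer_B[OF base_lift_upto_layer]])
      then have coord: "(\<lambda>\<pi>. \<psi> (a \<otimes>\<^bsub>B\<^esub> base_lift) (e, f, \<pi>)) \<in> chain_ideal CH (Suc l)" for e f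
        unfolding J preimage_iff by blast
      have F: "act a (column g \<one>\<^bsub>H\<^esub>) = \<psi> (a \<otimes>\<^bsub>B\<^esub> base_lift)"
        using layer_smult_layer_map[OF aB base_lift_upto_layer] \<psi>_base_lift by simp
      obtain c where c: "\<And>e. e \<in> dangles n k \<Longrightarrow> c e \<in> carrier H"
        "act a (column g \<one>\<^bsub>H\<^esub>) = (\<lambda>(e, f, \<pi>). if e \<in> dangles n k then V f * c e \<pi> else 0)"
        using smult_pure(2)[OF aB column1_W x] unfolding W_carrier by blast
      have "c e \<in> chain_ideal CH (Suc l)" if e: "e \<in> dangles n k" for e
      proof -
        have "(\<lambda>\<pi>. V g * c e \<pi>) \<in> chain_ideal CH (Suc l)"
          using coord[of e g] e unfolding F[symmetric] c(2) by simp
        then have "(1 / V g) \<odot>\<^bsub>H\<^esub> (\<lambda>\<pi>. V g * c e \<pi>) \<in> chain_ideal CH (Suc l)"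
          using H.V.submoduleD(6)[OF H.ideal_submodule[OF HL.I'_ideal], of "1 / V g"] by simp
        moreover have "(1 / V g) \<odot>\<^bsub>H\<^esub> (\<lambda>\<pi>. V g * c e \<pi>) = c e" using v_g by (simp add: H_smult)
        ultimately show ?thesis by simp
      qed
      then have "tp.pt (act a (column g \<one>\<^bsub>H\<^esub>)) x = \<zero>\<^bsub>G\<^esub>"
        unfolding c(2) using R by (intro pure_eq_zero[OF c(1) x]) blast+
      then show "a \<odot>\<^bsub>G\<^esub> corner_embed x = \<zero>\<^bsub>G\<^esub>" unfolding corner_embed_def smult_pure(1)[OF aB column1_W x] .
    qed
  qed
  then show ?thesis
    unfolding cp.corner_part_def HL.cell_radical_eq_annihilated using corner_embed_closed by blast
qed

text \<open>The radicals are annihilators of the cell ideals, which the embedding matches; so \<open>D(\<lambda>,k)\<close>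
  truncates to \<open>D(\<lambda>)\<close>. It is simple because each element outside of the radical generates.\<close>

lemma cell_head_corner:
  assumes ne: "cell_radical H (hyp_inv (n - k)) CH l \<noteq> carrier M"
  shows "\<exists>jD. corner_pair B H base_idem \<theta> below_layer (cell_head B brauer_inv E (start + l)) (cell_head H (hyp_inv (n - k)) CH l) jD"
    and "simple_module B (cell_head B brauer_inv E (start + l))"
    and "carrier (cell_head H (hyp_inv (n - k)) CH l) \<noteq> {\<zero>\<^bsub>cell_head H (hyp_inv (n - k)) CH l\<^esub>}"
proof -
  let ?rad = "cell_radical B brauer_inv E (start + l)"
  let ?D = "cell_head B brauer_inv E (start + l)"
  obtain \<phi> where bij: "bij_betw \<phi> (carrier P) (carrier G)"
    and add: "\<And>x y. \<lbrakk>x \<in> carrier P; y \<in> carrier P\<rbrakk> \<Longrightarrow> \<phi> (x \<oplus>\<^bsub>P\<^esub> y) = \<phi> x \<oplus>\<^bsub>G\<^esub> \<phi> y"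
    and sm: "\<And>a x. \<lbrakk>a \<in> carrier B; x \<in> carrier P\<rbrakk> \<Longrightarrow> \<phi> (a \<odot>\<^bsub>P\<^esub> x) = a \<odot>\<^bsub>G\<^esub> \<phi> x"
    and z0: "\<phi> \<zero>\<^bsub>P\<^esub> = \<zero>\<^bsub>G\<^esub>"
    using ex_iso by blast
  have inj: "\<phi> x = \<phi> y \<longleftrightarrow> x = y" if "x \<in> carrier P" "y \<in> carrier P" for x y
    using bij that by (auto simp: bij_betw_def inj_on_def simp del: BL.P_simps)
  have im: "\<phi> x \<in> carrier G" if "x \<in> carrier P" for x using bij that by (auto simp: bij_betw_def simp del: BL.P_simps)
  have rep: "\<exists>x\<in>carrier P. z = \<phi> x" if "z \<in> carrier G" for z using bij that unfolding bij_betw_def by blast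
  have rad: "x \<in> ?rad \<longleftrightarrow> x \<in> carrier P \<and> (\<forall>a\<in>chain_ideal E (Suc (start + l)). a \<odot>\<^bsub>P\<^esub> x = \<zero>\<^bsub>P\<^esub>)" for x
    by (simp only: BL.cell_radical_eq_annihilated mem_Collect_eq)
  have rad_iff: "\<phi> x \<in> radical_part \<longleftrightarrow> x \<in> ?rad" if x: "x \<in> carrier P" for x
  proof -
    have "a \<odot>\<^bsub>G\<^esub> \<phi> x = \<zero>\<^bsub>G\<^esub> \<longleftrightarrow> a \<odot>\<^bsub>P\<^esub> x = \<zero>\<^bsub>P\<^esub>" if a: "a \<in> chain_ideal E (Suc (start + l))" for a
      using sm[OF BL.I'_closed[OF a] x] inj[OF BL.P.smult_closed[OF BL.I'_closed[OF a] x] BL.P.zero_closed]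
      unfolding z0 by simp
    then show ?thesis unfolding rad using x im[OF x] by blast
  qed
  have radsub: "submodule ?rad B P" by (rule BL.radical_submodule)
  note rs = BL.P.submoduleD[OF radsub]
  have Dl: "left_module B ?D" unfolding cell_head_def by (rule BL.P.quotient_left_module[OF radsub])
  have sub: "submodule radical_part B G"
  proof -
    have rp: "radical_part = \<phi> ` ?rad"
    proof
      show "\<phi> ` ?rad \<subseteq> radical_part" using rad_iff rs(1) by blast
      show "radical_part \<subseteq> \<phi> ` ?rad"
      proof
        fix z assume z: "z \<in> radical_part"
        then obtain x where "x \<in> carrier P" "z = \<phi> x" using rep by blast
        then show "z \<in> \<phi> ` ?rad" using rad_iff z by blast
      qed
    qed
    have rP: "x \<in> carrier P" if "x \<in> ?rad" for x using that rad by blast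
    show ?thesis unfolding rp
    proof (rule G.submoduleI)
      show "\<phi> ` ?rad \<subseteq> carrier G" using im rP by blast
      show "\<zero>\<^bsub>G\<^esub> \<in> \<phi> ` ?rad" using imageI[OF rs(2), of \<phi>] unfolding z0 .
      show "y \<oplus>\<^bsub>G\<^esub> z \<in> \<phi> ` ?rad" if yz: "y \<in> \<phi> ` ?rad" "z \<in> \<phi> ` ?rad" for y z
      proof -
        obtain y' z' where *: "y' \<in> ?rad" "y = \<phi> y'" "z' \<in> ?rad" "z = \<phi> z'" using yz by blast
        then show ?thesis using add[OF rP[OF *(1)] rP[OF *(3)]] imageI[OF rs(3)[OF *(1,3)], of \<phi>] by (simp del: BL.P_simps)
      qed
      show "a \<odot>\<^bsub>G\<^esub> y \<in> \<phi> ` ?rad" if a: "a \<in> carrier B" and y: "y \<in> \<phi> ` ?rad" for a y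
      proof -
        obtain y' where *: "y' \<in> ?rad" "y = \<phi> y'" using y by blast
        then show ?thesis using sm[OF a rP[OF *(1)]] imageI[OF rs(6)[OF a *(1)], of \<phi>] by (simp del: BL.P_simps)
      qed
    qed
  qed
  define q where "q = (\<lambda>z. ?rad +>\<^bsub>P\<^esub> inv_into (carrier P) \<phi> z)"
  have q\<phi>: "q (\<phi> x) = ?rad +>\<^bsub>P\<^esub> x" if "x \<in> carrier P" for x
    using bij_betw_inv_into_left[OF bij that] by (simp add: q_def)
  have "module_epi B G radical_part ?D q"
    unfolding module_epi_def
  proof (intro conjI ballI)
    fix y z assume "y \<in> carrier G" "z \<in> carrier G"
    then obtain y' z' where *: "y' \<in> carrier P" "y = \<phi> y'" "z' \<in> carrier P" "z = \<phi> z'" using rep by metis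
    have "q (y \<oplus>\<^bsub>G\<^esub> z) = ?rad +>\<^bsub>P\<^esub> (y' \<oplus>\<^bsub>P\<^esub> z')"
      using q\<phi>[OF BL.P.add.m_closed[OF *(1,3)]] add[OF *(1,3)] * by simp
    then show "q (y \<oplus>\<^bsub>G\<^esub> z) = q y \<oplus>\<^bsub>?D\<^esub> q z"
      using BL.P.quotient_add[OF radsub *(1,3)] q\<phi> * unfolding cell_head_def by simp
  next
    fix a y assume a: "a \<in> carrier B" and "y \<in> carrier G"
    then obtain y' where *: "y' \<in> carrier P" "y = \<phi> y'" using rep by metis
    have "q (a \<odot>\<^bsub>G\<^esub> y) = ?rad +>\<^bsub>P\<^esub> (a \<odot>\<^bsub>P\<^esub> y')"
      using q\<phi>[OF BL.P.smult_closed[OF a *(1)]] sm[OF a *(1)] * by simp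
    then show "q (a \<odot>\<^bsub>G\<^esub> y) = a \<odot>\<^bsub>?D\<^esub> q y"
      using BL.P.quotient_smult[OF radsub a *(1)] q\<phi> * unfolding cell_head_def by simp
  next
    have "carrier ?D = (\<lambda>x. ?rad +>\<^bsub>P\<^esub> x) ` carrier P"
      unfolding cell_head_def by (rule BL.P.quotient_carrier)
    also have "\<dots> = q ` (\<phi> ` carrier P)" unfolding image_image by (rule image_cong) (simp_all only: q\<phi>)
    finally show "q ` carrier G = carrier ?D" using bij unfolding bij_betw_def by simp
  next
    fix z assume "z \<in> carrier G"
    then obtain x where x: "x \<in> carrier P" "z = \<phi> x" using rep by metis
    show "q z = \<zero>\<^bsub>?D\<^esub> \<longleftrightarrow> z \<in> radical_part"
      unfolding x(2) rad_iff[OF x(1)] q\<phi>[OF x(1)] cell_head_def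
      by (rule BL.P.quotient_coset_eq_zero_iff[OF radsub x(1)])
  qed
  from cp.corner_pair_epi[OF Dl sub this]
  show "\<exists>jD. corner_pair B H base_idem \<theta> below_layer ?D (cell_head H (hyp_inv (n - k)) CH l) jD"
    unfolding corner_part_radical cell_head_def .
  have radne: "?rad \<noteq> carrier P"
  proof
    assume eq: "?rad = carrier P"
    have "x \<in> cell_radical H (hyp_inv (n - k)) CH l" if x: "x \<in> carrier M" for x
    proof -
      obtain y where "y \<in> carrier P" "corner_embed x = \<phi> y" using rep[OF corner_embed_closed[OF x]] by blast
      then have "corner_embed x \<in> radical_part" using rad_iff eq by simp
      then show ?thesis using x unfolding corner_part_radical[symmetric] cp.corner_part_def by blast
    qed
    then have "carrier M \<subseteq> cell_radical H (hyp_inv (n - k)) CH l" by blast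
    moreover have "cell_radical H (hyp_inv (n - k)) CH l \<subseteq> carrier M"
      by (rule HL.P.submoduleD(1)[OF HL.radical_submodule])
    ultimately show False using ne by blast
  qed
  have "Y = ?rad \<or> Y = carrier P" if Y: "submodule Y B P" "?rad \<subseteq> Y" for Y
  proof (rule disjCI)
    assume nc: "Y \<noteq> carrier P"
    have "Y \<subseteq> ?rad"
    proof
      fix x assume x: "x \<in> Y"
      have YP: "Y \<subseteq> carrier P" by (rule BL.P.submoduleD(1)[OF Y(1)])
      show "x \<in> ?rad"
      proof (rule ccontr)
        assume nx: "x \<notin> ?rad"
        have "y \<in> Y" if y: "y \<in> carrier P" for y
        proof -
          have xP: "x \<in> carrier P" using x YP by blast
          obtain a where a: "a \<in> chain_ideal E (Suc (start + l))" "a \<odot>\<^bsub>P\<^esub> x = y"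
            using BL.generated_outside_radical[OF xP nx y] by blast
          show ?thesis using BL.P.submoduleD(6)[OF Y(1) BL.I'_closed[OF a(1)] x] unfolding a(2) .
        qed
        then show False using nc YP by blast
      qed
    qed
    then show "Y = ?rad" using Y(2) by blast
  qed
  then show "simple_module B ?D"
    unfolding cell_head_def BL.P.simple_quotient_iff[OF radsub] using radne by blast
  show "carrier (cell_head H (hyp_inv (n - k)) CH l) \<noteq> {\<zero>\<^bsub>cell_head H (hyp_inv (n - k)) CH l\<^esub>}"
  proof
    let ?r = "cell_radical H (hyp_inv (n - k)) CH l"
    assume triv: "carrier (cell_head H (hyp_inv (n - k)) CH l) = {\<zero>\<^bsub>cell_head H (hyp_inv (n - k)) CH l\<^esub>}"
    have "x \<in> ?r" if x: "x \<in> carrier M" for x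
    proof -
      have "?r +>\<^bsub>M\<^esub> x \<in> carrier (cell_head H (hyp_inv (n - k)) CH l)"
        unfolding cell_head_def HL.P.quotient_carrier using x by (rule imageI)
      then show ?thesis
        unfolding triv using HL.P.quotient_coset_eq_zero_iff[OF HL.radical_submodule x]
        unfolding cell_head_def by blast
    qed
    then have "carrier M \<subseteq> ?r" by blast
    then show False using ne HL.P.submoduleD(1)[OF HL.radical_submodule] by blast
  qed
qed

text \<open>Dimension, carried over from the cell module.\<close>

lemma ex_rank: "\<exists>\<rho> :: _ \<Rightarrow> nat.
    \<forall>U Y. submodule U B G \<and> submodule Y B G \<and> U \<subset> Y \<longrightarrow> \<rho> U < \<rho> Y"
proof -
  obtain \<phi> where bij: "bij_betw \<phi> (carrier P) (carrier G)"
    and add: "\<And>x y. \<lbrakk>x \<in> carrier P; y \<in> carrier P\<rbrakk> \<Longrightarrow> \<phi> (x \<oplus>\<^bsub>P\<^esub> y) = \<phi> x \<oplus>\<^bsub>G\<^esub> \<phi> y"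
    and sm: "\<And>a x. \<lbrakk>a \<in> carrier B; x \<in> carrier P\<rbrakk> \<Longrightarrow> \<phi> (a \<odot>\<^bsub>P\<^esub> x) = a \<odot>\<^bsub>G\<^esub> \<phi> x"
    and z0: "\<phi> \<zero>\<^bsub>P\<^esub> = \<zero>\<^bsub>G\<^esub>"
    using ex_iso by blast
  have rep: "\<exists>x\<in>carrier P. z = \<phi> x" if "z \<in> carrier G" for z using bij that unfolding bij_betw_def by blast
  obtain \<rho> :: "(node set set \<Rightarrow> 'r) set set \<Rightarrow> nat"
    where \<rho>: "\<And>U Y. \<lbrakk>submodule U B P; submodule Y B P; U \<subset> Y\<rbrakk> \<Longrightarrow> \<rho> U < \<rho> Y"
    using cell_module_rank[OF BL.cell_layer_axioms[unfolded brauer_C_def] finite_sym_diagrams]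
    unfolding brauer_C_def[symmetric] by blast
  let ?p = "\<lambda>U. {x \<in> carrier P. \<phi> x \<in> U}"
  have sub: "submodule (?p U) B P" if U: "submodule U B G" for U
  proof (rule BL.P.submoduleI)
    note Ud = G.submoduleD[OF U]
    show "?p U \<subseteq> carrier P" by blast
    show "\<zero>\<^bsub>P\<^esub> \<in> ?p U" using Ud(2) BL.P.zero_closed z0 by (simp del: BL.P_simps)
    show "x \<oplus>\<^bsub>P\<^esub> y \<in> ?p U" if "x \<in> ?p U" "y \<in> ?p U" for x y
      using that Ud(3) BL.P.add.m_closed[of x y] add[of x y] by (simp del: BL.P_simps)
    show "a \<odot>\<^bsub>P\<^esub> x \<in> ?p U" if "a \<in> carrier B" "x \<in> ?p U" for a x
      using that Ud(6) BL.P.smult_closed[of a x] sm[of a x] by (simp del: BL.P_simps)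
  qed
  have "\<rho> (?p U) < \<rho> (?p Y)" if UY: "submodule U B G" "submodule Y B G" "U \<subset> Y" for U Y
  proof (rule \<rho>[OF sub[OF UY(1)] sub[OF UY(2)]])
    obtain z where z: "z \<in> Y" "z \<notin> U" using UY(3) by blast
    have "z \<in> carrier G" using z(1) G.submoduleD(1)[OF UY(2)] by blast
    then obtain x where "x \<in> carrier P" "z = \<phi> x" using rep by blast
    then have "x \<in> ?p Y" "x \<notin> ?p U" using z by simp_all
    then show "?p U \<subset> ?p Y" using UY(3) by blast
  qed
  then show ?thesis by (intro exI[of _ "\<lambda>U. \<rho> (?p U)"]) blast
qed

end

section \<open>The decomposition matrices\<close>

theorem corollary7:
  fixes \<delta> :: "'r::field" and n k \<mu> \<nu> :: nat
    and C :: "nat \<Rightarrow> ((nat \<Rightarrow> nat) \<Rightarrow> 'r) cell_data"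
    and v :: "nat \<Rightarrow> nat set set \<Rightarrow> 'r"
    and E :: "(node set set \<Rightarrow> 'r) cell_data"
  assumes "\<delta> \<noteq> 0" and "n \<ge> 1"
    and "\<And>m. cell_chain (hyp_algebra m) (hyp_inv m) (C m)"
    and "\<And>l. l \<le> n \<Longrightarrow> v l \<in> dangle_space n l \<and> v l \<noteq> (\<lambda>_. 0)"
    and "brauer_cell_structure n \<delta> C v E"
    and "k \<le> n"
    and "\<mu> < chain_length (C (n - k))" and "\<nu> < chain_length (C (n - k))"
    and "cell_radical (hyp_algebra (n - k)) (hyp_inv (n - k)) (C (n - k)) \<nu>
           \<noteq> carrier (cell_module (hyp_algebra (n - k) :: ('r, _) module) (C (n - k)) \<nu>)"
  shows "composition_mult (brauer_C n \<delta>)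
           (inflated_module n \<delta> k (v k)
              (cell_module (hyp_algebra (n - k) :: ('r, _) module) (C (n - k)) \<mu>))
           (cell_head (brauer_C n \<delta>) brauer_inv E (layer_start C (n - k) + \<nu>))
       = composition_mult (hyp_algebra (n - k) :: ('r, _) module)
           (cell_module (hyp_algebra (n - k) :: ('r, _) module) (C (n - k)) \<mu>)
           (cell_head (hyp_algebra (n - k)) (hyp_inv (n - k)) (C (n - k)) \<nu>)"
proof -
  obtain g where g: "v k g \<noteq> 0" using assms(4)[OF assms(6)] by (auto simp: fun_eq_iff)
  interpret layer: brauer_layer n k \<delta> C v E g
    by unfold_locales (use assms g in auto)
  interpret M: inflated_layer n k \<delta> C v E g \<mu>
    by unfold_locales (rule assms(7))
  interpret D: inflated_layer n k \<delta> C v E g \<nu>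
    by unfold_locales (rule assms(8))
  obtain jD where jD: "corner_pair layer.B layer.H layer.base_idem layer.\<theta> layer.below_layer
      (cell_head layer.B brauer_inv E (layer.start + \<nu>)) (cell_head layer.H (hyp_inv (n - k)) (C (n - k)) \<nu>) jD"
    using D.cell_head_corner(1)[OF assms(9)] by blast
  obtain \<rho> :: "('r layer \<times> ((nat \<Rightarrow> nat) \<Rightarrow> 'r) set \<Rightarrow>\<^sub>0 int) set set \<Rightarrow> nat"
    where \<rho>: "\<And>U Y. \<lbrakk>submodule U layer.B M.G; submodule Y layer.B M.G; U \<subset> Y\<rbrakk> \<Longrightarrow> \<rho> U < \<rho> Y"
    using M.ex_rank by blast
  show ?thesis
    by (rule composition_mult_corner[OF M.cp.corner_pair_axioms jD D.cell_head_corner(2,3)[OF assms(9)] \<rho>])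
qed

end
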